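(* Let $X$ be a Banach space with separable dual $X^*$, and let $V=(v_i)_{i=1}^\infty$ be a normalized, $1$-unconditional, block stable, right dominant, and shrinking basic sequence, with biorthogonal functionals $V^*=(v_i^* )$. Then the following are equivalent. (1) $X$ satisfies subsequential $V$-upper tree estimates. (2) $X$ is a quotient of a Banach space $Z$ such that $Z^*$ is separable and $Z$ satisfies subsequential $V$-upper tree estimates. (3) $X$ is a quotient of a Banach space $Z$ with a shrinking FDD satisfying subsequential $V$-upper block estimates in $Z$. (4) There exist a Banach space $Z$ with an FDD $(F_i)$ such that $(F_i^* )$ is a boundedly complete FDD of $Z^*$ which satisfies subsequential $V^*$-lower block estimates in $Z^*$, and a $w^*$-$w^*$ continuous (linear, isomorphic) embedding of $X^*$ into $Z^*$. (5) $X$ is isomorphic to a subspace of a Banach space $Z$ with a shrinking FDD satisfying subsequential $V$-upper block estimates in $Z$.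
   Context: FDDs. An FDD of a Banach space $Z$ is a sequence $(E_i)$ of finite-dimensional subspaces such that every $z\in Z$ has a unique expansion $z=\sum_i z_i$ with $z_i\in E_i$. $E_i^*$ is regarded as the subspace of $Z^*$ of functionals vanishing on all $E_j$, $j\ne i$. $(E_i)$ is shrinking if the closed span of $(E_i^* )$ is $Z^*$ (then $(E_i^* )$ is an FDD of $Z^*$). It is boundedly complete if $\sum_i z_i$ converges whenever $z_i\in E_i$ and the partial sums are bounded. For $z=\sum z_i$, $\mathrm{supp}_E(z)=\{i: z_i\neq 0\}$. A block sequence of $(E_i)$ is a sequence $(z_i)$ of nonzero finitely supported vectors with $\max\mathrm{supp}_E(z_i)<\min\mathrm{supp}_E(z_{i+1})$ for all $i$. Domination. A sequence $(x_i)$ is $C$-dominated by $(y_i)$ (equivalently $(y_i)$ $C$-dominates $(x_i)$) if $\|\sum a_ix_i\|\le C\|\sum a_iy_i\|$ for all finitely supported scalar sequences $(a_i)$. Two sequences are $C$-equivalent if there are $A,B>0$ with $AB\le C$ such that $\frac1A\|\sum a_ix_i\|\le\|\sum a_iy_i\|\le B\|\sum a_ix_i\|$ for all such $(a_i)$. Properties of a basic sequence $(v_i)$. It is right dominant if for some $C\ge1$, for all $m_1<m_2<\dots$ and $n_1<n_2<\dots$ in $\mathbb N$ with $m_i\le n_i$ for all $i$, $(v_{m_i})$ is $C$-dominated by $(v_{n_i})$. It is block stable if for some $C\ge 1$ any two normalized block bases $(x_i)$, $(y_i)$ of $(v_i)$ with $\max(\mathrm{supp}(x_i)\cup\mathrm{supp}(y_i))<\min(\mathrm{supp}(x_{i+1})\cup\mathrm{supp}(y_{i+1}))$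 for all $i$ are $C$-equivalent. $V^*=(v_i^* )$ is the sequence of biorthogonal functionals in the dual of the closed span of $(v_i)$. Block estimates. For a normalized $1$-unconditional basic sequence $U=(u_i)$, an FDD $(E_i)$ of $Z$ satisfies subsequential $U$-upper (respectively lower) block estimates in $Z$ if there is $C\ge1$ such that every normalized block sequence $(z_i)$ of $(E_i)$ in $Z$ is $C$-dominated by (respectively $C$-dominates) $(u_{m_i})$, where $m_i=\min\mathrm{supp}_E(z_i)$. Trees. Let $T_\infty^{\mathrm{even}}=\{(n_1,\dots,n_{2\ell}): n_1<n_2<\dots<n_{2\ell}\text{ in }\mathbb N,\ \ell\in\mathbb N\}$. An even tree in $X$ is a family $(x_\alpha)_{\alpha\in T_\infty^{\mathrm{even}}}\subset X$. Its nodes are the sequences $(x_{(n_1,\dots,n_{2\ell-1},k)})_{k=n_{2\ell-1}+1}^\infty$, and its branches are the sequences $(n_{2\ell-1},x_{(n_1,\dots,n_{2\ell})})_{\ell=1}^\infty$ for $n_1<n_2<\cdots$. The tree is weakly null if $\|x_\alpha\|=1$ for all $\alpha$ and every node is a weakly null sequence. $X$ satisfies subsequential $V$-upper tree estimates if there is $C\ge1$ such that every weakly null even tree in $X$ has a branch $(n_{2\ell-1},x_{(n_1,\dots,n_{2\ell})})_{\ell=1}^\infty$ such that $(x_{(n_1,\dots,n_{2\ell})})_{\ell=1}^\infty$ is $C$-dominated by $(v_{n_{2\ell-1}})_{\ell=1}^\infty$. "Quotient" and "embedding" are meant in the isomorphic sense: a quotient of $Z$ is the image of $Z$ under a bounded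 linear surjection; an embedding is an isomorphism onto its image. *)

theory Defs
  imports
    "HOL-Analysis.Analysis"
    "HOL-Library.Function_Algebras"
    "HOL-Library.Equipollence"
    "HOL-Computational_Algebra.Polynomial"
begin

section \<open>Functions as a real vector space\<close>

text \<open>Needed so that the dual of a space is again a space of the kind considered below.\<close>

instantiation "fun" :: (type, real_vector) real_vector
begin

definition scaleR_fun :: "real \<Rightarrow> ('a \<Rightarrow> 'b) \<Rightarrow> 'a \<Rightarrow> 'b"
  where "scaleR_fun c f = (\<lambda>x. c *\<^sub>R f x)"

instance
  by standard (auto simp: scaleR_fun_def fun_eq_iff scaleR_add_right scaleR_add_left)

end


section \<open>Banach spaces carried by linear subspaces of a type\<close>

text \<open>
  The theorem asserts the existence of Banach spaces, and types cannot be quantified over.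
  A (real) normed space is therefore a linear subspace \<open>pts Z\<close> of some real vector space type
  together with a norm \<open>nrm Z\<close> that matters only on \<open>pts Z\<close>. The type itself carries no
  topology. For a type of class \<open>real_normed_vector\<close>, the space
  \<open>\<lparr>pts = UNIV, nrm = norm\<rparr>\<close> is the type itself.
\<close>

record 'a nspace =
  pts :: "'a set"
  nrm :: "'a \<Rightarrow> real"

definition normed_space :: "'a::real_vector nspace \<Rightarrow> bool"
  where "normed_space Z \<longleftrightarrow> subspace (pts Z) \<and>
    (\<forall>x\<in>pts Z. 0 \<le> nrm Z x \<and> (nrm Z x = 0 \<longleftrightarrow> x = 0)) \<and>
    (\<forall>c. \<forall>x\<in>pts Z. nrm Z (c *\<^sub>R x) = \<bar>c\<bar> * nrm Z x) \<and>
    (\<forall>x\<in>pts Z. \<forall>y\<in>pts Z. nrm Z (x + y) \<le> nrm Z x + nrm Z y)"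

text \<open>The value off \<open>pts Z\<close> is only there because the library's locale \<open>Metric_space\<close> asks
  for a nonnegative symmetric function on the whole type.\<close>

definition ndist :: "'a::real_vector nspace \<Rightarrow> 'a \<Rightarrow> 'a \<Rightarrow> real"
  where "ndist Z x y = (if x \<in> pts Z \<and> y \<in> pts Z then nrm Z (x - y) else 0)"

lemma Metric_space_ndist:
  assumes "normed_space Z"
  shows "Metric_space (pts Z) (ndist Z)"
proof
  have sub: "subspace (pts Z)"
    and pos: "\<And>x. x \<in> pts Z \<Longrightarrow> 0 \<le> nrm Z x \<and> (nrm Z x = 0 \<longleftrightarrow> x = 0)"
    and hom: "\<And>c x. x \<in> pts Z \<Longrightarrow> nrm Z (c *\<^sub>R x) = \<bar>c\<bar> * nrm Z x"
    and tri: "\<And>x y. x \<in> pts Z \<Longrightarrow> y \<in> pts Z \<Longrightarrow> nrm Z (x + y) \<le> nrm Z x + nrm Z y"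
    using assms unfolding normed_space_def by auto
  have diff: "x - y \<in> pts Z" if "x \<in> pts Z" "y \<in> pts Z" for x y
    using sub that by (rule subspace_diff)
  show "0 \<le> ndist Z x y" for x y
    using pos diff by (auto simp: ndist_def)
  show "ndist Z x y = ndist Z y x" for x y
    using hom[OF diff, of x y "-1"] by (auto simp: ndist_def)
  show "ndist Z x y = 0 \<longleftrightarrow> x = y" if "x \<in> pts Z" "y \<in> pts Z" for x y
    using pos[OF diff[OF that]] that by (auto simp: ndist_def)
  show "ndist Z x z \<le> ndist Z x y + ndist Z y z"
    if "x \<in> pts Z" "y \<in> pts Z" "z \<in> pts Z" for x y z
    using tri[OF diff diff, of x y y z] that by (auto simp: ndist_def)
qed

abbreviation ntop :: "'a::real_vector nspace \<Rightarrow> 'a topology"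
  where "ntop Z \<equiv> Metric_space.mtopology (pts Z) (ndist Z)"

definition banach_space :: "'a::real_vector nspace \<Rightarrow> bool"
  where "banach_space Z \<longleftrightarrow> normed_space Z \<and> Metric_space.mcomplete (pts Z) (ndist Z)"

lemma banach_space_type: "banach_space \<lparr>pts = UNIV :: 'a::banach set, nrm = norm\<rparr>"
proof -
  have "normed_space \<lparr>pts = UNIV :: 'a set, nrm = norm\<rparr>"
    by (auto simp: normed_space_def norm_triangle_ineq)
  moreover have "ndist \<lparr>pts = UNIV :: 'a set, nrm = norm\<rparr> = dist"
    by (auto simp: ndist_def dist_norm fun_eq_iff)
  ultimately show ?thesis
    by (simp add: banach_space_def mcomplete_iff_complete complete_UNIV)
qed

definition series_to :: "'a::real_vector nspace \<Rightarrow> (nat \<Rightarrow> 'a) \<Rightarrow> 'a \<Rightarrow> bool"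
  where "series_to Z s z \<longleftrightarrow> limitin (ntop Z) (\<lambda>n. \<Sum>i<n. s i) z sequentially"

definition closed_span :: "'a::real_vector nspace \<Rightarrow> 'a set \<Rightarrow> 'a set"
  where "closed_span Z A = ntop Z closure_of span A"

definition closed_span_space :: "'a::real_vector nspace \<Rightarrow> 'a set \<Rightarrow> 'a nspace"
  where "closed_span_space Z A = \<lparr>pts = closed_span Z A, nrm = nrm Z\<rparr>"

definition bounded_operator ::
    "'a::real_vector nspace \<Rightarrow> 'b::real_vector nspace \<Rightarrow> ('a \<Rightarrow> 'b) \<Rightarrow> bool"
  where "bounded_operator X Y T \<longleftrightarrow> T ` pts X \<subseteq> pts Y \<and>
    (\<forall>x\<in>pts X. \<forall>y\<in>pts X. T (x + y) = T x + T y) \<and>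
    (\<forall>c. \<forall>x\<in>pts X. T (c *\<^sub>R x) = c *\<^sub>R T x) \<and>
    (\<exists>K. \<forall>x\<in>pts X. nrm Y (T x) \<le> K * nrm X x)"

definition iso_embedding ::
    "'a::real_vector nspace \<Rightarrow> 'b::real_vector nspace \<Rightarrow> ('a \<Rightarrow> 'b) \<Rightarrow> bool"
  where "iso_embedding X Y T \<longleftrightarrow> bounded_operator X Y T \<and>
    (\<exists>c>0. \<forall>x\<in>pts X. c * nrm X x \<le> nrm Y (T x))"

definition is_quotient_of :: "'a::real_vector nspace \<Rightarrow> 'b::real_vector nspace \<Rightarrow> bool"
  where "is_quotient_of X Z \<longleftrightarrow> (\<exists>Q. bounded_operator Z X Q \<and> Q ` pts Z = pts X)"

text \<open>Functionals on \<open>pts Z\<close> are represented by functions on the type that vanish off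
  \<open>pts Z\<close>; with this choice distinct functions are distinct functionals.\<close>

definition dual :: "'a::real_vector nspace \<Rightarrow> ('a \<Rightarrow> real) nspace"
  where "dual Z = \<lparr>
    pts = {f. bounded_operator Z \<lparr>pts = UNIV, nrm = abs\<rparr> f \<and> (\<forall>x. x \<notin> pts Z \<longrightarrow> f x = 0)},
    nrm = (\<lambda>f. SUP x\<in>{x \<in> pts Z. nrm Z x \<le> 1}. \<bar>f x\<bar>)\<rparr>"

text \<open>Pointwise convergence on \<open>pts Z\<close> (all functionals vanish elsewhere).\<close>

definition weak_star_topology :: "'a::real_vector nspace \<Rightarrow> ('a \<Rightarrow> real) topology"
  where "weak_star_topology Z =
    subtopology (product_topology (\<lambda>_. euclideanreal) UNIV) (pts (dual Z))"

definition weakly_null :: "'a::real_vector nspace \<Rightarrow> (nat \<Rightarrow> 'a) \<Rightarrow> bool"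
  where "weakly_null X x \<longleftrightarrow> range x \<subseteq> pts X \<and> (\<forall>f\<in>pts (dual X). (\<lambda>k. f (x k)) \<longlonglongrightarrow> 0)"


section \<open>Finite-dimensional decompositions\<close>

definition is_FDD :: "'a::real_vector nspace \<Rightarrow> (nat \<Rightarrow> 'a set) \<Rightarrow> bool"
  where "is_FDD Z E \<longleftrightarrow>
    (\<forall>i. E i \<subseteq> pts Z \<and> (\<exists>B. finite B \<and> E i = span B)) \<and>
    (\<forall>z\<in>pts Z. \<exists>!s. (\<forall>i. s i \<in> E i) \<and> series_to Z s z)"

definition component :: "'a::real_vector nspace \<Rightarrow> (nat \<Rightarrow> 'a set) \<Rightarrow> 'a \<Rightarrow> nat \<Rightarrow> 'a"
  where "component Z E z = (THE s. (\<forall>i. s i \<in> E i) \<and> series_to Z s z)"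

definition supp :: "'a::real_vector nspace \<Rightarrow> (nat \<Rightarrow> 'a set) \<Rightarrow> 'a \<Rightarrow> nat set"
  where "supp Z E z = {i. component Z E z i \<noteq> 0}"

definition dual_FDD :: "'a::real_vector nspace \<Rightarrow> (nat \<Rightarrow> 'a set) \<Rightarrow> nat \<Rightarrow> ('a \<Rightarrow> real) set"
  where "dual_FDD Z E i = {f \<in> pts (dual Z). \<forall>j. j \<noteq> i \<longrightarrow> (\<forall>x\<in>E j. f x = 0)}"

definition shrinking_FDD :: "'a::real_vector nspace \<Rightarrow> (nat \<Rightarrow> 'a set) \<Rightarrow> bool"
  where "shrinking_FDD Z E \<longleftrightarrow>
    is_FDD Z E \<and> closed_span (dual Z) (\<Union>i. dual_FDD Z E i) = pts (dual Z)"

definition boundedly_complete_FDD :: "'a::real_vector nspace \<Rightarrow> (nat \<Rightarrow> 'a set) \<Rightarrow> bool"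
  where "boundedly_complete_FDD Z E \<longleftrightarrow> is_FDD Z E \<and>
    (\<forall>s. (\<forall>i. s i \<in> E i) \<and> (\<exists>K. \<forall>n. nrm Z (\<Sum>i<n. s i) \<le> K) \<longrightarrow> (\<exists>z. series_to Z s z))"

definition block_seq :: "'a::real_vector nspace \<Rightarrow> (nat \<Rightarrow> 'a set) \<Rightarrow> (nat \<Rightarrow> 'a) \<Rightarrow> bool"
  where "block_seq Z E z \<longleftrightarrow>
    (\<forall>i. z i \<in> pts Z \<and> z i \<noteq> 0 \<and> finite (supp Z E (z i))) \<and>
    (\<forall>i. Max (supp Z E (z i)) < Min (supp Z E (z (Suc i))))"

definition normalized :: "'a::real_vector nspace \<Rightarrow> (nat \<Rightarrow> 'a) \<Rightarrow> bool"
  where "normalized Z z \<longleftrightarrow> (\<forall>i. z i \<in> pts Z \<and> nrm Z (z i) = 1)"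


section \<open>Domination and basic sequences\<close>

text \<open>\<open>x\<close> in \<open>X\<close> is \<open>C\<close>-dominated by \<open>y\<close> in \<open>Y\<close>.\<close>

definition dominated_by :: "real \<Rightarrow> 'a::real_vector nspace \<Rightarrow> (nat \<Rightarrow> 'a) \<Rightarrow>
    'b::real_vector nspace \<Rightarrow> (nat \<Rightarrow> 'b) \<Rightarrow> bool"
  where "dominated_by C X x Y y \<longleftrightarrow>
    (\<forall>n a. nrm X (\<Sum>i<n. a i *\<^sub>R x i) \<le> C * nrm Y (\<Sum>i<n. a i *\<^sub>R y i))"

definition equivalent_seqs :: "real \<Rightarrow> 'a::real_vector nspace \<Rightarrow> (nat \<Rightarrow> 'a) \<Rightarrow>
    'b::real_vector nspace \<Rightarrow> (nat \<Rightarrow> 'b) \<Rightarrow> bool"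
  where "equivalent_seqs C X x Y y \<longleftrightarrow> (\<exists>A>0. \<exists>B>0. A * B \<le> C \<and> (\<forall>n a.
    1 / A * nrm X (\<Sum>i<n. a i *\<^sub>R x i) \<le> nrm Y (\<Sum>i<n. a i *\<^sub>R y i) \<and>
    nrm Y (\<Sum>i<n. a i *\<^sub>R y i) \<le> B * nrm X (\<Sum>i<n. a i *\<^sub>R x i)))"

definition basic_seq :: "'a::real_vector nspace \<Rightarrow> (nat \<Rightarrow> 'a) \<Rightarrow> bool"
  where "basic_seq W v \<longleftrightarrow> range v \<subseteq> pts W \<and>
    (\<forall>x\<in>closed_span W (range v). \<exists>!a. series_to W (\<lambda>i. a i *\<^sub>R v i) x)"

definition one_unconditional :: "'a::real_vector nspace \<Rightarrow> (nat \<Rightarrow> 'a) \<Rightarrow> bool"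
  where "one_unconditional W v \<longleftrightarrow> (\<forall>n a \<epsilon>. (\<forall>i. \<epsilon> i \<in> {-1, 1}) \<longrightarrow>
    nrm W (\<Sum>i<n. (\<epsilon> i * a i) *\<^sub>R v i) \<le> nrm W (\<Sum>i<n. a i *\<^sub>R v i))"

text \<open>A basic sequence is the FDD of its closed span \<open>seq_space W v\<close> into the lines
  \<open>lines v i\<close>; shrinking, supports and block bases are those of this FDD.\<close>

abbreviation seq_space :: "'a::real_vector nspace \<Rightarrow> (nat \<Rightarrow> 'a) \<Rightarrow> 'a nspace"
  where "seq_space W v \<equiv> closed_span_space W (range v)"

abbreviation lines :: "(nat \<Rightarrow> 'a::real_vector) \<Rightarrow> nat \<Rightarrow> 'a set"
  where "lines v \<equiv> \<lambda>i. span {v i}"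

definition shrinking_seq :: "'a::real_vector nspace \<Rightarrow> (nat \<Rightarrow> 'a) \<Rightarrow> bool"
  where "shrinking_seq W v \<longleftrightarrow> shrinking_FDD (seq_space W v) (lines v)"

definition right_dominant :: "'a::real_vector nspace \<Rightarrow> (nat \<Rightarrow> 'a) \<Rightarrow> bool"
  where "right_dominant W v \<longleftrightarrow> (\<exists>C\<ge>1. \<forall>m n. strict_mono m \<and> strict_mono n \<and> (\<forall>i. m i \<le> n i) \<longrightarrow>
    dominated_by C W (\<lambda>i. v (m i)) W (\<lambda>i. v (n i)))"

definition block_stable :: "'a::real_vector nspace \<Rightarrow> (nat \<Rightarrow> 'a) \<Rightarrow> bool"
  where "block_stable W v \<longleftrightarrow> (let S = seq_space W v; sp = supp S (lines v) in
    \<exists>C\<ge>1. \<forall>x y. block_seq S (lines v) x \<and> normalized S x \<and>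
      block_seq S (lines v) y \<and> normalized S y \<and>
      (\<forall>i. Max (sp (x i) \<union> sp (y i)) < Min (sp (x (Suc i)) \<union> sp (y (Suc i)))) \<longrightarrow>
      equivalent_seqs C S x S y)"

text \<open>The biorthogonal functionals live in \<open>dual (seq_space W v)\<close>.\<close>

definition biorthogonal :: "'a::real_vector nspace \<Rightarrow> (nat \<Rightarrow> 'a) \<Rightarrow> nat \<Rightarrow> 'a \<Rightarrow> real"
  where "biorthogonal W v i =
    (THE f. f \<in> pts (dual (seq_space W v)) \<and> (\<forall>j. f (v j) = (if j = i then 1 else 0)))"


section \<open>Block estimates and tree estimates\<close>

definition upper_block_estimates :: "'u::real_vector nspace \<Rightarrow> (nat \<Rightarrow> 'u) \<Rightarrow>
    'a::real_vector nspace \<Rightarrow> (nat \<Rightarrow> 'a set) \<Rightarrow> bool"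
  where "upper_block_estimates U u Z E \<longleftrightarrow> (\<exists>C\<ge>1. \<forall>z. block_seq Z E z \<and> normalized Z z \<longrightarrow>
    dominated_by C Z z U (\<lambda>i. u (Min (supp Z E (z i)))))"

definition lower_block_estimates :: "'u::real_vector nspace \<Rightarrow> (nat \<Rightarrow> 'u) \<Rightarrow>
    'a::real_vector nspace \<Rightarrow> (nat \<Rightarrow> 'a set) \<Rightarrow> bool"
  where "lower_block_estimates U u Z E \<longleftrightarrow> (\<exists>C\<ge>1. \<forall>z. block_seq Z E z \<and> normalized Z z \<longrightarrow>
    dominated_by C U (\<lambda>i. u (Min (supp Z E (z i)))) Z z)"

text \<open>An even tree is a function on lists of which only the values on \<open>even_indices\<close> matter.\<close>

definition even_indices :: "nat list set"
  where "even_indices = {ns. sorted_wrt (<) ns \<and> ns \<noteq> [] \<and> even (length ns)}"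

text \<open>The node above \<open>ns = [n\<^sub>1, \<dots>, n\<^sub>2\<^sub>l\<^sub>-\<^sub>1]\<close> is the sequence of the \<open>x (ns @ [k])\<close>,
  \<open>k = last ns + 1, last ns + 2, \<dots>\<close>.\<close>

definition weakly_null_even_tree :: "'a::real_vector nspace \<Rightarrow> (nat list \<Rightarrow> 'a) \<Rightarrow> bool"
  where "weakly_null_even_tree X x \<longleftrightarrow>
    (\<forall>\<alpha>\<in>even_indices. x \<alpha> \<in> pts X \<and> nrm X (x \<alpha>) = 1) \<and>
    (\<forall>ns. sorted_wrt (<) ns \<and> odd (length ns) \<longrightarrow>
      weakly_null X (\<lambda>j. x (ns @ [last ns + 1 + j])))"

text \<open>With indices starting at \<open>0\<close>, the branch of \<open>n 0 < n 1 < \<dots>\<close> consists of the pairs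
  of \<open>n (2 * l)\<close> and \<open>x [n 0, \<dots>, n (2 * l + 1)]\<close>.\<close>

definition upper_tree_estimates ::
    "'v::real_vector nspace \<Rightarrow> (nat \<Rightarrow> 'v) \<Rightarrow> 'a::real_vector nspace \<Rightarrow> bool"
  where "upper_tree_estimates W v X \<longleftrightarrow> (\<exists>C\<ge>1. \<forall>x. weakly_null_even_tree X x \<longrightarrow>
    (\<exists>n. strict_mono n \<and>
      dominated_by C X (\<lambda>l. x (map n [0..<2 * l + 2])) W (\<lambda>l. v (n (2 * l)))))"


section \<open>Types large enough to carry all separable Banach spaces\<close>

text \<open>
  A separable Banach space has algebraic dimension at most that of the continuum, so an
  isometric copy of it is carried by a subspace of any vector space type that contains
  continuum many linearly independent vectors, such as \<open>nat \<Rightarrow> real\<close>.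
\<close>

definition continuum_dimensional :: "'z::real_vector itself \<Rightarrow> bool"
  where "continuum_dimensional _ \<longleftrightarrow>
    (\<exists>B :: 'z set. independent B \<and> (UNIV :: real set) \<lesssim> B)"

lemma sum_fun_apply: "(\<Sum>i\<in>I. g i) x = (\<Sum>i\<in>I. g i x)"
  by (induction I rule: infinite_finite_induct) auto

lemma continuum_dimensional_sequences: "continuum_dimensional TYPE(nat \<Rightarrow> real)"
proof -
  define g :: "real \<Rightarrow> nat \<Rightarrow> real" where "g t = (\<lambda>n. t ^ n)" for t
  have inj: "inj g"
    by (rule injI) (metis g_def power_one_right)
  have "independent (range g)"
    unfolding independent_explicit_module
  proof (intro allI impI)
    fix T u w
    assume T: "finite T" "T \<subseteq> range g" and eq: "(\<Sum>f\<in>T. u f *\<^sub>R f) = 0" and w: "w \<in> T"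
    define S where "S = g -` T"
    have S: "finite S" "T = g ` S"
      using T inj by (auto simp: S_def finite_vimageI)
    have pow: "(\<Sum>t\<in>S. u (g t) * t ^ n) = 0" for n
    proof -
      have "(\<Sum>t\<in>S. u (g t) * t ^ n) = (\<Sum>f\<in>T. u f * f n)"
        unfolding S(2) using inj by (subst sum.reindex) (auto simp: g_def intro: inj_on_subset)
      also have "\<dots> = (\<Sum>f\<in>T. u f *\<^sub>R f) n"
        by (simp add: sum_fun_apply scaleR_fun_def)
      finally show ?thesis by (simp add: eq)
    qed
    have pol: "(\<Sum>t\<in>S. u (g t) * poly p t) = 0" for p
    proof -
      have "(\<Sum>t\<in>S. u (g t) * poly p t)
          = (\<Sum>i\<le>degree p. coeff p i * (\<Sum>t\<in>S. u (g t) * t ^ i))"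
        unfolding poly_altdef sum_distrib_left by (subst sum.swap) (simp add: mult_ac)
      then show ?thesis by (simp add: pow)
    qed
    obtain r where r: "r \<in> S" "w = g r"
      using w S(2) by auto
    define p where "p = (\<Prod>s\<in>S - {r}. [:- s, 1:])"
    have "(\<Sum>t\<in>S. u (g t) * poly p t) = u (g r) * poly p r"
      using S(1) r(1) by (subst sum.remove[of _ r]) (auto simp: p_def poly_prod prod_zero_iff
          intro!: sum.neutral)
    moreover have "poly p r \<noteq> 0"
      using S(1) by (auto simp: p_def poly_prod prod_zero_iff)
    ultimately show "u w = 0"
      using pol r(2) by simp
  qed
  moreover have "(UNIV :: real set) \<lesssim> range g"
    using inj unfolding lepoll_def by blast
  ultimately show ?thesis
    unfolding continuum_dimensional_def by blast
qed

end

theory Submission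
  imports Defs
begin

text \<open>
  Tree estimates are a statement about a game. If the player choosing unit vectors could force the
  domination by \<open>v\<close> to fail, his answers would form a weakly null even tree without a good branch. Hence
  the player choosing the indices wins, and discretizing his strategy by finite nets gives increasing
  finite-dimensional spaces \<open>F i\<close> in \<open>X\<close> and \<open>H i\<close> in the dual of \<open>X\<close>, both with dense union, such that
  vectors \<open>y j \<in> F (q j)\<close> annihilated by \<open>H (p j)\<close>, where \<open>p j \<le> q j < p (j + 1)\<close>, satisfy upper estimates.

  Both constructions put a norm on the finite sequences of vectors of finite-dimensional blocks, monotone
  under restriction to initial segments, in which finitely supported vectors satisfy upper estimates. The completion has
  an FDD with the same estimates, and this FDD is shrinking because \<open>v\<close> is. With the blocks
  \<open>{x \<in> F i. \<forall>h\<in>H (i - 1). h x = 0}\<close> and the supremum of the norms of the interval sums, summation is a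
  quotient map onto \<open>X\<close>. With the norm given by pairing with functionals split along a coarse scale,
  on which every functional almost agrees with an element of some \<open>H s\<close> (Johnson), \<open>X\<close> embeds.

  Conversely, let \<open>A\<close> embed \<open>X\<close> in \<open>Y\<close> and let the vectors of \<open>A ` X\<close> have bounded lifts under an operator from a
  space with such an FDD. By pigeonhole and Mazur's theorem every weakly null sequence in \<open>X\<close> has a
  member that is close to the image of a block far out, so every weakly null even tree has
  a branch close to a block sequence. The dual condition is equivalent to the quotient condition because the
  weak-star continuous embeddings of dual spaces are the adjoints of the quotient maps.
\<close>

section \<open>Normed spaces carried by subspaces\<close>

text \<open>\<open>X\<close> comes without a basis or FDD, so bounded projections are replaced by
  Helly-type lifts: a vector or functional can be exchanged for a member of some \<open>F i\<close>
  or \<open>H i\<close> with the same values on a finite-dimensional test space, at the price of a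
  factor 2. Differences of two such lifts provide the vectors annihilated by some
  \<open>H j\<close>.

  The index of \<open>v\<close> that a winning strategy prescribes depends on the whole play,
  whereas a block estimate sees only where a block sits. Finiteness of the nets gives a bound over
  all plays up to a level; right dominance allows the larger index, and block stability makes all
  interlaced choices equivalent.

  The embedding is harder than the quotient because a functional need not split along a blocking
  fixed in advance. Its cutting points may depend on the functional, within windows that weak-star
  compactness of the dual ball provides.

  All spaces to be found live in one given type, so a completion is formed in the bidual and carried
  over along a Hamel basis.\<close>

lemma normed_space_subspace: "normed_space Z ==> subspace (pts Z)"
 by (simp add: normed_space_def)

lemma
 assumes "normed_space Z"
 shows pts_zero: "0 \<in> pts Z"
  and pts_add: "x \<in> pts Z ==> y \<in> pts Z ==> x + y \<in> pts Z"
  and pts_diff: "x \<in> pts Z ==> y \<in> pts Z ==> x - y \<in> pts Z"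
  and pts_scale: "x \<in> pts Z ==> c *\<^sub>R x \<in> pts Z"
  and pts_minus: "x \<in> pts Z ==> - x \<in> pts Z"
  and pts_sum: "(!!i. i \<in> I ==> g i \<in> pts Z) ==> sum g I \<in> pts Z"
 using assms normed_space_subspace
  by (auto intro: subspace_0 subspace_add subspace_diff subspace_scale subspace_neg subspace_sum)

lemma nrm_nonneg: "normed_space Z ==> x \<in> pts Z ==> 0 <= nrm Z x"
 and nrm_eq_0: "normed_space Z ==> x \<in> pts Z ==> nrm Z x = 0 \<longleftrightarrow> x = 0"
 and nrm_scale: "normed_space Z ==> x \<in> pts Z ==> nrm Z (c *\<^sub>R x) = \<bar>c\<bar> * nrm Z x"
 and nrm_add: "normed_space Z ==> x \<in> pts Z ==> y \<in> pts Z ==> nrm Z (x + y) <= nrm Z x + nrm Z y"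
 by (simp_all add: normed_space_def)

lemma nrm_zero: "normed_space Z ==> nrm Z 0 = 0"
 using nrm_eq_0 pts_zero by blast

lemma nrm_pos: "normed_space Z ==> x \<in> pts Z ==> x ~= 0 ==> 0 < nrm Z x"
 using nrm_nonneg nrm_eq_0 by (metis less_eq_real_def)

lemma nrm_minus: "normed_space Z ==> x \<in> pts Z ==> nrm Z (- x) = nrm Z x"
 using nrm_scale[of Z x "-1"] by simp

lemma nrm_diff_commute:
 "normed_space Z ==> x \<in> pts Z ==> y \<in> pts Z ==> nrm Z (x - y) = nrm Z (y - x)"
 using nrm_minus[of Z "x - y"] pts_diff[of Z x y] by auto

lemma nrm_diff: "normed_space Z ==> x \<in> pts Z ==> y \<in> pts Z ==> nrm Z (x - y) <= nrm Z x + nrm Z y"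
 using nrm_add[of Z x "- y"] nrm_minus[of Z y] pts_minus by auto

lemma nrm_triangle:
 assumes "normed_space Z" "x \<in> pts Z" "y \<in> pts Z" "z \<in> pts Z"
 shows "nrm Z (x - z) <= nrm Z (x - y) + nrm Z (y - z)"
 using nrm_add[of Z "x - y" "y - z"] assms pts_diff by auto

lemma nrm_diff_ge:
 assumes "normed_space Z" "x \<in> pts Z" "y \<in> pts Z"
 shows "\<bar>nrm Z x - nrm Z y\<bar> <= nrm Z (x - y)"
 using nrm_add[of Z "x - y" y] nrm_add[of Z "y - x" x] nrm_diff_commute[of Z x y]
  assms pts_diff by force

lemma nrm_sum:
 assumes "normed_space Z" "!!i. i \<in> I ==> g i \<in> pts Z"
 shows "nrm Z (sum g I) <= (\<Sum>i\<in>I. nrm Z (g i))"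
 using assms(2)
proof (induction I rule: infinite_finite_induct)
 case (insert x F)
 have "nrm Z (g x + sum g F) <= nrm Z (g x) + nrm Z (sum g F)"
  by (rule nrm_add[OF assms(1)]) (use insert in \<open>auto intro: pts_sum[OF assms(1)]\<close>)
 then show ?case using insert by force
qed (auto simp: nrm_zero[OF assms(1)])

lemma span_subset_pts: "normed_space Z ==> B \<subseteq> pts Z ==> span B \<subseteq> pts Z"
 by (simp add: normed_space_subspace span_minimal)

lemma banach_normed: "banach_space Z ==> normed_space Z"
 by (simp add: banach_space_def)

definition nconv :: "'a::real_vector nspace => (nat => 'a) => 'a => bool"
 where "nconv Z s z \<longleftrightarrow> z \<in> pts Z & (\<lambda>n. nrm Z (s n - z)) \<longlonglongrightarrow> 0"

lemma limitin_ntop: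
 assumes "normed_space Z" "!!n. s n \<in> pts Z"
 shows "limitin (ntop Z) s z sequentially \<longleftrightarrow> nconv Z s z"
proof -
 interpret M: Metric_space "pts Z" "ndist Z" by (rule Metric_space_ndist[OF assms(1)])
 have "limitin (ntop Z) s z sequentially \<longleftrightarrow>
   z \<in> pts Z & (\<forall>e>0. \<forall>\<^sub>F n in sequentially. s n \<in> pts Z & ndist Z (s n) z < e)"
  by (rule M.limitin_metric)
 also have "\<dots> \<longleftrightarrow> z \<in> pts Z & (\<forall>e>0. \<forall>\<^sub>F n in sequentially. \<bar>nrm Z (s n - z)\<bar> < e)"
  using assms nrm_nonneg[OF assms(1) pts_diff[OF assms(1) assms(2)]]
  by (auto simp: ndist_def)
 also have "\<dots> \<longleftrightarrow> nconv Z s z"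
  by (auto simp: nconv_def tendsto_iff)
 finally show ?thesis .
qed

lemma nconv_pts: "nconv Z s z ==> z \<in> pts Z"
 by (simp add: nconv_def)

lemma nconv_iff:
 assumes "normed_space Z" "!!n. s n \<in> pts Z"
 shows "nconv Z s z \<longleftrightarrow> z \<in> pts Z & (\<forall>e>0. \<exists>N. \<forall>n\<ge>N. nrm Z (s n - z) < e)"
 using nrm_nonneg[OF assms(1) pts_diff[OF assms(1) assms(2)]]
 by (auto simp: nconv_def LIMSEQ_iff)

lemma nconv_const: "normed_space Z ==> z \<in> pts Z ==> nconv Z (\<lambda>n. z) z"
 by (simp add: nconv_def nrm_zero)

lemma nconv_squeeze:
 assumes "normed_space Z" "!!n. s n \<in> pts Z" "z \<in> pts Z"
  and "!!n. nrm Z (s n - z) <= d n" "d \<longlonglongrightarrow> 0"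
 shows "nconv Z s z"
 unfolding nconv_def
proof
 show "(\<lambda>n. nrm Z (s n - z)) \<longlonglongrightarrow> 0"
  by (rule tendsto_sandwich[OF _ _ tendsto_const assms(5)])
   (use assms nrm_nonneg[OF assms(1) pts_diff[OF assms(1)]] in auto)
qed fact

lemma nconv_unique:
 assumes "normed_space Z" "!!n. s n \<in> pts Z" "nconv Z s a" "nconv Z s b"
 shows "a = b"
proof -
 have ab: "a \<in> pts Z" "b \<in> pts Z" using assms by (auto simp: nconv_def)
 have "(\<lambda>n. nrm Z (s n - a) + nrm Z (s n - b)) \<longlonglongrightarrow> 0 + 0"
  using assms(3,4) by (intro tendsto_add) (auto simp: nconv_def)
 moreover have "nrm Z (a - b) <= nrm Z (s n - a) + nrm Z (s n - b)" for n
  using nrm_triangle[OF assms(1) ab(1) assms(2) ab(2), of n]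
   nrm_diff_commute[OF assms(1) ab(1) assms(2)] by simp
 ultimately have "nrm Z (a - b) <= 0"
  by (intro LIMSEQ_le_const[of "\<lambda>n. nrm Z (s n - a) + nrm Z (s n - b)"]) auto
 then have "nrm Z (a - b) = 0"
  using nrm_nonneg[OF assms(1) pts_diff[OF assms(1) ab]] by simp
 then show ?thesis
  using nrm_eq_0[OF assms(1) pts_diff[OF assms(1) ab]] by simp
qed

lemma nconv_nrm:
 assumes "normed_space Z" "!!n. s n \<in> pts Z" "nconv Z s a"
 shows "(\<lambda>n. nrm Z (s n)) \<longlonglongrightarrow> nrm Z a"
proof (rule LIM_zero_cancel, rule tendsto_rabs_zero_cancel)
 show "(\<lambda>n. \<bar>nrm Z (s n) - nrm Z a\<bar>) \<longlonglongrightarrow> 0"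
  by (rule tendsto_sandwich[OF _ _ tendsto_const, of _ _ _ "\<lambda>n. nrm Z (s n - a)"])
   (use assms nrm_diff_ge[OF assms(1)] in \<open>auto simp: nconv_def\<close>)
qed

lemma nconv_add:
 assumes Z: "normed_space Z" and s: "!!n. s n \<in> pts Z" "!!n. t n \<in> pts Z"
  and "nconv Z s a" "nconv Z t b"
 shows "nconv Z (\<lambda>n. s n + t n) (a + b)"
proof -
 have ab: "a \<in> pts Z" "b \<in> pts Z" using assms by (auto simp: nconv_def)
 have "(\<lambda>n. nrm Z (s n - a) + nrm Z (t n - b)) \<longlonglongrightarrow> 0 + 0"
  using assms(4,5) by (intro tendsto_add) (auto simp: nconv_def)
 moreover have "nrm Z (s n + t n - (a + b)) <= nrm Z (s n - a) + nrm Z (t n - b)" for n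
  using nrm_add[OF Z pts_diff[OF Z s(1) ab(1), of n] pts_diff[OF Z s(2) ab(2), of n]]
  by (simp add: algebra_simps)
 ultimately show ?thesis
  by (intro nconv_squeeze[OF Z, where d = "\<lambda>n. nrm Z (s n - a) + nrm Z (t n - b)"])
   (auto intro: pts_add[OF Z] s ab)
qed

lemma nconv_scale:
 assumes Z: "normed_space Z" and s: "!!n. s n \<in> pts Z" and "nconv Z s a"
 shows "nconv Z (\<lambda>n. c *\<^sub>R s n) (c *\<^sub>R a)"
proof -
 have a: "a \<in> pts Z" using assms by (auto simp: nconv_def)
 have "(\<lambda>n. \<bar>c\<bar> * nrm Z (s n - a)) \<longlonglongrightarrow> \<bar>c\<bar> * 0"
  using assms(3) by (intro tendsto_mult) (auto simp: nconv_def)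
 moreover have "nrm Z (c *\<^sub>R s n - c *\<^sub>R a) = \<bar>c\<bar> * nrm Z (s n - a)" for n
  using nrm_scale[OF Z pts_diff[OF Z s a], of c n] by (simp add: scaleR_diff_right)
 ultimately show ?thesis
  using pts_scale[OF Z a] by (simp add: nconv_def)
qed

lemma nconv_diff:
 assumes Z: "normed_space Z" and s: "!!n. s n \<in> pts Z" "!!n. t n \<in> pts Z"
  and "nconv Z s a" "nconv Z t b"
 shows "nconv Z (\<lambda>n. s n - t n) (a - b)"
 using nconv_add[OF Z s(1) _ assms(4) nconv_scale[OF Z s(2) assms(5), of "-1"]] pts_minus[OF Z s(2)]
 by auto

lemma nconv_eventually_const:
 assumes "normed_space Z" "z \<in> pts Z" "!!n. n >= N ==> s n = z"
 shows "nconv Z s z"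
 unfolding nconv_def
 by (intro conjI assms(2) tendsto_eventually eventually_sequentiallyI[of N])
  (simp add: assms nrm_zero)

lemma nrm_limit_le:
 assumes "normed_space Z" "!!n. s n \<in> pts Z" "nconv Z s z" "!!n. n >= N ==> nrm Z (s n) <= K"
 shows "nrm Z z <= K"
 using LIMSEQ_le_const2[OF nconv_nrm[OF assms(1-3)]] assms(4) by blast

lemma banach_conv:
 assumes "banach_space Z" "!!n. s n \<in> pts Z"
  and "!!e. e > 0 ==> \<exists>N. \<forall>m\<ge>N. \<forall>n\<ge>N. nrm Z (s m - s n) < e"
 shows "\<exists>z. nconv Z s z"
proof -
 have Z: "normed_space Z" by (rule banach_normed[OF assms(1)])
 interpret M: Metric_space "pts Z" "ndist Z" by (rule Metric_space_ndist[OF Z])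
 have "M.MCauchy s"
  unfolding M.MCauchy_def using assms(2,3) by (auto simp: ndist_def)
 then have "\<exists>z. limitin (ntop Z) s z sequentially"
  using assms(1) by (auto simp: banach_space_def M.mcomplete_def)
 then show ?thesis using limitin_ntop[of Z s] Z assms(2) by blast
qed

lemma banach_spaceI:
 assumes Z: "normed_space Z"
  and "!!s. (!!n. s n \<in> pts Z) ==>
   (!!e. e > 0 ==> \<exists>N. \<forall>m\<ge>N. \<forall>n\<ge>N. nrm Z (s m - s n) < e) ==> \<exists>z. nconv Z s z"
 shows "banach_space Z"
proof -
 interpret M: Metric_space "pts Z" "ndist Z" by (rule Metric_space_ndist[OF Z])
 have "\<exists>z. limitin (ntop Z) s z sequentially" if c: "M.MCauchy s" for s
 proof -
  have s: "s n \<in> pts Z" for n using c by (auto simp: M.MCauchy_def)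
  have "\<exists>N. \<forall>m\<ge>N. \<forall>n\<ge>N. nrm Z (s m - s n) < e" if "e > 0" for e
   using c that s by (auto simp: M.MCauchy_def ndist_def)
  then have "\<exists>z. nconv Z s z" by (rule assms(2)[OF s])
  then show ?thesis using limitin_ntop[of Z s] Z s by blast
 qed
 then show ?thesis using Z by (simp add: banach_space_def M.mcomplete_def)
qed

lemma geometric_partial_sum: "(\<Sum>i\<in>{m..<n}. (1/2::real) ^ i) <= 2 * (1/2) ^ m"
proof (cases "m <= n")
 case True
 then have "(\<Sum>i\<in>{m..<n}. (1/2::real) ^ i) = 2 * (1/2)^m - 2 * (1/2)^n"
  by (induction n rule: dec_induct) (auto simp: sum.atLeastLessThan_Suc)
 then show ?thesis by simp
qed auto

lemma sum_lessThan_diff: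
 fixes s :: "nat => 'a::ab_group_add"
 shows "m <= n ==> sum s {..<n} - sum s {..<m} = sum s {m..<n}"
 by (metis lessThan_atLeast0 sum_diff_nat_ivl zero_le)

lemma banach_geometric_series:
 assumes B: "banach_space Z" and s: "!!n. s n \<in> pts Z" and K: "!!n. nrm Z (s n) <= K * (1/2) ^ n"
 shows "\<exists>z. nconv Z (\<lambda>n. \<Sum>i<n. s i) z & nrm Z z <= 2 * K"
proof -
 have Z: "normed_space Z" by (rule banach_normed[OF B])
 have K0: "K >= 0" using K[of 0] nrm_nonneg[OF Z s[of 0]] by simp
 have P: "(\<Sum>i<n. s i) \<in> pts Z" for n using s by (intro pts_sum[OF Z])
 have le: "nrm Z ((\<Sum>i<n. s i) - (\<Sum>i<m. s i)) <= 2 * K * (1/2) ^ m" if "m <= n" for m n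
 proof -
  have "nrm Z ((\<Sum>i<n. s i) - (\<Sum>i<m. s i)) = nrm Z (\<Sum>i\<in>{m..<n}. s i)"
   using sum_lessThan_diff[OF that, of s] by simp
  also have "\<dots> <= (\<Sum>i\<in>{m..<n}. nrm Z (s i))" by (rule nrm_sum[OF Z s])
  also have "\<dots> <= (\<Sum>i\<in>{m..<n}. K * (1/2) ^ i)" by (intro sum_mono K)
  also have "\<dots> <= K * (2 * (1/2) ^ m)"
   unfolding sum_distrib_left[symmetric] using K0 geometric_partial_sum
   by (intro mult_left_mono)
  finally show ?thesis by simp
 qed
 have "\<exists>z. nconv Z (\<lambda>n. \<Sum>i<n. s i) z"
 proof (rule banach_conv[OF B P])
  fix e :: real assume "e > 0"
  have "(\<lambda>n. 2 * K * (1/2) ^ n) \<longlonglongrightarrow> 2 * K * 0"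
   by (intro tendsto_mult tendsto_const LIMSEQ_realpow_zero) auto
  then obtain N where N: "2 * K * (1/2) ^ N < e"
   using \<open>e > 0\<close> K0 by (auto simp: LIMSEQ_iff)
  have "nrm Z ((\<Sum>i<m. s i) - (\<Sum>i<n. s i)) < e" if "m >= N" "n >= N" for m n
  proof -
   have dec: "2 * K * (1/2) ^ k <= 2 * K * (1/2) ^ N" if "k >= N" for k
    using K0 that by (intro mult_left_mono power_decreasing) auto
   show ?thesis
    using le[of m n] le[of n m] dec[of m] dec[of n] that N nrm_diff_commute[OF Z P P, of m n]
    by (cases "m <= n") auto
  qed
  then show "\<exists>N. \<forall>m\<ge>N. \<forall>n\<ge>N. nrm Z ((\<Sum>i<m. s i) - (\<Sum>i<n. s i)) < e" by blast
 qed
 then obtain z where z: "nconv Z (\<lambda>n. \<Sum>i<n. s i) z" by blast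
 have "nrm Z z <= 2 * K"
  by (rule nrm_limit_le[OF Z P z, where N = 0]) (use le[of 0] in simp)
 then show ?thesis using z by blast
qed

lemma in_closure_ntop:
 assumes "normed_space Z" "A \<subseteq> pts Z"
 shows "z \<in> ntop Z closure_of A \<longleftrightarrow> z \<in> pts Z & (\<forall>e>0. \<exists>a\<in>A. nrm Z (z - a) < e)"
proof -
 interpret M: Metric_space "pts Z" "ndist Z" by (rule Metric_space_ndist[OF assms(1)])
 have "(\<exists>a\<in>A. a \<in> M.mball z e) \<longleftrightarrow> (\<exists>a\<in>A. nrm Z (z - a) < e)" if "z \<in> pts Z" for e
  using assms(2) that by (force simp: ndist_def)
 then show ?thesis
  unfolding M.metric_closure_of by auto
qed

lemma closure_seq:
 assumes Z: "normed_space Z" and "A \<subseteq> pts Z" "z \<in> pts Z" "!!e. e > 0 ==> \<exists>a\<in>A. nrm Z (z - a) < e"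
 obtains s where "!!n. s n \<in> A" "nconv Z s z" "!!n. nrm Z (s n - z) < (1/2) ^ n"
proof -
 have "\<exists>a. a \<in> A & nrm Z (z - a) < (1/2) ^ n" for n :: nat
  using assms(4)[of "(1/2) ^ n"] by auto
 then obtain s where s: "!!n. s n \<in> A" "!!n. nrm Z (z - s n) < (1/2) ^ n" by metis
 have s': "nrm Z (s n - z) < (1/2) ^ n" for n
  using s nrm_diff_commute[OF Z assms(3)] assms(2) by (metis subsetD)
 have "nconv Z s z"
  by (rule nconv_squeeze[OF Z, where d = "\<lambda>n. (1/2) ^ n"])
   (use s s' assms in \<open>auto intro!: LIMSEQ_realpow_zero less_imp_le\<close>)
 then show ?thesis using that s s' by blast
qed

lemma separable_iff:
 assumes "normed_space Z"
 shows "separable_space (ntop Z) \<longleftrightarrow>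
  (\<exists>D. countable D & D \<subseteq> pts Z & (\<forall>z\<in>pts Z. \<forall>e>0. \<exists>d\<in>D. nrm Z (z - d) < e))"
proof -
 interpret M: Metric_space "pts Z" "ndist Z" by (rule Metric_space_ndist[OF assms(1)])
 have "ntop Z closure_of D = pts Z \<longleftrightarrow> (\<forall>z\<in>pts Z. \<forall>e>0. \<exists>d\<in>D. nrm Z (z - d) < e)"
  if "D \<subseteq> pts Z" for D
  using in_closure_ntop[OF assms that] by blast
 then show ?thesis
  unfolding separable_space_def M.topspace_mtopology
  by (intro iff_exI conj_cong refl) blast
qed

section \<open>Bounded operators and duals\<close>

lemma bounded_operatorI:
 assumes "!!x. x \<in> pts X ==> T x \<in> pts Y"
  and "!!x y. x \<in> pts X ==> y \<in> pts X ==> T (x + y) = T x + T y"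
  and "!!c x. x \<in> pts X ==> T (c *\<^sub>R x) = c *\<^sub>R T x"
  and "!!x. x \<in> pts X ==> nrm Y (T x) <= K * nrm X x"
 shows "bounded_operator X Y T"
 unfolding bounded_operator_def using assms by blast

lemma op_mem: "bounded_operator X Y T ==> x \<in> pts X ==> T x \<in> pts Y"
 and op_add: "bounded_operator X Y T ==> x \<in> pts X ==> y \<in> pts X ==> T (x + y) = T x + T y"
 and op_scale: "bounded_operator X Y T ==> x \<in> pts X ==> T (c *\<^sub>R x) = c *\<^sub>R T x"
 by (auto simp: bounded_operator_def)

lemma op_bound:
 assumes "bounded_operator X Y T" "normed_space X"
 obtains K where "K > 0" "!!x. x \<in> pts X ==> nrm Y (T x) <= K * nrm X x"
proof -
 obtain K where K: "!!x. x \<in> pts X ==> nrm Y (T x) <= K * nrm X x"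
  using assms(1) unfolding bounded_operator_def by blast
 have "nrm Y (T x) <= (\<bar>K\<bar> + 1) * nrm X x" if "x \<in> pts X" for x
  using K[OF that] mult_right_mono[of K "\<bar>K\<bar> + 1" "nrm X x"] nrm_nonneg[OF assms(2) that] by linarith
 then show ?thesis using that[of "\<bar>K\<bar> + 1"] by auto
qed

lemma op_zero: "bounded_operator X Y T ==> normed_space X ==> T 0 = 0"
 using op_scale[of X Y T 0 0] pts_zero[of X] by simp

lemma op_minus: "bounded_operator X Y T ==> x \<in> pts X ==> T (- x) = - T x"
 using op_scale[of X Y T x "-1"] by simp

lemma op_diff:
 assumes "bounded_operator X Y T" "normed_space X" "x \<in> pts X" "y \<in> pts X"
 shows "T (x - y) = T x - T y"
 using op_add[OF assms(1,3) pts_minus[OF assms(2,4)]] op_minus[OF assms(1,4)] by simp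

lemma op_sum:
 assumes "bounded_operator X Y T" "normed_space X" "!!i. i \<in> I ==> g i \<in> pts X"
 shows "T (sum g I) = (\<Sum>i\<in>I. T (g i))"
 using assms(3)
proof (induction I rule: infinite_finite_induct)
 case (insert x F)
 have "T (g x + sum g F) = T (g x) + T (sum g F)"
  by (rule op_add[OF assms(1)]) (use insert in \<open>auto intro: pts_sum[OF assms(2)]\<close>)
 then show ?case using insert by simp
qed (auto simp: op_zero[OF assms(1,2)])

lemma op_comp:
 assumes "bounded_operator X Y T" "bounded_operator Y Z S" "normed_space X" "normed_space Y"
 shows "bounded_operator X Z (\<lambda>x. S (T x))"
proof -
 obtain K where K: "K > 0" "!!x. x \<in> pts X ==> nrm Y (T x) <= K * nrm X x"
  using op_bound[OF assms(1,3)] by blast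
 obtain L where L: "L > 0" "!!x. x \<in> pts Y ==> nrm Z (S x) <= L * nrm Y x"
  using op_bound[OF assms(2,4)] by blast
 show ?thesis
 proof (rule bounded_operatorI)
  fix x assume x: "x \<in> pts X"
  show "nrm Z (S (T x)) <= (L * K) * nrm X x"
   using L(2)[OF op_mem[OF assms(1) x]] mult_left_mono[OF K(2)[OF x] less_imp_le[OF L(1)]]
   unfolding mult.assoc by linarith
 qed (use assms(1,2) in \<open>simp_all add: op_mem op_add op_scale\<close>)
qed

lemma op_conv:
 assumes "bounded_operator X Y T" "normed_space X" "normed_space Y" "!!n. s n \<in> pts X" "nconv X s x"
 shows "nconv Y (\<lambda>n. T (s n)) (T x)"
proof -
 obtain K where K: "K > 0" "!!x. x \<in> pts X ==> nrm Y (T x) <= K * nrm X x"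
  using op_bound[OF assms(1,2)] by blast
 have x: "x \<in> pts X" using assms(5) by (rule nconv_pts)
 have "(\<lambda>n. K * nrm X (s n - x)) \<longlonglongrightarrow> K * 0"
  using assms(5) by (intro tendsto_mult) (auto simp: nconv_def)
 then show ?thesis
  using K(2)[OF pts_diff[OF assms(2) assms(4) x]] op_diff[OF assms(1,2) assms(4) x]
  by (intro nconv_squeeze[OF assms(3), where d = "\<lambda>n. K * nrm X (s n - x)"])
   (auto intro: op_mem[OF assms(1)] assms(4) x)
qed

lemma normed_space_real: "normed_space \<lparr>pts = (UNIV :: real set), nrm = abs\<rparr>"
 by (auto simp: normed_space_def abs_mult)

lemma dual_op: "f \<in> pts (dual Z) ==> bounded_operator Z \<lparr>pts = (UNIV :: real set), nrm = abs\<rparr> f"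
 and dual_off: "f \<in> pts (dual Z) ==> x \<notin> pts Z ==> f x = 0"
 by (auto simp: dual_def)

lemmas dual_add = op_add[OF dual_op]
lemmas dual_scale = op_scale[OF dual_op, simplified]
lemmas dual_zero = op_zero[OF dual_op]
lemmas dual_minus = op_minus[OF dual_op]
lemmas dual_diff = op_diff[OF dual_op]
lemmas dual_sum = op_sum[OF dual_op]

lemma dualI:
 assumes "!!x y. x \<in> pts Z ==> y \<in> pts Z ==> f (x + y) = f x + f y"
  and "!!c x. x \<in> pts Z ==> f (c *\<^sub>R x) = c * f x"
  and "!!x. x \<in> pts Z ==> \<bar>f x\<bar> <= K * nrm Z x"
  and "!!x. x \<notin> pts Z ==> f x = 0"
 shows "f \<in> pts (dual Z)"
 unfolding dual_def using assms by (auto intro!: bounded_operatorI[where K = K])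

lemma dual_restrictI:
 assumes "normed_space Z"
  and "!!x y. x \<in> pts Z ==> y \<in> pts Z ==> f (x + y) = f x + f y"
  and "!!c x. x \<in> pts Z ==> f (c *\<^sub>R x) = c * f x"
  and "!!x. x \<in> pts Z ==> \<bar>f x\<bar> <= K * nrm Z x"
 shows "(\<lambda>x. if x \<in> pts Z then f x else 0) \<in> pts (dual Z)"
 by (rule dualI[where K = K]) (use assms in \<open>auto simp: pts_add pts_scale\<close>)

lemma dual_bdd:
 assumes "normed_space Z" "f \<in> pts (dual Z)"
 shows "bdd_above ((\<lambda>x. \<bar>f x\<bar>) ` {x \<in> pts Z. nrm Z x <= 1})"
proof -
 obtain K where K: "K > 0" "!!x. x \<in> pts Z ==> \<bar>f x\<bar> <= K * nrm Z x"
  using op_bound[OF dual_op[OF assms(2)] assms(1)] by auto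
 have "\<bar>f x\<bar> <= K" if "x \<in> pts Z" "nrm Z x <= 1" for x
  using K(2)[OF that(1)] mult_left_mono[OF that(2) less_imp_le[OF K(1)]] by linarith
 then show ?thesis by (intro bdd_aboveI[where M = K]) auto
qed

lemma dual_nrm_def: "nrm (dual Z) f = (SUP x\<in>{x \<in> pts Z. nrm Z x <= 1}. \<bar>f x\<bar>)"
 by (simp add: dual_def)

lemma dual_nrm_ge:
 assumes "normed_space Z" "f \<in> pts (dual Z)" "x \<in> pts Z" "nrm Z x <= 1"
 shows "\<bar>f x\<bar> <= nrm (dual Z) f"
 unfolding dual_nrm_def using assms by (intro cSUP_upper dual_bdd) auto

lemma dual_nrm_nonneg: "normed_space Z ==> f \<in> pts (dual Z) ==> 0 <= nrm (dual Z) f"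
 using dual_nrm_ge[of Z f 0] by (auto simp: pts_zero nrm_zero)

lemma dual_bound:
 assumes "normed_space Z" "f \<in> pts (dual Z)" "x \<in> pts Z"
 shows "\<bar>f x\<bar> <= nrm (dual Z) f * nrm Z x"
proof (cases "x = 0")
 case True
 then show ?thesis using assms by (simp add: dual_zero nrm_zero)
next
 case False
 have n: "nrm Z x > 0" using nrm_pos[OF assms(1,3) False] .
 have "\<bar>f ((1 / nrm Z x) *\<^sub>R x)\<bar> <= nrm (dual Z) f"
  by (rule dual_nrm_ge[OF assms(1,2)]) (use assms n in \<open>auto simp: pts_scale nrm_scale\<close>)
 then show ?thesis
  using n by (simp add: dual_scale[OF assms(2,3)] abs_mult field_simps)
qed

lemma dual_nrm_le:
 assumes "normed_space Z" "0 <= K" "!!x. x \<in> pts Z ==> nrm Z x <= 1 ==> \<bar>f x\<bar> <= K"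
 shows "nrm (dual Z) f <= K"
 unfolding dual_nrm_def using assms by (intro cSUP_least) (auto intro!: exI[of _ 0] simp: pts_zero nrm_zero)

lemma dual_nrm_le':
 assumes "normed_space Z" "0 <= K" "!!x. x \<in> pts Z ==> \<bar>f x\<bar> <= K * nrm Z x"
 shows "nrm (dual Z) f <= K"
proof (rule dual_nrm_le[OF assms(1,2)])
 fix x assume "x \<in> pts Z" "nrm Z x <= 1"
 then show "\<bar>f x\<bar> <= K" using assms(3)[of x] mult_left_mono[of "nrm Z x" 1 K] assms(2) by simp
qed

lemma dual_nrm_approx:
 assumes "normed_space Z" "f \<in> pts (dual Z)" "c < nrm (dual Z) f"
 obtains x where "x \<in> pts Z" "nrm Z x <= 1" "c < f x"
proof -
 have "\<exists>x\<in>{x \<in> pts Z. nrm Z x <= 1}. c < \<bar>f x\<bar>"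
  using assms(3) pts_zero[OF assms(1)] nrm_zero[OF assms(1)] unfolding dual_nrm_def
  by (subst (asm) less_cSUP_iff[OF _ dual_bdd[OF assms(1,2)]]) (auto intro!: exI[of _ 0])
 then obtain x where x: "x \<in> pts Z" "nrm Z x <= 1" "c < \<bar>f x\<bar>" by blast
 then show ?thesis
  using that[of x] that[of "- x"] assms by (auto simp: pts_minus nrm_minus dual_minus abs_if split: if_splits)
qed

lemma pts_dual_subspace:
 assumes "normed_space Z"
 shows "subspace (pts (dual Z))"
proof (rule subspaceI)
 show "0 \<in> pts (dual Z)"
  by (rule dualI[where K = 0]) auto
next
 fix f g assume fg: "f \<in> pts (dual Z)" "g \<in> pts (dual Z)"
 show "f + g \<in> pts (dual Z)"
 proof (rule dualI[where K = "nrm (dual Z) f + nrm (dual Z) g"])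
  show "\<bar>(f + g) x\<bar> <= (nrm (dual Z) f + nrm (dual Z) g) * nrm Z x" if "x \<in> pts Z" for x
   using dual_bound[OF assms fg(1) that] dual_bound[OF assms fg(2) that]
   by (simp add: algebra_simps)
 qed (use fg in \<open>auto simp: dual_add dual_scale dual_off algebra_simps\<close>)
next
 fix f and c :: real assume f: "f \<in> pts (dual Z)"
 show "c *\<^sub>R f \<in> pts (dual Z)"
 proof (rule dualI[where K = "\<bar>c\<bar> * nrm (dual Z) f"])
  show "\<bar>(c *\<^sub>R f) x\<bar> <= \<bar>c\<bar> * nrm (dual Z) f * nrm Z x" if "x \<in> pts Z" for x
   using mult_left_mono[OF dual_bound[OF assms f that], of "\<bar>c\<bar>"]
   by (simp add: scaleR_fun_def abs_mult algebra_simps)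
 qed (use f in \<open>auto simp: dual_add dual_scale dual_off scaleR_fun_def algebra_simps\<close>)
qed

lemma normed_space_dual:
 assumes Z: "normed_space Z"
 shows "normed_space (dual Z)"
 unfolding normed_space_def
proof (intro conjI ballI allI)
 show sub: "subspace (pts (dual Z))" by (rule pts_dual_subspace[OF Z])
 fix f assume f: "f \<in> pts (dual Z)"
 show "0 <= nrm (dual Z) f" by (rule dual_nrm_nonneg[OF Z f])
 show "nrm (dual Z) f = 0 \<longleftrightarrow> f = 0"
 proof
  assume "nrm (dual Z) f = 0"
  then have "f x = 0" for x using dual_bound[OF Z f, of x] dual_off[OF f, of x] by fastforce
  then show "f = 0" by auto
 next
  assume "f = 0"
  then have "nrm (dual Z) f <= 0" by (intro dual_nrm_le[OF Z]) auto
  then show "nrm (dual Z) f = 0" using dual_nrm_nonneg[OF Z f] by simp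
 qed
 have sc: "nrm (dual Z) (c *\<^sub>R g) <= \<bar>c\<bar> * nrm (dual Z) g" if g: "g \<in> pts (dual Z)" for c g
  using dual_nrm_nonneg[OF Z g] mult_left_mono[OF dual_nrm_ge[OF Z g], of _ "\<bar>c\<bar>"]
  by (intro dual_nrm_le[OF Z]) (auto simp: scaleR_fun_def abs_mult)
 show "nrm (dual Z) (c *\<^sub>R f) = \<bar>c\<bar> * nrm (dual Z) f" for c
 proof (cases "c = 0")
  case True
  then show ?thesis using sc[OF f, of 0] dual_nrm_nonneg[OF Z, of 0] subspace_0[OF sub] by simp
 next
  case False
  have "nrm (dual Z) ((1/c) *\<^sub>R (c *\<^sub>R f)) <= \<bar>1/c\<bar> * nrm (dual Z) (c *\<^sub>R f)"
   by (rule sc[OF subspace_scale[OF sub f]])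
  then show ?thesis using sc[OF f, of c] False by (simp add: field_simps)
 qed
 fix g assume g: "g \<in> pts (dual Z)"
 show "nrm (dual Z) (f + g) <= nrm (dual Z) f + nrm (dual Z) g"
 proof (rule dual_nrm_le[OF Z])
  fix x assume "x \<in> pts Z" "nrm Z x <= 1"
  then show "\<bar>(f + g) x\<bar> <= nrm (dual Z) f + nrm (dual Z) g"
   using dual_nrm_ge[OF Z f, of x] dual_nrm_ge[OF Z g, of x] by simp
 qed (use dual_nrm_nonneg[OF Z f] dual_nrm_nonneg[OF Z g] in simp)
qed

lemma banach_dual:
 fixes Z :: "'a::real_vector nspace"
 assumes Z: "normed_space Z"
 shows "banach_space (dual Z)"
proof (rule banach_spaceI[OF normed_space_dual[OF Z]])
 fix s :: "nat => 'a => real" assume s: "!!n. s n \<in> pts (dual Z)"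
  and c: "!!e. e > 0 ==> \<exists>N. \<forall>m\<ge>N. \<forall>n\<ge>N. nrm (dual Z) (s m - s n) < e"
 note D = normed_space_dual[OF Z]
 have pw: "\<bar>s m x - s n x\<bar> <= nrm (dual Z) (s m - s n) * nrm Z x" if "x \<in> pts Z" for m n x
  using dual_bound[OF Z pts_diff[OF D s s] that, of m n] by simp
 have cau: "Cauchy (\<lambda>n. s n x)" for x
 proof (cases "x \<in> pts Z")
  case True
  show ?thesis
   unfolding Cauchy_def dist_real_def
  proof (intro allI impI)
   fix e :: real assume "e > 0"
   have pos: "0 < nrm Z x + 1" using nrm_nonneg[OF Z True] by simp
   then obtain N where N: "\<forall>m\<ge>N. \<forall>n\<ge>N. nrm (dual Z) (s m - s n) < e / (nrm Z x + 1)"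
    using c[of "e / (nrm Z x + 1)"] \<open>e > 0\<close> by auto
   have "\<bar>s m x - s n x\<bar> < e" if "m >= N" "n >= N" for m n
   proof -
    have "nrm (dual Z) (s m - s n) * nrm Z x <= nrm (dual Z) (s m - s n) * (nrm Z x + 1)"
     using dual_nrm_nonneg[OF Z pts_diff[OF D s s]] by (intro mult_left_mono) auto
    also have "\<dots> < e" using N that pos by (simp add: pos_less_divide_eq)
    finally show ?thesis using pw[OF True, of m n] by simp
   qed
   then show "\<exists>M. \<forall>m\<ge>M. \<forall>n\<ge>M. \<bar>s m x - s n x\<bar> < e" by blast
  qed
 qed (auto simp: dual_off[OF s] Cauchy_def)
 then obtain f where f: "!!x. (\<lambda>n. s n x) \<longlonglongrightarrow> f x"
  unfolding Cauchy_convergent_iff convergent_def by metis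
 have ex: "\<exists>N. \<forall>n\<ge>N. \<forall>x\<in>pts Z. \<bar>s n x - f x\<bar> <= e * nrm Z x" if "e > 0" for e
 proof -
  obtain N where N: "\<forall>m\<ge>N. \<forall>n\<ge>N. nrm (dual Z) (s m - s n) < e" using c[OF \<open>e > 0\<close>] by blast
  have "\<bar>s n x - f x\<bar> <= e * nrm Z x" if "n >= N" "x \<in> pts Z" for n x
  proof (rule LIMSEQ_le_const2)
   show "(\<lambda>m. \<bar>s n x - s m x\<bar>) \<longlonglongrightarrow> \<bar>s n x - f x\<bar>"
    by (intro tendsto_intros f)
   have "\<bar>s n x - s m x\<bar> <= e * nrm Z x" if "m >= N" for m
    using pw[OF \<open>x \<in> pts Z\<close>, of n m] N that \<open>n >= N\<close>
     mult_right_mono[of "nrm (dual Z) (s n - s m)" e "nrm Z x"] nrm_nonneg[OF Z \<open>x \<in> pts Z\<close>]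
    by force
   then show "\<exists>N. \<forall>m\<ge>N. \<bar>s n x - s m x\<bar> <= e * nrm Z x" by blast
  qed
  then show ?thesis by blast
 qed
 obtain N where N: "\<forall>n\<ge>N. \<forall>x\<in>pts Z. \<bar>s n x - f x\<bar> <= 1 * nrm Z x" using ex[of 1] by auto
 have fd: "f \<in> pts (dual Z)"
 proof (rule dualI[where K = "1 + nrm (dual Z) (s N)"])
  fix x y assume xy: "x \<in> pts Z" "y \<in> pts Z"
  have "(\<lambda>n. s n (x + y)) \<longlonglongrightarrow> f x + f y"
   using tendsto_add[OF f f, of x y] by (simp add: dual_add[OF s xy])
  then show "f (x + y) = f x + f y" using LIMSEQ_unique[OF f] by blast
 next
  fix c x assume x: "x \<in> pts Z"
  have "(\<lambda>n. s n (c *\<^sub>R x)) \<longlonglongrightarrow> c * f x"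
   using tendsto_mult[OF tendsto_const f, of c x] by (simp add: dual_scale[OF s x])
  then show "f (c *\<^sub>R x) = c * f x" using LIMSEQ_unique[OF f] by blast
 next
  fix x assume x: "x \<in> pts Z"
  show "\<bar>f x\<bar> <= (1 + nrm (dual Z) (s N)) * nrm Z x"
   using N[rule_format, OF order_refl x] dual_bound[OF Z s x, of N] by (simp add: algebra_simps)
 next
  fix x assume "x \<notin> pts Z"
  then have "(\<lambda>n. s n x) \<longlonglongrightarrow> 0" by (simp add: dual_off[OF s])
  then show "f x = 0" using LIMSEQ_unique[OF f] by blast
 qed
 have "nconv (dual Z) s f"
  unfolding nconv_iff[OF D s]
 proof (intro conjI fd allI impI)
  fix e :: real assume "e > 0"
  obtain N where N: "\<forall>n\<ge>N. \<forall>x\<in>pts Z. \<bar>s n x - f x\<bar> <= (e/2) * nrm Z x"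
   using ex[of "e/2"] \<open>e > 0\<close> by auto
  have "nrm (dual Z) (s n - f) <= e/2" if "n >= N" for n
   by (rule dual_nrm_le'[OF Z]) (use N that \<open>e > 0\<close> in auto)
  then show "\<exists>N. \<forall>n\<ge>N. nrm (dual Z) (s n - f) < e"
   using \<open>e > 0\<close> by (intro exI[of _ N]) force
 qed
 then show "\<exists>f. nconv (dual Z) s f" by blast
qed

section \<open>The Hahn-Banach theorem\<close>

text \<open>A maximal convex cone below the graph of the norm contains the graph of a linear functional.\<close>

lemma cone_functional:
 assumes Z: "normed_space Z" and K: "fst ` K \<subseteq> pts Z" "0 \<in> K"
  "!!a b. a \<in> K ==> b \<in> K ==> a + b \<in> K" "!!c a. c > 0 ==> a \<in> K ==> c *\<^sub>R a \<in> K"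
  and le: "!!y s. (y, s) \<in> K ==> s <= nrm Z y"
 obtains f where "f \<in> pts (dual Z)" "!!x. x \<in> pts Z ==> \<bar>f x\<bar> <= nrm Z x"
  "!!y s. (y, s) \<in> K ==> s <= f y"
proof -
 define Q where "Q = {M. K \<subseteq> M & fst ` M \<subseteq> pts Z & (\<forall>a\<in>M. \<forall>b\<in>M. a + b \<in> M) &
  (\<forall>c>0. \<forall>a\<in>M. c *\<^sub>R a \<in> M) & (\<forall>a\<in>M. snd a <= nrm Z (fst a))}"
 have "\<exists>M\<in>Q. \<forall>X\<in>Q. M \<subseteq> X --> X = M"
 proof (rule subset_Zorn_nonempty)
  have "K \<in> Q" unfolding Q_def using K(1,3,4) le by (intro CollectI conjI ballI allI impI order_refl) auto
  then show "Q ~= {}" by blast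
  fix C assume "C ~= {}" and C: "subset.chain Q C"
  have CQ: "M \<in> Q" if "M \<in> C" for M using C that by (auto simp: subset_chain_def)
  have "a + b \<in> \<Union>C" if ab: "M \<in> C" "a \<in> M" "N \<in> C" "b \<in> N" for a b M N
  proof -
   have "M \<subseteq> N \<or> N \<subseteq> M" using C ab(1,3) by (simp add: subset_chain_def)
   then obtain L where L: "L \<in> C" "a \<in> L" "b \<in> L" using ab by auto
   then have "a + b \<in> L" using CQ[OF L(1)] by (simp add: Q_def)
   then show ?thesis using L(1) by blast
  qed
  moreover have "K \<subseteq> M" "fst ` M \<subseteq> pts Z" if "M \<in> C" for M using CQ[OF that] by (simp_all add: Q_def)
  then have "K \<subseteq> \<Union>C" "fst ` \<Union>C \<subseteq> pts Z" using \<open>C ~= {}\<close> by blast+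
  moreover have "c *\<^sub>R a \<in> M" if "M \<in> C" "a \<in> M" "c > 0" for c a M using CQ[of M] that by (simp add: Q_def)
  moreover have "snd a <= nrm Z (fst a)" if "M \<in> C" "a \<in> M" for a M using CQ[of M] that by (auto simp: Q_def)
  ultimately show "\<Union>C \<in> Q" unfolding Q_def by blast
 qed
 then obtain M where M: "M \<in> Q" and max: "!!X. X \<in> Q ==> M \<subseteq> X ==> X = M" by blast
 have KM: "K \<subseteq> M" and Mf: "!!a. a \<in> M ==> fst a \<in> pts Z" and Ma: "!!a b. a \<in> M ==> b \<in> M ==> a + b \<in> M"
  and Mc: "!!c a. c > 0 ==> a \<in> M ==> c *\<^sub>R a \<in> M" and Mle: "!!a. a \<in> M ==> snd a <= nrm Z (fst a)"
  using M by (auto simp: Q_def)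
 have M0: "0 \<in> M" using KM K(2) by blast
 \<comment> \<open>Adjoining the ray through \<open>(x, t)\<close> again gives a cone in
   \<open>Q\<close>; rescaling by the coefficient of the ray reduces its bound to coefficient 1,
   which is the hypothesis on \<open>t\<close>.\<close>
 have extend: "(x, t) \<in> M" if x: "x \<in> pts Z" and t: "!!a. a \<in> M ==> snd a + t <= nrm Z (fst a + x)" for x t
 proof -
  define M' where "M' = {a + c *\<^sub>R (x, t) | a c. a \<in> M & c >= 0}"
  have in_M': "a + c *\<^sub>R (x, t) \<in> M'" if "a \<in> M" "c >= 0" for a c using that unfolding M'_def by blast
  have MM': "M \<subseteq> M'" using in_M'[of _ 0] by auto
  have bound: "snd (a + c *\<^sub>R (x, t)) <= nrm Z (fst (a + c *\<^sub>R (x, t)))" if a: "a \<in> M" and c: "c >= 0" for a c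
  proof (cases "c = 0")
   case False
   then have c: "c > 0" using c by simp
   have "fst a + c *\<^sub>R x = c *\<^sub>R (fst ((1 / c) *\<^sub>R a) + x)" using c by (simp add: scaleR_add_right)
   then have "nrm Z (fst a + c *\<^sub>R x) = c * nrm Z (fst ((1 / c) *\<^sub>R a) + x)"
    using c nrm_scale[OF Z pts_add[OF Z Mf[OF Mc[OF _ a]] x], of "1 / c" c] by simp
   moreover have "c * (snd ((1 / c) *\<^sub>R a) + t) <= c * nrm Z (fst ((1 / c) *\<^sub>R a) + x)"
    using c by (intro mult_left_mono t Mc a) auto
   ultimately show ?thesis using c by (simp add: algebra_simps)
  qed (use Mle[OF a] in simp)
  have "M' \<in> Q"
   unfolding Q_def
  proof (intro CollectI conjI ballI allI impI)
   show "K \<subseteq> M'" using KM MM' by blast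
   show "fst ` M' \<subseteq> pts Z" using Mf x by (auto simp: M'_def intro!: pts_add[OF Z] pts_scale[OF Z])
   show "snd b <= nrm Z (fst b)" if "b \<in> M'" for b using that bound unfolding M'_def by blast
   show "b + d \<in> M'" if bd: "b \<in> M'" "d \<in> M'" for b d
   proof -
    obtain a r a' r' where "b = a + r *\<^sub>R (x, t)" "d = a' + r' *\<^sub>R (x, t)" "a \<in> M" "a' \<in> M" "r >= 0" "r' >= 0"
     using bd unfolding M'_def by blast
    then show ?thesis using in_M'[OF Ma[of a a'], of "r + r'"] by (simp add: scaleR_add_left add_ac del: scaleR_Pair)
   qed
   show "c *\<^sub>R b \<in> M'" if c: "c > 0" "b \<in> M'" for c b
   proof -
    obtain a r where "b = a + r *\<^sub>R (x, t)" "a \<in> M" "r >= 0" using c(2) unfolding M'_def by blast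
    then show ?thesis using c(1) in_M'[OF Mc[of c a], of "c * r"] by (simp add: scaleR_add_right del: scaleR_Pair)
   qed
  qed
  then have "M' = M" using max MM' by blast
  then show ?thesis using in_M'[OF M0, of 1] by simp
 qed
 have "\<exists>t. (x, t) \<in> M & (- x, - t) \<in> M" if x: "x \<in> pts Z" for x
 proof -
  \<comment> \<open>The largest value at \<open>x\<close> that \<open>M\<close> tolerates. By
    sublinearity, in \<open>low\<close>, its negative is tolerated at \<open>- x\<close>, so
    maximality puts both points into \<open>M\<close>.\<close>
  define t where "t = (INF a\<in>M. nrm Z (fst a + x) - snd a)"
  have low: "snd b - nrm Z (fst b - x) <= nrm Z (fst a + x) - snd a" if "a \<in> M" "b \<in> M" for a b
   using Mle[OF Ma[OF that]] nrm_add[OF Z pts_add[OF Z Mf[OF that(1)] x] pts_diff[OF Z Mf[OF that(2)] x]] by simp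
  have "bdd_below ((\<lambda>a. nrm Z (fst a + x) - snd a) ` M)" using low[OF _ M0] by (intro bdd_belowI2) blast
  then have "t <= nrm Z (fst a + x) - snd a" if "a \<in> M" for a unfolding t_def using that by (rule cINF_lower)
  moreover have "snd b - nrm Z (fst b - x) <= t" if "b \<in> M" for b
   unfolding t_def by (rule cINF_greatest) (use M0 low that in auto)
  ultimately show ?thesis using x by (intro exI[of _ t] conjI extend pts_minus[OF Z]) (force simp: algebra_simps)+
 qed
 then obtain L where L: "!!x. x \<in> pts Z ==> (x, L x) \<in> M" "!!x. x \<in> pts Z ==> (- x, - L x) \<in> M" by metis
 \<comment> \<open>The two points add up to \<open>(0, s - r)\<close>, which lies below the norm of
   0. This makes the value \<open>L x\<close> unique.\<close>
 have above: "s <= r" if "(x, s) \<in> M" "(- x, - r) \<in> M" for x s r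
  using Mle[OF Ma[OF that]] nrm_zero[OF Z] by simp
 have eq: "L x = s" if "x \<in> pts Z" "(x, s) \<in> M" "(- x, - s) \<in> M" for x s
  using above[OF that(2) L(2)] above[OF L(1) that(3)] that(1) by simp
 have Ladd: "L (x + y) = L x + L y" if "x \<in> pts Z" "y \<in> pts Z" for x y
  using Ma[OF L(1) L(1), of x y] Ma[OF L(2) L(2), of x y] that pts_add[OF Z that] by (intro eq) (auto simp: algebra_simps)
 have Lscale: "L (c *\<^sub>R x) = c * L x" if x: "x \<in> pts Z" for c x
 proof (cases c "0 :: real" rule: linorder_cases)
  case less
  then show ?thesis using Mc[OF _ L(2)[OF x], of "- c"] Mc[OF _ L(1)[OF x], of "- c"] by (intro eq pts_scale[OF Z x]) auto
 next
  case equal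
  then show ?thesis using eq[of 0 0] M0 pts_zero[OF Z] by (simp add: zero_prod_def)
 next
  case greater
  then show ?thesis using Mc[OF _ L(1)[OF x], of c] Mc[OF _ L(2)[OF x], of c] by (intro eq pts_scale[OF Z x]) auto
 qed
 have Labs: "\<bar>L x\<bar> <= nrm Z x" if "x \<in> pts Z" for x
  using Mle[OF L(1)[OF that]] Mle[OF L(2)[OF that]] nrm_minus[OF Z that] by simp
 show ?thesis
 proof (rule that[of "\<lambda>x. if x \<in> pts Z then L x else 0"])
  show "(\<lambda>x. if x \<in> pts Z then L x else 0) \<in> pts (dual Z)"
   by (rule dual_restrictI[OF Z, where K = 1]) (use Ladd Lscale Labs in auto)
  show "s <= (if y \<in> pts Z then L y else 0)" if "(y, s) \<in> K" for y s
   using above[OF _ L(2), of y s] Mf[of "(y, s)"] that KM by auto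
 qed (use Labs in auto)
qed

text \<open>Scaling the argument by \<open>M\<close> instead of dividing \<open>f\<close> by it lets
  \<open>cone_functional\<close> treat \<open>M = 0\<close> as well; the extension is
  \<open>M\<close> times the functional obtained.\<close>

theorem hahn_banach:
 assumes Z: "normed_space Z" and S: "subspace S" "S \<subseteq> pts Z" and M: "M >= 0"
  and f: "!!x y. x \<in> S ==> y \<in> S ==> f (x + y) = f x + f y"
   "!!c x. x \<in> S ==> f (c *\<^sub>R x) = c * f x" "!!x. x \<in> S ==> \<bar>f x\<bar> <= M * nrm Z x"
 obtains g where "g \<in> pts (dual Z)" "!!x. x \<in> S ==> g x = f x" "nrm (dual Z) g <= M"
proof -
 define K where "K = (\<lambda>y. (M *\<^sub>R y, f y)) ` S"
 have f0: "f 0 = 0" using f(2)[OF subspace_0[OF S(1)], of 0] by simp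
 obtain g where g: "g \<in> pts (dual Z)" "!!x. x \<in> pts Z ==> \<bar>g x\<bar> <= nrm Z x"
  "!!y s. (y, s) \<in> K ==> s <= g y"
 proof (rule cone_functional[OF Z])
  show "fst ` K \<subseteq> pts Z" using S(2) by (auto simp: K_def intro!: pts_scale[OF Z])
  show "0 \<in> K" unfolding K_def by (rule image_eqI[OF _ subspace_0[OF S(1)]]) (simp add: f0 zero_prod_def)
  show "a + b \<in> K" if "a \<in> K" "b \<in> K" for a b
  proof -
   obtain x y where "a = (M *\<^sub>R x, f x)" "b = (M *\<^sub>R y, f y)" "x \<in> S" "y \<in> S" using \<open>a \<in> K\<close> \<open>b \<in> K\<close> by (auto simp: K_def)
   then show ?thesis using f(1)[of x y] subspace_add[OF S(1), of x y]
    by (auto simp: K_def scaleR_add_right intro!: image_eqI[of _ _ "x + y"])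
  qed
  show "c *\<^sub>R a \<in> K" if a: "c > 0" "a \<in> K" for c a
  proof -
   obtain y where y: "a = (M *\<^sub>R y, f y)" "y \<in> S" using a(2) by (auto simp: K_def)
   then have "c *\<^sub>R a = (M *\<^sub>R c *\<^sub>R y, f (c *\<^sub>R y))" using f(2) by (simp add: mult.commute)
   then show ?thesis unfolding K_def using subspace_scale[OF S(1) y(2)] by blast
  qed
  show "s <= nrm Z y" if "(y, s) \<in> K" for y s
   using that f(3) M S(2) by (force simp: K_def nrm_scale[OF Z])
 qed blast
 have ge: "f y <= M * g y" if "y \<in> S" for y
  using g(3)[of "M *\<^sub>R y" "f y"] that dual_scale[OF g(1) subsetD[OF S(2) that]] by (force simp: K_def)
 have eq: "M * g y = f y" if y: "y \<in> S" for y
  using ge[OF y] ge[OF subspace_neg[OF S(1) y]] f(2)[OF y, of "-1"] dual_minus[OF g(1)] S(2) y by force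
 have "\<bar>(M *\<^sub>R g) x\<bar> <= M * nrm Z x" if "x \<in> pts Z" for x
  using mult_left_mono[OF g(2)[OF that] M] M by (simp add: scaleR_fun_def abs_mult)
 then have "nrm (dual Z) (M *\<^sub>R g) <= M" using M by (intro dual_nrm_le'[OF Z]) auto
 then show ?thesis
  using eq by (intro that[of "M *\<^sub>R g"] pts_scale[OF normed_space_dual[OF Z] g(1)])
   (auto simp: scaleR_fun_def)
qed

lemma dual_nrm_le_1: "normed_space Z ==> (!!x. x \<in> pts Z ==> \<bar>f x\<bar> <= nrm Z x) ==> nrm (dual Z) f <= 1"
 by (rule dual_nrm_le'[where K = 1]) auto

text \<open>The cone spanned by \<open>A \<times> {c}\<close> lies below the graph of the norm
  because \<open>c\<close> bounds the norm from below on \<open>A\<close>; a linear functional above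
  this cone is at least \<open>c\<close> on \<open>A\<close>.\<close>

lemma convex_separation:
 assumes Z: "normed_space Z" and A: "convex A" "A \<subseteq> pts Z" and c: "c >= 0" "!!a. a \<in> A ==> c <= nrm Z a"
 obtains f where "f \<in> pts (dual Z)" "nrm (dual Z) f <= 1" "!!a. a \<in> A ==> c <= f a"
proof -
 define K where "K = insert 0 {t *\<^sub>R (a, c) | t a. t > 0 & a \<in> A}"
 have in_K: "t *\<^sub>R (a, c) \<in> K" if "t > 0" "a \<in> A" for t a using that unfolding K_def by blast
 have K: "x = 0 \<or> (\<exists>t a. x = t *\<^sub>R (a, c) & t > 0 & a \<in> A)" if "x \<in> K" for x using that unfolding K_def by blast
 obtain f where f: "f \<in> pts (dual Z)" "!!x. x \<in> pts Z ==> \<bar>f x\<bar> <= nrm Z x" "!!y s. (y, s) \<in> K ==> s <= f y"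
 proof (rule cone_functional[OF Z])
  show "0 \<in> K" by (simp add: K_def)
  show "fst ` K \<subseteq> pts Z" using A(2) by (auto simp: K_def intro!: pts_zero[OF Z] pts_scale[OF Z])
  show "r *\<^sub>R x \<in> K" if x: "r > 0" "x \<in> K" for r x
  proof (cases "x = 0")
   case False
   then obtain t a where "x = t *\<^sub>R (a, c)" "t > 0" "a \<in> A" using K[OF x(2)] by blast
   then show ?thesis using in_K[of "r * t" a] x(1) by (simp del: scaleR_Pair)
  qed (simp add: K_def)
  show "x + y \<in> K" if xy: "x \<in> K" "y \<in> K" for x y
  proof (cases "x = 0 \<or> y = 0")
   case False
   then obtain t a s b where ab: "x = t *\<^sub>R (a, c)" "y = s *\<^sub>R (b, c)" "t > 0" "s > 0" "a \<in> A" "b \<in> A"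
    using K[OF xy(1)] K[OF xy(2)] by blast
   have "(t / (t + s)) *\<^sub>R a + (s / (t + s)) *\<^sub>R b \<in> A"
    using ab by (intro convexD[OF A(1)]) (auto simp flip: add_divide_distrib)
   moreover have "(t + s) *\<^sub>R ((t / (t + s)) *\<^sub>R a + (s / (t + s)) *\<^sub>R b) = t *\<^sub>R a + s *\<^sub>R b"
    using ab(3,4) by (simp add: scaleR_add_right)
   ultimately show ?thesis using in_K[of "t + s" "(t / (t + s)) *\<^sub>R a + (s / (t + s)) *\<^sub>R b"] ab(1-4)
    by (simp add: distrib_right)
  qed (use xy in auto)
  show "s <= nrm Z y" if ys: "(y, s) \<in> K" for y s
   using K[OF ys] c(2) A(2) nrm_zero[OF Z] by (auto simp: nrm_scale[OF Z] subset_iff zero_prod_def mult_left_mono)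
 qed blast
 then show ?thesis using in_K[of 1] by (intro that[OF f(1) dual_nrm_le_1[OF Z f(2)]]) auto
qed

lemma separating_functional:
 assumes Z: "normed_space Z" and S: "subspace S" "S \<subseteq> pts Z" and x: "x \<in> pts Z"
  and d: "d >= 0" "!!s. s \<in> S ==> d <= nrm Z (x - s)"
 obtains f where "f \<in> pts (dual Z)" "nrm (dual Z) f <= 1" "!!s. s \<in> S ==> f s = 0" "d <= f x"
proof -
 have "convex ((\<lambda>s. x - s) ` S)"
  using convex_translation[OF convex_linear_image[OF linear_uminus subspace_imp_convex[OF S(1)]], of x]
  by (simp add: image_image)
 then obtain f where f: "f \<in> pts (dual Z)" "nrm (dual Z) f <= 1" "!!a. a \<in> (\<lambda>s. x - s) ` S ==> d <= f a"
  by (rule convex_separation[OF Z _ _ d(1)]) (use S x d in \<open>auto intro: pts_diff[OF Z]\<close>)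
 have ge: "d <= f x - c * f s" if "s \<in> S" for c s
  using f(3)[OF imageI[OF subspace_scale[OF S(1) that, of c]]] that S(2)
  by (simp add: dual_diff[OF f(1) Z x] dual_scale[OF f(1)] pts_scale[OF Z] subset_iff)
 \<comment> \<open>\<open>f\<close> is bounded below by \<open>d\<close> on the whole affine space
   \<open>x - S\<close>; if \<open>f s\<close> were nonzero, the chosen multiple would give the
   value \<open>d - 1\<close>.\<close>
 have "f s = 0" if "s \<in> S" for s
  using ge[OF that, of "(f x - d + 1) / f s"] by (cases "f s = 0") simp_all
 then show ?thesis using that f(1,2) ge[OF subspace_0[OF S(1)], of 0] by simp
qed

lemma norming_functional:
 assumes Z: "normed_space Z" and x: "x \<in> pts Z"
 obtains f where "f \<in> pts (dual Z)" "nrm (dual Z) f <= 1" "f x = nrm Z x"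
proof -
 obtain f where f: "f \<in> pts (dual Z)" "nrm (dual Z) f <= 1" "nrm Z x <= f x"
  by (rule convex_separation[OF Z convex_singleton[of x] _ nrm_nonneg[OF Z x]]) (use x in auto)
 have "f x <= nrm Z x"
  using dual_bound[OF Z f(1) x] mult_right_mono[OF f(2) nrm_nonneg[OF Z x]] by simp
 then show ?thesis using that f by force
qed

lemma dense_if_annihilator_trivial:
 assumes Z: "normed_space Z" and S: "subspace S" "S \<subseteq> pts Z"
  and ann: "!!f. f \<in> pts (dual Z) ==> (!!s. s \<in> S ==> f s = 0) ==> f = 0"
  and z: "z \<in> pts Z" and e: "e > 0"
 shows "\<exists>s\<in>S. nrm Z (z - s) < e"
proof (rule ccontr)
 assume "\<not> ?thesis"
 then have "!!s. s \<in> S ==> e <= nrm Z (z - s)" by force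
 then obtain f where "f \<in> pts (dual Z)" "!!s. s \<in> S ==> f s = 0" "e <= f z"
  using separating_functional[OF Z S z less_imp_le[OF e]] by blast
 then show False using ann e by force
qed

text \<open>Mazur's theorem in the form suited to weakly null sequences: if all norms on
  \<open>A\<close> were at least \<open>c\<close>, a separating functional would stay above
  \<open>c\<close> on all of \<open>A\<close>.\<close>

lemma mazur:
 assumes Z: "normed_space Z" and A: "convex A" "A \<subseteq> pts Z" and c: "c > 0"
  and null: "!!f. f \<in> pts (dual Z) ==> \<exists>a\<in>A. f a < c"
 shows "\<exists>a\<in>A. nrm Z a < c"
proof (rule ccontr)
 assume "\<not> ?thesis"
 then have "!!a. a \<in> A ==> c <= nrm Z a" by force
 then obtain f where "f \<in> pts (dual Z)" "!!a. a \<in> A ==> c <= f a"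
  using convex_separation[OF Z A less_imp_le[OF c]] by blast
 then show False using null by force
qed

section \<open>Open mappings and extension by density\<close>

text \<open>The iteration behind the open mapping theorem: the residual is halved in each round and
  the corrections form a geometric series. It is shared by dense lifts, the open mapping theorem and
  the predual of an embedding.\<close>

lemma lifts_of_approximate_lifts:
 assumes B: "banach_space Z" and Y: "normed_space Y" and T: "bounded_operator Z Y T" and C: "C >= 0"
  and approx: "!!y. y \<in> pts Y ==>
   \<exists>z\<in>pts Z. nrm Z z <= C * nrm Y y & nrm Y (y - T z) <= (1/2) * nrm Y y"
  and y: "y \<in> pts Y"
 shows "\<exists>z\<in>pts Z. T z = y & nrm Z z <= 2 * C * nrm Y y"
proof -
 note Z = banach_normed[OF B]
 obtain g where g: "!!y. y \<in> pts Y ==>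
   g y \<in> pts Z & nrm Z (g y) <= C * nrm Y y & nrm Y (y - T (g y)) <= (1/2) * nrm Y y"
  using approx by metis
 define r where "r n = ((\<lambda>y. y - T (g y)) ^^ n) y" for n
 have r0: "r 0 = y" and rS: "r (Suc n) = r n - T (g (r n))" for n
  by (simp_all add: r_def)
 have r: "r n \<in> pts Y & nrm Y (r n) <= (1/2) ^ n * nrm Y y" for n
 proof (induction n)
  case (Suc n)
  then have "nrm Y (r (Suc n)) <= (1/2) * nrm Y (r n)" using g by (simp add: rS)
  also have "\<dots> <= (1/2) * ((1/2) ^ n * nrm Y y)" using Suc by simp
  finally show ?case using Suc g T Y by (auto simp: rS intro!: pts_diff op_mem[OF T])
 qed (simp add: r0 y)
 have gp: "g (r n) \<in> pts Z" for n using g r by blast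
 have gn: "nrm Z (g (r n)) <= (C * nrm Y y) * (1/2) ^ n" for n
 proof -
  have "nrm Z (g (r n)) <= C * nrm Y (r n)" using g r by blast
  also have "\<dots> <= C * ((1/2) ^ n * nrm Y y)" using r C by (intro mult_left_mono) auto
  finally show ?thesis by (simp add: mult_ac)
 qed
 obtain z where z: "nconv Z (\<lambda>n. \<Sum>i<n. g (r i)) z" "nrm Z z <= 2 * (C * nrm Y y)"
  using banach_geometric_series[of Z "\<lambda>n. g (r n)", OF B gp gn] by blast
 have P: "(\<Sum>i<n. g (r i)) \<in> pts Z" for n using gp by (intro pts_sum[OF Z])
 have Ts: "T (\<Sum>i<n. g (r i)) = y - r n" for n
 proof (induction n)
  case (Suc n)
  have "T ((\<Sum>i<n. g (r i)) + g (r n)) = T (\<Sum>i<n. g (r i)) + T (g (r n))"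
   by (rule op_add[OF T P gp])
  then show ?case using Suc by (simp add: rS)
 qed (simp add: r0 op_zero[OF T Z])
 have "nconv Y (\<lambda>n. T (\<Sum>i<n. g (r i))) (T z)"
  by (rule op_conv[OF T Z Y P z(1)])
 moreover have "nconv Y (\<lambda>n. T (\<Sum>i<n. g (r i))) y"
 proof (rule nconv_squeeze[OF Y _ y])
  show "T (\<Sum>i<n. g (r i)) \<in> pts Y" for n by (rule op_mem[OF T P])
  show "nrm Y (T (\<Sum>i<n. g (r i)) - y) <= (1/2) ^ n * nrm Y y" for n
   using r[of n] nrm_minus[OF Y, of "r n"] by (simp add: Ts)
  have "(\<lambda>n. (1/2) ^ n * nrm Y y) \<longlonglongrightarrow> 0 * nrm Y y"
   by (intro tendsto_mult tendsto_const LIMSEQ_realpow_zero) auto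
  then show "(\<lambda>n. (1/2) ^ n * nrm Y y) \<longlonglongrightarrow> 0" by simp
 qed
 ultimately have "T z = y" by (intro nconv_unique[OF Y _, of "\<lambda>n. T (\<Sum>i<n. g (r i))"] op_mem[OF T P])
 then show ?thesis using z nconv_pts by (intro bexI[of _ z]) (auto simp: mult_ac)
qed

text \<open>A point of \<open>D\<close> within half the norm of \<open>y\<close> has norm at most
  twice that of \<open>y\<close>, so its lift is an approximate lift with constant
  \<open>2 * C\<close>; summing the corrections doubles this again.\<close>

lemma lifts_of_dense_lifts:
 assumes B: "banach_space Z" and Y: "normed_space Y" and T: "bounded_operator Z Y T" and C: "C >= 0"
  and D: "D \<subseteq> pts Y" "!!y e. y \<in> pts Y ==> e > 0 ==> \<exists>d\<in>D. nrm Y (y - d) < e"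
  and lift: "!!y. y \<in> D ==> \<exists>z\<in>pts Z. T z = y & nrm Z z <= C * nrm Y y"
  and y: "y \<in> pts Y"
 shows "\<exists>z\<in>pts Z. T z = y & nrm Z z <= 4 * C * nrm Y y"
proof -
 note Z = banach_normed[OF B]
 have "\<exists>z\<in>pts Z. nrm Z z <= (2 * C) * nrm Y y & nrm Y (y - T z) <= (1/2) * nrm Y y"
  if y: "y \<in> pts Y" for y
 proof (cases "y = 0")
  case True
  then show ?thesis using pts_zero[OF Z] op_zero[OF T Z] nrm_zero[OF Z] nrm_zero[OF Y]
   by (intro bexI[of _ 0]) auto
 next
  case False
  then have pos: "nrm Y y > 0" by (rule nrm_pos[OF Y y])
  then obtain d where d: "d \<in> D" "nrm Y (y - d) < (1/2) * nrm Y y" using D(2)[OF y, of "(1/2) * nrm Y y"] by auto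
  obtain z where z: "z \<in> pts Z" "T z = d" "nrm Z z <= C * nrm Y d" using lift[OF d(1)] by blast
  have "nrm Y d <= 2 * nrm Y y" using nrm_diff_ge[OF Y y, of d] d D(1) by auto
  then have "nrm Z z <= C * (2 * nrm Y y)" using z(3) C mult_left_mono order_trans by blast
  then show ?thesis using z d(2) by (intro bexI[of _ z]) (auto simp: mult_ac)
 qed
 then have "\<exists>z\<in>pts Z. T z = y & nrm Z z <= 2 * (2 * C) * nrm Y y"
  by (intro lifts_of_approximate_lifts[OF B Y T _ _ y]) (use C in auto)
 then show ?thesis by (simp add: mult_ac)
qed

theorem open_mapping:
 assumes BZ: "banach_space Z" and BY: "banach_space Y" and T: "bounded_operator Z Y T"
  and surj: "T ` pts Z = pts Y"
 obtains C where "C > 0" "!!y. y \<in> pts Y ==> \<exists>z\<in>pts Z. T z = y & nrm Z z <= C * nrm Y y"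
proof -
 note Z = banach_normed[OF BZ] and Y = banach_normed[OF BY]
 interpret M: Metric_space "pts Y" "ndist Y" by (rule Metric_space_ndist[OF Y])
 define A where "A n = ntop Y closure_of (T ` {z \<in> pts Z. nrm Z z <= real n})" for n :: nat
 have sub: "T ` {z \<in> pts Z. nrm Z z <= real n} \<subseteq> pts Y" for n using op_mem[OF T] by auto
 have AY: "A n \<subseteq> pts Y" for n
  unfolding A_def using closure_of_subset_topspace[of "ntop Y"] by (metis M.topspace_mtopology)
 have un: "\<Union>(range A) = pts Y"
 proof
  show "\<Union>(range A) \<subseteq> pts Y" using AY by auto
  show "pts Y \<subseteq> \<Union>(range A)"
  proof
   fix y assume "y \<in> pts Y"
   then have "y \<in> T ` pts Z" by (simp only: surj)
   then obtain z where z: "z \<in> pts Z" "T z = y" by (rule imageE) simp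
   obtain n where "nrm Z z <= real n" using real_arch_simple by blast
   then have "y \<in> T ` {z \<in> pts Z. nrm Z z <= real n}" using z by blast
   moreover have "T ` {z \<in> pts Z. nrm Z z <= real n} \<subseteq> A n"
    unfolding A_def using sub[of n] by (intro closure_of_subset) simp
   ultimately have "y \<in> A n" by (rule subsetD[rotated])
   then show "y \<in> \<Union>(range A)" by blast
  qed
 qed
 have "\<exists>n. ntop Y interior_of A n ~= {}"
 proof (rule ccontr)
  assume "\<not> ?thesis"
  then have "ntop Y interior_of \<Union>(range A) = {}"
   using BY by (intro M.metric_Baire_category_alt) (auto simp: banach_space_def A_def)
  then have "pts Y = {}" unfolding un by (metis M.topspace_mtopology interior_of_topspace)
  then show False using pts_zero[OF Y] by blast
 qed
 then obtain n y0 r where r: "r > 0" "M.mball y0 r \<subseteq> A n" and y0: "y0 \<in> pts Y"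
  by (auto simp: M.metric_interior_of)
 have cl: "\<exists>z\<in>pts Z. nrm Z z <= real n & nrm Y (y - T z) < e"
  if y: "y \<in> pts Y" "nrm Y (y0 - y) < r" and e: "e > 0" for y e
 proof -
  have "y \<in> A n" using r(2) that y0 by (auto simp: ndist_def)
  then show ?thesis using in_closure_ntop[OF Y sub] e unfolding A_def by blast
 qed
 define C where "C = 4 * real n / r"
 have C0: "C >= 0" using r by (simp add: C_def)
 have "\<exists>z\<in>pts Z. nrm Z z <= C * nrm Y y & nrm Y (y - T z) <= (1/2) * nrm Y y"
  if y: "y \<in> pts Y" for y
 proof (cases "y = 0")
  case True
  then show ?thesis using pts_zero[OF Z] op_zero[OF T Z] nrm_zero[OF Z] nrm_zero[OF Y]
   by (intro bexI[of _ 0]) auto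
 next
  case False
  then have pos: "nrm Y y > 0" by (rule nrm_pos[OF Y y])
  \<comment> \<open>Scales \<open>y\<close> to norm \<open>r / 2\<close>, so that both
    \<open>y0\<close> and \<open>y0 + t *\<^sub>R y\<close> can be approximated from a bounded set;
    the difference of the two preimages is divided by \<open>t\<close> again.\<close>
  define t where "t = r / (2 * nrm Y y)"
  have t: "t > 0" using pos r by (simp add: t_def)
  have ty: "t *\<^sub>R y \<in> pts Y" by (rule pts_scale[OF Y y])
  have tn: "nrm Y (t *\<^sub>R y) = r / 2" using pos r t by (simp add: nrm_scale[OF Y y] t_def)
  obtain z1 where z1: "z1 \<in> pts Z" "nrm Z z1 <= real n" "nrm Y ((y0 + t *\<^sub>R y) - T z1) < r / 8"
   using cl[of "y0 + t *\<^sub>R y" "r/8"] r(1) tn nrm_minus[OF Y ty] pts_add[OF Y y0 ty] by auto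
  obtain z2 where z2: "z2 \<in> pts Z" "nrm Z z2 <= real n" "nrm Y (y0 - T z2) < r / 8"
   using cl[of y0 "r/8"] r(1) nrm_zero[OF Y] y0 by auto
  have T1: "T z1 \<in> pts Y" "T z2 \<in> pts Y" using op_mem[OF T] z1 z2 by auto
  have e: "nrm Y (((y0 + t *\<^sub>R y) - T z1) - (y0 - T z2)) < r / 4"
   using nrm_diff[OF Y pts_diff[OF Y pts_add[OF Y y0 ty] T1(1)] pts_diff[OF Y y0 T1(2)]] z1 z2 by simp
  define z where "z = (1/t) *\<^sub>R (z1 - z2)"
  have z12: "z1 - z2 \<in> pts Z" by (rule pts_diff[OF Z z1(1) z2(1)])
  have Tz: "T z = (1/t) *\<^sub>R (T z1 - T z2)"
   unfolding z_def by (simp add: op_scale[OF T z12] op_diff[OF T Z z1(1) z2(1)])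
  have "y - T z = (1/t) *\<^sub>R (((y0 + t *\<^sub>R y) - T z1) - (y0 - T z2))"
   unfolding Tz using t by (simp add: algebra_simps)
  then have "nrm Y (y - T z) = (1/t) * nrm Y (((y0 + t *\<^sub>R y) - T z1) - (y0 - T z2))"
   using nrm_scale[OF Y pts_diff[OF Y pts_diff[OF Y pts_add[OF Y y0 ty] T1(1)] pts_diff[OF Y y0 T1(2)]], of "1/t"] t
   by simp
  also have "\<dots> <= (1/t) * (r / 4)" using e t by (intro mult_left_mono) auto
  also have "\<dots> = (1/2) * nrm Y y" using pos r by (simp add: t_def field_simps)
  finally have 1: "nrm Y (y - T z) <= (1/2) * nrm Y y" .
  have "nrm Z z = (1/t) * nrm Z (z1 - z2)" unfolding z_def using nrm_scale[OF Z z12, of "1/t"] t by simp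
  also have "\<dots> <= (1/t) * (2 * real n)"
   using nrm_diff[OF Z z1(1) z2(1)] z1 z2 t by (intro mult_left_mono) auto
  also have "\<dots> = C * nrm Y y" using pos r by (simp add: t_def C_def field_simps)
  finally show ?thesis using 1 pts_scale[OF Z z12] unfolding z_def by blast
 qed
 note approx = this
 show ?thesis
 proof (rule that[of "2 * C + 1"])
  fix y assume y: "y \<in> pts Y"
  obtain z where "z \<in> pts Z" "T z = y" "nrm Z z <= 2 * C * nrm Y y"
   using lifts_of_approximate_lifts[OF BZ Y T C0 approx y] by blast
  then show "\<exists>z\<in>pts Z. T z = y & nrm Z z <= (2 * C + 1) * nrm Y y"
   using nrm_nonneg[OF Y y] by (intro bexI[of _ z]) (auto simp: algebra_simps)
 qed (use C0 in simp)
qed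

text \<open>The lower bound by \<open>c\<close> is carried through the limit so that the extension
  of an embedding is an embedding; \<open>c = 0\<close> gives plain extension.\<close>

lemma extend_dense:
 assumes X: "normed_space X" and BY: "banach_space Y" and D: "subspace D" "D \<subseteq> pts X"
  and dense: "!!x e. x \<in> pts X ==> e > 0 ==> \<exists>d\<in>D. nrm X (x - d) < e"
  and mem: "!!x. x \<in> D ==> T x \<in> pts Y"
  and add: "!!x y. x \<in> D ==> y \<in> D ==> T (x + y) = T x + T y"
  and scale: "!!c x. x \<in> D ==> T (c *\<^sub>R x) = c *\<^sub>R T x"
  and K: "!!x. x \<in> D ==> nrm Y (T x) <= K * nrm X x"
  and c: "!!x. x \<in> D ==> c * nrm X x <= nrm Y (T x)"
 obtains S where "bounded_operator X Y S" "!!x. x \<in> D ==> S x = T x"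
  "!!x. x \<in> pts X ==> c * nrm X x <= nrm Y (S x)"
proof -
 note Y = banach_normed[OF BY]
 \<comment> \<open>The extension as a relation, with all approximating sequences at once: sums and
   multiples of sequences give linearity, and uniqueness follows from the upper bound at 0.\<close>
 define G where "G x y \<longleftrightarrow> (\<exists>s. (\<forall>n. s n \<in> D) & nconv X s x & nconv Y (\<lambda>n. T (s n)) y)" for x y
 have diff: "T (x - y) = T x - T y" if "x \<in> D" "y \<in> D" for x y
  using add[OF that(1) subspace_neg[OF D(1) that(2)]] scale[OF that(2), of "-1"] by simp
 have ex: "\<exists>y. G x y" if x: "x \<in> pts X" for x
 proof -
  obtain s where s: "!!n. s n \<in> D" "nconv X s x" "!!n. nrm X (s n - x) < (1/2) ^ n"
   using closure_seq[OF X D(2) x dense[OF x]] by blast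
  have sp: "s n \<in> pts X" for n using s D by blast
  have "\<exists>y. nconv Y (\<lambda>n. T (s n)) y"
  proof (rule banach_conv[OF BY mem[OF s(1)]])
   fix e :: real assume e: "e > 0"
   define e' where "e' = e / (2 * (\<bar>K\<bar> + 1))"
   have e': "e' > 0" using e by (simp add: e'_def)
   then obtain N where N: "!!n. n >= N ==> nrm X (s n - x) < e'"
    using s(2) nconv_iff[of X s x, OF X sp] by blast
   have "nrm Y (T (s m) - T (s n)) < e" if "m >= N" "n >= N" for m n
   proof -
    have "nrm X (s m - s n) <= nrm X (s m - x) + nrm X (x - s n)"
     by (rule nrm_triangle[OF X sp x sp])
    then have lt: "nrm X (s m - s n) <= 2 * e'"
     using N[OF that(1)] N[OF that(2)] nrm_diff_commute[OF X x sp, of n] by simp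
    have n0: "nrm X (s m - s n) >= 0" by (rule nrm_nonneg[OF X pts_diff[OF X sp sp]])
    have "nrm Y (T (s m) - T (s n)) <= K * nrm X (s m - s n)"
     using K[OF subspace_diff[OF D(1) s(1) s(1)], of m n] diff[OF s(1) s(1)] by simp
    also have "\<dots> <= \<bar>K\<bar> * nrm X (s m - s n)" using n0 by (intro mult_right_mono) auto
    also have "\<dots> <= \<bar>K\<bar> * (2 * e')" using lt by (intro mult_left_mono) auto
    also have "\<dots> < (\<bar>K\<bar> + 1) * (2 * e')" using e' by (intro mult_strict_right_mono) auto
    also have "\<dots> = e"
    proof -
     have "\<bar>K\<bar> + 1 ~= 0" using abs_ge_zero[of K] by linarith
     then show ?thesis by (simp add: e'_def field_simps)
    qed
    finally show ?thesis .
   qed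
   then show "\<exists>N. \<forall>m\<ge>N. \<forall>n\<ge>N. nrm Y (T (s m) - T (s n)) < e" by blast
  qed
  then show ?thesis unfolding G_def using s by blast
 qed
 have Gp: "y \<in> pts Y" if "G x y" for x y using that nconv_pts by (auto simp: G_def)
 have Gadd: "G (x + x') (y + y')" if xy: "G x y" "G x' y'" for x y x' y'
 proof -
  obtain s t where s: "\<forall>n. s n \<in> D" "nconv X s x" "nconv Y (\<lambda>n. T (s n)) y"
   and t: "\<forall>n. t n \<in> D" "nconv X t x'" "nconv Y (\<lambda>n. T (t n)) y'"
   using xy unfolding G_def by blast
  have "nconv X (\<lambda>n. s n + t n) (x + x')"
   by (rule nconv_add[OF X _ _ s(2) t(2)]) (use s t D in auto)
  moreover have "nconv Y (\<lambda>n. T (s n) + T (t n)) (y + y')"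
   by (rule nconv_add[OF Y _ _ s(3) t(3)]) (use s t mem in auto)
  moreover have "T (s n + t n) = T (s n) + T (t n)" "s n + t n \<in> D" for n
   using add s t subspace_add[OF D(1)] by auto
  ultimately show ?thesis unfolding G_def by (intro exI[of _ "\<lambda>n. s n + t n"]) simp
 qed
 have Gscale: "G (a *\<^sub>R x) (a *\<^sub>R y)" if xy: "G x y" for x y a
 proof -
  obtain s where s: "\<forall>n. s n \<in> D" "nconv X s x" "nconv Y (\<lambda>n. T (s n)) y"
   using xy unfolding G_def by blast
  have "nconv X (\<lambda>n. a *\<^sub>R s n) (a *\<^sub>R x)"
   by (rule nconv_scale[OF X _ s(2)]) (use s D in auto)
  moreover have "nconv Y (\<lambda>n. a *\<^sub>R T (s n)) (a *\<^sub>R y)"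
   by (rule nconv_scale[OF Y _ s(3)]) (use s mem in auto)
  moreover have "T (a *\<^sub>R s n) = a *\<^sub>R T (s n)" "a *\<^sub>R s n \<in> D" for n
   using scale s subspace_scale[OF D(1)] by auto
  ultimately show ?thesis unfolding G_def by (intro exI[of _ "\<lambda>n. a *\<^sub>R s n"]) simp
 qed
 have Gb: "nrm Y y <= K * nrm X x & c * nrm X x <= nrm Y y" if xy: "G x y" for x y
 proof -
  obtain s where s: "\<forall>n. s n \<in> D" "nconv X s x" "nconv Y (\<lambda>n. T (s n)) y"
   using xy unfolding G_def by blast
  have 1: "(\<lambda>n. nrm X (s n)) \<longlonglongrightarrow> nrm X x" by (rule nconv_nrm[OF X _ s(2)]) (use s D in auto)
  have 2: "(\<lambda>n. nrm Y (T (s n))) \<longlonglongrightarrow> nrm Y y" by (rule nconv_nrm[OF Y _ s(3)]) (use s mem in auto)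
  show ?thesis
   using LIMSEQ_le[OF 2 tendsto_mult[OF tendsto_const 1]] LIMSEQ_le[OF tendsto_mult[OF tendsto_const 1] 2]
    K c s(1) by blast
 qed
 have uniq: "y = y'" if "G x y" "G x y'" for x y y'
 proof -
  have "G (x + (-1) *\<^sub>R x) (y + (-1) *\<^sub>R y')" by (intro Gadd Gscale that)
  then have G0: "G 0 (y - y')" by simp
  then have "nrm Y (y - y') <= 0" using Gb[OF G0] nrm_zero[OF X] by simp
  then show ?thesis using nrm_pos[OF Y Gp[OF G0]] by force
 qed
 define S where "S x = (SOME y. G x y)" for x
 have S: "G x (S x)" if "x \<in> pts X" for x unfolding S_def using ex[OF that] by (rule someI_ex)
 show ?thesis
 proof (rule that[of S])
  show "bounded_operator X Y S"
  proof (rule bounded_operatorI[where K = K])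
   show "S (x + y) = S x + S y" if "x \<in> pts X" "y \<in> pts X" for x y
    using uniq[OF S[OF pts_add[OF X that]] Gadd[OF S S]] that by blast
   show "S (a *\<^sub>R x) = a *\<^sub>R S x" if "x \<in> pts X" for a x
    using uniq[OF S[OF pts_scale[OF X that]] Gscale[OF S]] that by blast
  qed (use S Gp Gb in auto)
  show "S x = T x" if "x \<in> D" for x
  proof -
   have "G x (T x)"
    unfolding G_def using that D mem nconv_const[OF X] nconv_const[OF Y]
    by (intro exI[of _ "\<lambda>_. x"]) auto
   then show ?thesis using uniq S that D by blast
  qed
  show "c * nrm X x <= nrm Y (S x)" if "x \<in> pts X" for x using Gb[OF S[OF that]] by blast
 qed
qed

section \<open>Finite-dimensional subspaces\<close>

lemma span_finite_ex:
 assumes "finite B" "x \<in> span B"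
 obtains u where "x = (\<Sum>b\<in>B. u b *\<^sub>R b)"
 using assms(2) unfolding span_finite[OF assms(1)] by blast

lemma finite_span_subspace:
 assumes V: "subspace V" and "V \<subseteq> span B" "finite B"
 obtains C where "finite C" "independent C" "V = span C"
proof -
 obtain C where C: "C \<subseteq> V" "independent C" "V \<subseteq> span C" by (rule maximal_independent_subset)
 then have "finite C" using independent_span_bound[OF assms(3), of C] assms(2) by blast
 moreover have "V = span C" using C span_minimal[OF C(1) V] by blast
 ultimately show ?thesis using that C by blast
qed

lemma dual_conv:
 assumes Z: "normed_space Z" and f: "f \<in> pts (dual Z)" and s: "!!n. s n \<in> pts Z" "nconv Z s z"
 shows "(\<lambda>n. f (s n)) \<longlonglongrightarrow> f z"
 using op_conv[OF dual_op[OF f] Z normed_space_real s]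
 by (auto simp: nconv_def intro: LIM_zero_cancel tendsto_rabs_zero_cancel)

lemma closed_subspace_separation:
 assumes Z: "normed_space Z" and S: "subspace S" "S \<subseteq> pts Z" "!!s z. (!!n :: nat. s n \<in> S) ==> nconv Z s z ==> z \<in> S"
  and b: "b \<in> pts Z" "b \<notin> S"
 obtains f where "f \<in> pts (dual Z)" "!!x. x \<in> S ==> f x = 0" "f b = 1"
proof -
 have "\<exists>d>0. \<forall>x\<in>S. d <= nrm Z (b - x)"
 proof (rule ccontr)
  assume neg: "\<not> ?thesis"
  have "\<exists>x\<in>S. nrm Z (b - x) < (1/2) ^ n" for n :: nat
   using neg[unfolded not_ex, rule_format, of "(1/2) ^ n"] by (auto simp: not_le)
  then obtain s where s: "!!n. s n \<in> S" "!!n. nrm Z (b - s n) < (1/2) ^ n" by metis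
  have "nconv Z s b"
  proof (rule nconv_squeeze[OF Z _ b(1)])
   show sp: "s n \<in> pts Z" for n using s(1) S(2) by blast
   show "nrm Z (s n - b) <= (1/2) ^ n" for n using s(2)[of n] nrm_diff_commute[OF Z b(1) sp] by simp
  qed (auto intro: LIMSEQ_realpow_zero)
  then show False using S(3)[of s b, OF s(1)] b(2) by blast
 qed
 then obtain d where d: "d > 0" "!!x. x \<in> S ==> d <= nrm Z (b - x)" by blast
 obtain f where f: "f \<in> pts (dual Z)" "!!x. x \<in> S ==> f x = 0" "d <= f b"
  by (rule separating_functional[OF Z S(1,2) b(1) less_imp_le[OF d(1)] d(2)]) blast+
 show thesis
  by (rule that[OF pts_scale[OF normed_space_dual[OF Z] f(1), of "1 / f b"]])
   (use f(2,3) d(1) in \<open>simp_all add: scaleR_fun_def\<close>)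
qed

text \<open>Induction on the spanning set. As the smaller span is closed, some functional vanishes
  on it and is 1 at the new vector \<open>b\<close>; it reads off the coefficient of
  \<open>b\<close>, so these coefficients converge and can be split off.\<close>

lemma findim_closed:
 assumes Z: "normed_space Z" and B: "finite B" "B \<subseteq> pts Z" and s: "!!n. s n \<in> span B" "nconv Z s z"
 shows "z \<in> span B"
 using assms(2-)
proof (induction B arbitrary: s z rule: finite_induct)
 case empty
 then have "s = (\<lambda>n. 0)" by (auto simp: fun_eq_iff)
 then show ?case
  using nconv_unique[OF Z _ empty.prems(3) nconv_const[OF Z pts_zero[OF Z], folded \<open>s = (\<lambda>n. 0)\<close>]] pts_zero[OF Z] by simp
next
 case (insert b B)
 have bB: "b \<in> pts Z" "B \<subseteq> pts Z" using insert.prems(1) by auto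
 show ?case
 proof (cases "b \<in> span B")
  case True
  then show ?thesis using insert.IH[OF bB(2) _ insert.prems(3)] insert.prems(2) by (simp add: span_redundant)
 next
  case False
  obtain f where f: "f \<in> pts (dual Z)" "!!x. x \<in> span B ==> f x = 0" "f b = 1"
  proof (rule closed_subspace_separation[OF Z subspace_span span_subset_pts[OF Z bB(2)] _ bB(1) False])
   show "w \<in> span B" if "!!n :: nat. t n \<in> span B" "nconv Z t w" for t w by (rule insert.IH[OF bB(2) that])
  qed blast
  have sp: "s n \<in> pts Z" for n using insert.prems(1,2) span_subset_pts[OF Z] by blast
  have fb: "c *\<^sub>R b \<in> pts Z" for c by (rule pts_scale[OF Z bB(1)])
  have sf: "s n - f (s n) *\<^sub>R b \<in> span B" for n
  proof -
   obtain t where t: "s n - t *\<^sub>R b \<in> span B" using insert.prems(2)[of n] by (auto simp: span_breakdown_eq)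
   then have "f (s n) = t" using f(2)[OF t] f(3) by (simp add: dual_diff[OF f(1) Z sp fb] dual_scale[OF f(1) bB(1)])
   then show ?thesis using t by simp
  qed
  have "nconv Z (\<lambda>n. f (s n) *\<^sub>R b) (f z *\<^sub>R b)"
  proof (rule nconv_squeeze[OF Z fb fb])
   show "nrm Z (f (s n) *\<^sub>R b - f z *\<^sub>R b) <= \<bar>f (s n) - f z\<bar> * nrm Z b" for n
    by (simp add: nrm_scale[OF Z bB(1)] flip: scaleR_diff_left)
   have "(\<lambda>n. \<bar>f (s n) - f z\<bar> * nrm Z b) \<longlonglongrightarrow> \<bar>f z - f z\<bar> * nrm Z b"
    by (intro tendsto_intros dual_conv[OF Z f(1) sp insert.prems(3)])
   then show "(\<lambda>n. \<bar>f (s n) - f z\<bar> * nrm Z b) \<longlonglongrightarrow> 0" by simp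
  qed
  from nconv_diff[OF Z sp fb insert.prems(3) this]
  have "z - f z *\<^sub>R b \<in> span B" by (rule insert.IH[OF bB(2) sf])
  then show ?thesis by (auto simp: span_breakdown_eq)
 qed
qed

text \<open>Each basis vector is separated from the closed span of the others, which makes the
  coordinates restrictions of bounded functionals; the sum of their norms controls the
  constant.\<close>

lemma findim_coeff_bound:
 assumes Z: "normed_space Z" and B: "finite B" "independent B" "B \<subseteq> pts Z"
 shows "\<exists>c>0. \<forall>u. c * (\<Sum>b\<in>B. \<bar>u b\<bar>) <= nrm Z (\<Sum>b\<in>B. u b *\<^sub>R b)"
proof -
 have "\<exists>f\<in>pts (dual Z). (\<forall>x\<in>B - {b}. f x = 0) & f b = 1" if b: "b \<in> B" for b
 proof (rule closed_subspace_separation[OF Z subspace_span[of "B - {b}"]])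
  show "b \<notin> span (B - {b})" using B(2) b by (simp add: dependent_def)
  show "b \<in> pts Z" using B(3) b by blast
  show "span (B - {b}) \<subseteq> pts Z" using B(3) by (intro span_subset_pts[OF Z]) auto
  show "z \<in> span (B - {b})" if "!!n :: nat. s n \<in> span (B - {b})" "nconv Z s z" for s z
   using findim_closed[OF Z, of "B - {b}" s z] B that by blast
 qed (auto intro: span_base)
 then obtain f where f: "!!b. b \<in> B ==> f b \<in> pts (dual Z) & (\<forall>x\<in>B - {b}. f b x = 0) & f b b = 1" by metis
 define M where "M = (\<Sum>b\<in>B. nrm (dual Z) (f b)) + 1"
 have M: "M > 0" unfolding M_def using f by (intro add_nonneg_pos sum_nonneg dual_nrm_nonneg[OF Z]) auto
 have "1 / M * (\<Sum>b\<in>B. \<bar>u b\<bar>) <= nrm Z (\<Sum>b\<in>B. u b *\<^sub>R b)" for u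
 proof -
  define x where "x = (\<Sum>b\<in>B. u b *\<^sub>R b)"
  have ub: "u b *\<^sub>R b \<in> pts Z" if "b \<in> B" for b using B(3) that by (intro pts_scale[OF Z]) auto
  have x: "x \<in> pts Z" unfolding x_def by (rule pts_sum[OF Z ub])
  have "u b = f b x" if b: "b \<in> B" for b
  proof -
   have "f b x = (\<Sum>a\<in>B. f b (u a *\<^sub>R a))" unfolding x_def using f[OF b] ub by (intro dual_sum[OF _ Z]) auto
   also have "\<dots> = (\<Sum>a\<in>B. if a = b then u b else 0)"
    using f[OF b] B(3) by (intro sum.cong) (auto simp: dual_scale subset_iff)
   finally show ?thesis using b B(1) by simp
  qed
  then have "(\<Sum>b\<in>B. \<bar>u b\<bar>) <= (\<Sum>b\<in>B. nrm (dual Z) (f b) * nrm Z x)"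
   using f dual_bound[OF Z _ x] by (intro sum_mono) auto
  also have "\<dots> <= M * nrm Z x" using nrm_nonneg[OF Z x] by (simp add: M_def distrib_right sum_distrib_right)
  finally show ?thesis using M by (simp add: x_def field_simps)
 qed
 then show ?thesis using M by (intro exI[of _ "1 / M"]) auto
qed

text \<open>A bounded set is split into finitely many cells according to the rounded values of
 finitely many functions.\<close>

lemma finite_value_net:
 fixes \<Phi> :: "('a => real) set"
 assumes \<Phi>: "finite \<Phi>" and bd: "!!\<phi> a. \<phi> \<in> \<Phi> ==> a \<in> A ==> \<bar>\<phi> a\<bar> <= R" and \<delta>: "\<delta> > 0"
 shows "\<exists>D. finite D & D \<subseteq> A & (\<forall>a\<in>A. \<exists>d\<in>D. \<forall>\<phi>\<in>\<Phi>. \<bar>\<phi> a - \<phi> d\<bar> <= \<delta>)"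
proof -
 define cell where "cell a = (\<lambda>\<phi>\<in>\<Phi>. \<lfloor>\<phi> a / \<delta>\<rfloor>)" for a
 have "cell ` A \<subseteq> \<Phi> \<rightarrow>\<^sub>E {\<lfloor>- R / \<delta>\<rfloor>..\<lfloor>R / \<delta>\<rfloor>}"
 proof
  fix g assume "g \<in> cell ` A"
  then obtain a where a: "a \<in> A" "g = cell a" by blast
  have "- R / \<delta> <= \<phi> a / \<delta> & \<phi> a / \<delta> <= R / \<delta>" if "\<phi> \<in> \<Phi>" for \<phi>
   using bd[OF that a(1)] \<delta> by (intro conjI divide_right_mono) (auto simp: abs_le_iff)
  then show "g \<in> \<Phi> \<rightarrow>\<^sub>E {\<lfloor>- R / \<delta>\<rfloor>..\<lfloor>R / \<delta>\<rfloor>}"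
   unfolding a(2) cell_def by (intro restrict_PiE_iff[THEN iffD2] ballI) (simp add: floor_mono)
 qed
 then have fin: "finite (cell ` A)"
  by (rule finite_subset) (use \<Phi> in \<open>auto intro: finite_PiE\<close>)
 define D where "D = (\<lambda>g. SOME a. a \<in> A & cell a = g) ` (cell ` A)"
 have some: "(SOME a. a \<in> A & cell a = g) \<in> A & cell (SOME a. a \<in> A & cell a = g) = g"
  if "g \<in> cell ` A" for g
  using someI_ex[of "\<lambda>a. a \<in> A & cell a = g"] that by blast
 have "\<exists>d\<in>D. \<forall>\<phi>\<in>\<Phi>. \<bar>\<phi> a - \<phi> d\<bar> <= \<delta>" if a: "a \<in> A" for a
 proof
  let ?d = "SOME a'. a' \<in> A & cell a' = cell a"
  show "?d \<in> D" using a by (auto simp: D_def)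
  have "cell ?d = cell a" using some[of "cell a"] a by blast
  then have eq: "\<lfloor>\<phi> ?d / \<delta>\<rfloor> = \<lfloor>\<phi> a / \<delta>\<rfloor>" if "\<phi> \<in> \<Phi>" for \<phi>
   using that fun_cong[of "cell ?d" "cell a" \<phi>] unfolding cell_def restrict_def by simp
  show "\<forall>\<phi>\<in>\<Phi>. \<bar>\<phi> a - \<phi> ?d\<bar> <= \<delta>"
  proof
   fix \<phi> assume "\<phi> \<in> \<Phi>"
   then have "\<bar>\<phi> a / \<delta> - \<phi> ?d / \<delta>\<bar> <= 1" using eq[of \<phi>] by linarith
   then have "\<bar>(\<phi> a - \<phi> ?d) / \<delta>\<bar> <= 1" by (simp add: diff_divide_distrib)
   then show "\<bar>\<phi> a - \<phi> ?d\<bar> <= \<delta>" using \<delta> by (simp add: abs_divide)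
  qed
 qed
 moreover have "finite D" "D \<subseteq> A" using fin some by (auto simp: D_def)
 ultimately show ?thesis by blast
qed

text \<open>The net lies inside \<open>A\<close>, not merely near it: in the game its members have
  to be legal moves. It comes from rounding the coordinates with respect to a basis.\<close>

lemma findim_net:
 assumes Z: "normed_space Z" and B: "finite B" "B \<subseteq> pts Z" and A: "A \<subseteq> span B"
  and R: "!!a. a \<in> A ==> nrm Z a <= R" and \<delta>: "\<delta> > 0"
 shows "\<exists>D. finite D & D \<subseteq> A & (\<forall>a\<in>A. \<exists>d\<in>D. nrm Z (a - d) <= \<delta>)"
proof -
 obtain C where C: "finite C" "independent C" "span B = span C"
  using finite_span_subspace[OF subspace_span order_refl B(1)] by blast
 have Cp: "C \<subseteq> pts Z" using span_subset_pts[OF Z B(2)] C span_superset by blast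
 obtain c where c: "c > 0" "!!u. c * (\<Sum>b\<in>C. \<bar>u b\<bar>) <= nrm Z (\<Sum>b\<in>C. u b *\<^sub>R b)"
  using findim_coeff_bound[OF Z C(1,2) Cp] by blast
 define r where "r = representation C"
 have rep: "(\<Sum>b\<in>C. r a b *\<^sub>R b) = a" if "a \<in> A" for a
  unfolding r_def using that A C by (intro sum_representation_eq) auto
 define L where "L = (\<Sum>b\<in>C. nrm Z b) + 1"
 have L: "L > 0" unfolding L_def using Cp by (intro add_nonneg_pos sum_nonneg nrm_nonneg[OF Z]) auto
 have "\<exists>D. finite D & D \<subseteq> A & (\<forall>a\<in>A. \<exists>d\<in>D. \<forall>\<phi>\<in>(\<lambda>b a. r a b) ` C. \<bar>\<phi> a - \<phi> d\<bar> <= \<delta> / L)"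
 proof (rule finite_value_net)
  fix \<phi> a assume "\<phi> \<in> (\<lambda>b a. r a b) ` C" and a: "a \<in> A"
  then obtain b where b: "b \<in> C" "\<phi> = (\<lambda>a. r a b)" by blast
  have "c * \<bar>r a b\<bar> <= c * (\<Sum>b\<in>C. \<bar>r a b\<bar>)"
   using c(1) b C(1) by (intro mult_left_mono member_le_sum) auto
  also have "\<dots> <= R" using c(2)[of "r a"] rep[OF a] R[OF a] by simp
  finally show "\<bar>\<phi> a\<bar> <= R / c" using c(1) by (simp add: b field_simps)
 qed (use C(1) \<delta> L in auto)
 then obtain D where D: "finite D" "D \<subseteq> A"
  "!!a. a \<in> A ==> \<exists>d\<in>D. \<forall>b\<in>C. \<bar>r a b - r d b\<bar> <= \<delta> / L" by auto
 have "\<exists>d\<in>D. nrm Z (a - d) <= \<delta>" if a: "a \<in> A" for a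
 proof -
  obtain d where d: "d \<in> D" "\<forall>b\<in>C. \<bar>r a b - r d b\<bar> <= \<delta> / L" using D(3)[OF a] by blast
  then have "a - d = (\<Sum>b\<in>C. (r a b - r d b) *\<^sub>R b)"
   using rep[OF a] rep[of d] D(2) by (auto simp: algebra_simps sum_subtractf)
  then have "nrm Z (a - d) <= (\<Sum>b\<in>C. nrm Z ((r a b - r d b) *\<^sub>R b))"
   using Cp by (auto intro!: nrm_sum[OF Z] pts_scale[OF Z])
  also have "\<dots> <= (\<Sum>b\<in>C. \<delta> / L * nrm Z b)"
  proof (rule sum_mono)
   fix b assume b: "b \<in> C"
   then have "\<bar>r a b - r d b\<bar> * nrm Z b <= \<delta> / L * nrm Z b"
    using d(2) Cp nrm_nonneg[OF Z] by (intro mult_right_mono) auto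
   then show "nrm Z ((r a b - r d b) *\<^sub>R b) <= \<delta> / L * nrm Z b"
    using b Cp by (subst nrm_scale[OF Z]) auto
  qed
  also have "\<dots> = \<delta> / L * (L - 1)" unfolding L_def by (simp add: sum_distrib_left)
  also have "\<dots> <= \<delta>" using L \<delta> by (simp add: field_simps)
  finally show ?thesis using d(1) by blast
 qed
 then show ?thesis using D by blast
qed

text \<open>Passing to the functions that vanish at one of the points lowers the dimension by at
  most one, which drives the induction.\<close>

lemma findim_functions:
 fixes V :: "('a => real) set"
 assumes "finite B" "subspace V" "!!f. f \<in> V ==> (!!b. b \<in> B ==> f b = 0) ==> f = 0"
 shows "\<exists>C. finite C & V = span C"
 using assms
proof (induction B arbitrary: V rule: finite_induct)
 case empty
 then have "V \<subseteq> {0}" by blast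
 then have "V = span {}" using subspace_0[OF empty.prems(1)] by auto
 then show ?case by blast
next
 case (insert b B)
 define V' where "V' = {f \<in> V. f b = 0}"
 have V': "subspace V'"
  using insert.prems(1) unfolding V'_def subspace_def by (auto simp: scaleR_fun_def)
 have "\<exists>C. finite C & V' = span C"
  by (rule insert.IH[OF V']) (use insert.prems(2) in \<open>auto simp: V'_def\<close>)
 then obtain C where C: "finite C" "V' = span C" by blast
 show ?case
 proof (cases "V' = V")
  case False
  then obtain g where g: "g \<in> V" "g b ~= 0" by (auto simp: V'_def)
  have "V = span (insert g C)"
  proof
   show "span (insert g C) \<subseteq> V"
    using g C span_superset[of C] by (intro span_minimal insert.prems(1)) (auto simp: V'_def)
   show "V \<subseteq> span (insert g C)"
   proof
    fix f assume f: "f \<in> V"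
    have "f - (f b / g b) *\<^sub>R g \<in> V'"
     unfolding V'_def
     using subspace_diff[OF insert.prems(1) f subspace_scale[OF insert.prems(1) g(1)]] g(2)
     by (intro CollectI conjI) (simp_all only: minus_apply scaleR_fun_def, simp)
    then show "f \<in> span (insert g C)" unfolding C(2) span_breakdown_eq by blast
   qed
  qed
  then show ?thesis using C(1) by blast
 qed (use C in blast)
qed

abbreviation functional_on :: "'a::real_vector nspace => ('a => real) => bool"
 where "functional_on Y \<equiv> bounded_operator Y \<lparr>pts = UNIV, nrm = abs\<rparr>"

text \<open>The value vectors of \<open>\<Phi>\<close> form a finite-dimensional space, where
  coefficients over a basis are bounded by the sum norm; lifting that basis once and for all gives
  preimages in a fixed finite-dimensional space with linear control.\<close>

lemma functional_lifts:
 assumes Y: "normed_space Y" and "finite \<Phi>" "!!\<phi>. \<phi> \<in> \<Phi> ==> functional_on Y \<phi>"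
 shows "\<exists>B K. finite B & B \<subseteq> pts Y & K >= 0 & (\<forall>y\<in>pts Y. \<exists>y0\<in>span B. (\<forall>\<phi>\<in>\<Phi>. \<phi> y0 = \<phi> y) &
  nrm Y y0 <= K * (\<Sum>\<phi>\<in>\<Phi>. \<bar>\<phi> y\<bar>))"
proof -
 \<comment> \<open>Extended by 0 outside \<open>\<Phi>\<close>, the value vectors are functions
   determined by finitely many values.\<close>
 define ev where "ev y = (\<lambda>\<phi>. if \<phi> \<in> \<Phi> then \<phi> y else 0)" for y
 have add: "ev (x + y) = ev x + ev y" if "x \<in> pts Y" "y \<in> pts Y" for x y
  using op_add[OF assms(3) that] by (auto simp: ev_def fun_eq_iff)
 have scale: "ev (c *\<^sub>R x) = c *\<^sub>R ev x" if "x \<in> pts Y" for x c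
  using op_scale[OF assms(3) that] by (auto simp: ev_def fun_eq_iff scaleR_fun_def)
 have "subspace (ev ` pts Y)"
  unfolding subspace_def
 proof (intro conjI ballI allI)
  have "ev 0 = 0" using scale[OF pts_zero[OF Y], of 0] by simp
  then show "0 \<in> ev ` pts Y" using pts_zero[OF Y] by (metis imageI)
  show "a + b \<in> ev ` pts Y" if "a \<in> ev ` pts Y" "b \<in> ev ` pts Y" for a b
   using that pts_add[OF Y] by (auto simp flip: add)
  show "c *\<^sub>R a \<in> ev ` pts Y" if "a \<in> ev ` pts Y" for c a
   using that pts_scale[OF Y] by (auto simp flip: scale)
 qed
 note sub = this
 have "\<exists>C. finite C & ev ` pts Y = span C"
  by (rule findim_functions[OF assms(2) sub]) (auto simp: ev_def fun_eq_iff)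
 then obtain C where C: "finite C" "independent C" "ev ` pts Y = span C"
  using finite_span_subspace[OF sub] by (metis order_refl)
 define V where "V = \<lparr>pts = span C, nrm = \<lambda>a. \<Sum>\<phi>\<in>\<Phi>. \<bar>a \<phi>\<bar>\<rparr>"
 have "normed_space V"
  unfolding normed_space_def V_def nspace.simps
 proof (intro conjI ballI allI)
  fix a b and c :: real assume a: "a \<in> span C"
  have "a = 0" if "!!\<phi>. \<phi> \<in> \<Phi> ==> a \<phi> = 0" using a that unfolding C(3)[symmetric] by (auto simp: ev_def fun_eq_iff)
  then show "(\<Sum>\<phi>\<in>\<Phi>. \<bar>a \<phi>\<bar>) = 0 \<longleftrightarrow> a = 0" using assms(2) by (auto simp: sum_nonneg_eq_0_iff)
  show "(\<Sum>\<phi>\<in>\<Phi>. \<bar>(a + b) \<phi>\<bar>) <= (\<Sum>\<phi>\<in>\<Phi>. \<bar>a \<phi>\<bar>) + (\<Sum>\<phi>\<in>\<Phi>. \<bar>b \<phi>\<bar>)"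
   unfolding sum.distrib[symmetric] by (intro sum_mono) (simp add: abs_triangle_ineq)
 qed (auto simp: sum_nonneg scaleR_fun_def abs_mult sum_distrib_left)
 moreover have "C \<subseteq> pts V" by (auto simp: V_def span_base)
 ultimately obtain c where c: "c > 0" "!!u. c * (\<Sum>b\<in>C. \<bar>u b\<bar>) <= nrm V (\<Sum>b\<in>C. u b *\<^sub>R b)"
  using findim_coeff_bound[OF _ C(1,2)] by blast
 have "\<exists>y\<in>pts Y. ev y = b" if "b \<in> C" for b using span_base[OF that] unfolding C(3)[symmetric] by blast
 then obtain g where g: "!!b. b \<in> C ==> g b \<in> pts Y & ev (g b) = b" by metis
 define M where "M = (\<Sum>b\<in>C. nrm Y (g b))"
 have M: "M >= 0" unfolding M_def using g by (intro sum_nonneg nrm_nonneg[OF Y]) auto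
 have lift: "\<exists>y0\<in>span (g ` C). (\<forall>\<phi>\<in>\<Phi>. \<phi> y0 = \<phi> y) & nrm Y y0 <= M / c * (\<Sum>\<phi>\<in>\<Phi>. \<bar>\<phi> y\<bar>)" if y: "y \<in> pts Y" for y
 proof -
  have "ev y \<in> span C" using y C(3) by blast
  then obtain u where u: "ev y = (\<Sum>b\<in>C. u b *\<^sub>R b)" by (rule span_finite_ex[OF C(1)])
  define y0 where "y0 = (\<Sum>b\<in>C. u b *\<^sub>R g b)"
  have ug: "u b *\<^sub>R g b \<in> pts Y" if "b \<in> C" for b using g[OF that] by (intro pts_scale[OF Y]) auto
  have "\<phi> y0 = \<phi> y" if \<phi>: "\<phi> \<in> \<Phi>" for \<phi>
  proof -
   have "\<phi> y0 = (\<Sum>b\<in>C. \<phi> (u b *\<^sub>R g b))" unfolding y0_def by (rule op_sum[OF assms(3)[OF \<phi>] Y ug])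
   also have "\<dots> = (\<Sum>b\<in>C. u b * ev (g b) \<phi>)"
    using op_scale[OF assms(3)[OF \<phi>] conjunct1[OF g]] \<phi> by (intro sum.cong) (auto simp: ev_def)
   also have "\<dots> = ev y \<phi>" unfolding u using g by (simp add: sum_fun_apply scaleR_fun_def)
   finally show ?thesis using \<phi> by (simp add: ev_def)
  qed
  moreover have "nrm Y y0 <= (\<Sum>b\<in>C. \<bar>u b\<bar> * nrm Y (g b))"
   unfolding y0_def using g by (intro order_trans[OF nrm_sum[OF Y ug]] sum_mono) (auto simp: nrm_scale[OF Y])
  moreover have "\<dots> <= (\<Sum>b\<in>C. \<bar>u b\<bar> * M)"
   unfolding M_def using g C(1) by (intro sum_mono mult_left_mono member_le_sum nrm_nonneg[OF Y]) auto
  moreover have "\<dots> <= M / c * (\<Sum>\<phi>\<in>\<Phi>. \<bar>\<phi> y\<bar>)"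
  proof -
   have "nrm V (ev y) = (\<Sum>\<phi>\<in>\<Phi>. \<bar>\<phi> y\<bar>)" by (simp add: V_def ev_def)
   then have "(\<Sum>b\<in>C. \<bar>u b\<bar>) <= (\<Sum>\<phi>\<in>\<Phi>. \<bar>\<phi> y\<bar>) / c" using c(2)[of u] c(1) by (simp add: u field_simps)
   from mult_right_mono[OF this M] show ?thesis unfolding sum_distrib_right[symmetric] by (simp add: mult.commute)
  qed
  ultimately show ?thesis by (intro bexI[of _ y0]) (auto simp: y0_def intro: span_sum span_scale span_base)
 qed
 show ?thesis
  by (intro exI[of _ "g ` C"] exI[of _ "M / c"] conjI ballI lift finite_imageI C(1))
   (use g in blast, use M c(1) in simp)
qed

text \<open>Helly's theorem, with all lifts from one finite-dimensional subspace. A net point of the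
  unit ball with almost the right values has norm at most 1, and correcting the error exactly costs
  at most 1 more; hence the 2.\<close>

lemma helly_finite:
 assumes Y: "normed_space Y" and \<Phi>: "finite \<Phi>" "!!\<phi>. \<phi> \<in> \<Phi> ==> functional_on Y \<phi>"
 shows "\<exists>B. finite B & B \<subseteq> pts Y &
  (\<forall>y\<in>pts Y. \<exists>y'\<in>span B. (\<forall>\<phi>\<in>\<Phi>. \<phi> y' = \<phi> y) & nrm Y y' <= 2 * nrm Y y)"
proof -
 obtain B K where B: "finite B" "B \<subseteq> pts Y" "K >= 0"
  and K: "!!y. y \<in> pts Y ==> \<exists>y0\<in>span B. (\<forall>\<phi>\<in>\<Phi>. \<phi> y0 = \<phi> y) & nrm Y y0 <= K * (\<Sum>\<phi>\<in>\<Phi>. \<bar>\<phi> y\<bar>)"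
  using functional_lifts[OF Y \<Phi>] by blast
 \<comment> \<open>An error of \<open>\<delta>\<close> in each functional is corrected by a vector
   of norm at most \<open>K * (card \<Phi> * \<delta>)\<close>, which this choice keeps at most
   1.\<close>
 define \<delta> where "\<delta> = 1 / (K * card \<Phi> + 1)"
 have \<delta>: "\<delta> > 0" using B(3) by (simp add: \<delta>_def add_nonneg_pos)
 have K\<delta>: "K * (card \<Phi> * \<delta>) <= 1" using B(3) by (simp add: \<delta>_def divide_le_eq add_nonneg_pos)
 have "\<forall>\<phi>\<in>\<Phi>. \<exists>R>0. \<forall>y\<in>pts Y. \<bar>\<phi> y\<bar> <= R * nrm Y y"
 proof
  fix \<phi> assume "\<phi> \<in> \<Phi>"
  obtain R where "R > 0" "!!x. x \<in> pts Y ==> nrm \<lparr>pts = UNIV, nrm = abs\<rparr> (\<phi> x) <= R * nrm Y x"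
   using op_bound[OF \<Phi>(2)[OF \<open>\<phi> \<in> \<Phi>\<close>] Y] by blast
  then show "\<exists>R>0. \<forall>y\<in>pts Y. \<bar>\<phi> y\<bar> <= R * nrm Y y" by auto
 qed
 then obtain R where R: "!!\<phi>. \<phi> \<in> \<Phi> ==> R \<phi> > 0" "!!\<phi> y. \<phi> \<in> \<Phi> ==> y \<in> pts Y ==> \<bar>\<phi> y\<bar> <= R \<phi> * nrm Y y"
  by metis
 have "\<exists>D. finite D & D \<subseteq> {y \<in> pts Y. nrm Y y <= 1} &
   (\<forall>a\<in>{y \<in> pts Y. nrm Y y <= 1}. \<exists>d\<in>D. \<forall>\<phi>\<in>\<Phi>. \<bar>\<phi> a - \<phi> d\<bar> <= \<delta>)"
 proof (rule finite_value_net[OF \<Phi>(1) _ \<delta>])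
  fix \<phi> a assume \<phi>: "\<phi> \<in> \<Phi>" and "a \<in> {y \<in> pts Y. nrm Y y <= 1}"
  then have "\<bar>\<phi> a\<bar> <= R \<phi>" using R(2)[OF \<phi>, of a] mult_left_mono[OF _ less_imp_le[OF R(1)[OF \<phi>]], of "nrm Y a" 1] by simp
  also have "R \<phi> <= sum R \<Phi>" using \<phi> R(1) \<Phi>(1) by (intro member_le_sum) (auto intro: less_imp_le)
  finally show "\<bar>\<phi> a\<bar> <= sum R \<Phi>" .
 qed
 then obtain D where D: "finite D" "D \<subseteq> {y \<in> pts Y. nrm Y y <= 1}"
  "!!a. a \<in> pts Y ==> nrm Y a <= 1 ==> \<exists>d\<in>D. \<forall>\<phi>\<in>\<Phi>. \<bar>\<phi> a - \<phi> d\<bar> <= \<delta>" by blast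
 have unit: "\<exists>y'\<in>span (B \<union> D). (\<forall>\<phi>\<in>\<Phi>. \<phi> y' = \<phi> y) & nrm Y y' <= 2" if y: "y \<in> pts Y" "nrm Y y <= 1" for y
 proof -
  obtain d where d: "d \<in> D" "\<forall>\<phi>\<in>\<Phi>. \<bar>\<phi> y - \<phi> d\<bar> <= \<delta>" using D(3)[OF y] by blast
  have dp: "d \<in> pts Y" "nrm Y d <= 1" using d(1) D(2) by auto
  obtain y0 where y0: "y0 \<in> span B" "\<forall>\<phi>\<in>\<Phi>. \<phi> y0 = \<phi> (y - d)" "nrm Y y0 <= K * (\<Sum>\<phi>\<in>\<Phi>. \<bar>\<phi> (y - d)\<bar>)"
   using K[OF pts_diff[OF Y y(1) dp(1)]] by blast
  have y0p: "y0 \<in> pts Y" using y0(1) span_subset_pts[OF Y B(2)] by blast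
  have diff: "\<phi> (y - d) = \<phi> y - \<phi> d" if "\<phi> \<in> \<Phi>" for \<phi> using op_diff[OF \<Phi>(2)[OF that] Y y(1) dp(1)] .
  have "(\<Sum>\<phi>\<in>\<Phi>. \<bar>\<phi> (y - d)\<bar>) <= (\<Sum>\<phi>\<in>\<Phi>. \<delta>)" using d(2) diff by (intro sum_mono) auto
  then have "nrm Y y0 <= 1" using y0(3) mult_left_mono[of "\<Sum>\<phi>\<in>\<Phi>. \<bar>\<phi> (y - d)\<bar>" "card \<Phi> * \<delta>" K] B(3) K\<delta> by simp
  then have "nrm Y (d + y0) <= 2" using nrm_add[OF Y dp(1) y0p] dp(2) by simp
  moreover have "\<phi> (d + y0) = \<phi> y" if "\<phi> \<in> \<Phi>" for \<phi>
   using op_add[OF \<Phi>(2)[OF that] dp(1) y0p] y0(2)[rule_format, OF that] diff[OF that] by simp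
  moreover have "d + y0 \<in> span (B \<union> D)"
   using d(1) y0(1) span_mono[of B "B \<union> D"] by (intro span_add) (auto intro: span_base)
  ultimately show ?thesis by blast
 qed
 have "\<exists>y'\<in>span (B \<union> D). (\<forall>\<phi>\<in>\<Phi>. \<phi> y' = \<phi> y) & nrm Y y' <= 2 * nrm Y y" if y: "y \<in> pts Y" for y
 proof (cases "y = 0")
  case True
  then show ?thesis using nrm_zero[OF Y] by (intro bexI[of _ 0]) (auto intro: span_zero)
 next
  case False
  then have pos: "nrm Y y > 0" by (rule nrm_pos[OF Y y])
  obtain y' where y': "y' \<in> span (B \<union> D)" "\<forall>\<phi>\<in>\<Phi>. \<phi> y' = \<phi> ((1 / nrm Y y) *\<^sub>R y)" "nrm Y y' <= 2"
   using unit[OF pts_scale[OF Y y, of "1 / nrm Y y"]] pos by (auto simp: nrm_scale[OF Y y])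
  have "span (B \<union> D) \<subseteq> pts Y" using B D by (intro span_subset_pts[OF Y]) auto
  then have p: "y' \<in> pts Y" using y' by blast
  have "\<phi> (nrm Y y *\<^sub>R y') = \<phi> y" if "\<phi> \<in> \<Phi>" for \<phi>
   using op_scale[OF \<Phi>(2)[OF that] p] op_scale[OF \<Phi>(2)[OF that] y] y'(2)[rule_format, OF that] pos by simp
  moreover have "nrm Y (nrm Y y *\<^sub>R y') <= 2 * nrm Y y"
   using y'(3) pos by (simp add: nrm_scale[OF Y p])
  ultimately show ?thesis using y'(1) by (intro bexI[of _ "nrm Y y *\<^sub>R y'"] span_scale) auto
 qed
 moreover have "finite (B \<union> D)" "B \<union> D \<subseteq> pts Y" using B D by auto
 ultimately show ?thesis by blast
qed

section \<open>Finite-dimensional decompositions\<close>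

lemma banach_closed_span:
 assumes B: "banach_space W" and A: "A \<subseteq> pts W"
 shows "banach_space (closed_span_space W A)"
proof -
 note W = banach_normed[OF B]
 have sp: "span A \<subseteq> pts W" by (rule span_subset_pts[OF W A])
 define S where "S = closed_span_space W A"
 have pS: "x \<in> pts S \<longleftrightarrow> x \<in> pts W & (\<forall>e>0. \<exists>a\<in>span A. nrm W (x - a) < e)" for x
  using in_closure_ntop[OF W sp] by (simp add: S_def closed_span_space_def closed_span_def)
 have nS: "nrm S = nrm W" by (simp add: S_def closed_span_space_def)
 have "subspace (pts S)"
 proof (rule subspaceI)
  show "0 \<in> pts S" unfolding pS using pts_zero[OF W] nrm_zero[OF W] span_zero[of A] by force
 next
  fix x y assume xy: "x \<in> pts S" "y \<in> pts S"
  have "\<exists>a\<in>span A. nrm W (x + y - a) < e" if "e > 0" for e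
  proof -
   obtain a b where a: "a \<in> span A" "nrm W (x - a) < e/2" and b: "b \<in> span A" "nrm W (y - b) < e/2"
    using xy \<open>e > 0\<close> unfolding pS by (meson half_gt_zero)
   have "nrm W ((x - a) + (y - b)) <= nrm W (x - a) + nrm W (y - b)"
    using xy a b sp by (intro nrm_add[OF W] pts_diff[OF W]) (auto simp: pS)
   then have "nrm W (x + y - (a + b)) < e" using a b by (simp add: algebra_simps)
   then show ?thesis using span_add[OF a(1) b(1)] by blast
  qed
  then show "x + y \<in> pts S" using xy pts_add[OF W] by (auto simp: pS)
 next
  fix c :: real and x assume x: "x \<in> pts S"
  have "\<exists>a\<in>span A. nrm W (c *\<^sub>R x - a) < e" if "e > 0" for e
  proof -
   have "e / (\<bar>c\<bar> + 1) > 0" using \<open>e > 0\<close> by (simp add: add_nonneg_pos)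
   then obtain a where a: "a \<in> span A" "nrm W (x - a) < e / (\<bar>c\<bar> + 1)"
    using x unfolding pS by meson
   have p: "x - a \<in> pts W" using x a sp by (auto simp: pS intro: pts_diff[OF W])
   have "(\<bar>c\<bar> + 1) * nrm W (x - a) < e" using a(2) by (simp add: pos_less_divide_eq add_nonneg_pos mult.commute)
   then have "nrm W (c *\<^sub>R (x - a)) < e"
    using nrm_nonneg[OF W p] unfolding nrm_scale[OF W p] distrib_right by linarith
   then show ?thesis using span_scale[OF a(1), of c] unfolding scaleR_diff_right by blast
  qed
  then show "c *\<^sub>R x \<in> pts S" using x pts_scale[OF W] by (auto simp: pS)
 qed
 moreover have SW: "pts S \<subseteq> pts W" by (auto simp: pS)
 ultimately have NS: "normed_space S"
  unfolding normed_space_def nS using W by (auto simp: normed_space_def subset_iff)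
 have "banach_space S"
 proof (rule banach_spaceI[OF NS])
  fix s :: "nat => 'a" assume s: "!!n. s n \<in> pts S"
   and c: "!!e. e > 0 ==> \<exists>N. \<forall>m\<ge>N. \<forall>n\<ge>N. nrm S (s m - s n) < e"
  have sW: "s n \<in> pts W" for n using s SW by blast
  obtain z where z: "nconv W s z" using banach_conv[of W s] B sW c unfolding nS by blast
  have "\<exists>a\<in>span A. nrm W (z - a) < e" if "e > 0" for e
  proof -
   obtain n where n: "nrm W (s n - z) < e/2"
    using z nconv_iff[of W s z, OF W sW] \<open>e > 0\<close> by (meson half_gt_zero order_refl)
   obtain a where a: "a \<in> span A" "nrm W (s n - a) < e/2"
    using s[of n] \<open>e > 0\<close> unfolding pS by (meson half_gt_zero)
   have "nrm W (z - a) <= nrm W (z - s n) + nrm W (s n - a)"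
    using a sp by (intro nrm_triangle[OF W nconv_pts[OF z] sW]) auto
   then have "nrm W (z - a) < e" using n a nrm_diff_commute[OF W nconv_pts[OF z] sW, of n] by simp
   then show ?thesis using a by blast
  qed
  then have "z \<in> pts S" using nconv_pts[OF z] by (auto simp: pS)
  then show "\<exists>z. nconv S s z" using z by (auto simp: nconv_def nS)
 qed
 then show ?thesis by (simp add: S_def)
qed

lemma series_to_nconv:
 assumes "normed_space Z" "!!i. s i \<in> pts Z"
 shows "series_to Z s z \<longleftrightarrow> nconv Z (\<lambda>n. \<Sum>i<n. s i) z"
 unfolding series_to_def by (rule limitin_ntop[OF assms(1)]) (rule pts_sum[OF assms(1) assms(2)])

definition proj :: "'a::real_vector nspace => (nat => 'a set) => nat => 'a => 'a"
 where "proj Z E n z = (\<Sum>i<n. component Z E z i)"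

locale fdd =
 fixes Z :: "'a::real_vector nspace" and E :: "nat => 'a set"
 assumes B: "banach_space Z" and FDD: "is_FDD Z E"
begin

lemma Z: "normed_space Z" by (rule banach_normed[OF B])

lemma E_pts: "x \<in> E i ==> x \<in> pts Z" using FDD by (auto simp: is_FDD_def)

lemma E_span: obtains C where "finite C" "E i = span C" using FDD unfolding is_FDD_def by blast

lemma E_sub: "subspace (E i)" using E_span[of i] subspace_span by metis

lemma
 assumes "z \<in> pts Z"
 shows comp_mem: "component Z E z i \<in> E i" and comp_series: "series_to Z (component Z E z) z"
proof -
 have "\<exists>!s. (\<forall>i. s i \<in> E i) & series_to Z s z" using FDD assms by (auto simp: is_FDD_def)
 from theI'[OF this] show "component Z E z i \<in> E i" "series_to Z (component Z E z) z"
  by (auto simp: component_def)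
qed

lemma comp_pts: "z \<in> pts Z ==> component Z E z i \<in> pts Z" using comp_mem E_pts by blast

lemma comp_eq:
 assumes "!!i. s i \<in> E i" "nconv Z (\<lambda>n. \<Sum>i<n. s i) z"
 shows "component Z E z = s"
proof -
 have "z \<in> pts Z" using assms(2) by (rule nconv_pts)
 then have "\<exists>!s. (\<forall>i. s i \<in> E i) & series_to Z s z" using FDD by (auto simp: is_FDD_def)
 moreover have "series_to Z s z" using assms E_pts series_to_nconv[OF Z] by blast
 ultimately show ?thesis using assms(1) unfolding component_def by (intro the1_equality) auto
qed

lemma proj_conv: "z \<in> pts Z ==> nconv Z (\<lambda>n. proj Z E n z) z"
 using comp_series[of z] series_to_nconv[OF Z, of "component Z E z" z] comp_pts[of z] by (simp add: proj_def)

lemma proj_pts: "z \<in> pts Z ==> proj Z E n z \<in> pts Z"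
 unfolding proj_def by (intro pts_sum[OF Z] comp_pts)

lemma comp_add:
 assumes "x \<in> pts Z" "y \<in> pts Z"
 shows "component Z E (x + y) i = component Z E x i + component Z E y i"
proof -
 have "component Z E (x + y) = (\<lambda>i. component Z E x i + component Z E y i)"
 proof (rule comp_eq)
  show "component Z E x i + component Z E y i \<in> E i" for i
   using assms by (intro subspace_add[OF E_sub] comp_mem)
  show "nconv Z (\<lambda>n. \<Sum>i<n. component Z E x i + component Z E y i) (x + y)"
   using nconv_add[OF Z proj_pts proj_pts proj_conv proj_conv, OF assms(1) assms(2) assms]
   by (simp add: proj_def sum.distrib)
 qed
 then show ?thesis by simp
qed

lemma comp_scale:
 assumes "x \<in> pts Z"
 shows "component Z E (c *\<^sub>R x) i = c *\<^sub>R component Z E x i"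
proof -
 have "component Z E (c *\<^sub>R x) = (\<lambda>i. c *\<^sub>R component Z E x i)"
 proof (rule comp_eq)
  show "c *\<^sub>R component Z E x i \<in> E i" for i
   using assms by (intro subspace_scale[OF E_sub] comp_mem)
  show "nconv Z (\<lambda>n. \<Sum>i<n. c *\<^sub>R component Z E x i) (c *\<^sub>R x)"
   using nconv_scale[OF Z proj_pts proj_conv, OF assms assms] by (simp add: proj_def scaleR_sum_right)
 qed
 then show ?thesis by simp
qed

lemma comp_finite_sum:
 assumes "!!i. s i \<in> E i"
 shows "component Z E (\<Sum>i<n. s i) = (\<lambda>i. if i < n then s i else 0)"
proof (rule comp_eq)
 show "(if i < n then s i else 0) \<in> E i" for i using assms subspace_0[OF E_sub] by auto
 show "nconv Z (\<lambda>m. \<Sum>i<m. if i < n then s i else 0) (\<Sum>i<n. s i)"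
 proof (rule nconv_eventually_const[OF Z, where N = n])
  show "(\<Sum>i<n. s i) \<in> pts Z" using assms E_pts by (intro pts_sum[OF Z]) auto
  show "(\<Sum>i<m. if i < n then s i else 0) = (\<Sum>i<n. s i)" if "m >= n" for m
   using that by (intro sum.mono_neutral_cong_right) auto
 qed
qed

lemma comp_proj:
 assumes "z \<in> pts Z"
 shows "component Z E (proj Z E n z) i = (if i < n then component Z E z i else 0)"
 unfolding proj_def using comp_finite_sum[of "component Z E z" n] comp_mem[OF assms] by simp

lemma comp_0: "component Z E 0 i = 0"
 using comp_scale[OF pts_zero[OF Z], of 0] by simp

lemma comp_single:
 assumes "x \<in> E k"
 shows "component Z E x i = (if i = k then x else 0)"
proof -
 have "component Z E (\<Sum>i<Suc k. if i = k then x else 0) = (\<lambda>i. if i < Suc k then (if i = k then x else 0) else 0)"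
  by (rule comp_finite_sum) (use assms subspace_0[OF E_sub] in auto)
 moreover have "(\<Sum>i<Suc k. if i = k then x else 0) = x" by (simp add: sum.delta)
 ultimately show ?thesis by auto
qed

lemma proj_add: "x \<in> pts Z ==> y \<in> pts Z ==> proj Z E n (x + y) = proj Z E n x + proj Z E n y"
 by (simp add: proj_def comp_add sum.distrib)

lemma proj_scale: "x \<in> pts Z ==> proj Z E n (c *\<^sub>R x) = c *\<^sub>R proj Z E n x"
 by (simp add: proj_def comp_scale scaleR_sum_right)

lemma proj_diff:
 assumes "x \<in> pts Z" "y \<in> pts Z"
 shows "proj Z E n (x - y) = proj Z E n x - proj Z E n y"
 using proj_add[OF assms(1) pts_scale[OF Z assms(2)], of n "-1"] proj_scale[OF assms(2), of n "-1"] by simp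

lemma comp_zero_imp: "z \<in> pts Z ==> (!!i. component Z E z i = 0) ==> z = 0"
 using proj_conv[of z] nconv_unique[OF Z, of "\<lambda>n. 0" z 0] pts_zero[OF Z] nconv_const[OF Z, of 0]
 by (simp add: proj_def)

lemma supp_bounded_eq:
 assumes "z \<in> pts Z" "!!i. i >= n ==> component Z E z i = 0"
 shows "proj Z E n z = z"
proof -
 have "proj Z E m z = proj Z E n z" if "m >= n" for m
  unfolding proj_def using that assms(2) by (intro sum.mono_neutral_right) auto
 then have "nconv Z (\<lambda>m. proj Z E m z) (proj Z E n z)"
  by (intro nconv_eventually_const[OF Z proj_pts[OF assms(1)]])
 then show ?thesis using nconv_unique[OF Z proj_pts[OF assms(1)] _ proj_conv[OF assms(1)]] by blast
qed

lemma E_findim_closed: "(!!n. s n \<in> E i) ==> nconv Z s z ==> z \<in> E i"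
proof -
 assume s: "!!n. s n \<in> E i" "nconv Z s z"
 obtain C where C: "finite C" "E i = span C" by (rule E_span)
 have "C \<subseteq> pts Z" using C(2) E_pts span_superset by blast
 then show ?thesis using findim_closed[OF Z C(1), of s z] s C by auto
qed

text \<open>The classical renorming: under the supremum of the norms of the partial sums the space
  stays complete, and the identity back to the original norm is a bounded bijection, to which the
  open mapping theorem applies.\<close>

lemma proj_bounded: obtains K where "K > 0" "!!n z. z \<in> pts Z ==> nrm Z (proj Z E n z) <= K * nrm Z z"
proof -
 define N where "N z = (SUP n. nrm Z (proj Z E n z))" for z
 define Z' where "Z' = \<lparr>pts = pts Z, nrm = N\<rparr>"
 have bdd: "bdd_above (range (\<lambda>n. nrm Z (proj Z E n z)))" if "z \<in> pts Z" for z
  using nconv_nrm[OF Z proj_pts[OF that] proj_conv[OF that]]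
  by (intro Bseq_bdd_above convergent_imp_Bseq) (auto simp: convergent_def)
 have up: "nrm Z (proj Z E n z) <= N z" if "z \<in> pts Z" for n z
  unfolding N_def by (rule cSUP_upper[OF _ bdd[OF that]]) simp
 have least: "N z <= c" if "!!n. nrm Z (proj Z E n z) <= c" for z c
  unfolding N_def by (rule cSUP_least) (use that in auto)
 have NZ: "nrm Z z <= N z" if "z \<in> pts Z" for z
  by (rule nrm_limit_le[OF Z proj_pts[OF that] proj_conv[OF that]]) (rule up[OF that])
 have N0: "0 <= N z" if "z \<in> pts Z" for z using NZ[OF that] nrm_nonneg[OF Z that] by simp
 have "normed_space Z'"
  unfolding normed_space_def Z'_def nspace.simps
 proof (intro conjI ballI allI)
  fix x y and c :: real assume x: "x \<in> pts Z"
  show "N x = 0 \<longleftrightarrow> x = 0"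
  proof
   assume "N x = 0"
   then show "x = 0" using NZ[OF x] nrm_pos[OF Z x] by force
  next
   assume "x = 0"
   then show "N x = 0" by (simp add: N_def proj_def comp_0 nrm_zero[OF Z])
  qed
  have le: "N (c *\<^sub>R x) <= \<bar>c\<bar> * N x" if "x \<in> pts Z" for c x
   by (rule least) (use up[OF that] that in \<open>auto simp: proj_scale nrm_scale[OF Z] proj_pts intro: mult_left_mono\<close>)
  show "N (c *\<^sub>R x) = \<bar>c\<bar> * N x"
  proof (cases "c = 0")
   case True
   then show ?thesis using le[OF x, of 0] N0[OF pts_zero[OF Z]] by simp
  next
   case False
   then show ?thesis
    using le[OF x, of c] le[OF pts_scale[OF Z x], of "1/c" c] by (simp add: field_simps)
  qed
  assume y: "y \<in> pts Z"
  show "N (x + y) <= N x + N y"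
  proof (rule least)
   fix n
   show "nrm Z (proj Z E n (x + y)) <= N x + N y"
    using nrm_add[OF Z proj_pts[OF x] proj_pts[OF y], of n n] up[OF x, of n] up[OF y, of n]
    by (simp add: proj_add x y)
  qed
 qed (use N0 normed_space_subspace[OF Z] in auto)
 note Z' = this
 have p': "pts Z' = pts Z" "nrm Z' = N" by (simp_all add: Z'_def)
 have "banach_space Z'"
 proof (rule banach_spaceI[OF Z'])
  fix z :: "nat => 'a" assume "!!n. z n \<in> pts Z'" and c: "!!e. e > 0 ==> \<exists>N. \<forall>m\<ge>N. \<forall>n\<ge>N. nrm Z' (z m - z n) < e"
  then have z: "!!n. z n \<in> pts Z" by (simp add: p')
  have pd: "nrm Z (proj Z E n (z k) - proj Z E n (z l)) <= N (z k - z l)" for n k l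
   using up[OF pts_diff[OF Z z z], of n k l] by (simp add: proj_diff z)
  have "\<exists>w. nconv Z (\<lambda>k. proj Z E n (z k)) w" for n
  proof (rule banach_conv[OF B proj_pts[OF z]])
   fix e :: real assume "e > 0"
   then show "\<exists>M. \<forall>k\<ge>M. \<forall>l\<ge>M. nrm Z (proj Z E n (z k) - proj Z E n (z l)) < e"
    using c[of e] pd[of n] unfolding p' by (meson le_less_trans)
  qed
  then obtain w where w: "!!n. nconv Z (\<lambda>k. proj Z E n (z k)) (w n)" by metis
  have wp: "w n \<in> pts Z" for n using w nconv_pts by blast
  \<comment> \<open>The projections of the Cauchy sequence converge uniformly in \<open>n\<close>,
    so their limits \<open>w n\<close> converge in \<open>n\<close> and become the partial sums of
    the limit.\<close>
  have unif: "\<exists>M. \<forall>k\<ge>M. \<forall>n. nrm Z (proj Z E n (z k) - w n) <= e" if "e > 0" for e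
  proof -
   obtain M where M: "!!k l. k >= M ==> l >= M ==> N (z k - z l) < e" using c[OF \<open>e > 0\<close>] unfolding p' by blast
   have "nrm Z (proj Z E n (z k) - w n) <= e" if "k >= M" for k n
   proof (rule nrm_limit_le[OF Z])
    show "proj Z E n (z k) - proj Z E n (z l) \<in> pts Z" for l by (intro pts_diff[OF Z] proj_pts z)
    show "nconv Z (\<lambda>l. proj Z E n (z k) - proj Z E n (z l)) (proj Z E n (z k) - w n)"
     by (rule nconv_diff[OF Z _ _ nconv_const[OF Z] w]) (auto intro: proj_pts z)
    show "nrm Z (proj Z E n (z k) - proj Z E n (z l)) <= e" if "l >= M" for l
     using pd[of n k l] M[OF \<open>k >= M\<close> that] by simp
   qed
   then show ?thesis by blast
  qed
  define s where "s i = w (Suc i) - w i" for i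
  have w0: "w 0 = 0"
   using nconv_unique[OF Z _ w[of 0], of 0] pts_zero[OF Z] nconv_const[OF Z] by (simp add: proj_def)
  have sw: "(\<Sum>i<n. s i) = w n" for n by (induction n) (auto simp: s_def w0)
  have sE: "s i \<in> E i" for i
  proof (rule E_findim_closed)
   show "component Z E (z k) i \<in> E i" for k by (rule comp_mem[OF z])
   have "nconv Z (\<lambda>k. proj Z E (Suc i) (z k) - proj Z E i (z k)) (s i)"
    unfolding s_def by (rule nconv_diff[OF Z _ _ w w]) (auto intro: proj_pts z)
   then show "nconv Z (\<lambda>k. component Z E (z k) i) (s i)" by (simp add: proj_def)
  qed
  have "\<exists>x. nconv Z w x"
  proof (rule banach_conv[OF B wp])
   fix e :: real assume "e > 0"
   then have "e / 4 > 0" by simp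
   then obtain k where k: "!!n. nrm Z (proj Z E n (z k) - w n) <= e / 4" using unif by (meson order_refl)
   obtain M where M: "!!n. n >= M ==> nrm Z (proj Z E n (z k) - z k) < e / 4"
    using nconv_iff[of Z "\<lambda>n. proj Z E n (z k)" "z k", OF Z proj_pts[OF z]] proj_conv[OF z] \<open>e / 4 > 0\<close> by meson
   have "nrm Z (w n - z k) < e / 2" if "n >= M" for n
    using nrm_triangle[OF Z wp[of n] proj_pts[OF z[of k], of n] z[of k]] k[of n] M[OF that]
     nrm_diff_commute[OF Z wp[of n] proj_pts[OF z[of k], of n]] by simp
   then have "nrm Z (w m - w n) < e" if "m >= M" "n >= M" for m n
    using nrm_triangle[OF Z wp[of m] z[of k] wp[of n]] nrm_diff_commute[OF Z wp[of n] z[of k]] that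
    by (smt (verit) field_sum_of_halves)
   then show "\<exists>M. \<forall>m\<ge>M. \<forall>n\<ge>M. nrm Z (w m - w n) < e" by blast
  qed
  then obtain x where x: "nconv Z w x" by blast
  have "component Z E x = s" by (rule comp_eq[OF sE]) (simp add: sw x)
  then have px: "proj Z E n x = w n" for n by (simp add: proj_def sw)
  have xp: "x \<in> pts Z" using x by (rule nconv_pts)
  have "nconv Z' z x"
   unfolding nconv_iff[of Z' z x, OF Z' z[folded p']]
  proof (intro conjI allI impI)
   show "x \<in> pts Z'" using xp by (simp add: p')
   fix e :: real assume "e > 0"
   then obtain M where M: "!!k n. k >= M ==> nrm Z (proj Z E n (z k) - w n) <= e / 2"
    using unif[of "e/2"] by auto
   have "N (z k - x) <= e / 2" if "k >= M" for k
    by (rule least) (use M[OF that] in \<open>simp add: proj_diff z xp px\<close>)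
   then show "\<exists>M. \<forall>k\<ge>M. nrm Z' (z k - x) < e" using \<open>e > 0\<close> unfolding p' by (intro exI[of _ M]) force
  qed
  then show "\<exists>x. nconv Z' z x" by blast
 qed
 moreover have "bounded_operator Z' Z (\<lambda>z. z)"
  by (rule bounded_operatorI[where K = 1]) (use NZ in \<open>auto simp: p'\<close>)
 ultimately obtain C where C: "C > 0" "!!y. y \<in> pts Z ==> \<exists>z\<in>pts Z'. z = y & nrm Z' z <= C * nrm Z y"
  using open_mapping[of Z' Z "\<lambda>z. z"] B by (auto simp: p')
 have "nrm Z (proj Z E n z) <= C * nrm Z z" if "z \<in> pts Z" for n z
  using C(2)[OF that] up[OF that, of n] by (auto simp: p')
 then show ?thesis using that C(1) by blast
qed

end

text \<open>Grunblum's criterion: when initial segments are dominated by longer sums, the components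
  of approximating finite sums converge, and expansions are unique because a series with sum 0 has
  vanishing partial sums.\<close>

lemma is_FDD_I:
 assumes B: "banach_space Z" and E: "!!i. E i \<subseteq> pts Z" "!!i. \<exists>C. finite C & E i = span C"
  and K: "!!s m n. (!!i. s i \<in> E i) ==> m <= n ==> nrm Z (\<Sum>i<m. s i) <= K * nrm Z (\<Sum>i<n. s i)"
  and dense: "!!z e. z \<in> pts Z ==> e > 0 ==> \<exists>s n. (\<forall>i. s i \<in> E i) & nrm Z (z - (\<Sum>i<n. s i)) < e"
 shows "is_FDD Z E"
 unfolding is_FDD_def
proof (intro conjI allI ballI)
 note Z = banach_normed[OF B]
 show "E i \<subseteq> pts Z" "\<exists>C. finite C & E i = span C" for i using E by auto
 have sub: "subspace (E i)" for i using E(2)[of i] subspace_span by metis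
 have Ep: "x \<in> E i ==> x \<in> pts Z" for x i using E(1) by blast
 have sp: "(\<Sum>i<n. s i) \<in> pts Z" if "!!i. s i \<in> E i" for s n using that Ep by (intro pts_sum[OF Z]) auto
 fix z assume z: "z \<in> pts Z"
 have "\<exists>s n. (\<forall>i. s i \<in> E i) & nrm Z (z - (\<Sum>i<n. s i)) < (1/2) ^ k" for k :: nat
  using dense[OF z] by simp
 then obtain s0 n0 where s0: "!!k i. s0 k i \<in> E i" "!!k. nrm Z (z - (\<Sum>i<n0 k. s0 k i)) < (1/2) ^ k"
  by metis
 define d where "d k = (\<Sum>i<n0 k. s0 k i)" for k
 \<comment> \<open>Padding with zeros makes finite sums of different lengths comparable.\<close>
 define t where "t k i = (if i < n0 k then s0 k i else 0)" for k i
 have t: "t k i \<in> E i" for k i using s0 subspace_0[OF sub] by (auto simp: t_def)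
 have td: "(\<Sum>i<n. t k i) = d k" if "n >= n0 k" for n k
  unfolding d_def t_def using that by (intro sum.mono_neutral_cong_right) auto
 have dp: "d k \<in> pts Z" for k unfolding d_def by (rule sp) (rule s0)
 have dz: "nrm Z (d k - z) < (1/2) ^ k" for k
  using s0(2)[of k] nrm_diff_commute[OF Z z dp, of k] by (simp add: d_def)
 have tp: "(\<Sum>i<n. t k i) \<in> pts Z" for n k by (rule sp) (rule t)
 have tdiff: "nrm Z ((\<Sum>i<n. t k i) - (\<Sum>i<n. t l i)) <= K * nrm Z (d k - d l)" for n k l
 proof -
  define m where "m = max n (max (n0 k) (n0 l))"
  have "nrm Z (\<Sum>i<n. t k i - t l i) <= K * nrm Z (\<Sum>i<m. t k i - t l i)"
   by (rule K) (auto simp: m_def intro!: subspace_diff[OF sub] t)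
  moreover have "(\<Sum>i<m. t k i) = d k" "(\<Sum>i<m. t l i) = d l" by (auto simp: m_def intro!: td)
  ultimately show ?thesis by (simp add: sum_subtractf)
 qed
 have ddiff: "nrm Z (d k - d l) <= 2 * (1/2) ^ M" if "k >= M" "l >= M" for k l M
 proof -
  have "nrm Z (d k - d l) <= nrm Z (d k - z) + nrm Z (z - d l)" by (rule nrm_triangle[OF Z dp z dp])
  moreover have "(1/2::real) ^ k <= (1/2) ^ M" "(1/2::real) ^ l <= (1/2) ^ M" using that by (auto intro: power_decreasing)
  ultimately show ?thesis using dz[of k] dz[of l] nrm_diff_commute[OF Z z dp, of l] by linarith
 qed
 have lim0: "(\<lambda>M. \<bar>c\<bar> * (1/2) ^ M) \<longlonglongrightarrow> 0" for c :: real
  using tendsto_mult[OF tendsto_const[of "\<bar>c\<bar>"] LIMSEQ_realpow_zero[of "1/2::real"]] by simp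
 have small: "\<exists>M. \<bar>c\<bar> * (1/2) ^ M < e" if "e > 0" for c e :: real
  using LIMSEQ_D[OF lim0[of c] that] by auto
 have Kd: "K * nrm Z (d k - d l) <= \<bar>2 * K\<bar> * (1/2) ^ M" if "k >= M" "l >= M" for k l M
 proof -
  have "K * nrm Z (d k - d l) <= \<bar>K\<bar> * nrm Z (d k - d l)"
   using nrm_nonneg[OF Z pts_diff[OF Z dp dp]] by (intro mult_right_mono) auto
  also have "\<dots> <= \<bar>K\<bar> * (2 * (1/2) ^ M)" using ddiff[OF that] by (intro mult_left_mono) auto
  finally show ?thesis by simp
 qed
 have "\<exists>w. nconv Z (\<lambda>k. \<Sum>i<n. t k i) w" for n
 proof (rule banach_conv[OF B tp])
  fix e :: real assume "e > 0"
  then obtain M where "\<bar>2 * K\<bar> * (1/2) ^ M < e" using small by blast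
  then show "\<exists>M. \<forall>k\<ge>M. \<forall>l\<ge>M. nrm Z ((\<Sum>i<n. t k i) - (\<Sum>i<n. t l i)) < e"
   using Kd tdiff[of _ n] by (meson order.strict_trans1 order_trans)
 qed
 then obtain w where w: "!!n. nconv Z (\<lambda>k. \<Sum>i<n. t k i) (w n)" by metis
 have wp: "w n \<in> pts Z" for n using w nconv_pts by blast
 have tw: "nrm Z ((\<Sum>i<n. t k i) - w n) <= \<bar>2 * K\<bar> * (1/2) ^ k" for n k
 proof (rule nrm_limit_le[OF Z])
  show "(\<Sum>i<n. t k i) - (\<Sum>i<n. t l i) \<in> pts Z" for l by (intro pts_diff[OF Z] tp)
  show "nconv Z (\<lambda>l. (\<Sum>i<n. t k i) - (\<Sum>i<n. t l i)) ((\<Sum>i<n. t k i) - w n)"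
   by (rule nconv_diff[OF Z tp tp nconv_const[OF Z tp] w])
  show "nrm Z ((\<Sum>i<n. t k i) - (\<Sum>i<n. t l i)) <= \<bar>2 * K\<bar> * (1/2) ^ k" if "l >= k" for l
   using tdiff[of k n l] Kd[OF order_refl that] by linarith
 qed
 define s where "s i = w (Suc i) - w i" for i
 have w0: "w 0 = 0"
  using nconv_unique[OF Z _ w[of 0], of 0] pts_zero[OF Z] nconv_const[OF Z] by simp
 have sw: "(\<Sum>i<n. s i) = w n" for n by (induction n) (auto simp: s_def w0)
 have sE: "s i \<in> E i" for i
 proof -
  obtain C where C: "finite C" "E i = span C" using E(2) by blast
  have "nconv Z (\<lambda>k. (\<Sum>i<Suc i. t k i) - (\<Sum>i<i. t k i)) (s i)"
   unfolding s_def by (rule nconv_diff[OF Z tp tp w w])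
  then have "nconv Z (\<lambda>k. t k i) (s i)" by simp
  moreover have "C \<subseteq> pts Z" using C E(1) span_superset by blast
  moreover have "t k i \<in> span C" for k using t[of k i] C(2) by simp
  ultimately show ?thesis using findim_closed[OF Z C(1), of "\<lambda>k. t k i" "s i"] C(2) by simp
 qed
 have "nconv Z w z"
  unfolding nconv_iff[OF Z wp]
 proof (intro conjI z allI impI)
  fix e :: real assume "e > 0"
  then obtain k where k: "\<bar>\<bar>2 * K\<bar> + 1\<bar> * (1/2) ^ k < e" using small by blast
  have "nrm Z (w n - z) < e" if "n >= n0 k" for n
  proof -
   have "nrm Z (w n - z) <= nrm Z (w n - (\<Sum>i<n. t k i)) + nrm Z ((\<Sum>i<n. t k i) - z)"
    by (rule nrm_triangle[OF Z wp tp z])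
   also have "\<dots> <= \<bar>2 * K\<bar> * (1/2) ^ k + (1/2) ^ k"
    using tw[where n=n and k=k] dz[of k] td[OF that] nrm_diff_commute[OF Z wp[of n] tp[where n=n and k=k]]
    by simp
   also have "\<dots> < e" using k by (simp add: algebra_simps)
   finally show ?thesis .
  qed
  then show "\<exists>N. \<forall>n\<ge>N. nrm Z (w n - z) < e" by blast
 qed
 then have sz: "nconv Z (\<lambda>n. \<Sum>i<n. s i) z" by (simp add: sw)
 have "s' = s" if s': "!!i. s' i \<in> E i" "nconv Z (\<lambda>n. \<Sum>i<n. s' i) z" for s'
 proof -
  have dE: "s' i - s i \<in> E i" for i by (intro subspace_diff[OF sub] s' sE)
  have "nconv Z (\<lambda>n. (\<Sum>i<n. s' i) - (\<Sum>i<n. s i)) (z - z)"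
   by (rule nconv_diff[OF Z sp[OF s'(1)] sp[OF sE] s'(2) sz])
  then have "(\<lambda>n. nrm Z (\<Sum>i<n. s' i - s i)) \<longlonglongrightarrow> 0"
   by (simp add: nconv_def sum_subtractf)
  then have lim: "(\<lambda>n. K * nrm Z (\<Sum>i<n. s' i - s i)) \<longlonglongrightarrow> K * 0" by (intro tendsto_mult tendsto_const)
  have "(\<Sum>i<m. s' i - s i) = 0" for m
  proof -
   have "nrm Z (\<Sum>i<m. s' i - s i) <= K * 0"
    using K[of "\<lambda>i. s' i - s i", OF dE] by (intro LIMSEQ_le_const[OF lim]) auto
   then show ?thesis using nrm_pos[OF Z sp[of "\<lambda>i. s' i - s i", OF dE]] by force
  qed
  then have "s' i - s i = 0" for i using sum.lessThan_Suc[of "\<lambda>i. s' i - s i" i] by simp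
  then show ?thesis by auto
 qed
 then show "\<exists>!s. (\<forall>i. s i \<in> E i) & series_to Z s z"
  using sE sz series_to_nconv[OF Z] Ep by (intro ex1I[of _ s]) blast+
qed

section \<open>Unconditional, block stable, right dominant, shrinking sequences\<close>

lemma span_Union_finite_support:
 assumes "f \<in> span (\<Union>i. A i)"
 shows "\<exists>n s. (\<forall>i. s i \<in> span (A i)) & f = (\<Sum>i<(n::nat). s i)"
 using assms
proof (induction rule: span_induct_alt)
 case base
 show ?case by (intro exI[of _ 0] exI[of _ "\<lambda>_. 0"]) (auto intro: span_zero)
next
 case (step c x y)
 obtain k where k: "x \<in> A k" using step(1) by blast
 obtain n s where s: "\<forall>i. s i \<in> span (A i)" "y = (\<Sum>i<n. s i)" using step(2) by blast
 define m where "m = max n (Suc k)"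
 define t where "t i = (if i = k then c *\<^sub>R x else 0) + (if i < n then s i else 0)" for i
 have "t i \<in> span (A i)" for i
  using span_base[OF k] s(1) by (auto simp: t_def intro!: span_add span_scale span_zero)
 moreover have "(\<Sum>i<m. t i) = c *\<^sub>R x + y"
 proof -
  have "(\<Sum>i<m. if i < n then s i else 0) = y"
   unfolding s(2) by (intro sum.mono_neutral_cong_right) (auto simp: m_def)
  moreover have "(\<Sum>i<m. if i = k then c *\<^sub>R x else 0) = c *\<^sub>R x"
   by (subst sum.delta) (auto simp: m_def)
  ultimately show ?thesis by (simp add: t_def sum.distrib)
 qed
 ultimately show ?case by metis
qed

locale vseq =
 fixes W :: "'v::real_vector nspace" and v :: "nat => 'v"
 assumes BW: "banach_space W" and norm_v: "normalized W v"
  and uncond: "one_unconditional W v" and stable: "block_stable W v" and rdom: "right_dominant W v"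
  and shrink: "shrinking_seq W v"
begin

abbreviation "S \<equiv> seq_space W v"

lemma W: "normed_space W" by (rule banach_normed[OF BW])

lemma v_pts: "v i \<in> pts W" and v_nrm: "nrm W (v i) = 1"
 using norm_v by (auto simp: normalized_def)

lemma BS: "banach_space S" by (rule banach_closed_span[OF BW]) (use v_pts in auto)

lemma nrm_S: "nrm S = nrm W" by (simp add: closed_span_space_def)

lemma S_fdd: "fdd S (lines v)"
 using shrink BS by unfold_locales (auto simp: shrinking_seq_def shrinking_FDD_def)

lemma v_S: "v i \<in> pts S"
proof -
 have "span {v i} \<subseteq> pts S" using fdd.FDD[OF S_fdd] by (auto simp: is_FDD_def)
 then show ?thesis using span_base[of "v i" "{v i}"] by blast
qed

lemma v_nonzero: "v i ~= 0" using v_nrm[of i] nrm_zero[OF W] by auto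

lemma sum_pts: "(\<Sum>j\<in>J. a j *\<^sub>R v (e j)) \<in> pts W"
 by (intro pts_sum[OF W] pts_scale[OF W] v_pts)

lemma sum_pts_S: "(\<Sum>j\<in>J. a j *\<^sub>R v (e j)) \<in> pts S"
 by (intro pts_sum[OF banach_normed[OF BS]] pts_scale[OF banach_normed[OF BS]] v_S)

lemma sign_flip:
 assumes "!!i. \<epsilon> i \<in> {-1, 1::real}"
 shows "nrm W (\<Sum>i<n. (\<epsilon> i * a i) *\<^sub>R v i) = nrm W (\<Sum>i<n. a i *\<^sub>R v i)"
proof (rule antisym)
 have le: "nrm W (\<Sum>i<n. (\<epsilon> i * a i) *\<^sub>R v i) <= nrm W (\<Sum>i<n. a i *\<^sub>R v i)" for a
  using uncond assms unfolding one_unconditional_def by blast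
 then show "nrm W (\<Sum>i<n. (\<epsilon> i * a i) *\<^sub>R v i) <= nrm W (\<Sum>i<n. a i *\<^sub>R v i)" .
 have "\<epsilon> i * (\<epsilon> i * a i) = a i" for i using assms[of i] by auto
 then show "nrm W (\<Sum>i<n. a i *\<^sub>R v i) <= nrm W (\<Sum>i<n. (\<epsilon> i * a i) *\<^sub>R v i)"
  using le[of "\<lambda>i. \<epsilon> i * a i"] by (simp only:)
qed

lemma sum_pts0: "(\<Sum>i\<in>J. a i *\<^sub>R v i) \<in> pts W"
 by (intro pts_sum[OF W] pts_scale[OF W] v_pts)

text \<open>Shrinking one coefficient is a convex combination of keeping it and flipping its sign.\<close>

lemma coeff_mono_prefix:
 assumes "!!i. i < n ==> \<bar>a i\<bar> <= \<bar>b i\<bar>"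
 shows "nrm W (\<Sum>i<n. a i *\<^sub>R v i) <= nrm W (\<Sum>i<n. b i *\<^sub>R v i)"
proof -
 have "nrm W (\<Sum>i<n. (if i < k then a i else b i) *\<^sub>R v i) <= nrm W (\<Sum>i<n. b i *\<^sub>R v i)" if "k <= n" for k
  using that
 proof (induction k)
  case (Suc k)
  define c where "c i = (if i < k then a i else b i)" for i
  \<comment> \<open>If \<open>b k = 0\<close> then \<open>a k = 0\<close> as well, and the default 1
    satisfies both requirements on \<open>t\<close>.\<close>
  define t where "t = (if b k = 0 then 1 else a k / b k)"
  have "\<bar>a k\<bar> <= \<bar>b k\<bar>" using assms Suc.prems by simp
  then have t: "a k = t * b k" "\<bar>t\<bar> <= 1" by (auto simp: t_def)
  \<comment> \<open>The weights \<open>p\<close> and \<open>1 - p\<close> of the original and the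
    flipped sign satisfy \<open>p - (1 - p) = t\<close>.\<close>
  define p where "p = (1 + t) / 2"
  have p: "0 <= p" "p <= 1" using t(2) by (auto simp: p_def abs_le_iff)
  define \<epsilon> where "\<epsilon> i = (if i = k then -1 else 1::real)" for i
  have fl: "nrm W (\<Sum>i<n. (\<epsilon> i * c i) *\<^sub>R v i) = nrm W (\<Sum>i<n. c i *\<^sub>R v i)"
   by (rule sign_flip) (auto simp: \<epsilon>_def)
  have coef: "(if i < Suc k then a i else b i) = p * c i + (1 - p) * (\<epsilon> i * c i)" for i
   using t(1) by (auto simp: c_def \<epsilon>_def p_def field_simps less_Suc_eq)
  have "(\<Sum>i<n. (if i < Suc k then a i else b i) *\<^sub>R v i) =
    p *\<^sub>R (\<Sum>i<n. c i *\<^sub>R v i) + (1 - p) *\<^sub>R (\<Sum>i<n. (\<epsilon> i * c i) *\<^sub>R v i)"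
   unfolding coef by (simp add: scaleR_sum_right sum.distrib[symmetric] scaleR_add_left)
  also have "nrm W \<dots> <= nrm W (p *\<^sub>R (\<Sum>i<n. c i *\<^sub>R v i)) + nrm W ((1 - p) *\<^sub>R (\<Sum>i<n. (\<epsilon> i * c i) *\<^sub>R v i))"
   by (intro nrm_add[OF W] pts_scale[OF W] pts_sum[OF W] v_pts)
  also have "\<dots> = nrm W (\<Sum>i<n. c i *\<^sub>R v i)"
   using p by (simp only: nrm_scale[OF W sum_pts0] fl) (simp add: algebra_simps)
  also have "\<dots> <= nrm W (\<Sum>i<n. b i *\<^sub>R v i)" using Suc by (simp add: c_def)
  finally show ?case .
 qed simp
 from this[of n]
 have "nrm W (\<Sum>i<n. (if i < n then a i else b i) *\<^sub>R v i) <= nrm W (\<Sum>i<n. b i *\<^sub>R v i)" by simp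
 moreover have "(\<Sum>i<n. (if i < n then a i else b i) *\<^sub>R v i) = (\<Sum>i<n. a i *\<^sub>R v i)"
  by (rule sum.cong) auto
 ultimately show ?thesis by simp
qed

lemma coeff_mono:
 assumes J: "finite J'" "J \<subseteq> J'" "inj_on e J'" and le: "!!j. j \<in> J ==> \<bar>a j\<bar> <= \<bar>b j\<bar>"
 shows "nrm W (\<Sum>j\<in>J. a j *\<^sub>R v (e j)) <= nrm W (\<Sum>j\<in>J'. b j *\<^sub>R v (e j))"
proof -
 obtain n where n: "!!j. j \<in> J' ==> e j < n"
  using J(1) finite_nat_set_iff_bounded[of "e ` J'"] by blast
 define d where "d c I i = (if i \<in> e ` I then c (inv_into J' e i) else 0::real)" for c I i
 have eq: "(\<Sum>j\<in>I. c j *\<^sub>R v (e j)) = (\<Sum>i<n. d c I i *\<^sub>R v i)" if "I \<subseteq> J'" for c I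
 proof -
  have inj: "inj_on e I" using J(3) that inj_on_subset by blast
  have "(\<Sum>i<n. d c I i *\<^sub>R v i) = (\<Sum>i\<in>e ` I. d c I i *\<^sub>R v i)"
   using n that by (intro sum.mono_neutral_right) (auto simp: d_def)
  also have "\<dots> = (\<Sum>j\<in>I. d c I (e j) *\<^sub>R v (e j))" by (simp add: sum.reindex[OF inj])
  also have "\<dots> = (\<Sum>j\<in>I. c j *\<^sub>R v (e j))"
   using that J(3) by (intro sum.cong) (auto simp: d_def inv_into_f_f subset_iff)
  finally show ?thesis by simp
 qed
 have "\<bar>d a J i\<bar> <= \<bar>d b J' i\<bar>" for i
 proof (cases "i \<in> e ` J")
  case True
  then obtain j where "j \<in> J" "i = e j" by blast
  then show ?thesis using le J(2) inv_into_f_f[OF J(3), of j] by (auto simp: d_def)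
 qed (simp add: d_def)
 then show ?thesis unfolding eq[OF J(2)] eq[OF order_refl] by (intro coeff_mono_prefix)
qed

lemma coeff_le:
 assumes "finite J" "inj_on e J" "j \<in> J"
 shows "\<bar>a j\<bar> <= nrm W (\<Sum>j\<in>J. a j *\<^sub>R v (e j))"
 using coeff_mono[OF assms(1) _ assms(2), of "{j}" a a] assms(3) by (simp add: nrm_scale[OF W v_pts] v_nrm)

lemma supp_v: "supp S (lines v) (v i) = {i}"
proof -
 have "component S (lines v) (v i) k = (if k = i then v i else 0)" for k
  by (rule fdd.comp_single[OF S_fdd]) (simp add: span_base)
 then show ?thesis using v_nonzero by (auto simp: supp_def)
qed

lemma block_seq_v: "strict_mono p ==> block_seq S (lines v) (\<lambda>i. v (p i))"
 by (simp add: block_seq_def supp_v v_S v_nonzero strict_mono_Suc_iff)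

lemma normalized_v: "normalized S (\<lambda>i. v (p i))"
 by (simp add: normalized_def v_S nrm_S v_nrm)

text \<open>Block stability and right dominance speak of infinite sequences; a finite index sequence
  is continued beyond a bound \<open>M\<close> of its members.\<close>

definition cont :: "nat => (nat => nat) => nat => nat => nat"
 where "cont k p M j = (if j < k then p j else M + j)"

text \<open>Block stability applied to the vectors \<open>v i\<close> themselves: moving each index
  within its own window changes norms only by a constant factor.\<close>

lemma exchange:
 obtains C where "C >= 1" "!!k p q (a :: nat => real). (!!j. Suc j < k ==> max (p j) (q j) < min (p (Suc j)) (q (Suc j))) ==>
  nrm W (\<Sum>j<k. a j *\<^sub>R v (p j)) <= C * nrm W (\<Sum>j<k. a j *\<^sub>R v (q j))"
proof -
 obtain C where C: "C >= 1" and st: "!!x y. block_seq S (lines v) x ==> normalized S x ==>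
   block_seq S (lines v) y ==> normalized S y ==>
   (!!i. Max (supp S (lines v) (x i) \<union> supp S (lines v) (y i)) <
     Min (supp S (lines v) (x (Suc i)) \<union> supp S (lines v) (y (Suc i)))) ==>
   equivalent_seqs C S x S y"
  using stable unfolding block_stable_def Let_def by blast
 show ?thesis
 proof (rule that[OF C])
  fix k :: nat and p q :: "nat => nat" and a :: "nat => real"
  assume w: "!!j. Suc j < k ==> max (p j) (q j) < min (p (Suc j)) (q (Suc j))"
  obtain M where M: "!!j. j < k ==> p j < M & q j < M"
  proof -
   obtain M where "\<forall>i\<in>p ` {..<k} \<union> q ` {..<k}. i < M"
    using finite_nat_set_iff_bounded[of "p ` {..<k} \<union> q ` {..<k}"] by auto
   then show ?thesis using that[of M] by auto
  qed
  define p' q' where "p' = cont k p M" and "q' = cont k q M"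
  have step: "max (p' j) (q' j) < min (p' (Suc j)) (q' (Suc j))" for j
   using w[of j] M[of j] by (auto simp: p'_def q'_def cont_def less_Suc_eq)
  then have "strict_mono p'" "strict_mono q'" by (auto simp: strict_mono_Suc_iff)
  then have "equivalent_seqs C S (\<lambda>i. v (p' i)) S (\<lambda>i. v (q' i))"
  proof (intro st block_seq_v normalized_v)
   fix i
   have "Max {p' i, q' i} < Min {p' (Suc i), q' (Suc i)}" using step[of i] by simp
   then show "Max (supp S (lines v) (v (p' i)) \<union> supp S (lines v) (v (q' i)))
     < Min (supp S (lines v) (v (p' (Suc i))) \<union> supp S (lines v) (v (q' (Suc i))))"
    by (simp add: supp_v)
  qed
  then obtain A B where AB: "A > 0" "B > 0" "A * B <= C" and
   ineq: "!!n a. 1 / A * nrm W (\<Sum>i<n. a i *\<^sub>R v (p' i)) <= nrm W (\<Sum>i<n. a i *\<^sub>R v (q' i)) &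
    nrm W (\<Sum>i<n. a i *\<^sub>R v (q' i)) <= B * nrm W (\<Sum>i<n. a i *\<^sub>R v (p' i))"
   unfolding equivalent_seqs_def nrm_S by blast
  \<comment> \<open>A single vector shows that \<open>B\<close> is at least 1, so that
    \<open>A\<close> alone is bounded by \<open>C\<close>.\<close>
  have B1: "1 <= B" using ineq[where n = 1 and a = "\<lambda>_. 1"] by (simp add: v_nrm)
  then have "A <= C" using AB(3) mult_left_mono[OF B1 less_imp_le[OF AB(1)]] by linarith
  have "nrm W (\<Sum>j<k. a j *\<^sub>R v (p' j)) <= A * nrm W (\<Sum>j<k. a j *\<^sub>R v (q' j))"
   using ineq[of a k] AB(1) by (simp add: field_simps)
  also have "\<dots> <= C * nrm W (\<Sum>j<k. a j *\<^sub>R v (q' j))"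
   using \<open>A <= C\<close> nrm_nonneg[OF W sum_pts] by (intro mult_right_mono) auto
  finally show "nrm W (\<Sum>j<k. a j *\<^sub>R v (p j)) <= C * nrm W (\<Sum>j<k. a j *\<^sub>R v (q j))"
   by (simp add: p'_def q'_def cont_def)
 qed
qed

lemma shift_right:
 obtains C where "C >= 1" "!!k p q (a :: nat => real). (!!j. Suc j < k ==> p j < p (Suc j) & q j < q (Suc j)) ==>
  (!!j. j < k ==> p j <= q j) ==>
  nrm W (\<Sum>j<k. a j *\<^sub>R v (p j)) <= C * nrm W (\<Sum>j<k. a j *\<^sub>R v (q j))"
proof -
 obtain C where C: "C >= 1" and rd: "!!m n. strict_mono m ==> strict_mono n ==> (!!i. m i <= n i) ==>
  dominated_by C W (\<lambda>i. v (m i)) W (\<lambda>i. v (n i))"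
  using rdom unfolding right_dominant_def by blast
 show ?thesis
 proof (rule that[OF C])
  fix k :: nat and p q :: "nat => nat" and a :: "nat => real"
  assume w: "!!j. Suc j < k ==> p j < p (Suc j) & q j < q (Suc j)" and le: "!!j. j < k ==> p j <= q j"
  obtain M where M: "!!j. j < k ==> q j < M"
   using finite_nat_set_iff_bounded[of "q ` {..<k}"] by auto
  define p' q' where "p' = cont k p M" and "q' = cont k q M"
  have "p' j < p' (Suc j) & q' j < q' (Suc j)" "p' j <= q' j" for j
   using w[of j] le[of j] M[of j] by (auto simp: p'_def q'_def cont_def less_Suc_eq)
  then have "dominated_by C W (\<lambda>i. v (p' i)) W (\<lambda>i. v (q' i))" by (intro rd) (auto simp: strict_mono_Suc_iff)
  then have "nrm W (\<Sum>j<k. a j *\<^sub>R v (p' j)) <= C * nrm W (\<Sum>j<k. a j *\<^sub>R v (q' j))"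
   unfolding dominated_by_def by blast
  then show "nrm W (\<Sum>j<k. a j *\<^sub>R v (p j)) <= C * nrm W (\<Sum>j<k. a j *\<^sub>R v (q j))"
   by (simp add: p'_def q'_def cont_def)
 qed
qed

text \<open>By shrinking, a functional is norm-close to a finite sum of functionals that each see
  only one \<open>v i\<close>, and such a sum vanishes at \<open>v n\<close> for large
  \<open>n\<close>.\<close>

lemma weakly_null_v:
 assumes f: "f \<in> pts (dual S)" and e: "e > 0"
 shows "\<exists>N. \<forall>n\<ge>N. \<bar>f (v n)\<bar> < e"
proof -
 note S = banach_normed[OF BS] and D = normed_space_dual[OF banach_normed[OF BS]]
 define A where "A i = dual_FDD S (lines v) i" for i
 have AD: "(\<Union>i. A i) \<subseteq> pts (dual S)" by (auto simp: A_def dual_FDD_def)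
 have "f \<in> closed_span (dual S) (\<Union>i. A i)"
  using shrink f unfolding shrinking_seq_def shrinking_FDD_def A_def by simp
 then obtain g where g: "g \<in> span (\<Union>i. A i)" "nrm (dual S) (f - g) < e"
  using in_closure_ntop[OF D span_subset_pts[OF D AD]] e by (auto simp: closed_span_def)
 obtain n s where s: "\<forall>i. s i \<in> span (A i)" "g = (\<Sum>i<n. s i)"
  using span_Union_finite_support[OF g(1)] by blast
 have "s i (v m) = 0" if "m ~= i" for i m
 proof -
  have "span (A i) \<subseteq> {f. f (v m) = 0}"
  proof (rule span_minimal)
   have "v m \<in> span {v m}" by (simp add: span_base)
   then show "A i \<subseteq> {f. f (v m) = 0}" using that by (auto simp: A_def dual_FDD_def)
   show "subspace {f. f (v m) = 0}" by (auto simp: subspace_def scaleR_fun_def)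
  qed
  then show ?thesis using s by blast
 qed
 then have "g (v m) = 0" if "m >= n" for m using that unfolding s(2) sum_fun_apply by (intro sum.neutral) auto
 moreover have gD: "g \<in> pts (dual S)" using g(1) span_subset_pts[OF D AD] by blast
 moreover have "\<bar>(f - g) (v m)\<bar> < e" for m
  using dual_bound[OF S pts_diff[OF D f gD] v_S[of m]] g(2) by (simp add: nrm_S v_nrm)
 ultimately show ?thesis by (intro exI[of _ n]) (auto, metis diff_zero)
qed

end

section \<open>Finite-dimensional skeletons of a space and its dual\<close>

text \<open>A substitute for a shrinking FDD of \<open>X\<close>: in place of projections,
  \<open>F_lift\<close> and \<open>H_lift\<close> supply members of the finite-dimensional pieces
  with prescribed values. \<open>H_lift\<close> needs the next index because \<open>F i\<close> is
  chosen after \<open>H i\<close>, and the functionals prescribed on it are added only then.\<close>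

locale skeleton =
 fixes X :: "'x::real_vector nspace" and F :: "nat => 'x set" and H :: "nat => ('x => real) set"
 assumes X: "normed_space X"
  and F0: "F 0 = {0}" and H0: "H 0 = {0}"
  and F_span: "\<exists>C. finite C & C \<subseteq> pts X & F i = span C"
  and H_span: "\<exists>C. finite C & C \<subseteq> pts (dual X) & H i = span C"
  and F_Suc: "F i \<subseteq> F (Suc i)" and H_Suc: "H i \<subseteq> H (Suc i)"
  and F_dense: "x \<in> pts X ==> e > 0 ==> \<exists>i. \<exists>y\<in>F i. nrm X (x - y) < e"
  and H_dense: "f \<in> pts (dual X) ==> e > 0 ==> \<exists>i. \<exists>g\<in>H i. nrm (dual X) (f - g) < e"
  and F_lift: "x \<in> pts X ==> \<exists>y\<in>F i. (\<forall>h\<in>H i. h y = h x) & nrm X y <= 2 * nrm X x"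
  and H_lift: "f \<in> pts (dual X) ==>
   \<exists>g\<in>H (Suc i). (\<forall>x\<in>F i. g x = f x) & nrm (dual X) g <= 2 * nrm (dual X) f"
begin

lemma D: "normed_space (dual X)" by (rule normed_space_dual[OF X])

lemma F_mono: "i <= j ==> F i \<subseteq> F j" by (rule lift_Suc_mono_le[of F]) (use F_Suc in auto)

lemma H_mono: "i <= j ==> H i \<subseteq> H j" by (rule lift_Suc_mono_le[of H]) (use H_Suc in auto)

lemma F_sub: "subspace (F i)" using F_span[of i] by (auto intro: subspace_span)

lemma H_sub: "subspace (H i)" using H_span[of i] by (auto intro: subspace_span)

lemma F_pts: "x \<in> F i ==> x \<in> pts X" using F_span[of i] span_subset_pts[OF X] by blast

lemma H_pts: "f \<in> H i ==> f \<in> pts (dual X)" using H_span[of i] span_subset_pts[OF D] by blast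

text \<open>A functional is close to a member of some \<open>H i\<close>, which annihilates the
  sequence from \<open>i\<close> on. Moves annihilated by growing \<open>H j\<close> thus form legal
  nodes of a tree.\<close>

lemma weakly_null_annihilated:
 assumes "!!j. x j \<in> pts X" "!!j. nrm X (x j) = 1" "!!j h. h \<in> H j ==> h (x j) = 0"
 shows "weakly_null X x"
 unfolding weakly_null_def
proof (intro conjI ballI)
 show "range x \<subseteq> pts X" using assms by blast
 fix f assume f: "f \<in> pts (dual X)"
 show "(\<lambda>k. f (x k)) \<longlonglongrightarrow> 0"
 proof (rule LIMSEQ_I)
  fix e :: real assume "0 < e"
  then obtain i h where h: "h \<in> H i" "nrm (dual X) (f - h) < e" using H_dense[OF f] by blast
  have "norm (f (x j) - 0) < e" if "j >= i" for j
  proof -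
   have "h (x j) = 0" using assms(3) H_mono[OF that] h(1) by blast
   then show ?thesis
    using dual_bound[OF X pts_diff[OF D f H_pts[OF h(1)]] assms(1)[of j]] assms(2)[of j] h(2) by simp
  qed
  then show "\<exists>N. \<forall>j\<ge>N. norm (f (x j) - 0) < e" by blast
 qed
qed

lemma subskeleton:
 assumes t: "strict_mono t" "t 0 = 0"
 shows "skeleton X (\<lambda>i. F (t i)) (\<lambda>i. H (t i))"
proof
 fix i x f and e :: real
 have le: "t i <= t (Suc i)" "Suc (t i) <= t (Suc i)" using t(1) by (simp_all add: strict_mono_Suc_iff less_imp_le Suc_leI)
 show "F (t i) \<subseteq> F (t (Suc i))" "H (t i) \<subseteq> H (t (Suc i))" using F_mono H_mono le by auto
 show "\<exists>i. \<exists>y\<in>F (t i). nrm X (x - y) < e" if "x \<in> pts X" "0 < e"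
  using F_dense[OF that] F_mono[OF strict_mono_imp_increasing[OF t(1)]] by blast
 show "\<exists>i. \<exists>g\<in>H (t i). nrm (dual X) (f - g) < e" if "f \<in> pts (dual X)" "0 < e"
  using H_dense[OF that] H_mono[OF strict_mono_imp_increasing[OF t(1)]] by blast
 show "\<exists>g\<in>H (t (Suc i)). (\<forall>x\<in>F (t i). g x = f x) & nrm (dual X) g <= 2 * nrm (dual X) f" if "f \<in> pts (dual X)"
  using H_lift[OF that, of "t i"] H_mono[OF le(2)] by blast
qed (use X F0 H0 t(2) F_span H_span F_lift in auto)

end

text \<open>Each member \<open>h i\<close> of a dense sequence in the dual is normed up to a factor
  2 by some \<open>x i\<close>. A functional vanishing at all \<open>x i\<close> is close to some
  \<open>h i\<close>, which is then small at \<open>x i\<close> and hence small in norm.\<close>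

lemma separable_of_separable_dual:
 fixes X :: "'x::real_vector nspace"
 assumes X: "normed_space X" and sep: "separable_space (ntop (dual X))"
 obtains h :: "nat => 'x => real" and x :: "nat => 'x" where "!!i. h i \<in> pts (dual X)" "!!i. x i \<in> pts X"
  "!!f e. f \<in> pts (dual X) ==> e > 0 ==> \<exists>i. nrm (dual X) (f - h i) < e"
  "!!z e. z \<in> pts X ==> e > 0 ==> \<exists>y\<in>span (range x). nrm X (z - y) < e"
proof -
 note D = normed_space_dual[OF X]
 obtain Q where Q: "countable Q" "Q \<subseteq> pts (dual X)" "\<forall>z\<in>pts (dual X). \<forall>e>0. \<exists>d\<in>Q. nrm (dual X) (z - d) < e"
  using sep separable_iff[OF D] by blast
 have "Q ~= {}" using Q(3) pts_zero[OF D] by (metis empty_iff zero_less_one)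
 define h where "h = from_nat_into Q"
 have h: "range h = Q" unfolding h_def using \<open>Q ~= {}\<close> Q(1) by (rule range_from_nat_into)
 have hD: "h i \<in> pts (dual X)" for i using h Q(2) by blast
 have "\<exists>x\<in>pts X. nrm X x <= 1 & nrm (dual X) (h i) / 2 <= h i x" for i
 proof (cases "nrm (dual X) (h i) = 0")
  case True
  then show ?thesis using pts_zero[OF X] nrm_zero[OF X] dual_zero[OF hD X] by (intro bexI[of _ 0]) auto
 next
  case False
  then have "nrm (dual X) (h i) / 2 < nrm (dual X) (h i)" using dual_nrm_nonneg[OF X hD, of i] by simp
  then show ?thesis using dual_nrm_approx[OF X hD] by (metis less_imp_le)
 qed
 then obtain x where x: "!!i. x i \<in> pts X" "!!i. nrm X (x i) <= 1" "!!i. nrm (dual X) (h i) / 2 <= h i (x i)"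
  by metis
 show ?thesis
 proof (rule that[of h x])
  show dense: "\<exists>i. nrm (dual X) (f - h i) < e" if "f \<in> pts (dual X)" "e > 0" for f e
   using Q(3) that h by (metis rangeE)
  show "\<exists>y\<in>span (range x). nrm X (z - y) < e" if "z \<in> pts X" "e > 0" for z e
  proof (rule dense_if_annihilator_trivial[OF X subspace_span _ _ that])
   show "span (range x) \<subseteq> pts X" using x(1) by (intro span_subset_pts[OF X]) auto
   fix f assume f: "f \<in> pts (dual X)" and "!!s. s \<in> span (range x) ==> f s = 0"
   then have fx: "f (x i) = 0" for i by (simp add: span_base)
   have "nrm (dual X) f <= 0"
   proof (rule field_le_epsilon)
    fix e :: real assume "e > 0"
    then obtain i where i: "nrm (dual X) (f - h i) < e / 3" using dense[OF f, of "e/3"] by auto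
    have "\<bar>(f - h i) (x i)\<bar> <= nrm (dual X) (f - h i)"
     by (rule dual_nrm_ge[OF X pts_diff[OF D f hD] x(1,2)])
    then have "nrm (dual X) (h i) <= 2 * nrm (dual X) (f - h i)" using x(3)[of i] fx[of i] by (simp add: abs_le_iff)
    then show "nrm (dual X) f <= 0 + e" using nrm_diff_ge[OF D f hD, of i] i by simp
   qed
   then show "f = 0" using nrm_pos[OF D f] by force
  qed
 qed (use hD x in auto)
qed

lemma eval_functional:
 assumes "normed_space X" "x \<in> pts X"
 shows "functional_on (dual X) (\<lambda>f. f x)"
 by (rule bounded_operatorI[where K = "nrm X x"])
  (use dual_bound[OF assms(1) _ assms(2)] in \<open>auto simp: scaleR_fun_def mult.commute\<close>)

lemma eq_on_span_functions:
 assumes "h \<in> span A" "!!h. h \<in> A ==> h y = h x"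
 shows "(h :: 'a => real) y = h x"
proof -
 have "span A \<subseteq> {h. h y = h x}"
  by (rule span_minimal) (use assms(2) in \<open>auto simp: subspace_def scaleR_fun_def\<close>)
 then show ?thesis using assms(1) by blast
qed

lemma eq_on_span_points:
 assumes X: "normed_space X" and A: "A \<subseteq> pts X" and fg: "f \<in> pts (dual X)" "g \<in> pts (dual X)"
  and eq: "!!a. a \<in> A ==> f a = g a" and x: "x \<in> span A"
 shows "f x = g x"
proof -
 have "span A \<subseteq> {x \<in> pts X. f x = g x}"
  by (rule span_minimal) (use assms in \<open>auto simp: subspace_def pts_zero pts_add pts_scale dual_zero dual_add dual_scale\<close>)
 then show ?thesis using x by blast
qed

text \<open>Two requirements are met alternately: \<open>H\<close> grows to represent functionals on
  the last \<open>F\<close>, then \<open>F\<close> grows to represent vectors on the new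
  \<open>H\<close>. The dense sequences are fed in one member at a time.\<close>

theorem skeleton_exists:
 fixes X :: "'x::real_vector nspace"
 assumes X: "normed_space X" and sep: "separable_space (ntop (dual X))"
 obtains F H where "skeleton X F H"
proof -
 note D = normed_space_dual[OF X]
 obtain h :: "nat => 'x => real" and x :: "nat => 'x" where h: "!!i. h i \<in> pts (dual X)" and x: "!!i. x i \<in> pts X"
  and hd: "!!f e. f \<in> pts (dual X) ==> e > 0 ==> \<exists>i. nrm (dual X) (f - h i) < e"
  and xd: "!!z e. z \<in> pts X ==> e > 0 ==> \<exists>y\<in>span (range x). nrm X (z - y) < e"
  using separable_of_separable_dual[OF X sep] by blast
 define \<alpha> where "\<alpha> A G \<longleftrightarrow> (\<forall>x\<in>pts X. \<exists>y\<in>span A. (\<forall>h\<in>G. h y = h x) & nrm X y <= 2 * nrm X x)" for A and G :: "('x => real) set"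
 define \<beta> where "\<beta> A G \<longleftrightarrow> (\<forall>f\<in>pts (dual X). \<exists>g\<in>span G. (\<forall>x\<in>A. g x = f x) & nrm (dual X) g <= 2 * nrm (dual X) f)" for A G
 have \<alpha>ex: "\<exists>B. finite B & B \<subseteq> pts X & \<alpha> B G" if G: "finite G" "G \<subseteq> pts (dual X)" for G
 proof -
  have "functional_on X \<phi>" if "\<phi> \<in> G" for \<phi> using that G(2) dual_op by blast
  from helly_finite[OF X G(1) this] show ?thesis unfolding \<alpha>_def .
 qed
 have \<beta>ex: "\<exists>B. finite B & B \<subseteq> pts (dual X) & \<beta> A B" if A: "finite A" "A \<subseteq> pts X" for A
 proof -
  have fin: "finite ((\<lambda>x f. f x) ` A)" using A by simp
  have op: "functional_on (dual X) \<phi>" if "\<phi> \<in> (\<lambda>x f. f x) ` A" for \<phi>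
   using that A eval_functional[OF X] by auto
  show ?thesis unfolding \<beta>_def using helly_finite[OF D fin op] by auto
 qed
 define P where "P n s \<longleftrightarrow> finite (fst s) & fst s \<subseteq> pts X & finite (snd s) & snd s \<subseteq> pts (dual X) & \<alpha> (fst s) (snd s) &
  (n = 0 --> s = ({}, {}))" for n :: nat and s
 define Q where "Q n s s' \<longleftrightarrow> fst s \<subseteq> fst s' & snd s \<subseteq> snd s' & h n \<in> snd s' & x n \<in> fst s' & \<beta> (fst s) (snd s')" for n s s'
 have "\<exists>f. \<forall>n. P n (f n) & Q n (f n) (f (Suc n))"
 proof (rule dependent_nat_choice)
  have "P 0 ({}, {})" using nrm_zero[OF X] nrm_nonneg[OF X] by (auto simp: P_def \<alpha>_def)
  then show "\<exists>s. P 0 s" by blast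
 next
  fix s n assume s: "P n s"
  then obtain B where B: "finite B" "B \<subseteq> pts (dual X)" "\<beta> (fst s) B" using \<beta>ex[of "fst s"] by (auto simp: P_def)
  define G where "G = insert (h n) (snd s \<union> B)"
  have G: "finite G" "G \<subseteq> pts (dual X)" using s B h by (auto simp: G_def P_def)
  obtain A where A: "finite A" "A \<subseteq> pts X" "\<alpha> A G" using \<alpha>ex[OF G] by blast
  define A' where "A' = insert (x n) (fst s \<union> A)"
  have "\<alpha> A' G" using A(3) span_mono[of A A'] unfolding \<alpha>_def A'_def by blast
  moreover have "\<beta> (fst s) G" using B(3) span_mono[of B G] unfolding \<beta>_def G_def by blast
  ultimately have "P (Suc n) (A', G)" "Q n s (A', G)"
   using s A G x by (auto simp: P_def Q_def A'_def G_def)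
  then show "\<exists>s'. P (Suc n) s' & Q n s s'" by blast
 qed
 then obtain s where P: "!!n. P n (s n)" and Q: "!!n. Q n (s n) (s (Suc n))" by blast
 have A: "fst (s n) \<subseteq> pts X" and G: "snd (s n) \<subseteq> pts (dual X)" for n using P by (auto simp: P_def)
 have mono: "span (fst (s i)) \<subseteq> span (fst (s j))" if "i <= j" for i j
  by (rule lift_Suc_mono_le[of "\<lambda>i. span (fst (s i))", OF _ that]) (use Q in \<open>auto simp: Q_def intro!: span_mono\<close>)
 have "skeleton X (\<lambda>i. span (fst (s i))) (\<lambda>i. span (snd (s i)))"
 proof
  show "span (fst (s 0)) = {0}" "span (snd (s 0)) = {0}" using P[of 0] by (auto simp: P_def)
  show "\<exists>C. finite C & C \<subseteq> pts X & span (fst (s i)) = span C" for i using P[of i] by (auto simp: P_def)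
  show "\<exists>C. finite C & C \<subseteq> pts (dual X) & span (snd (s i)) = span C" for i using P[of i] by (auto simp: P_def)
  show "span (fst (s i)) \<subseteq> span (fst (s (Suc i)))" "span (snd (s i)) \<subseteq> span (snd (s (Suc i)))" for i
   using Q[of i] by (auto simp: Q_def intro!: span_mono)
  show "\<exists>i. \<exists>y\<in>span (snd (s i)). nrm (dual X) (f - y) < e" if fe: "f \<in> pts (dual X)" "e > 0" for f e
  proof -
   obtain i where i: "nrm (dual X) (f - h i) < e" using hd[OF fe] by blast
   have "h i \<in> span (snd (s (Suc i)))" using Q[of i] by (intro span_base) (simp add: Q_def)
   then show ?thesis using i by blast
  qed
  show "\<exists>i. \<exists>y\<in>span (fst (s i)). nrm X (z - y) < e" if ze: "z \<in> pts X" "e > 0" for z e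
  proof -
   obtain y where y: "y \<in> span (range x)" "nrm X (z - y) < e" using xd[OF ze] by blast
   have "range x = (\<Union>i. {x i})" by auto
   then obtain n r where r: "\<forall>i. r i \<in> span {x i}" "y = (\<Sum>i<n. r i)"
    using span_Union_finite_support[of y "\<lambda>i. {x i}"] y(1) by auto
   have "r i \<in> span (fst (s n))" if "i < n" for i
   proof -
    have "span {x i} \<subseteq> span (fst (s (Suc i)))" using Q[of i] by (intro span_mono) (simp add: Q_def)
    then show ?thesis using r(1) mono[of "Suc i" n] that by (meson Suc_leI subsetD)
   qed
   then have "y \<in> span (fst (s n))" unfolding r(2) by (intro span_sum) auto
   then show ?thesis using y by blast
  qed
  show "\<exists>y\<in>span (fst (s i)). (\<forall>h\<in>span (snd (s i)). h y = h z) & nrm X y <= 2 * nrm X z" if z: "z \<in> pts X" for z i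
  proof -
   obtain y where y: "y \<in> span (fst (s i))" "\<forall>h\<in>snd (s i). h y = h z" "nrm X y <= 2 * nrm X z"
    using P[of i] z by (auto simp: P_def \<alpha>_def)
   then show ?thesis using eq_on_span_functions[of _ "snd (s i)" y z] by blast
  qed
  show "\<exists>g\<in>span (snd (s (Suc i))). (\<forall>x\<in>span (fst (s i)). g x = f x) & nrm (dual X) g <= 2 * nrm (dual X) f"
   if f: "f \<in> pts (dual X)" for f i
  proof -
   obtain g where g: "g \<in> span (snd (s (Suc i)))" "\<forall>x\<in>fst (s i). g x = f x" "nrm (dual X) g <= 2 * nrm (dual X) f"
    using Q[of i] f by (auto simp: Q_def \<beta>_def)
   then have "g \<in> pts (dual X)" using span_subset_pts[OF D G] by blast
   then show ?thesis using eq_on_span_points[OF X A _ f, of g i] g by blast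
  qed
 qed (rule X)
 then show ?thesis by (rule that)
qed

section \<open>The game behind tree estimates\<close>

locale game = vseq W v + skeleton X F H
 for W :: "'v::real_vector nspace" and v and X :: "'x::real_vector nspace" and F H
begin

definition dom :: "real => (nat \<times> 'x) list => bool"
 where "dom C s \<longleftrightarrow> (\<forall>a. nrm X (\<Sum>i<length s. a i *\<^sub>R snd (s ! i)) <=
  C * nrm W (\<Sum>i<length s. a i *\<^sub>R v (fst (s ! i))))"

definition unit_annihilated :: "nat => 'x set"
 where "unit_annihilated m = {x \<in> pts X. nrm X x = 1 & (\<forall>h\<in>H m. h x = 0)}"

text \<open>A position is lost if the second player, answering each pair \<open>(n, m)\<close> by a unit vector
 annihilated by \<open>H m\<close>, can force domination to fail after finitely many moves.\<close>

inductive lost :: "real => (nat \<times> 'x) list => bool" for C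
 where
  lost_now: "\<not> dom C s ==> lost C s"
 | lost_later: "(!!n m. (\<forall>p\<in>fst ` set s. p < n) ==> \<exists>x\<in>unit_annihilated m. lost C (s @ [(n, x)])) ==> lost C s"

lemma unit_annihilated_mono: "m <= k ==> unit_annihilated k \<subseteq> unit_annihilated m"
 using H_mono[of m k] by (auto simp: unit_annihilated_def)

lemma weakly_null_tree_last:
 assumes "!!m. u m \<in> unit_annihilated m"
 shows "weakly_null_even_tree X (\<lambda>\<alpha>. u (last \<alpha>))"
 unfolding weakly_null_even_tree_def
proof (intro conjI ballI allI impI)
 fix ns :: "nat list"
 have "h (u (last ns + 1 + j)) = 0" if "h \<in> H j" for j h
  using assms[of "last ns + 1 + j"] that H_mono[of j "last ns + 1 + j"] by (auto simp: unit_annihilated_def)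
 then show "weakly_null X (\<lambda>j. u (last (ns @ [last ns + 1 + j])))"
  using assms by (intro weakly_null_annihilated) (auto simp: unit_annihilated_def)
qed (use assms in \<open>auto simp: unit_annihilated_def\<close>)

lemma even_indices_Cons2:
 "n # k # r \<in> even_indices ==> r ~= [] ==> r \<in> even_indices"
 by (auto simp: even_indices_def)

text \<open>Induction along the derivation of \<open>lost\<close>. The refuting answers and the
  trees for the subsequent positions are glued below the first two indices; \<open>u\<close> fills
  the places where nothing has to be refuted.\<close>

lemma lost_imp_bad_tree:
 assumes "lost C s" and u: "!!m. u m \<in> unit_annihilated m"
 shows "\<exists>t. weakly_null_even_tree X t & (\<forall>b. strict_mono b & (\<forall>p\<in>fst ` set s. p < b 0) -->
  (\<exists>l. \<not> dom C (s @ map (\<lambda>i. (b (2 * i), t (map b [0..<2 * i + 2]))) [0..<l])))"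
 using assms(1)
proof (induction rule: lost.induct)
 case (lost_now s)
 then have "\<not> dom C (s @ map (\<lambda>i. (b (2 * i), u (last (map b [0..<2 * i + 2])))) [0..<0])" for b by simp
 then show ?case using weakly_null_tree_last[OF u] by blast
next
 case (lost_later s)
 define ok where "ok n \<longleftrightarrow> (\<forall>p\<in>fst ` set s. p < n)" for n
 define bad where "bad n x t \<longleftrightarrow> (\<forall>b. strict_mono b & (\<forall>p\<in>fst ` set (s @ [(n, x)]). p < b 0) -->
   (\<exists>l. \<not> dom C ((s @ [(n, x)]) @ map (\<lambda>i. (b (2 * i), t (map b [0..<2 * i + 2]))) [0..<l])))"
  for n and x :: 'x and t
 \<comment> \<open>If \<open>n\<close> does not exceed the earlier indices, no branch under
   consideration starts with it, and an arbitrary weakly null tree will do.\<close>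
 have "\<exists>x t. x \<in> unit_annihilated m & weakly_null_even_tree X t & (ok n --> bad n x t)" for n m
 proof (cases "ok n")
  case True
  then show ?thesis using lost_later[of n m] unfolding ok_def bad_def by blast
 next
  case False
  then show ?thesis using weakly_null_tree_last[OF u] u by blast
 qed
 then have ex: "\<exists>z. fst z \<in> unit_annihilated m & weakly_null_even_tree X (snd z) & (ok n --> bad n (fst z) (snd z))" for n m
  by (metis fst_conv snd_conv)
 define z where "z n m = (SOME z. fst z \<in> unit_annihilated m & weakly_null_even_tree X (snd z) & (ok n --> bad n (fst z) (snd z)))" for n m
 define x where "x n m = fst (z n m)" for n m
 define t where "t n m = snd (z n m)" for n m
 have x: "x n m \<in> unit_annihilated m" and t: "weakly_null_even_tree X (t n m)"
  and bad: "ok n ==> bad n (x n m) (t n m)" for n m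
  using someI_ex[OF ex[of m n]] unfolding x_def t_def z_def by auto
 \<comment> \<open>The first two indices \<open>n, k\<close> select the vector \<open>x n k\<close>
   and, for longer lists, the subtree below. Taking \<open>k\<close> as annihilation level makes the
   node at \<open>[n]\<close> weakly null.\<close>
 define T where "T \<alpha> = (case \<alpha> of n # k # r => if r = [] then x n k else t n k r | _ => 0)" for \<alpha>
 have "weakly_null_even_tree X T"
  unfolding weakly_null_even_tree_def
 proof (intro conjI ballI allI impI)
  fix \<alpha> assume \<alpha>: "\<alpha> \<in> even_indices"
  then obtain n r0 where n: "\<alpha> = n # r0" by (cases \<alpha>) (auto simp: even_indices_def)
  with \<alpha> obtain k r where "r0 = k # r" by (cases r0) (auto simp: even_indices_def)
  with n have nk: "\<alpha> = n # k # r" by simp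
  have "T \<alpha> \<in> pts X & nrm X (T \<alpha>) = 1"
  proof (cases "r = []")
   case True
   then show ?thesis using x[of n k] by (simp add: T_def nk unit_annihilated_def)
  next
   case False
   then have "r \<in> even_indices" using even_indices_Cons2 \<alpha> nk by blast
   then show ?thesis using t[of n k] False unfolding weakly_null_even_tree_def T_def nk by simp
  qed
  then show "T \<alpha> \<in> pts X" "nrm X (T \<alpha>) = 1" by auto
 next
  fix ns :: "nat list" assume ns: "sorted_wrt (<) ns & odd (length ns)"
  then obtain n r where nr: "ns = n # r" by (cases ns) auto
  show "weakly_null X (\<lambda>j. T (ns @ [last ns + 1 + j]))"
  proof (cases r)
   case Nil
   have "h (x n (n + 1 + j)) = 0" if "h \<in> H j" for j h
    using x[of n "n + 1 + j"] that H_mono[of j "n + 1 + j"] by (auto simp: unit_annihilated_def)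
   then show ?thesis
    using x by (intro weakly_null_annihilated) (auto simp: T_def nr Nil unit_annihilated_def)
  next
   case (Cons k r')
   then have r': "sorted_wrt (<) r' & odd (length r')" "r' ~= []" using ns nr by (auto intro: ccontr)
   then have "weakly_null X (\<lambda>j. t n k (r' @ [last r' + 1 + j]))"
    using t[of n k] unfolding weakly_null_even_tree_def by blast
   then show ?thesis using r'(2) by (simp add: T_def nr Cons)
  qed
 qed
 moreover have "\<exists>l. \<not> dom C (s @ map (\<lambda>i. (b (2 * i), T (map b [0..<2 * i + 2]))) [0..<l])"
  if b: "strict_mono b" "\<forall>p\<in>fst ` set s. p < b 0" for b
 proof -
  define b' where "b' i = b (Suc (Suc i))" for i
  have b': "strict_mono b'" using b(1) by (simp add: b'_def strict_mono_Suc_iff)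
  have "b 0 < b 2" using b(1) by (simp add: strict_mono_less)
  then have "\<forall>p\<in>fst ` set (s @ [(b 0, x (b 0) (b 1))]). p < b' 0" using b(2) by (auto simp: b'_def numeral_2_eq_2)
  with bad[of "b 0" "b 1"] b' b(2)
  obtain l where l: "\<not> dom C ((s @ [(b 0, x (b 0) (b 1))]) @
    map (\<lambda>i. (b' (2 * i), t (b 0) (b 1) (map b' [0..<2 * i + 2]))) [0..<l])"
   unfolding ok_def bad_def by blast
  have up: "map b [0..<Suc (Suc m)] = b 0 # b 1 # map b' [0..<m]" for m
   by (rule nth_equalityI) (auto simp: b'_def nth_Cons simp del: upt_Suc split: nat.split)
  have "map (\<lambda>i. (b (2 * i), T (map b [0..<2 * i + 2]))) [0..<Suc l] =
    (b 0, x (b 0) (b 1)) # map (\<lambda>i. (b' (2 * i), t (b 0) (b 1) (map b' [0..<2 * i + 2]))) [0..<l]"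
  proof (rule nth_equalityI)
   fix i assume "i < length (map (\<lambda>i. (b (2 * i), T (map b [0..<2 * i + 2]))) [0..<Suc l])"
   then have i: "i < Suc l" by simp
   show "map (\<lambda>i. (b (2 * i), T (map b [0..<2 * i + 2]))) [0..<Suc l] ! i =
    ((b 0, x (b 0) (b 1)) # map (\<lambda>i. (b' (2 * i), t (b 0) (b 1) (map b' [0..<2 * i + 2]))) [0..<l]) ! i"
   proof (cases i)
    case 0
    then show ?thesis using up[of 0] by (simp add: T_def numeral_2_eq_2 del: upt_Suc)
   next
    case (Suc i')
    have m: "2 * i + 2 = Suc (Suc (2 * i' + 2))" "b (2 * i) = b' (2 * i')" using Suc by (auto simp: b'_def)
    have "T (map b [0..<2 * i + 2]) = t (b 0) (b 1) (map b' [0..<2 * i' + 2])"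
     unfolding m(1) up by (simp add: T_def)
    then show ?thesis using i Suc m(2) by (simp add: nth_Cons del: upt_Suc)
   qed
  qed simp
  then show ?thesis using l by (intro exI[of _ "Suc l"]) simp
 qed
 ultimately show ?case by blast
qed

lemma not_lost:
 assumes "upper_tree_estimates W v X"
 obtains C where "C >= 1" "\<not> lost C []"
proof -
 obtain C where C: "C >= 1" and est: "!!x. weakly_null_even_tree X x ==> \<exists>n. strict_mono n &
   dominated_by C X (\<lambda>l. x (map n [0..<2 * l + 2])) W (\<lambda>l. v (n (2 * l)))"
  using assms unfolding upper_tree_estimates_def by blast
 have "\<not> lost C []"
 proof
  assume L: "lost C []"
  show False
  proof (cases "\<exists>u. \<forall>m. u m \<in> unit_annihilated m")
   case True
   then obtain u where u: "!!m. u m \<in> unit_annihilated m" by blast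
   obtain t where t: "weakly_null_even_tree X t" and
    bad: "!!b. strict_mono b ==> \<exists>l. \<not> dom C (map (\<lambda>i. (b (2 * i), t (map b [0..<2 * i + 2]))) [0..<l])"
    using lost_imp_bad_tree[OF L u] unfolding list.set image_empty append_Nil by blast
   obtain n where n: "strict_mono n" "dominated_by C X (\<lambda>l. t (map n [0..<2 * l + 2])) W (\<lambda>l. v (n (2 * l)))"
    using est[OF t] by blast
   then show False using bad[OF n(1)] unfolding dom_def dominated_by_def by (simp del: upt_Suc)
  next
   case False
   \<comment> \<open>If some level admits no unit vector, the second player cannot answer it, so the
     starting position is not lost.\<close>
   then obtain m where m: "unit_annihilated m = {}"
    using choice[of "\<lambda>m x. x \<in> unit_annihilated m"] by blast
   have "dom C []" using nrm_zero[OF X] nrm_zero[OF W] by (simp add: dom_def)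
   from L show False
   proof (cases rule: lost.cases)
    case lost_now
    then show False using \<open>dom C []\<close> by simp
   next
    case lost_later
    show False using lost_later[of 0 m] m by simp
   qed
  qed
 qed
 then show ?thesis using that C by blast
qed

text \<open>The strategy is replaced by functions of the level alone. With answers rounded to nets
  there are finitely many positions up to each level, and \<open>N\<close> and \<open>M\<close>
  dominate everything demanded in them. Each rounding error is charged to one coefficient, which the
  norm on the right bounds.\<close>

theorem strategy_domination:
 assumes "upper_tree_estimates W v X"
 obtains C N M where "C >= 1" "strict_mono N" "strict_mono M"
  "!!k p q y a. (!!j. j < k ==> p j <= q j & y j \<in> F (q j) \<inter> unit_annihilated (M (p j))) ==>
   (!!j. Suc j < k ==> q j < p (Suc j)) ==>
   nrm X (\<Sum>j<k. a j *\<^sub>R y j) <= C * nrm W (\<Sum>j<k. a j *\<^sub>R v (N (p j)))"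
proof -
 obtain C where C: "C >= 1" "\<not> lost C []" by (rule not_lost[OF assms])
 obtain R where R: "R >= 1" "!!k p q a. (!!j. Suc j < k ==> p j < p (Suc j) & q j < q (Suc j)) ==>
  (!!j. j < k ==> p j <= q j) ==>
  nrm W (\<Sum>j<k. a j *\<^sub>R v (p j)) <= R * nrm W (\<Sum>j<k. a j *\<^sub>R v (q j))"
  by (rule shift_right) blast
 \<comment> \<open>The contrapositive of \<open>lost_later\<close>: from a position that is not
   lost, some move of the index player leaves no answer leading to a lost one.\<close>
 have "\<exists>n m. \<not> lost C s --> (\<forall>p\<in>fst ` set s. p < n) & (\<forall>x\<in>unit_annihilated m. \<not> lost C (s @ [(n, x)]))" for s
  using lost_later[of s C] by blast
 then obtain \<sigma> \<mu> where strat: "!!s. \<not> lost C s ==> (\<forall>p\<in>fst ` set s. p < \<sigma> s) &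
   (\<forall>x\<in>unit_annihilated (\<mu> s). \<not> lost C (s @ [(\<sigma> s, x)]))" by metis
 have "\<exists>D. finite D & D \<subseteq> F q \<inter> unit_annihilated m &
   (\<forall>a\<in>F q \<inter> unit_annihilated m. \<exists>d\<in>D. nrm X (a - d) <= (1/2) ^ q)" for q m
 proof -
  obtain B where B: "finite B" "B \<subseteq> pts X" "F q = span B" using F_span by blast
  show ?thesis
   by (rule findim_net[OF X B(1,2), where R = 1]) (auto simp: unit_annihilated_def B(3))
 qed
 then obtain net where net: "!!q m. finite (net q m)" "!!q m. net q m \<subseteq> F q \<inter> unit_annihilated m"
  "!!q m a. a \<in> F q \<inter> unit_annihilated m ==> \<exists>d\<in>net q m. nrm X (a - d) <= (1/2) ^ q" by metis
 \<comment> \<open>\<open>P q\<close> collects the positions whose answers are net points from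
   levels below \<open>q\<close>, at most one from each level.\<close>
 define P where "P = rec_nat {[]} (\<lambda>q A. A \<union> (\<Union>s\<in>A. (\<lambda>x. s @ [(\<sigma> s, x)]) ` net q (\<mu> s)))"
 have P0: "P 0 = {[]}" and PS: "P (Suc q) = P q \<union> (\<Union>s\<in>P q. (\<lambda>x. s @ [(\<sigma> s, x)]) ` net q (\<mu> s))" for q
  by (simp_all add: P_def)
 have Pm: "P i \<subseteq> P j" if "i <= j" for i j by (rule lift_Suc_mono_le[OF _ that]) (use PS in auto)
 have fin: "finite (P q)" for q by (induction q) (auto simp: P0 PS net(1))
 have good: "\<not> lost C s & sorted_wrt (<) (map fst s)" if "s \<in> P q" for s q
  using that
 proof (induction q arbitrary: s)
  case 0
  then show ?case using C by (simp add: P0)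
 next
  case (Suc q)
  show ?case
  proof (cases "s \<in> P q")
   case False
   then obtain s' x where s': "s' \<in> P q" "x \<in> net q (\<mu> s')" "s = s' @ [(\<sigma> s', x)]"
    using Suc.prems by (auto simp: PS)
   have g: "\<not> lost C s'" "sorted_wrt (<) (map fst s')" using Suc.IH[OF s'(1)] by auto
   have "x \<in> unit_annihilated (\<mu> s')" using net(2) s'(2) by blast
   then show ?thesis using strat[OF g(1)] g(2) by (auto simp: s'(3) sorted_wrt_append)
  qed (use Suc.IH in blast)
 qed
 define N where "N p = p + (\<Sum>q\<le>p. \<Sum>s\<in>P q. \<sigma> s)" for p
 define M where "M p = p + (\<Sum>q\<le>p. \<Sum>s\<in>P q. \<mu> s)" for p
 have ge: "g s <= (\<Sum>q\<le>p. \<Sum>s\<in>P q. g s)" if "s \<in> P p" for g :: "_ => nat" and s p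
 proof -
  have "g s <= (\<Sum>s\<in>P p. g s)" using that fin by (intro member_le_sum) auto
  also have "\<dots> <= (\<Sum>q\<le>p. \<Sum>s\<in>P q. g s)" by (rule member_le_sum) auto
  finally show ?thesis .
 qed
 have \<sigma>N: "\<sigma> s <= N p" and \<mu>M: "\<mu> s <= M p" if "s \<in> P p" for s p
  using ge[OF that, of \<sigma>] ge[OF that, of \<mu>] by (auto simp: N_def M_def)
 have mono: "strict_mono N" "strict_mono M" by (auto simp: strict_mono_Suc_iff N_def M_def)
 \<comment> \<open>\<open>R\<close> pays for replacing the indices of the strategy by the larger
   \<open>N (p j)\<close>, and 2 is the sum of the geometric rounding errors.\<close>
 show ?thesis
 proof (rule that[of "C * R + 2" N M])
  have "0 <= C * R" using C(1) R(1) by simp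
  then show "1 <= C * R + 2" by simp
  fix k :: nat and p q :: "nat => nat" and y a
  assume y: "!!j. j < k ==> p j <= q j & y j \<in> F (q j) \<inter> unit_annihilated (M (p j))"
   and pq: "!!j. Suc j < k ==> q j < p (Suc j)"
  have qj: "j <= q j" if "j < k" for j
   using that
  proof (induction j)
   case (Suc j)
   then show ?case using pq[of j] y[of "Suc j"] by simp
  qed simp
  \<comment> \<open>The play in which the rounded \<open>y j\<close> are the answers. After
    \<open>y j\<close> the position belongs to \<open>P (Suc (q j))\<close>, and
    \<open>q j < p (Suc j)\<close> puts it among those that \<open>N\<close> and \<open>M\<close>
    take into account at the next block.\<close>
  have "\<exists>s. s \<in> P (if j = 0 then 0 else Suc (q (j - 1))) & length s = j &
    (\<forall>i<j. snd (s ! i) \<in> pts X & nrm X (y i - snd (s ! i)) <= (1/2) ^ q i & fst (s ! i) <= N (p i))"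
   if "j <= k" for j
   using that
  proof (induction j)
   case 0
   then show ?case by (simp add: P0)
  next
   case (Suc j)
   then obtain s where s: "s \<in> P (if j = 0 then 0 else Suc (q (j - 1)))" "length s = j"
    "\<forall>i<j. snd (s ! i) \<in> pts X & nrm X (y i - snd (s ! i)) <= (1/2) ^ q i & fst (s ! i) <= N (p i)" by auto
   have j: "j < k" using Suc.prems by simp
   have "(if j = 0 then 0 else Suc (q (j - 1))) <= p j" using pq[of "j - 1"] j by auto
   then have sp: "s \<in> P (p j)" using s(1) Pm by blast
   then have sq: "s \<in> P (q j)" using Pm y[OF j] by blast
   have "y j \<in> F (q j) \<inter> unit_annihilated (\<mu> s)"
    using y[OF j] unit_annihilated_mono[OF \<mu>M[OF sp]] by blast
   then obtain d where d: "d \<in> net (q j) (\<mu> s)" "nrm X (y j - d) <= (1/2) ^ q j" using net(3) by blast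
   have dp: "d \<in> pts X" using d(1) net(2) by (auto simp: unit_annihilated_def)
   have "s @ [(\<sigma> s, d)] \<in> P (Suc (q j))" using sq d(1) by (auto simp: PS)
   moreover have "\<forall>i<Suc j. snd ((s @ [(\<sigma> s, d)]) ! i) \<in> pts X &
     nrm X (y i - snd ((s @ [(\<sigma> s, d)]) ! i)) <= (1/2) ^ q i & fst ((s @ [(\<sigma> s, d)]) ! i) <= N (p i)"
    using s(2,3) d(2) dp \<sigma>N[OF sp] by (auto simp: nth_append less_Suc_eq)
   ultimately show ?case using s(2) by (intro exI[of _ "s @ [(\<sigma> s, d)]"]) simp
  qed
  from this[OF order_refl] obtain s l where s: "s \<in> P l" "length s = k"
   and near: "!!i. i < k ==> snd (s ! i) \<in> pts X & nrm X (y i - snd (s ! i)) <= (1/2) ^ q i & fst (s ! i) <= N (p i)"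
   by blast
  define V where "V = nrm W (\<Sum>j<k. a j *\<^sub>R v (N (p j)))"
  have yp: "y j \<in> pts X" if "j < k" for j using y[OF that] F_pts by blast
  have pinc: "p j < p (Suc j)" if "Suc j < k" for j using pq[OF that] y[of j] that by simp
  have Ninc: "N (p j) < N (p (Suc j))" if "Suc j < k" for j
   using pinc[OF that] mono(1) by (simp add: strict_mono_less)
  have "inj_on (\<lambda>j. N (p j)) {..<k}"
  proof (rule strict_mono_on_imp_inj_on)
   have "p i < p j" if "i < j" "j < k" for i j
    using that
   proof (induction j)
    case (Suc j)
    then show ?case using pinc[of j] by (cases "i = j") (auto intro: less_trans)
   qed simp
   then show "strict_mono_on {..<k} (\<lambda>j. N (p j))" using mono(1) by (auto intro!: strict_mono_onI simp: strict_mono_less)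
  qed
  then have aV: "\<bar>a j\<bar> <= V" if "j < k" for j unfolding V_def by (intro coeff_le) (use that in auto)
  have "dom C s" using good[OF s(1)] lost_now by blast
  then have "nrm X (\<Sum>i<k. a i *\<^sub>R snd (s ! i)) <= C * nrm W (\<Sum>i<k. a i *\<^sub>R v (fst (s ! i)))"
   unfolding dom_def s(2) by blast
  also have "\<dots> <= C * (R * V)"
   unfolding V_def
  proof (intro mult_left_mono R(2))
   fix j assume "Suc j < k"
   moreover have "sorted_wrt (<) (map fst s)" using good[OF s(1)] by blast
   ultimately show "fst (s ! j) < fst (s ! Suc j) & N (p j) < N (p (Suc j))"
    using Ninc s(2) sorted_wrt_nth_less[of "(<)" "map fst s" j "Suc j"] by simp
  qed (use near C(1) in auto)
  finally have 1: "nrm X (\<Sum>i<k. a i *\<^sub>R snd (s ! i)) <= C * R * V" by (simp add: mult_ac)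
  have "nrm X (\<Sum>i<k. a i *\<^sub>R (y i - snd (s ! i))) <= (\<Sum>i<k. nrm X (a i *\<^sub>R (y i - snd (s ! i))))"
   using near yp by (intro nrm_sum[OF X] pts_scale[OF X] pts_diff[OF X]) auto
  also have "\<dots> <= (\<Sum>i<k. V * (1/2) ^ i)"
  proof (rule sum_mono)
   fix i assume "i \<in> {..<k}"
   then have i: "i < k" by simp
   have p: "y i - snd (s ! i) \<in> pts X" using near[OF i] yp[OF i] by (intro pts_diff[OF X]) auto
   have "(1/2::real) ^ q i <= (1/2) ^ i" using qj[OF i] by (intro power_decreasing) auto
   then have "nrm X (y i - snd (s ! i)) <= (1/2) ^ i" using near[OF i] by linarith
   then show "nrm X (a i *\<^sub>R (y i - snd (s ! i))) <= V * (1/2) ^ i"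
    unfolding nrm_scale[OF X p] using aV[OF i] nrm_nonneg[OF X p] by (intro mult_mono) auto
  qed
  also have "\<dots> = V * (\<Sum>i\<in>{0..<k}. (1/2) ^ i)" by (simp add: sum_distrib_left lessThan_atLeast0)
  also have "\<dots> <= V * 2"
   using geometric_partial_sum[of 0 k] nrm_nonneg[OF W sum_pts] by (intro mult_left_mono) (auto simp: V_def)
  finally have 2: "nrm X (\<Sum>i<k. a i *\<^sub>R (y i - snd (s ! i))) <= 2 * V" by simp
  have "(\<Sum>i<k. a i *\<^sub>R y i) = (\<Sum>i<k. a i *\<^sub>R snd (s ! i)) + (\<Sum>i<k. a i *\<^sub>R (y i - snd (s ! i)))"
   by (simp add: sum.distrib[symmetric] algebra_simps)
  moreover have "nrm X \<dots> <= nrm X (\<Sum>i<k. a i *\<^sub>R snd (s ! i)) + nrm X (\<Sum>i<k. a i *\<^sub>R (y i - snd (s ! i)))"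
   using near yp by (intro nrm_add[OF X] pts_sum[OF X] pts_scale[OF X] pts_diff[OF X]) auto
  ultimately show "nrm X (\<Sum>j<k. a j *\<^sub>R y j) <= (C * R + 2) * nrm W (\<Sum>j<k. a j *\<^sub>R v (N (p j)))"
   using 1 2 by (simp add: V_def algebra_simps)
 qed (use mono in auto)
qed

end

text \<open>Reindexing is stated for two types because sums in \<open>X\<close> and in the space of
  \<open>v\<close> are rewritten with the same enumeration.\<close>

lemma finite_increasing_enumeration:
 fixes J :: "nat set"
 assumes "finite J"
 obtains r where "!!i j. i < j ==> j < card J ==> r i < r j" "!!i. i < card J ==> r i \<in> J"
  "!!f :: nat => 'a::comm_monoid_add. (\<Sum>j\<in>J. f j) = (\<Sum>i<card J. f (r i))"
  "!!f :: nat => 'b::comm_monoid_add. (\<Sum>j\<in>J. f j) = (\<Sum>i<card J. f (r i))"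
proof -
 define r where "r i = sorted_list_of_set J ! i" for i
 have inc: "r i < r j" if "i < j" "j < card J" for i j
  unfolding r_def using that by (intro sorted_wrt_nth_less[of "(<)"]) auto
 have mem: "r i \<in> J" if "i < card J" for i
  unfolding r_def using nth_mem[of i "sorted_list_of_set J"] that assms by simp
 have "inj_on r {..<card J}" by (rule linorder_inj_onI') (use inc in force)
 moreover have "r ` {..<card J} \<subseteq> J" using mem by auto
 moreover have "card (r ` {..<card J}) = card J" using card_image[OF calculation(1)] by simp
 ultimately have bij: "bij_betw r {..<card J} J"
  using card_subset_eq[OF assms] unfolding bij_betw_def by blast
 show ?thesis
  by (rule that[of r, OF inc mem]) (auto simp: sum.reindex_bij_betw[OF bij, symmetric])
qed

context vseq
begin

lemma exchange_set:
 obtains C where "C >= 1" "!!J p q (a :: nat => real). finite J ==>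
  (!!i j. i \<in> J ==> j \<in> J ==> i < j ==> max (p i) (q i) < min (p j) (q j)) ==>
  nrm W (\<Sum>j\<in>J. a j *\<^sub>R v (p j)) <= C * nrm W (\<Sum>j\<in>J. a j *\<^sub>R v (q j))"
proof -
 obtain C where C: "C >= 1" and ex: "!!k p q (a :: nat => real). (!!j. Suc j < k ==> max (p j) (q j) < min (p (Suc j)) (q (Suc j))) ==>
  nrm W (\<Sum>j<k. a j *\<^sub>R v (p j)) <= C * nrm W (\<Sum>j<k. a j *\<^sub>R v (q j))"
  by (rule exchange) blast
 show ?thesis
 proof (rule that[OF C])
  fix J :: "nat set" and p q :: "nat => nat" and a :: "nat => real"
  assume J: "finite J" and w: "!!i j. i \<in> J ==> j \<in> J ==> i < j ==> max (p i) (q i) < min (p j) (q j)"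
  obtain r where r: "!!i j. i < j ==> j < card J ==> r i < r j" "!!i. i < card J ==> r i \<in> J"
   and eq: "!!f :: nat => 'v. (\<Sum>j\<in>J. f j) = (\<Sum>i<card J. f (r i))"
   by (rule finite_increasing_enumeration[OF J]) blast
  show "nrm W (\<Sum>j\<in>J. a j *\<^sub>R v (p j)) <= C * nrm W (\<Sum>j\<in>J. a j *\<^sub>R v (q j))"
   unfolding eq by (rule ex[of "card J" "\<lambda>i. p (r i)" "\<lambda>i. q (r i)" "\<lambda>i. a (r i)"]) (use r w in auto)
 qed
qed

end

section \<open>Thinning the skeleton: upper estimates with free comparison indices\<close>

context game
begin

text \<open>The comparison indices \<open>e\<close> are free up to interlacing with
  \<open>N (p j)\<close>, so that each construction can insert its own positions. Norms at most 1
  admit zero vectors, and \<open>1 <= p j\<close> leaves room for a preceding level.\<close>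

definition good_estimate :: "real => (nat => nat) => (nat => 'x set) => (nat => ('x => real) set) => bool"
 where "good_estimate C N F' H' \<longleftrightarrow> (\<forall>(J :: nat set) p q y (e :: nat => nat) a. finite J &
  (\<forall>j\<in>J. 1 <= p j & p j <= q j & y j \<in> F' (q j) & (\<forall>h\<in>H' (p j). h (y j) = 0) & nrm X (y j) <= 1) &
  (\<forall>i\<in>J. \<forall>j\<in>J. i < j --> q i < p j & max (N (p i)) (e i) < min (N (p j)) (e j)) -->
  nrm X (\<Sum>j\<in>J. a j *\<^sub>R y j) <= C * nrm W (\<Sum>j\<in>J. a j *\<^sub>R v (e j)))"

lemma thinning:
 assumes "upper_tree_estimates W v X"
 obtains C N t where "C >= 1" "strict_mono N" "strict_mono t" "t 0 = 0"
  "good_estimate C N (\<lambda>i. F (t i)) (\<lambda>i. H (t i))"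
proof -
 obtain C N M where C: "C >= 1" and N: "strict_mono N" and M: "strict_mono M" and
  est: "!!k p q y a. (!!j. j < k ==> p j <= q j & y j \<in> F (q j) \<inter> unit_annihilated (M (p j))) ==>
   (!!j. Suc j < k ==> q j < p (Suc j)) ==>
   nrm X (\<Sum>j<k. a j *\<^sub>R y j) <= C * nrm W (\<Sum>j<k. a j *\<^sub>R v (N (p j)))"
  using strategy_domination[OF assms] by blast
 obtain R where R: "R >= 1" and ex: "!!J p q (a :: nat => real). finite J ==>
  (!!i j. i \<in> J ==> j \<in> J ==> i < j ==> max (p i) (q i) < min (p j) (q j)) ==>
  nrm W (\<Sum>j\<in>J. a j *\<^sub>R v (p j)) <= R * nrm W (\<Sum>j\<in>J. a j *\<^sub>R v (q j))"
  by (rule exchange_set) blast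
 \<comment> \<open>\<open>t p\<close> is at least \<open>M (t (p - 1) + 1)\<close>, so annihilation
   by \<open>H (t p)\<close> implies the annihilation that the strategy asks for when a block starts
   at level \<open>t (p - 1) + 1\<close>.\<close>
 define t where "t = rec_nat 0 (\<lambda>i s. s + 1 + M (s + 1))"
 have t0: "t 0 = 0" and tS: "t (Suc i) = t i + 1 + M (t i + 1)" for i by (simp_all add: t_def)
 have t: "strict_mono t" by (simp add: strict_mono_Suc_iff tS)
 \<comment> \<open>A block start \<open>p\<close> is read by the strategy as level
   \<open>t (p - 1) + 1\<close>; at 0 the default \<open>N 0\<close> keeps \<open>N'\<close>
   strictly increasing.\<close>
 define N' where "N' p = (if p = 0 then N 0 else N (t (p - 1) + 1))" for p
 have N': "strict_mono N'"
  using N t0 tS by (auto simp: strict_mono_Suc_iff[of N'] N'_def strict_mono_less gr0_conv_Suc)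
 have "good_estimate (C * R) N' (\<lambda>i. F (t i)) (\<lambda>i. H (t i))"
  unfolding good_estimate_def
 proof (intro allI impI, elim conjE)
  fix J :: "nat set" and p q y and e :: "nat => nat" and a :: "nat => real"
  assume J: "finite J" and y: "\<forall>j\<in>J. 1 <= p j & p j <= q j & y j \<in> F (t (q j)) & (\<forall>h\<in>H (t (p j)). h (y j) = 0) & nrm X (y j) <= 1"
   and pq: "\<forall>i\<in>J. \<forall>j\<in>J. i < j --> q i < p j & max (N' (p i)) (e i) < min (N' (p j)) (e j)"
  \<comment> \<open>Zero vectors are dropped and the others normalized, their norms moving into the
    coefficients \<open>b\<close>; monotonicity in the coefficients restores \<open>a\<close> at the
    end.\<close>
  define I where "I = {j \<in> J. y j ~= 0}"
  have I: "finite I" "I \<subseteq> J" using J by (auto simp: I_def)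
  have yp: "y j \<in> pts X" if "j \<in> J" for j using y that F_pts by blast
  obtain r where r: "!!i j. i < j ==> j < card I ==> r i < r j" "!!i. i < card I ==> r i \<in> I"
   and eqX: "!!f :: nat => 'x. (\<Sum>j\<in>I. f j) = (\<Sum>i<card I. f (r i))"
   and eqV: "!!f :: nat => 'v. (\<Sum>j\<in>I. f j) = (\<Sum>i<card I. f (r i))"
   by (rule finite_increasing_enumeration[OF I(1)]) blast
  define b where "b j = a j * nrm X (y j)" for j
  define u where "u j = (1 / nrm X (y j)) *\<^sub>R y j" for j
  have by': "b j *\<^sub>R u j = a j *\<^sub>R y j" if "j \<in> I" for j
   using that nrm_pos[OF X yp, of j] I(2) by (auto simp: b_def u_def I_def)
  have u: "t (p j - 1) + 1 <= t (q j) & u j \<in> F (t (q j)) \<inter> unit_annihilated (M (t (p j - 1) + 1))" if j: "j \<in> I" for j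
  proof -
   have jJ: "j \<in> J" and pj: "1 <= p j" "p j <= q j" using j I y by auto
   have tp: "t (p j) = t (p j - 1) + 1 + M (t (p j - 1) + 1)" using tS[of "p j - 1"] pj by simp
   have "t (p j) <= t (q j)" using t pj(2) by (simp add: strict_mono_less_eq)
   moreover have "nrm X (y j) > 0" using nrm_pos[OF X yp[OF jJ]] j by (auto simp: I_def)
   then have "nrm X (u j) = 1" by (simp add: u_def nrm_scale[OF X yp[OF jJ]])
   moreover have "h (u j) = 0" if h: "h \<in> H (M (t (p j - 1) + 1))" for h
   proof -
    have "h \<in> H (t (p j))" using h H_mono[of "M (t (p j - 1) + 1)" "t (p j)"] tp by auto
    then show ?thesis using y jJ dual_scale[OF H_pts[OF h] yp[OF jJ]] by (simp add: u_def)
   qed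
   moreover have "u j \<in> F (t (q j))" using y jJ by (auto simp: u_def intro: subspace_scale[OF F_sub])
   ultimately show ?thesis using tp F_pts by (auto simp: unit_annihilated_def)
  qed
  have "(\<Sum>j\<in>J. a j *\<^sub>R y j) = (\<Sum>j\<in>I. b j *\<^sub>R u j)"
   using J by' by (intro sum.mono_neutral_cong_right) (auto simp: I_def)
  also have "nrm X \<dots> <= C * nrm W (\<Sum>j\<in>I. b j *\<^sub>R v (N' (p j)))"
  proof -
   have "nrm X (\<Sum>i<card I. b (r i) *\<^sub>R u (r i)) <= C * nrm W (\<Sum>i<card I. b (r i) *\<^sub>R v (N (t (p (r i) - 1) + 1)))"
   proof (rule est[of "card I" "\<lambda>i. t (p (r i) - 1) + 1" "\<lambda>i. t (q (r i))" "\<lambda>i. u (r i)" "\<lambda>i. b (r i)"])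
    fix j assume j: "Suc j < card I"
    then have "q (r j) < p (r (Suc j))" using pq r I(2) by (meson Suc_lessD lessI subsetD)
    then have "t (q (r j)) <= t (p (r (Suc j)) - 1)" using t by (simp add: strict_mono_less_eq)
    then show "t (q (r j)) < t (p (r (Suc j)) - 1) + 1" by simp
   qed (use u r in blast)
   moreover have "N (t (p (r i) - 1) + 1) = N' (p (r i))" if "i < card I" for i
   proof -
    have "1 <= p (r i)" using y r(2)[OF that] I(2) by blast
    then show ?thesis by (simp add: N'_def)
   qed
   ultimately show ?thesis unfolding eqX eqV by simp
  qed
  also have "\<dots> <= C * (R * nrm W (\<Sum>j\<in>I. b j *\<^sub>R v (e j)))"
   using C pq I by (intro mult_left_mono ex) auto
  also have "\<dots> <= C * (R * nrm W (\<Sum>j\<in>J. a j *\<^sub>R v (e j)))"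
  proof (intro mult_left_mono coeff_mono[OF J I(2)])
   show "inj_on e J" using pq by (intro linorder_inj_onI') force
   fix j assume "j \<in> I"
   then have j: "j \<in> J" using I by blast
   then have "\<bar>a j\<bar> * nrm X (y j) <= \<bar>a j\<bar> * 1" using y by (intro mult_left_mono) auto
   then show "\<bar>b j\<bar> <= \<bar>a j\<bar>" using nrm_nonneg[OF X yp[OF j]] by (simp add: b_def abs_mult)
  qed (use C R in auto)
  finally show "nrm X (\<Sum>j\<in>J. a j *\<^sub>R y j) <= C * R * nrm W (\<Sum>j\<in>J. a j *\<^sub>R v (e j))" by (simp add: mult_ac)
 qed
 moreover have "1 <= C * R" using mult_mono[of 1 C 1 R] C R by simp
 ultimately show ?thesis using that N' t t0 by blast
qed

text \<open>Splitting by parity leaves room between consecutive vectors; the first vector of each class is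
 estimated by its coefficient alone.\<close>

lemma upper_estimate_overlapping:
 fixes k :: nat
 assumes G: "good_estimate C N F H" and C: "C >= 1" and N: "strict_mono N"
  and y: "!!j. j < k ==> p j <= q j & y j \<in> F (q j) & (\<forall>h\<in>H (p j). h (y j) = 0) & nrm X (y j) <= 1"
  and pq: "!!i j. j < k ==> i + 2 <= j ==> q i < p j & max (N (p i)) (e i) < min (N (p j)) (e j)"
  and e: "inj_on e {..<k}"
 shows "nrm X (\<Sum>j<k. a j *\<^sub>R y j) <= (2 * C + 2) * nrm W (\<Sum>j<k. a j *\<^sub>R v (e j))"
proof -
 define V where "V = nrm W (\<Sum>j<k. a j *\<^sub>R v (e j))"
 have V0: "V >= 0" unfolding V_def by (rule nrm_nonneg[OF W sum_pts])
 have yp: "y j \<in> pts X" if "j < k" for j using y[OF that] F_pts by blast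
 have P: "(\<Sum>j\<in>J. a j *\<^sub>R y j) \<in> pts X" if "J \<subseteq> {..<k}" for J
  using that yp by (intro pts_sum[OF X] pts_scale[OF X]) auto
 have tail: "nrm X (\<Sum>j\<in>J. a j *\<^sub>R y j) <= C * V" if J: "J \<subseteq> {..<k}" and J2: "!!j. j \<in> J ==> 2 <= j"
  and sep: "!!i j. i \<in> J ==> j \<in> J ==> i < j ==> i + 2 <= j" for J
 proof -
  have fin: "finite J" using J by (rule finite_subset) simp
  \<comment> \<open>From index 2 on, a block starts beyond the end of block 0, so its start is
    positive.\<close>
  have "1 <= p j" if "j \<in> J" for j
   using pq[of j 0] J2[OF that] that J by auto
  then have "nrm X (\<Sum>j\<in>J. a j *\<^sub>R y j) <= C * nrm W (\<Sum>j\<in>J. a j *\<^sub>R v (e j))"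
   using y pq sep J fin
   by (intro G[unfolded good_estimate_def, rule_format, of J p q y e a]) (auto simp: subset_iff)
  also have "\<dots> <= C * V"
   unfolding V_def using C J e by (intro mult_left_mono coeff_mono) auto
  finally show ?thesis .
 qed
 have single: "nrm X (\<Sum>j\<in>J. a j *\<^sub>R y j) <= V" if J: "J \<subseteq> {i}" "J \<subseteq> {..<k}" for J i
 proof (cases "J = {}")
  case True
  then show ?thesis using V0 nrm_zero[OF X] by simp
 next
  case False
  then have "J = {i}" "i < k" using J by auto
  then have "nrm X (\<Sum>j\<in>J. a j *\<^sub>R y j) = \<bar>a i\<bar> * nrm X (y i)" by (simp add: nrm_scale[OF X yp])
  also have "\<dots> <= \<bar>a i\<bar> * 1" using y[OF \<open>i < k\<close>] by (intro mult_left_mono) auto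
  also have "\<dots> <= V" unfolding V_def using coeff_le[OF _ e, of i a] \<open>i < k\<close> by simp
  finally show ?thesis .
 qed
 define A where "A i = {..<k} \<inter> {i}" for i :: nat
 define B where "B i = {j \<in> {..<k}. 2 <= j & j mod 2 = i}" for i
 have part: "{..<k} = A 0 \<union> (A 1 \<union> (B 0 \<union> B 1))"
 proof (intro equalityI subsetI)
  fix j assume "j \<in> {..<k}"
  moreover have "j = 0 \<or> j = 1 \<or> 2 <= j & (j mod 2 = 0 \<or> j mod 2 = 1)" by presburger
  ultimately show "j \<in> A 0 \<union> (A 1 \<union> (B 0 \<union> B 1))" by (auto simp: A_def B_def)
 qed (auto simp: A_def B_def)
 have gap: "i + 2 <= j" if "i \<in> B r" "j \<in> B r" "i < j" for i j r
  using that unfolding B_def by (simp, presburger)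
 have fin: "finite (A i)" "finite (B i)" for i by (auto simp: A_def B_def)
 have sub: "A i \<subseteq> {..<k}" "B i \<subseteq> {..<k}" for i by (auto simp: A_def B_def)
 let ?s = "\<lambda>J. \<Sum>j\<in>J. a j *\<^sub>R y j"
 have "?s {..<k} = ?s (A 0) + (?s (A 1) + (?s (B 0) + ?s (B 1)))"
  unfolding part using fin by (subst sum.union_disjoint; auto simp: A_def B_def)+
 also have "nrm X \<dots> <= nrm X (?s (A 0)) + (nrm X (?s (A 1)) + (nrm X (?s (B 0)) + nrm X (?s (B 1))))"
  using nrm_add[OF X P[OF sub(1)] pts_add[OF X P[OF sub(1)] pts_add[OF X P[OF sub(2)] P[OF sub(2)]]]]
   nrm_add[OF X P[OF sub(1)] pts_add[OF X P[OF sub(2)] P[OF sub(2)]]] nrm_add[OF X P[OF sub(2)] P[OF sub(2)]]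
  by (smt (verit))
 also have "\<dots> <= V + (V + (C * V + C * V))"
  using sub gap by (intro add_mono single[of _ 0] single[of _ 1] tail) (auto simp: A_def B_def)
 finally show ?thesis by (simp add: V_def algebra_simps)
qed

end

section \<open>Completions inside a given type\<close>

lemma closed_span_iff:
 assumes "normed_space W" "A \<subseteq> pts W"
 shows "x \<in> closed_span W A \<longleftrightarrow> x \<in> pts W & (\<forall>e>0. \<exists>a\<in>span A. nrm W (x - a) < e)"
 unfolding closed_span_def by (rule in_closure_ntop[OF assms(1) span_subset_pts[OF assms]])

lemma separable_if_countable_span_dense:
 assumes Z: "normed_space Z" and A: "countable A" "A \<subseteq> pts Z"
  and dense: "!!z e. z \<in> pts Z ==> e > 0 ==> \<exists>a\<in>span A. nrm Z (z - a) < e"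
 shows "separable_space (ntop Z)"
proof -
 define val where "val l = (\<Sum>p\<leftarrow>l. of_rat (fst p) *\<^sub>R snd p)" for l :: "(rat \<times> 'a) list"
 define Q where "Q = val ` lists (UNIV \<times> A)"
 have "countable (lists ((UNIV :: rat set) \<times> A))" using A(1) by (intro countable_lists countable_SIGMA) auto
 then have cQ: "countable Q" by (simp add: Q_def)
 have vp: "val l \<in> pts Z" if "l \<in> lists (UNIV \<times> A)" for l
  using that A(2) by (induction l) (auto simp: val_def pts_zero[OF Z] intro!: pts_add[OF Z] pts_scale[OF Z])
 have appr: "x \<in> pts Z & (\<forall>e>0. \<exists>q\<in>Q. nrm Z (x - q) < e)" if "x \<in> span A" for x
  using that
 proof (induction rule: span_induct_alt)
  case base
  have "val [] \<in> Q" by (simp add: Q_def)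
  then show ?case using nrm_zero[OF Z] pts_zero[OF Z] by (force simp: val_def)
 next
  case (step c a y)
  have a: "a \<in> pts Z" and y: "y \<in> pts Z" using step A by auto
  show ?case
  proof (intro conjI allI impI pts_add[OF Z] pts_scale[OF Z] a y)
   fix e :: real assume "e > 0"
   then have "\<exists>q\<in>Q. nrm Z (y - q) < e / 2" using step(2)[THEN conjunct2, rule_format, of "e/2"] by simp
   then obtain l where l: "l \<in> lists (UNIV \<times> A)" "nrm Z (y - val l) < e / 2"
    unfolding Q_def by blast
   define d where "d = e / (2 * (nrm Z a + 1))"
   have na: "nrm Z a >= 0" by (rule nrm_nonneg[OF Z a])
   then have "d > 0" using \<open>e > 0\<close> by (simp add: d_def)
   then obtain r where r: "c < of_rat r" "of_rat r < c + d" using of_rat_dense[of c "c + d"] by auto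
   have eq: "c *\<^sub>R a + y - val ((r, a) # l) = (c - of_rat r) *\<^sub>R a + (y - val l)"
    by (simp add: val_def algebra_simps)
   have "\<bar>c - of_rat r\<bar> * nrm Z a <= d * nrm Z a" using r na by (intro mult_right_mono) auto
   also have "\<dots> <= e / 2" using na \<open>e > 0\<close> by (simp add: d_def field_simps)
   finally have "nrm Z (c *\<^sub>R a + y - val ((r, a) # l)) < e"
    unfolding eq using nrm_add[OF Z pts_scale[OF Z a] pts_diff[OF Z y vp[OF l(1)]], of "c - of_rat r"] l(2)
    by (simp add: nrm_scale[OF Z a])
   moreover have "val ((r, a) # l) \<in> Q" unfolding Q_def using l(1) step(1) by (intro imageI) auto
   ultimately show "\<exists>q\<in>Q. nrm Z (c *\<^sub>R a + y - q) < e" by blast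
  qed
 qed
 have "\<exists>q\<in>Q. nrm Z (z - q) < e" if ze: "z \<in> pts Z" "e > 0" for z e
 proof -
  obtain a where a: "a \<in> span A" "nrm Z (z - a) < e / 2" using dense[OF ze(1) half_gt_zero[OF ze(2)]] by blast
  then obtain q where q: "q \<in> Q" "nrm Z (a - q) < e / 2" using appr half_gt_zero[OF ze(2)] by blast
  have "nrm Z (z - q) <= nrm Z (z - a) + nrm Z (a - q)"
   using a q vp span_subset_pts[OF Z A(2)] ze(1) by (intro nrm_triangle[OF Z]) (auto simp: Q_def)
  then show ?thesis using a q by force
 qed
 moreover have "Q \<subseteq> pts Z" using vp by (auto simp: Q_def)
 ultimately show ?thesis using cQ separable_iff[OF Z] by blast
qed

text \<open>A point is determined by a sequence from a countable dense set converging to it, and the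
  graph of that sequence is coded as a set of natural numbers.\<close>

lemma separable_lepoll_reals:
 assumes Z: "normed_space Z" and sep: "separable_space (ntop Z)"
 shows "pts Z \<lesssim> (UNIV :: real set)"
proof -
 obtain D where D: "countable D" "D \<subseteq> pts Z" "\<forall>z\<in>pts Z. \<forall>e>0. \<exists>d\<in>D. nrm Z (z - d) < e"
  using sep separable_iff[OF Z] by blast
 have "\<exists>s. (\<forall>n. s n \<in> D) & nconv Z s z" if z: "z \<in> pts Z" for z
  using closure_seq[OF Z D(2) z] D(3) z by metis
 then obtain s where s: "!!z n. z \<in> pts Z ==> s z n \<in> D" "!!z. z \<in> pts Z ==> nconv Z (s z) z" by metis
 define c where "c z = (\<lambda>n. prod_encode (n, to_nat_on D (s z n))) ` UNIV" for z
 have "inj_on c (pts Z)"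
 proof (rule inj_onI)
  fix x y assume xy: "x \<in> pts Z" "y \<in> pts Z" "c x = c y"
  have "s x n = s y n" for n
  proof -
   have "prod_encode (n, to_nat_on D (s x n)) \<in> c y" using xy(3) by (auto simp: c_def)
   then have "to_nat_on D (s x n) = to_nat_on D (s y n)" by (auto simp: c_def inj_eq[OF inj_prod_encode])
   then show ?thesis using to_nat_on_inj[OF D(1)] s(1) xy by blast
  qed
  then have "s x = s y" by auto
  then have "nconv Z (s x) y" using s(2)[OF xy(2)] by simp
  then show "x = y" using nconv_unique[OF Z, of "s x" x y] s(1,2)[OF xy(1)] D(2) by blast
 qed
 then have "pts Z \<lesssim> (UNIV :: nat set set)" unfolding lepoll_def by blast
 then show ?thesis using lepoll_trans nat_sets_eqpoll_reals eqpoll_imp_lepoll by blast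
qed

text \<open>Separability bounds the size of a Hamel basis by the continuum, so it injects into the
  independent set of the target type. The linear extension is injective, and the norm is transported
  along it.\<close>

lemma isometric_copy:
 fixes Z :: "'a::real_vector nspace"
 assumes c: "continuum_dimensional TYPE('z::real_vector)" and B: "banach_space Z"
  and sep: "separable_space (ntop Z)"
 obtains Z' :: "'z::real_vector nspace" and T where "banach_space Z'" "bounded_operator Z Z' T" "T ` pts Z = pts Z'"
  "!!x. x \<in> pts Z ==> nrm Z' (T x) = nrm Z x"
proof -
 note Z = banach_normed[OF B]
 obtain C :: "'z set" where C: "independent C" "(UNIV :: real set) \<lesssim> C"
  using c unfolding continuum_dimensional_def by blast
 obtain A where A: "A \<subseteq> pts Z" "independent A" "pts Z \<subseteq> span A" by (rule maximal_independent_subset)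
 have "A \<lesssim> C" using subset_imp_lepoll[OF A(1)] separable_lepoll_reals[OF Z sep] C(2) lepoll_trans by metis
 then obtain g where g: "inj_on g A" "g ` A \<subseteq> C" unfolding lepoll_def by blast
 obtain L where L: "linear L" "\<forall>x\<in>A. L x = g x" using linear_independent_extend[OF A(2)] by blast
 have "inj_on L A" using L(2) g(1) by (simp add: inj_on_def)
 moreover have "L ` A = g ` A" using L(2) by (intro image_cong) auto
 then have "independent (L ` A)" using independent_mono[OF C(1) g(2)] by simp
 ultimately have "inj_on L (span A)" using linear_inj_on_span_independent_image[OF L(1)] by blast
 then have inj: "inj_on L (pts Z)" using A(3) inj_on_subset by blast
 define Z' where "Z' = \<lparr>pts = L ` pts Z, nrm = \<lambda>y. nrm Z (inv_into (pts Z) L y)\<rparr>"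
 have p: "pts Z' = L ` pts Z" by (simp add: Z'_def)
 have n: "nrm Z' (L x) = nrm Z x" if "x \<in> pts Z" for x using inv_into_f_f[OF inj that] by (simp add: Z'_def)
 have L0: "L x = 0 \<longleftrightarrow> x = 0" if "x \<in> pts Z" for x
  using inj_onD[OF inj, of x 0] that pts_zero[OF Z] linear_0[OF L(1)] by auto
 have Z': "normed_space Z'"
  unfolding normed_space_def p ball_simps
 proof (intro conjI ballI allI)
  show "subspace (L ` pts Z)" by (rule linear_subspace_image[OF L(1) normed_space_subspace[OF Z]])
  fix x assume x: "x \<in> pts Z"
  show "0 <= nrm Z' (L x)" using n[OF x] nrm_nonneg[OF Z x] by simp
  show "nrm Z' (L x) = 0 \<longleftrightarrow> L x = 0" using n[OF x] nrm_eq_0[OF Z x] L0[OF x] by simp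
  show "nrm Z' (c *\<^sub>R L x) = \<bar>c\<bar> * nrm Z' (L x)" for c
   using n[OF pts_scale[OF Z x]] n[OF x] nrm_scale[OF Z x] by (simp add: linear_scale[OF L(1)])
  fix y assume y: "y \<in> pts Z"
  show "nrm Z' (L x + L y) <= nrm Z' (L x) + nrm Z' (L y)"
   using n[OF pts_add[OF Z x y]] n[OF x] n[OF y] nrm_add[OF Z x y] by (simp add: linear_add[OF L(1)])
 qed
 have "banach_space Z'"
 proof (rule banach_spaceI[OF Z'])
  fix s :: "nat => 'z" assume s: "!!n. s n \<in> pts Z'"
   and cau: "!!e. e > 0 ==> \<exists>N. \<forall>m\<ge>N. \<forall>n\<ge>N. nrm Z' (s m - s n) < e"
  have "\<exists>x. x \<in> pts Z & s n = L x" for n using s[of n] unfolding p by blast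
  then obtain r where r: "!!n. r n \<in> pts Z" "!!n. s n = L (r n)" by metis
  have eq: "nrm Z' (L x - L y) = nrm Z (x - y)" if "x \<in> pts Z" "y \<in> pts Z" for x y
   using n[OF pts_diff[OF Z that]] by (simp add: linear_diff[OF L(1)])
  have "\<exists>x. nconv Z r x" by (rule banach_conv[OF B r(1)]) (use cau in \<open>simp add: r(2) eq r(1)\<close>)
  then obtain x where x: "nconv Z r x" by blast
  then have "nconv Z' s (L x)" using nconv_pts[OF x] by (simp add: nconv_def p r eq)
  then show "\<exists>x. nconv Z' s x" by blast
 qed
 moreover have "bounded_operator Z Z' L"
  by (rule bounded_operatorI[where K = 1]) (use n in \<open>auto simp: p linear_add[OF L(1)] linear_scale[OF L(1)]\<close>)
 ultimately show ?thesis using that p n by metis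
qed

text \<open>The completion is the closure of the canonical image in the bidual.\<close>

theorem completion:
 fixes N :: "'a::real_vector nspace"
 assumes c: "continuum_dimensional TYPE('z::real_vector)" and N: "normed_space N"
  and A: "countable A" "pts N = span A"
 obtains Z :: "'z::real_vector nspace" and J where "banach_space Z" "bounded_operator N Z J"
  "!!x. x \<in> pts N ==> nrm Z (J x) = nrm N x"
  "!!z e. z \<in> pts Z ==> e > 0 ==> \<exists>x\<in>pts N. nrm Z (z - J x) < e"
proof -
 note D = normed_space_dual[OF N]
 define B where "B = dual (dual N)"
 have BB: "banach_space B" unfolding B_def by (rule banach_dual[OF D])
 note BN = banach_normed[OF BB]
 define ev where "ev x = (\<lambda>f. if f \<in> pts (dual N) then f x else 0)" for x :: 'a
 have evB: "ev x \<in> pts B" if "x \<in> pts N" for x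
  unfolding ev_def B_def
  by (rule dual_restrictI[OF D, where K = "nrm N x"])
   (use dual_bound[OF N _ that] in \<open>auto simp: scaleR_fun_def mult.commute\<close>)
 have evn: "nrm B (ev x) = nrm N x" if x: "x \<in> pts N" for x
 proof (rule antisym)
  show "nrm B (ev x) <= nrm N x"
   unfolding B_def by (rule dual_nrm_le'[OF D nrm_nonneg[OF N x]])
    (use dual_bound[OF N _ x] in \<open>auto simp: ev_def mult.commute\<close>)
  obtain f where f: "f \<in> pts (dual N)" "nrm (dual N) f <= 1" "f x = nrm N x"
   by (rule norming_functional[OF N x])
  show "nrm N x <= nrm B (ev x)"
   using dual_nrm_ge[OF D evB[OF x, unfolded B_def] f(1,2)] f by (simp add: ev_def B_def)
 qed
 have eva: "ev (x + y) = ev x + ev y" if "x \<in> pts N" "y \<in> pts N" for x y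
  by (auto simp: ev_def fun_eq_iff dual_add that)
 have evs: "ev (a *\<^sub>R x) = a *\<^sub>R ev x" if "x \<in> pts N" for a x
  by (auto simp: ev_def fun_eq_iff dual_scale that scaleR_fun_def)
 have op: "bounded_operator N B ev"
  by (rule bounded_operatorI[where K = 1]) (use evB evn eva evs in auto)
 define I where "I = ev ` A"
 have AN: "A \<subseteq> pts N" using A(2) span_superset by blast
 have I: "countable I" "I \<subseteq> pts B" using A evB AN by (auto simp: I_def)
 have spI: "span I = ev ` pts N"
 proof
  have "subspace (ev ` pts N)"
   unfolding subspace_def
  proof (intro conjI ballI allI)
   show "0 \<in> ev ` pts N" using op_zero[OF op N] pts_zero[OF N] by (metis imageI)
   fix a b assume "a \<in> ev ` pts N" "b \<in> ev ` pts N"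
   then show "a + b \<in> ev ` pts N" using eva pts_add[OF N] by (auto simp flip: eva)
  next
   fix r :: real and a assume "a \<in> ev ` pts N"
   then show "r *\<^sub>R a \<in> ev ` pts N" using pts_scale[OF N] by (auto simp flip: evs)
  qed
  then show "span I \<subseteq> ev ` pts N" using AN by (intro span_minimal) (auto simp: I_def)
  have "x \<in> pts N & ev x \<in> span I" if "x \<in> span A" for x
   using that
  proof (induction rule: span_induct_alt)
   case base
   have "ev 0 \<in> span I" unfolding op_zero[OF op N] by (rule span_zero)
   then show ?case using pts_zero[OF N] by blast
  next
   case (step r x y)
   then have xy: "x \<in> pts N" "y \<in> pts N" using AN by auto
   have "ev x \<in> I" using step(1) by (simp add: I_def)
   then have "r *\<^sub>R ev x + ev y \<in> span I" using step(2) by (intro span_add span_scale) (auto intro: span_base)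
   then have "ev (r *\<^sub>R x + y) \<in> span I" unfolding eva[OF pts_scale[OF N xy(1)] xy(2)] evs[OF xy(1)] .
   then show ?case using pts_add[OF N pts_scale[OF N xy(1)] xy(2)] by blast
  qed
  then show "ev ` pts N \<subseteq> span I" using A(2) by auto
 qed
 define Y where "Y = closed_span_space B I"
 have YB: "banach_space Y" unfolding Y_def by (rule banach_closed_span[OF BB I(2)])
 note YN = banach_normed[OF YB]
 have nY: "nrm Y = nrm B" by (simp add: Y_def closed_span_space_def)
 have pY: "y \<in> pts Y \<longleftrightarrow> y \<in> pts B & (\<forall>e>0. \<exists>a\<in>span I. nrm B (y - a) < e)" for y
  using closed_span_iff[OF BN I(2)] by (simp add: Y_def closed_span_space_def)
 have evY: "ev x \<in> pts Y" if "x \<in> pts N" for x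
  unfolding pY using evB[OF that] that spI nrm_zero[OF BN] by (intro conjI allI impI bexI[of _ "ev x"]) auto
 have IY: "I \<subseteq> pts Y" using evY AN by (auto simp: I_def)
 have "separable_space (ntop Y)"
  by (rule separable_if_countable_span_dense[OF YN I(1) IY]) (auto simp: nY pY)
 from isometric_copy[OF c YB this]
 obtain Z :: "'z nspace" and T where Z: "banach_space Z" "bounded_operator Y Z T" "T ` pts Y = pts Z"
  "!!x. x \<in> pts Y ==> nrm Z (T x) = nrm Y x" by blast
 show ?thesis
 proof (rule that[of Z "\<lambda>x. T (ev x)"])
  have op': "bounded_operator N Y ev"
   by (rule bounded_operatorI[where K = 1]) (use evY evn eva evs nY in auto)
  show "bounded_operator N Z (\<lambda>x. T (ev x))" by (rule op_comp[OF op' Z(2) N YN])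
  show "nrm Z (T (ev x)) = nrm N x" if "x \<in> pts N" for x using Z(4)[OF evY[OF that]] evn[OF that] nY by simp
  fix z and e :: real assume z: "z \<in> pts Z" and e: "e > 0"
  have "z \<in> T ` pts Y" using z Z(3) by simp
  then obtain y where y: "y \<in> pts Y" "z = T y" by blast
  then obtain x where x: "x \<in> pts N" "nrm B (y - ev x) < e" using e unfolding pY spI by blast
  have "nrm Z (T y - T (ev x)) = nrm B (y - ev x)"
   using Z(4)[OF pts_diff[OF YN y(1) evY[OF x(1)]]] op_diff[OF Z(2) YN y(1) evY[OF x(1)]] nY by simp
  then show "\<exists>x\<in>pts N. nrm Z (z - T (ev x)) < e" unfolding y(2) using x by (intro bexI[of _ x]) simp_all
 qed (rule Z(1))
qed

section \<open>Duals of finite-dimensional decompositions\<close>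

context fdd
begin

lemma D: "normed_space (dual Z)" by (rule normed_space_dual[OF Z])

text \<open>Adjoints of the coordinate map and, in \<open>dproj\<close>, of the partial sum
  projection, set to 0 off \<open>pts Z\<close> as members of \<open>dual Z\<close> must be.\<close>

definition coord :: "('a => real) => nat => 'a => real"
 where "coord f i = (\<lambda>z. if z \<in> pts Z then f (component Z E z i) else 0)"

definition dproj :: "('a => real) => nat => 'a => real"
 where "dproj f n = (\<lambda>z. if z \<in> pts Z then f (proj Z E n z) else 0)"

lemma supp_nonempty: "z \<in> pts Z ==> z ~= 0 ==> supp Z E z ~= {}"
 using comp_zero_imp by (auto simp: supp_def)

lemma dproj_dual: "f \<in> pts (dual Z) ==> dproj f n \<in> pts (dual Z)"
proof -
 assume f: "f \<in> pts (dual Z)"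
 obtain K where K: "K > 0" "!!n z. z \<in> pts Z ==> nrm Z (proj Z E n z) <= K * nrm Z z"
  by (rule proj_bounded) blast
 show ?thesis
  unfolding dproj_def
 proof (rule dual_restrictI[OF Z, where K = "nrm (dual Z) f * K"])
  fix x assume x: "x \<in> pts Z"
  show "\<bar>f (proj Z E n x)\<bar> <= nrm (dual Z) f * K * nrm Z x"
   using dual_bound[OF Z f proj_pts[OF x], of n] mult_left_mono[OF K(2)[OF x, of n] dual_nrm_nonneg[OF Z f]]
   by (simp add: mult.assoc)
 qed (auto simp: proj_add proj_scale proj_pts dual_add[OF f] dual_scale[OF f])
qed

lemma dproj_norm:
 obtains K where "K > 0" "!!f n. f \<in> pts (dual Z) ==> nrm (dual Z) (dproj f n) <= K * nrm (dual Z) f"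
proof -
 obtain K where K: "K > 0" "!!n z. z \<in> pts Z ==> nrm Z (proj Z E n z) <= K * nrm Z z"
  by (rule proj_bounded) blast
 have "nrm (dual Z) (dproj f n) <= K * nrm (dual Z) f" if f: "f \<in> pts (dual Z)" for f n
 proof (rule dual_nrm_le'[OF Z])
  fix x assume x: "x \<in> pts Z"
  show "\<bar>dproj f n x\<bar> <= K * nrm (dual Z) f * nrm Z x"
   using dual_bound[OF Z f proj_pts[OF x], of n] mult_left_mono[OF K(2)[OF x, of n] dual_nrm_nonneg[OF Z f]] x
   by (simp add: dproj_def mult_ac)
 qed (use K(1) dual_nrm_nonneg[OF Z f] in simp)
 then show ?thesis using that K(1) by blast
qed

lemma coord_dproj: "f \<in> pts (dual Z) ==> coord f i = dproj f (Suc i) - dproj f i"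
 using dual_add[OF _ proj_pts comp_pts] by (force simp: fun_eq_iff coord_def dproj_def proj_def)

lemma coord_mem:
 assumes f: "f \<in> pts (dual Z)"
 shows "coord f i \<in> dual_FDD Z E i"
proof -
 have "coord f i \<in> pts (dual Z)"
  unfolding coord_dproj[OF f] by (intro pts_diff[OF D] dproj_dual f)
 moreover have "coord f i x = 0" if "j ~= i" "x \<in> E j" for j x
  using that E_pts dual_zero[OF f Z] by (auto simp: coord_def comp_single)
 ultimately show ?thesis by (auto simp: dual_FDD_def)
qed

lemma dproj_sum: "f \<in> pts (dual Z) ==> dproj f n = (\<Sum>i<n. coord f i)"
 by (auto simp: fun_eq_iff sum_fun_apply dproj_def coord_def proj_def intro!: dual_sum[OF _ Z] comp_pts)

lemma coord_of_dual_FDD: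
 assumes "f \<in> dual_FDD Z E i" "z \<in> pts Z"
 shows "f z = f (component Z E z i)"
proof -
 have f: "f \<in> pts (dual Z)" and f0: "!!j x. j ~= i ==> x \<in> E j ==> f x = 0" using assms by (auto simp: dual_FDD_def)
 have "f (proj Z E n z) = f (component Z E z i)" if "n > i" for n
 proof -
  have "f (proj Z E n z) = (\<Sum>j<n. f (component Z E z j))"
   unfolding proj_def by (rule dual_sum[OF f Z comp_pts[OF assms(2)]])
  also have "\<dots> = (\<Sum>j<n. if j = i then f (component Z E z i) else 0)"
   using f0 comp_mem[OF assms(2)] by (intro sum.cong) auto
  finally show ?thesis using that by simp
 qed
 then have "(\<lambda>n. f (proj Z E n z)) \<longlonglongrightarrow> f (component Z E z i)"
  by (intro tendsto_eventually eventually_sequentiallyI[of "Suc i"]) auto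
 moreover have "(\<lambda>n. f (proj Z E n z)) \<longlonglongrightarrow> f z"
  by (rule dual_conv[OF Z f proj_pts[OF assms(2)] proj_conv[OF assms(2)]])
 ultimately show ?thesis using LIMSEQ_unique by blast
qed

lemma dual_FDD_sub: "subspace (dual_FDD Z E i)"
 using normed_space_subspace[OF D] unfolding subspace_def dual_FDD_def by (auto simp: scaleR_fun_def)

lemma comp_diff:
 assumes "x \<in> pts Z" "y \<in> pts Z"
 shows "component Z E (x - y) i = component Z E x i - component Z E y i"
 using comp_add[OF assms(1) pts_scale[OF Z assms(2)], of "-1" i] comp_scale[OF assms(2), of "-1" i] by simp

lemma comp_outside_supp: "i \<notin> supp Z E z ==> component Z E z i = 0"
 by (simp add: supp_def)

lemma supp_scale: "z \<in> pts Z ==> c ~= 0 ==> supp Z E (c *\<^sub>R z) = supp Z E z"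
 by (simp add: supp_def comp_scale)

lemma exists_unit_vector:
 assumes "E i ~= {0}"
 shows "\<exists>z\<in>E i. nrm Z z = 1 & supp Z E z = {i}"
proof -
 have "0 \<in> E i" by (rule subspace_0[OF E_sub])
 then obtain x where x: "x \<in> E i" "x ~= 0" using assms by blast
 have xp: "x \<in> pts Z" using x(1) E_pts by blast
 have pos: "nrm Z x > 0" using nrm_pos[OF Z xp] x(2) by simp
 show ?thesis
 proof (intro bexI[of _ "(1 / nrm Z x) *\<^sub>R x"] conjI)
  show "nrm Z ((1 / nrm Z x) *\<^sub>R x) = 1" using pos by (simp add: nrm_scale[OF Z xp])
  show "supp Z E ((1 / nrm Z x) *\<^sub>R x) = {i}"
   using pos x by (simp add: supp_scale[OF xp]) (simp add: supp_def comp_single)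
  show "(1 / nrm Z x) *\<^sub>R x \<in> E i" by (rule subspace_scale[OF E_sub x(1)])
 qed
qed

lemma unit_vectors_beyond:
 assumes inf: "infinite {i. E i ~= {0}}"
 obtains u g where "strict_mono g" "!!i. i <= g i"
  "!!i :: nat. u i \<in> pts Z & nrm Z (u i) = 1 & supp Z E (u i) = {g i}"
proof -
 define g where "g = enumerate {i. E i ~= {0}}"
 have gm: "strict_mono g" unfolding g_def by (rule strict_mono_enumerate[OF inf])
 have gE: "E (g i) ~= {0}" for i using enumerate_in_set[OF inf, of i] by (simp add: g_def)
 define u where "u i = (SOME z. z \<in> E (g i) & nrm Z z = 1 & supp Z E z = {g i})" for i
 have u: "u i \<in> E (g i) & nrm Z (u i) = 1 & supp Z E (u i) = {g i}" for i
  unfolding u_def by (rule someI_ex) (use exists_unit_vector[OF gE] in blast)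
 have "u i \<in> pts Z" for i using u[of i] E_pts by blast
 then show thesis
  using u by (intro that[OF gm strict_mono_imp_increasing[OF gm]]) blast
qed

text \<open>Block estimates quantify over infinite sequences, so a finite family is normalized and
  continued by unit vectors from later nonzero summands; for these there must be infinitely
  many.\<close>

lemma extend_to_block_seq:
 fixes J :: "nat set"
 assumes inf: "infinite {i. E i ~= {0}}" and J: "finite J"
  and z: "!!j. j \<in> J ==> z j \<in> pts Z" "!!j. j \<in> J ==> z j ~= 0" "!!j. j \<in> J ==> finite (supp Z E (z j))"
  and less: "!!i j. i \<in> J ==> j \<in> J ==> i < j ==> Max (supp Z E (z i)) < Min (supp Z E (z j))"
 obtains w where "block_seq Z E w" "normalized Z w"
  "!!i. i < card J ==> w i = (1 / nrm Z (z (sorted_list_of_set J ! i))) *\<^sub>R z (sorted_list_of_set J ! i)"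
  "!!i. i < card J ==> supp Z E (w i) = supp Z E (z (sorted_list_of_set J ! i))"
proof -
 define r where "r i = sorted_list_of_set J ! i" for i
 have rJ: "r i \<in> J" if "i < card J" for i
  using nth_mem[of i "sorted_list_of_set J"] that J by (simp add: r_def)
 have rmono: "r i < r j" if "i < j" "j < card J" for i j
  using sorted_wrt_nth_less[OF strict_sorted_list_of_set[of J], of i j] that by (simp add: r_def)
 obtain g u where g: "strict_mono g" "!!i. i <= g i"
  and u: "!!i :: nat. u i \<in> pts Z & nrm Z (u i) = 1 & supp Z E (u i) = {g i}"
  by (rule unit_vectors_beyond[OF inf]) (rule that)
 have "finite (\<Union>j\<in>J. supp Z E (z j))" using J z(3) by blast
 then obtain P where P: "\<forall>i\<in>(\<Union>j\<in>J. supp Z E (z j)). i < P" using finite_nat_set_iff_bounded by blast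
 define w where "w i = (if i < card J then (1 / nrm Z (z (r i))) *\<^sub>R z (r i) else u (P + i))" for i
 have pos: "nrm Z (z j) > 0" if "j \<in> J" for j using nrm_pos[OF Z z(1)[OF that]] z(2)[OF that] by simp
 have w1: "w i = (1 / nrm Z (z (r i))) *\<^sub>R z (r i)" if "i < card J" for i using that by (simp add: w_def)
 have w2: "w i = u (P + i)" if "\<not> i < card J" for i using that by (simp add: w_def)
 have sw1: "supp Z E (w i) = supp Z E (z (r i))" if "i < card J" for i
  unfolding w1[OF that] by (rule supp_scale[OF z(1)[OF rJ[OF that]]]) (use pos[OF rJ[OF that]] in simp)
 have sw2: "supp Z E (w i) = {g (P + i)}" if "\<not> i < card J" for i using w2[OF that] u by simp
 have n1: "w i \<in> pts Z & nrm Z (w i) = 1" for i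
 proof (cases "i < card J")
  case True
  then show ?thesis
   using w1[OF True] pos[OF rJ[OF True]] z(1)[OF rJ[OF True]] by (simp add: nrm_scale[OF Z] pts_scale[OF Z])
 qed (use w2 u in simp)
 have fin: "finite (supp Z E (w i))" for i using sw1 sw2 z(3) rJ by (cases "i < card J") auto
 have nz: "w i ~= 0" for i using n1[of i] nrm_zero[OF Z] by force
 have "Max (supp Z E (w i)) < Min (supp Z E (w (Suc i)))" for i
 proof (cases "Suc i < card J")
  case True
  then show ?thesis using less[OF rJ rJ rmono, of i "Suc i"] sw1[of i] sw1[of "Suc i"] by simp
 next
  case False
  show ?thesis
  proof (cases "i < card J")
   case True
   have "Max (supp Z E (w i)) \<in> supp Z E (z (r i))"
    using Max_in[OF fin[of i] supp_nonempty] n1[of i] nz[of i] sw1[OF True] by simp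
   then have "Max (supp Z E (w i)) < P" using P rJ[OF True] by blast
   also have "P <= g (P + Suc i)" using g(2)[of "P + Suc i"] by simp
   finally show ?thesis using sw2[OF False] by simp
  next
   case F: False
   then show ?thesis using sw2[OF F] sw2[OF False] strict_monoD[OF g(1), of "P + i" "P + Suc i"] by simp
  qed
 qed
 then have "block_seq Z E w" using n1 nz fin by (simp add: block_seq_def)
 moreover have "normalized Z w" using n1 by (simp add: normalized_def)
 ultimately show thesis using that w1 sw1 unfolding r_def by blast
qed

lemma sum_sorted_list:
 fixes f :: "nat => 'd::comm_monoid_add"
 assumes "finite J"
 shows "(\<Sum>i<card J. f (sorted_list_of_set J ! i)) = (\<Sum>j\<in>J. f j)"
proof (rule sum.reindex_bij_betw)
 show "bij_betw ((!) (sorted_list_of_set J)) {..<card J} J"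
  by (rule bij_betw_nth) (use assms in auto)
qed

lemma window_less:
 assumes win: "!!l. l < k ==> supp Z E (z l) \<subseteq> {p l..<p (Suc l)} & m l \<in> {p l..<p (Suc l)}"
  and ij: "i < j" "j < (k :: nat)"
 shows "p (Suc i) <= p j"
 using ij
proof (induction j)
 case (Suc j)
 show ?case
 proof (cases "i = j")
  case False
  then have "p (Suc i) <= p j" using Suc by simp
  also have "p j <= p (Suc j)" using win[of j] Suc.prems by auto
  finally show ?thesis .
 qed simp
qed simp

text \<open>Block estimates as they are applied: finitely many vectors of the unit ball, possibly
  zero, with comparison indices anywhere in the windows. If only finitely many summands are nonzero
  there are no block sequences to apply the estimate to, but then the number of nonzero
  \<open>z l\<close> is bounded.\<close>

lemma windowed_upper_estimate:
 assumes V: "vseq W v" and up: "upper_block_estimates W v Z E"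
 obtains C where "C >= 1"
  "!!(k :: nat) z p m a. (!!l. l < k ==> z l \<in> pts Z & nrm Z (z l) <= 1) ==>
   (!!l. l < k ==> supp Z E (z l) \<subseteq> {p l..<p (Suc l)} & m l \<in> {p l..<p (Suc l)}) ==>
   nrm Z (\<Sum>l<k. a l *\<^sub>R z l) <= C * nrm W (\<Sum>l<k. a l *\<^sub>R v (m l))"
proof -
 interpret vseq W v by (rule V)
 obtain C where C: "C >= 1" and dom: "!!z. block_seq Z E z ==> normalized Z z ==>
   dominated_by C Z z W (\<lambda>i. v (Min (supp Z E (z i))))"
  using up unfolding upper_block_estimates_def by blast
 obtain C2 where C2: "C2 >= 1" and ex: "!!J p q (a :: nat => real). finite J ==>
  (!!i j. i \<in> J ==> j \<in> J ==> i < j ==> max (p i) (q i) < min (p j) (q j)) ==>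
  nrm W (\<Sum>j\<in>J. a j *\<^sub>R v (p j)) <= C2 * nrm W (\<Sum>j\<in>J. a j *\<^sub>R v (q j))"
  by (rule exchange_set) blast
 \<comment> \<open>One summand for each case: \<open>C * C2\<close> from domination and exchange of
   indices, the number of nonzero summands from counting.\<close>
 define D where "D = C * C2 + real (card {i. E i ~= {0}})"
 have D1: "D >= 1" unfolding D_def using mult_mono[of 1 C 1 C2] C C2 by simp
 show thesis
 proof (rule that[OF D1])
  fix k :: nat and z p m and a :: "nat => real"
  assume z: "!!l. l < k ==> z l \<in> pts Z & nrm Z (z l) <= 1"
   and win: "!!l. l < k ==> supp Z E (z l) \<subseteq> {p l..<p (Suc l)} & m l \<in> {p l..<p (Suc l)}"
  define J where "J = {l. l < k & z l ~= 0}"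
  have J: "finite J" "J \<subseteq> {..<k}" by (auto simp: J_def)
  have pj: "p (Suc i) <= p j" if "i < j" "j < k" for i j using window_less[of k z p m, OF win that] by blast
  have mlt: "m i < m j" if "i < j" "j < k" for i j
   using pj[OF that] win[of i] win[of j] that by force
  have minj: "inj_on m {..<k}" by (rule linorder_inj_onI) (use mlt in force)+
  have fin: "finite (supp Z E (z j))" if "j \<in> J" for j
   using win[of j] that J(2) by (auto intro: finite_subset)
  have ne: "supp Z E (z j) ~= {}" if "j \<in> J" for j
   using supp_nonempty z[of j] that by (simp add: J_def)
  have Mi: "Min (supp Z E (z j)) \<in> supp Z E (z j)" "Max (supp Z E (z j)) \<in> supp Z E (z j)" if "j \<in> J" for j
   using Min_in[OF fin ne] Max_in[OF fin ne] that by auto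
  have win': "p j <= i & i < p (Suc j)" if "i \<in> supp Z E (z j)" "j \<in> J" for i j
   using subsetD[OF conjunct1[OF win[of j]] that(1)] that J(2) by auto
  have less: "Max (supp Z E (z i)) < Min (supp Z E (z j))" if "i \<in> J" "j \<in> J" "i < j" for i j
   using win'[OF Mi(2)[OF that(1)] that(1)] win'[OF Mi(1)[OF that(2)] that(2)] pj[of i j] that J(2) by force
  have sumJ: "(\<Sum>l<k. a l *\<^sub>R z l) = (\<Sum>l\<in>J. a l *\<^sub>R z l)"
   by (rule sum.mono_neutral_right) (auto simp: J_def)
  define R where "R = nrm W (\<Sum>l<k. a l *\<^sub>R v (m l))"
  have R0: "R >= 0" unfolding R_def by (rule nrm_nonneg[OF W sum_pts])
  have "nrm Z (\<Sum>l\<in>J. a l *\<^sub>R z l) <= D * R"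
  proof (cases "finite {i. E i ~= {0}}")
   case True
   have "Min (supp Z E (z j)) \<in> {i. E i ~= {0}}" if "j \<in> J" for j
    using Mi(1)[OF that] comp_mem[of "z j"] z[of j] that J(2) by (force simp: supp_def)
   then have img: "(\<lambda>j. Min (supp Z E (z j))) ` J \<subseteq> {i. E i ~= {0}}" by blast
   have inj: "inj_on (\<lambda>j. Min (supp Z E (z j))) J"
   proof (rule linorder_inj_onI)
    fix i j assume ij: "i < j" "i \<in> J" "j \<in> J"
    then show "Min (supp Z E (z i)) ~= Min (supp Z E (z j))"
     using less[of i j] Min_le[OF fin Mi(2), of i] by force
   qed linarith
   have card: "card J <= card {i. E i ~= {0}}" by (rule card_inj_on_le[OF inj img True])
   have "nrm Z (\<Sum>l\<in>J. a l *\<^sub>R z l) <= (\<Sum>l\<in>J. nrm Z (a l *\<^sub>R z l))"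
    by (rule nrm_sum[OF Z]) (use z J in \<open>auto intro!: pts_scale[OF Z]\<close>)
   also have "\<dots> <= (\<Sum>l\<in>J. R)"
   proof (rule sum_mono)
    fix l assume "l \<in> J"
    then have l: "l < k" using J by blast
    have "nrm Z (a l *\<^sub>R z l) <= \<bar>a l\<bar>"
     using nrm_scale[OF Z, of "z l" "a l"] z[OF l] mult_left_mono[of "nrm Z (z l)" 1 "\<bar>a l\<bar>"] by simp
    also have "\<dots> <= R" unfolding R_def by (rule coeff_le) (use minj l in auto)
    finally show "nrm Z (a l *\<^sub>R z l) <= R" .
   qed
   also have "\<dots> <= real (card {i. E i ~= {0}}) * R" using card R0 by (simp add: mult_right_mono)
   also have "\<dots> <= D * R" unfolding D_def using R0 C C2 by (intro mult_right_mono) auto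
   finally show ?thesis .
  next
   case inf: False
   obtain w where w: "block_seq Z E w" "normalized Z w"
    "!!i. i < card J ==> w i = (1 / nrm Z (z (sorted_list_of_set J ! i))) *\<^sub>R z (sorted_list_of_set J ! i)"
    "!!i. i < card J ==> supp Z E (w i) = supp Z E (z (sorted_list_of_set J ! i))"
    by (rule extend_to_block_seq[OF inf J(1), of z]) (use z fin less J in \<open>auto simp: J_def\<close>)
   define b where "b l = a l * nrm Z (z l)" for l
   have eq1: "(\<Sum>l\<in>J. a l *\<^sub>R z l) = (\<Sum>i<card J. b (sorted_list_of_set J ! i) *\<^sub>R w i)"
   proof -
    have "(\<Sum>l\<in>J. a l *\<^sub>R z l) = (\<Sum>l\<in>J. b l *\<^sub>R (1 / nrm Z (z l)) *\<^sub>R z l)"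
     using nrm_pos[OF Z] z J(2) by (intro sum.cong) (force simp: b_def J_def)+
    also have "\<dots> = (\<Sum>i<card J. b (sorted_list_of_set J ! i) *\<^sub>R w i)"
     using w(3) by (subst sum_sorted_list[OF J(1), symmetric]) (auto intro: sum.cong)
    finally show ?thesis .
   qed
   have eq2: "(\<Sum>i<card J. b (sorted_list_of_set J ! i) *\<^sub>R v (Min (supp Z E (w i))))
     = (\<Sum>l\<in>J. b l *\<^sub>R v (Min (supp Z E (z l))))"
    using w(4) by (subst sum_sorted_list[OF J(1), symmetric]) (auto intro: sum.cong)
   have "nrm Z (\<Sum>l\<in>J. a l *\<^sub>R z l) <= C * nrm W (\<Sum>l\<in>J. b l *\<^sub>R v (Min (supp Z E (z l))))"
    using dom[OF w(1,2)] unfolding dominated_by_def eq1 eq2[symmetric] by (elim allE)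
   also have "nrm W (\<Sum>l\<in>J. b l *\<^sub>R v (Min (supp Z E (z l)))) <= C2 * nrm W (\<Sum>l\<in>J. b l *\<^sub>R v (m l))"
   proof (rule ex[OF J(1)])
    fix i j assume ij: "i \<in> J" "j \<in> J" "i < j"
    then have k: "i < k" "j < k" using J by auto
    show "max (Min (supp Z E (z i))) (m i) < min (Min (supp Z E (z j))) (m j)"
     using win'[OF Mi(1) ij(1)] win'[OF Mi(1) ij(2)] ij win[OF k(1)] win[OF k(2)] pj[OF ij(3) k(2)] by auto
   qed
   also have "nrm W (\<Sum>l\<in>J. b l *\<^sub>R v (m l)) <= R"
    unfolding R_def
   proof (rule coeff_mono[OF _ J(2) minj])
    show "\<bar>b j\<bar> <= \<bar>a j\<bar>" if "j \<in> J" for j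
     using z[of j] that J(2) mult_left_mono[of "nrm Z (z j)" 1 "\<bar>a j\<bar>"] nrm_nonneg[OF Z, of "z j"]
     by (auto simp: b_def abs_mult)
   qed simp
   finally have "nrm Z (\<Sum>l\<in>J. a l *\<^sub>R z l) <= C * (C2 * R)" using C C2 by (simp add: mult_left_mono)
   also have "\<dots> <= D * R" using R0 by (simp add: D_def algebra_simps)
   finally show ?thesis .
  qed
  then show "nrm Z (\<Sum>l<k. a l *\<^sub>R z l) <= D * nrm W (\<Sum>l<k. a l *\<^sub>R v (m l))" unfolding sumJ R_def .
 qed
qed

text \<open>If \<open>f\<close> were not approximated by the \<open>dproj f n\<close>, a block sequence on which \<open>f\<close> is bounded
 below would dominate \<open>\<ell>\<^sub>1\<close> on convex combinations, against the shrinking of \<open>v\<close>.\<close>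

lemma upper_estimates_imp_shrinking:
 assumes V: "vseq W v" and up: "upper_block_estimates W v Z E"
 shows "shrinking_FDD Z E"
proof -
 interpret vseq W v by (rule V)
 obtain C where C: "C >= 1" and UW: "!!(k :: nat) z p m a. (!!l. l < k ==> z l \<in> pts Z & nrm Z (z l) <= 1) ==>
   (!!l. l < k ==> supp Z E (z l) \<subseteq> {p l..<p (Suc l)} & m l \<in> {p l..<p (Suc l)}) ==>
   nrm Z (\<Sum>l<k. a l *\<^sub>R z l) <= C * nrm W (\<Sum>l<k. a l *\<^sub>R v (m l))"
  by (rule windowed_upper_estimate[OF V up]) blast
 obtain K where K: "K > 0" "!!n z. z \<in> pts Z ==> nrm Z (proj Z E n z) <= K * nrm Z z"
  by (rule proj_bounded) blast
 have approx: "\<exists>n. nrm (dual Z) (f - dproj f n) <= 2 * K * \<delta>" if f: "f \<in> pts (dual Z)" and \<delta>: "\<delta> > 0" for f \<delta>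
 proof (rule ccontr)
  assume "\<not> ?thesis"
  then have far: "2 * K * \<delta> < nrm (dual Z) (f - dproj f n)" for n by (simp add: not_le)
  \<comment> \<open>A vector at which the tail of \<open>f\<close> exceeds
    \<open>2 * K * \<delta>\<close> is cut to a window; cutting costs \<open>2 * K\<close> in norm,
    so normalization leaves \<open>\<delta>\<close>.\<close>
  have "\<exists>m u. n < m & u \<in> pts Z & nrm Z u <= 1 & \<delta> <= f u & supp Z E u \<subseteq> {n..<m}" for n
  proof -
   obtain z where z: "z \<in> pts Z" "nrm Z z <= 1" "2 * K * \<delta> < (f - dproj f n) z"
    using dual_nrm_approx[OF Z pts_diff[OF D f dproj_dual[OF f]] far] by blast
   have "(\<lambda>m. f (proj Z E m z)) \<longlonglongrightarrow> f z" by (intro dual_conv[OF Z f] proj_pts proj_conv z(1))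
   moreover have "2 * K * \<delta> + f (proj Z E n z) < f z" using z(1,3) by (simp add: dproj_def)
   ultimately have "\<forall>\<^sub>F m in sequentially. 2 * K * \<delta> + f (proj Z E n z) < f (proj Z E m z)" by (rule order_tendstoD)
   then obtain M where M: "!!m. m >= M ==> 2 * K * \<delta> + f (proj Z E n z) < f (proj Z E m z)"
    unfolding eventually_sequentially by blast
   define m where "m = max M (Suc n)"
   define y where "y = proj Z E m z - proj Z E n z"
   have y: "y \<in> pts Z" unfolding y_def by (intro pts_diff[OF Z] proj_pts z(1))
   have "nrm Z y <= 2 * K"
    using nrm_diff[OF Z proj_pts[OF z(1)] proj_pts[OF z(1)], of m n] K(2)[OF z(1), of m] K(2)[OF z(1), of n]
     mult_left_mono[OF z(2) less_imp_le[OF K(1)]] unfolding y_def by linarith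
   moreover have "2 * K * \<delta> < f y"
    using M[of m] by (simp add: y_def m_def dual_diff[OF f Z] proj_pts z(1))
   moreover have "supp Z E y \<subseteq> {n..<m}"
    by (auto simp: supp_def y_def comp_diff proj_pts z(1) comp_proj m_def split: if_splits)
   ultimately show ?thesis
    using K(1) by (intro exI[of _ m] exI[of _ "(1 / (2 * K)) *\<^sub>R y"])
     (auto simp: nrm_scale[OF Z y] dual_scale[OF f y] supp_scale[OF y] pts_scale[OF Z y] m_def field_simps)
  qed
  then obtain g u where g: "!!n. n < g n" and u: "!!n. u n \<in> pts Z" "!!n. nrm Z (u n) <= 1" "!!n. \<delta> <= f (u n)"
   "!!n. supp Z E (u n) \<subseteq> {n..<g n}" by metis
  define s where "s = rec_nat 0 (\<lambda>_. g)"
  have sS: "s (Suc j) = g (s j)" for j by (simp add: s_def)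
  have s: "strict_mono s" unfolding strict_mono_Suc_iff sS using g by blast
  \<comment> \<open>Convex combinations of pairs apply the same coefficients to \<open>v\<close> and
    to the blocks, so a small combination of the \<open>v\<close> yields a small combination of
    blocks.\<close>
  define w where "w j = (v (s j), u (s j))" for j
  define A where "A = convex hull (range w)"
  have "A \<subseteq> span (range w)" unfolding A_def by (rule convex_hull_subset_span)
  have dom: "nrm Z (snd a) <= C * nrm W (fst a)" if "a \<in> A" for a
  proof -
   have "a \<in> span (\<Union>j. {w j})" using subsetD[OF \<open>A \<subseteq> span (range w)\<close> that] by (simp add: UNION_singleton_eq_range)
   then obtain n t where t: "\<forall>j. t j \<in> span {w j}" "a = (\<Sum>j<(n :: nat). t j)" using span_Union_finite_support by blast
   have "\<exists>c. t j = c *\<^sub>R w j" for j using t(1) by (auto simp: span_singleton)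
   then obtain c where c: "!!j. t j = c j *\<^sub>R w j" by metis
   have "nrm Z (\<Sum>j<n. c j *\<^sub>R u (s j)) <= C * nrm W (\<Sum>j<n. c j *\<^sub>R v (s j))"
    by (rule UW[where p = s]) (use u g in \<open>simp_all add: sS\<close>)
   then show ?thesis unfolding t(2) c by (simp add: fst_sum snd_sum w_def)
  qed
  have "A \<subseteq> {a. fst a \<in> pts S & snd a \<in> pts Z & \<delta> <= f (snd a)}"
   unfolding A_def
  proof (rule hull_minimal)
   show "convex {a. fst a \<in> pts S & snd a \<in> pts Z & \<delta> <= f (snd a)}"
   proof (rule convexI)
    fix x y :: "'b \<times> 'a" and r t :: real
    assume x: "x \<in> {a. fst a \<in> pts S & snd a \<in> pts Z & \<delta> <= f (snd a)}" and y: "y \<in> {a. fst a \<in> pts S & snd a \<in> pts Z & \<delta> <= f (snd a)}"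
     and rt: "0 <= r" "0 <= t" "r + t = 1"
    have "r * \<delta> + t * \<delta> <= r * f (snd x) + t * f (snd y)" using x y rt by (intro add_mono mult_left_mono) auto
    then show "r *\<^sub>R x + t *\<^sub>R y \<in> {a. fst a \<in> pts S & snd a \<in> pts Z & \<delta> <= f (snd a)}"
     using x y rt(3) banach_normed[OF BS] by (simp add: pts_add pts_scale Z dual_add[OF f] dual_scale[OF f] flip: distrib_right)
   qed
  qed (use u v_S in \<open>auto simp: w_def\<close>)
  then have A: "fst a \<in> pts S" "snd a \<in> pts Z" "\<delta> <= f (snd a)" if "a \<in> A" for a using that by auto
  \<comment> \<open>A combination of the \<open>v\<close> of norm below \<open>c\<close> has a block
    counterpart of norm at most \<open>C * c\<close>, where \<open>f\<close> would be less than
    \<open>\<delta>\<close>.\<close>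
  define P where "P = C * (nrm (dual Z) f + 1)"
  define c where "c = \<delta> / P"
  have fn: "nrm (dual Z) f >= 0" by (rule dual_nrm_nonneg[OF Z f])
  then have P: "P > 0" using C by (simp add: P_def add_nonneg_pos)
  then have c: "c > 0" using \<delta> by (simp add: c_def)
  have "\<exists>x\<in>fst ` A. nrm S x < c"
  proof (rule mazur[OF banach_normed[OF BS] _ _ c])
   show "convex (fst ` A)" unfolding A_def by (intro convex_linear_image linear_fst convex_convex_hull)
   show "fst ` A \<subseteq> pts S" using A(1) by blast
   fix h assume "h \<in> pts (dual S)"
   then obtain M where M: "!!n. n >= M ==> \<bar>h (v n)\<bar> < c" using weakly_null_v[OF _ c] by blast
   have "s M >= M" using s by (simp add: strict_mono_imp_increasing)
   then have "h (v (s M)) < c" using M[of "s M"] by (simp add: abs_less_iff)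
   moreover have "w M \<in> A" unfolding A_def by (rule hull_inc) blast
   ultimately show "\<exists>x\<in>fst ` A. h x < c" by (force simp: w_def)
  qed
  then obtain a where a: "a \<in> A" "nrm W (fst a) < c" by (auto simp: nrm_S)
  have "\<delta> <= nrm (dual Z) f * nrm Z (snd a)" using A[OF a(1)] dual_bound[OF Z f A(2)[OF a(1)]] by linarith
  also have "\<dots> <= nrm (dual Z) f * (C * c)"
   using dom[OF a(1)] a(2) C mult_left_mono[of "nrm W (fst a)" c C] fn by (intro mult_left_mono) linarith+
  also have "\<dots> < P * c" using C c by (simp add: P_def algebra_simps)
  also have "\<dots> = \<delta>" using P by (simp add: c_def)
  finally show False by simp
 qed
 have U: "(\<Union>i. dual_FDD Z E i) \<subseteq> pts (dual Z)" by (auto simp: dual_FDD_def)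
 have "\<exists>a\<in>span (\<Union>i. dual_FDD Z E i). nrm (dual Z) (f - a) < e" if f: "f \<in> pts (dual Z)" and e: "e > 0" for f e
 proof -
  obtain n where n: "nrm (dual Z) (f - dproj f n) <= 2 * K * (e / (4 * K))" using approx[OF f, of "e / (4 * K)"] e K(1) by auto
  have "dproj f n \<in> span (\<Union>i. dual_FDD Z E i)"
   unfolding dproj_sum[OF f] using coord_mem[OF f] by (intro span_sum span_base) blast
  then show ?thesis using n e K(1) by (intro bexI[of _ "dproj f n"]) auto
 qed
 then show ?thesis using FDD closed_span_iff[OF D U] by (auto simp: shrinking_FDD_def)
qed

end

section \<open>Spaces with a decomposition built from block norms\<close>

lemma image_span_finite:
 fixes T :: "'a::real_vector => 'b::real_vector"
 assumes C: "finite C" and add: "!!x y. x \<in> span C ==> y \<in> span C ==> T (x + y) = T x + T y"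
  and scale: "!!c x. x \<in> span C ==> T (c *\<^sub>R x) = c *\<^sub>R T x"
 shows "T ` span C = span (T ` C)"
proof
 have T0: "T 0 = 0" using scale[OF span_zero, of 0] by simp
 have "T x \<in> span (T ` C) & x \<in> span C" if "x \<in> span C" for x
  using that
 proof (induction rule: span_induct_alt)
  case (step c x y)
  have "T (c *\<^sub>R x + y) = c *\<^sub>R T x + T y"
   using add[OF span_scale[OF span_base[OF step(1)]], of y c] step scale[OF span_base[OF step(1)]] by simp
  then show ?case using step by (auto intro!: span_add span_scale intro: span_base)
 qed (auto simp: T0 span_zero)
 then show "T ` span C \<subseteq> span (T ` C)" by blast
 show "span (T ` C) \<subseteq> T ` span C"
 proof (rule span_minimal)
  show "subspace (T ` span C)"
   unfolding subspace_def
  proof (intro conjI ballI allI)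
   show "0 \<in> T ` span C" using T0 span_zero by (metis imageI)
   fix a b assume "a \<in> T ` span C" "b \<in> T ` span C"
   then obtain x y where "x \<in> span C" "y \<in> span C" "a = T x" "b = T y" by blast
   then show "a + b \<in> T ` span C" using add[of x y] span_add[of x C y] by (metis imageI)
  next
   fix c :: real and a assume "a \<in> T ` span C"
   then obtain x where "x \<in> span C" "a = T x" by blast
   then show "c *\<^sub>R a \<in> T ` span C" using scale[of x c] span_scale[of x C c] by (metis imageI)
  qed
 qed (use span_superset in blast)
qed

definition single :: "nat => 'y::zero => nat => 'y"
 where "single i g = (\<lambda>k. if k = i then g else 0)"

text \<open>\<open>N i\<close> is the place that block \<open>i\<close> will occupy in the FDD, so
  that the minimum of a support becomes \<open>N (lo j)\<close>. Level 0 is kept trivial because the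
  estimates start at level 1.\<close>

locale block_norm = vseq W v
 for W :: "'v::real_vector nspace" and v +
 fixes G :: "nat => 'y::real_vector set" and nu :: "(nat => 'y) => real" and N :: "nat => nat" and C :: real
 assumes N: "strict_mono N" and C1: "C >= 1"
  and G_span: "\<exists>A. finite A & G i = span A" and G0: "G 0 = {0}"
  and nu_normed: "normed_space \<lparr>pts = {z. (\<forall>i. z i \<in> G i) & finite {i. z i ~= 0}}, nrm = nu\<rparr>"
  and nu_mono: "(\<forall>i. z i \<in> G i) ==> finite {i. z i ~= 0} ==> nu (\<lambda>i. if i < n then z i else 0) <= nu z"
  and nu_upper: "!!(k :: nat) y lo hi a. (!!j. j < k ==> (\<forall>i. y j i \<in> G i) & finite {i. y j i ~= 0} & nu (y j) <= 1 &
    1 <= lo j & lo j <= hi j & (\<forall>i. y j i ~= 0 --> lo j <= i & i <= hi j)) ==>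
   (!!i j. i < j ==> j < k ==> hi i < lo j) ==>
   nu (\<Sum>j<k. a j *\<^sub>R y j) <= C * nrm W (\<Sum>j<k. a j *\<^sub>R v (N (lo j)))"
begin

definition c00 :: "(nat => 'y) nspace"
 where "c00 = \<lparr>pts = {z. (\<forall>i. z i \<in> G i) & finite {i. z i ~= 0}}, nrm = nu\<rparr>"

lemma c00: "normed_space c00" using nu_normed by (simp add: c00_def)

lemma c00_iff: "z \<in> pts c00 \<longleftrightarrow> (\<forall>i. z i \<in> G i) & finite {i. z i ~= 0}" by (simp add: c00_def)

lemma nrm_c00: "nrm c00 = nu" by (simp add: c00_def)

lemma G_sub: "subspace (G i)" using G_span[of i] by (auto intro: subspace_span)

lemma single_c00: "g \<in> G i ==> single i g \<in> pts c00"
 using subspace_0[OF G_sub] by (auto simp: c00_iff single_def)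

lemma single_add: "single i (g + h) = single i g + single i (h::'y)"
 and single_scale: "single i (c *\<^sub>R g) = c *\<^sub>R single i (g::'y)"
 by (auto simp: single_def fun_eq_iff scaleR_fun_def)

lemma c00_sum_single:
 fixes y :: "nat => 'y"
 assumes "!!i. i >= n ==> y i = 0"
 shows "(\<Sum>i<n. single i (y i)) = y"
proof
 fix k
 have "(\<Sum>i<n. single i (y i)) k = (\<Sum>i<n. if i = k then y k else 0)"
  by (induction n) (auto simp: single_def)
 also have "\<dots> = y k" using assms[of k] by (simp add: not_less)
 finally show "(\<Sum>i<n. single i (y i)) k = y k" .
qed

lemma c00_countable_span: "\<exists>A. countable A & pts c00 = span A"
proof -
 obtain B where B: "!!i. finite (B i)" "!!i. G i = span (B i)" using G_span by metis
 define A where "A = (\<Union>i. single i ` B i)"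
 have "countable A" unfolding A_def using B(1) by (intro countable_UN) (auto intro: countable_finite)
 moreover have "span A \<subseteq> pts c00"
  using B(2) span_superset by (intro span_minimal normed_space_subspace[OF c00]) (auto simp: A_def intro!: single_c00)
 moreover have "y \<in> span A" if y: "y \<in> pts c00" for y
 proof -
  obtain n where "\<forall>i\<in>{i. y i ~= 0}. i < n"
   using y finite_nat_set_iff_bounded[of "{i. y i ~= 0}"] by (auto simp: c00_iff)
  then have n: "!!i. i >= n ==> y i = 0" by (meson leD mem_Collect_eq)
  have "single i (y i) \<in> span A" for i
  proof -
   have "y i \<in> span (B i)" using y B(2) by (auto simp: c00_iff)
   then have "single i (y i) \<in> single i ` span (B i)" by blast
   also have "\<dots> = span (single i ` B i)"
    by (rule image_span_finite[OF B(1)]) (auto simp: single_add single_scale)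
   also have "\<dots> \<subseteq> span A" by (intro span_mono) (auto simp: A_def)
   finally show ?thesis .
  qed
  then have "(\<Sum>i<n. single i (y i)) \<in> span A" by (intro span_sum)
  then show ?thesis using c00_sum_single[of n y] n by simp
 qed
 ultimately show ?thesis by blast
qed

theorem block_norm_space:
 assumes cd: "continuum_dimensional TYPE('z::real_vector)"
 obtains Z :: "'z::real_vector nspace" and E J where "banach_space Z" "shrinking_FDD Z E" "upper_block_estimates W v Z E"
  "bounded_operator c00 Z J" "!!y. y \<in> pts c00 ==> nrm Z (J y) = nu y"
  "!!z e. z \<in> pts Z ==> e > 0 ==> \<exists>y\<in>pts c00. nrm Z (z - J y) < e"
proof -
 obtain A where A: "countable A" "pts c00 = span A" using c00_countable_span by blast
 obtain Z :: "'z nspace" and J where ZB: "banach_space Z" and J: "bounded_operator c00 Z J"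
  and Jn: "!!y. y \<in> pts c00 ==> nrm Z (J y) = nu y"
  and Jd: "!!z e. z \<in> pts Z ==> e > 0 ==> \<exists>y\<in>pts c00. nrm Z (z - J y) < e"
  using completion[OF cd c00 A] unfolding nrm_c00 by blast
 note Z = banach_normed[OF ZB]
 have Ninj: "N i = N j \<longleftrightarrow> i = j" for i j using strict_mono_eq[OF N] by simp
 \<comment> \<open>The blocks are spread out to the places \<open>N i\<close>, with zero summands
   between them; this turns minimal supports into the indices for which \<open>nu_upper\<close> is
   available.\<close>
 define E where "E l = (if l \<in> range N then (\<lambda>g. J (single (inv N l) g)) ` G (inv N l) else {0})" for l
 have EN: "E (N i) = (\<lambda>g. J (single i g)) ` G i" for i
  using strict_mono_imp_inj_on[OF N] by (simp add: E_def)
 have E0: "E l = {0}" if "l \<notin> range N" for l using that by (simp add: E_def)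
 have Jadd: "J (y + y') = J y + J y'" if "y \<in> pts c00" "y' \<in> pts c00" for y y' by (rule op_add[OF J that])
 have Epts: "E l \<subseteq> pts Z" for l
 proof (cases "l \<in> range N")
  case True
  then obtain i where i: "l = N i" by blast
  show ?thesis unfolding i EN using op_mem[OF J single_c00] by blast
 next
  case False
  then show ?thesis using pts_zero[OF Z] by (simp add: E0)
 qed
 have Espan: "\<exists>A. finite A & E l = span A" for l
 proof (cases "l \<in> range N")
  case True
  then obtain i where i: "l = N i" by blast
  obtain B where B: "finite B" "G i = span B" using G_span by blast
  have "(\<lambda>g. J (single i g)) ` span B = span ((\<lambda>g. J (single i g)) ` B)"
   using B(2) by (intro image_span_finite[OF B(1)]) (auto simp: single_add single_scale Jadd single_c00 op_scale[OF J])
  then show ?thesis unfolding i EN using B by (metis finite_imageI)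
 next
  case False
  then show ?thesis by (intro exI[of _ "{}"]) (simp add: E0)
 qed
 have rep: "\<exists>y. (\<forall>i. y i \<in> G i) & (\<forall>n. (\<lambda>i. if N i < n then y i else 0) \<in> pts c00 & (\<Sum>l<n. s l) = J (\<lambda>i. if N i < n then y i else 0))"
  if s: "!!l. s l \<in> E l" for s
 proof -
  have "\<exists>g. g \<in> G i & s (N i) = J (single i g)" for i using s[of "N i"] unfolding EN by blast
  then obtain y where y: "!!i. y i \<in> G i" "!!i. s (N i) = J (single i (y i))" by metis
  have c: "(\<lambda>i. if N i < n then y i else 0) \<in> pts c00" for n
  proof -
   have "{i. (if N i < n then y i else 0) ~= 0} \<subseteq> {..<n}"
    using strict_mono_imp_increasing[OF N] by (auto intro: le_less_trans split: if_splits)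
   then have "finite {i. (if N i < n then y i else 0) ~= 0}" by (rule finite_subset) simp
   then show ?thesis unfolding c00_iff using y(1) subspace_0[OF G_sub] by (intro conjI allI) auto
  qed
  have "(\<Sum>l<n. s l) = J (\<lambda>i. if N i < n then y i else 0)" for n
  proof (induction n)
   case 0
   have "(\<lambda>i. if N i < 0 then y i else 0) = 0" by auto
   then show ?case using op_zero[OF J c00] by (simp only:) simp
  next
   case (Suc n)
   show ?case
   proof (cases "n \<in> range N")
    case True
    then obtain i where i: "n = N i" by blast
    have "(\<lambda>k. if N k < Suc n then y k else 0) = (\<lambda>k. if N k < n then y k else 0) + single i (y i)"
     by (auto simp: fun_eq_iff single_def i less_Suc_eq Ninj)
    then show ?thesis using Suc Jadd[OF c single_c00[OF y(1)], of n i] by (simp add: i y(2))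
   next
    case False
    then have "(\<lambda>k. if N k < Suc n then y k else 0) = (\<lambda>k. if N k < n then y k else 0)"
     by (auto simp: fun_eq_iff less_Suc_eq)
    then show ?thesis using Suc s[of n] E0[OF False] by simp
   qed
  qed
  then show ?thesis using y(1) c by blast
 qed
 have sums: "\<exists>s. (\<forall>l. s l \<in> E l) & (\<forall>i. s (N i) = J (single i (y i))) & (\<forall>l. l \<notin> range N --> s l = 0) &
   (\<Sum>l<N n. s l) = J y" if y: "y \<in> pts c00" and n: "!!i. i >= n ==> y i = 0" for y n
 proof -
  define s where "s l = (if l \<in> range N then J (single (inv N l) (y (inv N l))) else 0)" for l
  have sN: "s (N i) = J (single i (y i))" for i using strict_mono_imp_inj_on[OF N] by (simp add: s_def)
  have yG: "y i \<in> G i" for i using y by (simp add: c00_iff)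
  have "s l \<in> E l" for l
  proof (cases "l \<in> range N")
   case True
   then obtain i where i: "l = N i" by blast
   then show ?thesis unfolding i EN sN using yG by blast
  qed (simp add: s_def E0)
  moreover have "(\<Sum>l<N n. s l) = (\<Sum>i<n. s (N i))"
  proof -
   have "(\<Sum>l<N n. s l) = (\<Sum>l\<in>N ` {..<n}. s l)"
    by (rule sum.mono_neutral_right) (auto simp: s_def strict_mono_less[OF N])
   then show ?thesis using strict_mono_imp_inj_on[OF N] by (simp add: sum.reindex inj_on_subset)
  qed
  moreover have "(\<Sum>i<n. s (N i)) = J (\<Sum>i<n. single i (y i))"
   unfolding sN using op_sum[OF J c00, of "{..<n}" "\<lambda>i. single i (y i)"] single_c00[OF yG] by simp
  ultimately show ?thesis using sN c00_sum_single[of n y] n by (intro exI[of _ s]) (simp add: s_def)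
 qed
 have bnd: "\<exists>n. \<forall>i\<ge>n. y i = 0" if y: "y \<in> pts c00" for y
  using y finite_nat_set_iff_bounded[of "{i. y i ~= 0}"] by (auto simp: c00_iff not_less) (meson leD)
 have "is_FDD Z E"
 proof (rule is_FDD_I[OF ZB Epts Espan, where K = 1])
  fix s and m n :: nat assume s: "!!l. s l \<in> E l" and mn: "m <= n"
  obtain y where y: "!!n. (\<lambda>i. if N i < n then y i else 0) \<in> pts c00 & (\<Sum>l<n. s l) = J (\<lambda>i. if N i < n then y i else 0)"
   using rep[OF s] by blast
  \<comment> \<open>The first block placed at or after \<open>m\<close>: cutting the series at
    \<open>m\<close> means cutting the sequence at \<open>r\<close>, which \<open>nu_mono\<close>
    handles.\<close>
  define r where "r = (LEAST i. m <= N i)"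
  have mr: "m <= N r" unfolding r_def by (rule LeastI[of _ m]) (rule strict_mono_imp_increasing[OF N])
  have Nr: "N i < m \<longleftrightarrow> i < r" for i
  proof
   assume "N i < m"
   then show "i < r" using mr strict_mono_less_eq[OF N, of r i] by linarith
  next
   assume "i < r"
   then show "N i < m" using not_less_Least[of i "\<lambda>i. m <= N i"] by (simp add: r_def not_le)
  qed
  have "(\<lambda>i. if N i < m then y i else 0) = (\<lambda>i. if i < r then (if N i < n then y i else 0) else 0)"
  proof
   fix i
   have "N i < n" if "i < r" using Nr[of i] that mn by linarith
   then show "(if N i < m then y i else 0) = (if i < r then (if N i < n then y i else 0) else 0)"
    by (simp add: Nr)
  qed
  then have "nu (\<lambda>i. if N i < m then y i else 0) <= nu (\<lambda>i. if N i < n then y i else 0)"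
   using nu_mono[of "\<lambda>i. if N i < n then y i else 0" r] y[of n] by (simp add: c00_iff)
  then show "nrm Z (\<Sum>l<m. s l) <= 1 * nrm Z (\<Sum>l<n. s l)"
   using y Jn by simp
 next
  fix z and e :: real assume "z \<in> pts Z" "e > 0"
  then obtain y where y: "y \<in> pts c00" "nrm Z (z - J y) < e" using Jd by blast
  obtain n where n: "!!i. i >= n ==> y i = 0" using bnd[OF y(1)] by blast
  from sums[OF y(1) n] obtain s where "(\<forall>l. s l \<in> E l) & (\<forall>i. s (N i) = J (single i (y i))) &
   (\<forall>l. l \<notin> range N --> s l = 0) & (\<Sum>l<N n. s l) = J y" ..
  then show "\<exists>s n. (\<forall>i. s i \<in> E i) & nrm Z (z - (\<Sum>i<n. s i)) < e"
   using y(2) by (intro exI[of _ s] exI[of _ "N n"]) simp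
 qed
 then interpret Zf: fdd Z E using ZB by unfold_locales
 have Jinj: "J y = 0 \<longleftrightarrow> y = 0" if "y \<in> pts c00" for y
  using Jn[OF that] nrm_eq_0[OF Z op_mem[OF J that]] nrm_eq_0[OF c00 that] by (simp add: nrm_c00)
 have suppJ: "supp Z E (J y) = N ` {i. y i ~= 0}" if y: "y \<in> pts c00" for y
 proof -
  obtain n where n: "!!i. i >= n ==> y i = 0" using bnd[OF y] by blast
  from sums[OF y n] obtain s where s0: "(\<forall>l. s l \<in> E l) & (\<forall>i. s (N i) = J (single i (y i))) &
   (\<forall>l. l \<notin> range N --> s l = 0) & (\<Sum>l<N n. s l) = J y" ..
  then have s: "!!l. s l \<in> E l" "!!i. s (N i) = J (single i (y i))" "!!l. l \<notin> range N ==> s l = 0"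
   "(\<Sum>l<N n. s l) = J y" by auto
  have sn: "s (N i) ~= 0 \<longleftrightarrow> y i ~= 0" for i
  proof -
   have "y i \<in> G i" using y by (simp add: c00_iff)
   moreover have "single i (y i) = 0 \<longleftrightarrow> y i = 0" by (auto simp: single_def fun_eq_iff)
   ultimately show ?thesis unfolding s(2) using Jinj[OF single_c00] by simp
  qed
  have "component Z E (J y) = (\<lambda>l. if l < N n then s l else 0)"
   using Zf.comp_finite_sum[of s "N n"] s(1,4) by simp
  then have "supp Z E (J y) = {l. l < N n & s l ~= 0}" by (auto simp: supp_def)
  also have "\<dots> = N ` {i. y i ~= 0}"
  proof (intro equalityI subsetI)
   fix l assume "l \<in> {l. l < N n & s l ~= 0}"
   then show "l \<in> N ` {i. y i ~= 0}" using s(3)[of l] sn by (auto simp: image_iff)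
  next
   fix l assume "l \<in> N ` {i. y i ~= 0}"
   then obtain i where i: "l = N i" "y i ~= 0" by blast
   then have "i < n" using n[of i] not_le by blast
   then show "l \<in> {l. l < N n & s l ~= 0}" using i sn[of i] strict_mono_less[OF N, of i n] by simp
  qed
  finally show ?thesis .
 qed
 have fin: "\<exists>y\<in>pts c00. z = J y" if z: "z \<in> pts Z" "finite (supp Z E z)" for z
 proof -
  obtain n where n: "\<forall>l\<in>supp Z E z. l < n" using z(2) finite_nat_set_iff_bounded[of "supp Z E z"] by auto
  have "proj Z E n z = z" by (rule Zf.supp_bounded_eq[OF z(1)]) (use n in \<open>force simp: supp_def\<close>)
  moreover from rep[OF Zf.comp_mem[OF z(1)]] obtain y where
   "(\<forall>i. y i \<in> G i) & (\<forall>n. (\<lambda>i. if N i < n then y i else 0) \<in> pts c00 &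
    (\<Sum>l<n. component Z E z l) = J (\<lambda>i. if N i < n then y i else 0))" ..
  ultimately show ?thesis unfolding proj_def by (intro bexI[of _ "\<lambda>i. if N i < n then y i else 0"]) auto
 qed
 have "upper_block_estimates W v Z E"
  unfolding upper_block_estimates_def
 proof (intro exI[of _ C] conjI C1 allI impI)
  fix z assume "block_seq Z E z & normalized Z z"
  then have z: "!!j. z j \<in> pts Z" "!!j. z j ~= 0" "!!j. finite (supp Z E (z j))" "!!j. nrm Z (z j) = 1"
   and bl: "!!j. Max (supp Z E (z j)) < Min (supp Z E (z (Suc j)))"
   by (auto simp: block_seq_def normalized_def)
  have "\<exists>x. x \<in> pts c00 & z j = J x" for j using fin[OF z(1) z(3), of j] by blast
  then have "\<forall>j. \<exists>x. x \<in> pts c00 & z j = J x" ..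
  from choice[OF this] obtain y where y: "!!j. y j \<in> pts c00" "!!j. z j = J (y j)" by blast
  define I where "I j = {i. y j i ~= 0}" for j
  have I: "finite (I j)" for j using y(1)[of j] by (simp add: I_def c00_iff)
  have sI: "supp Z E (z j) = N ` I j" for j using suppJ[OF y(1)] by (simp add: y(2) I_def)
  have Ine: "I j ~= {}" for j using Zf.supp_nonempty[OF z(1,2), of j] by (simp add: sI)
  have mono: "mono N" using N by (rule strict_mono_mono)
  have MM: "Min (supp Z E (z j)) = N (Min (I j))" "Max (supp Z E (z j)) = N (Max (I j))" for j
   unfolding sI using mono_Min_commute[OF mono I Ine] mono_Max_commute[OF mono I Ine] by auto
  have lh: "Max (I j) < Min (I (Suc j))" for j using bl[of j] by (simp add: MM strict_mono_less[OF N])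
  have mM: "Min (I j) <= Max (I j)" for j using I Ine by simp
  have lt: "Max (I i) < Min (I j)" if "i < j" for i j
   using that
  proof (induction j)
   case (Suc j)
   then show ?case using lh[of j] mM[of j] by (cases "i = j") (auto intro: less_trans le_less_trans)
  qed simp
  have "y j 0 = 0" for j using y(1)[of j] G0 by (auto simp: c00_iff)
  then have pos: "1 <= Min (I j)" for j
   using Min_in[OF I Ine, of j] by (auto simp: I_def Suc_le_eq intro: ccontr)
  show "dominated_by C Z z W (\<lambda>i. v (Min (supp Z E (z i))))"
   unfolding dominated_by_def MM
  proof (intro allI)
   fix n and a :: "nat => real"
   have P: "(\<Sum>i<n. a i *\<^sub>R y i) \<in> pts c00" by (intro pts_sum[OF c00] pts_scale[OF c00] y(1))
   have "(\<Sum>i<n. a i *\<^sub>R z i) = J (\<Sum>i<n. a i *\<^sub>R y i)"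
    using op_sum[OF J c00, of "{..<n}" "\<lambda>i. a i *\<^sub>R y i"] by (simp add: y pts_scale[OF c00] op_scale[OF J])
   then have "nrm Z (\<Sum>i<n. a i *\<^sub>R z i) = nu (\<Sum>i<n. a i *\<^sub>R y i)" using Jn[OF P] by simp
   also have "\<dots> <= C * nrm W (\<Sum>i<n. a i *\<^sub>R v (N (Min (I i))))"
   proof (rule nu_upper[of n y "\<lambda>j. Min (I j)" "\<lambda>j. Max (I j)"])
    fix j assume "j < n"
    have "lo <= i & i <= hi" if "y j i ~= 0" "lo = Min (I j)" "hi = Max (I j)" for i lo hi
     using that I[of j] by (auto simp: I_def)
    then show "(\<forall>i. y j i \<in> G i) & finite {i. y j i ~= 0} & nu (y j) <= 1 & 1 <= Min (I j) & Min (I j) <= Max (I j) &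
      (\<forall>i. y j i ~= 0 --> Min (I j) <= i & i <= Max (I j))"
     using y(1)[of j] z(4)[of j] Jn[OF y(1)] pos[of j] mM[of j] by (auto simp: c00_iff y(2))
   qed (use lt in auto)
   finally show "nrm Z (\<Sum>i<n. a i *\<^sub>R z i) <= C * nrm W (\<Sum>i<n. a i *\<^sub>R v (N (Min (I i))))" .
  qed
 qed
 moreover from this have "shrinking_FDD Z E" by (intro Zf.upper_estimates_imp_shrinking) unfold_locales
 ultimately show ?thesis using that ZB J Jn Jd by blast
qed

end

text \<open>Serves the interval norm and the pairing norm alike, both suprema of seminorms that
  separate points.\<close>

lemma sup_seminorms_normed:
 assumes P: "subspace P" and ne: "T ~= {}"
  and nonneg: "!!t x. t \<in> T ==> x \<in> P ==> (0::real) <= p t x"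
  and add: "!!t x y. t \<in> T ==> x \<in> P ==> y \<in> P ==> p t (x + y) <= p t x + p t y"
  and scale: "!!t c x. t \<in> T ==> x \<in> P ==> p t (c *\<^sub>R x) = \<bar>c\<bar> * p t x"
  and bdd: "!!x. x \<in> P ==> bdd_above ((\<lambda>t. p t x) ` T)"
  and sep: "!!x. x \<in> P ==> (!!t. t \<in> T ==> p t x = 0) ==> x = 0"
 shows "normed_space \<lparr>pts = P, nrm = \<lambda>x. SUP t\<in>T. p t x\<rparr>"
proof -
 define q where "q = (\<lambda>x. SUP t\<in>T. p t x)"
 have up: "p t x <= q x" if "t \<in> T" "x \<in> P" for t x
  unfolding q_def by (rule cSUP_upper[OF that(1) bdd[OF that(2)]])
 have least: "q x <= c" if "!!t. t \<in> T ==> p t x <= c" for x c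
  unfolding q_def by (rule cSUP_least[OF ne that])
 have q0: "0 <= q x" if "x \<in> P" for x
 proof -
  obtain t where "t \<in> T" using ne by blast
  then show ?thesis using up[OF _ that] nonneg[OF _ that] order_trans by blast
 qed
 have le: "q (c *\<^sub>R x) <= \<bar>c\<bar> * q x" if "x \<in> P" for c x
  by (rule least) (use up[OF _ that] scale[OF _ that] in \<open>auto intro: mult_left_mono\<close>)
 have "normed_space \<lparr>pts = P, nrm = q\<rparr>"
  unfolding normed_space_def nspace.simps
 proof (intro conjI ballI allI P)
  fix x y and c :: real assume x: "x \<in> P"
  show "0 <= q x" by (rule q0[OF x])
  show "q x = 0 \<longleftrightarrow> x = 0"
  proof
   assume "q x = 0"
   then have "p t x = 0" if "t \<in> T" for t using up[OF that x] nonneg[OF that x] by simp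
   then show "x = 0" by (rule sep[OF x])
  next
   assume "x = 0"
   then have "q x <= 0" using le[OF x, of 0] by simp
   then show "q x = 0" using q0[OF x] by simp
  qed
  show "q (c *\<^sub>R x) = \<bar>c\<bar> * q x"
  proof (cases "c = 0")
   case True
   then show ?thesis using le[OF x, of 0] q0[OF subspace_0[OF P]] by simp
  next
   case False
   then show ?thesis using le[OF x, of c] le[OF subspace_scale[OF P x], of "1/c" c] by (simp add: field_simps)
  qed
  assume y: "y \<in> P"
  show "q (x + y) <= q x + q y"
   by (rule least) (use add[OF _ x y] up[OF _ x] up[OF _ y] in \<open>force intro: order_trans add_mono\<close>)
 qed
 then show ?thesis by (simp add: q_def)
qed

lemma finite_sequences_subspace:
 fixes G :: "nat => 'y::real_vector set"
 assumes G: "!!i. subspace (G i)"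
 shows "subspace {z. (\<forall>i. z i \<in> G i) & finite {i. z i ~= 0}}"
proof -
 have "finite {i. z i + w i ~= 0}" if "finite {i. z i ~= 0}" "finite {i. w i ~= 0}" for z w :: "nat => 'y"
  by (rule finite_subset[OF _ finite_UnI[OF that]]) auto
 moreover have "finite {i. c *\<^sub>R z i ~= 0}" if "finite {i. z i ~= 0}" for z :: "nat => 'y" and c
  by (rule finite_subset[OF _ that]) auto
 ultimately show ?thesis
  unfolding subspace_def
  by (auto simp: scaleR_fun_def subspace_0[OF G] subspace_add[OF G] subspace_scale[OF G])
qed

lemma finite_sequence_bound:
 fixes y :: "nat => 'y::zero"
 assumes "finite {i. y i ~= 0}"
 shows "\<exists>n. \<forall>i\<ge>n. y i = 0"
proof -
 obtain n where "\<forall>i\<in>{i. y i ~= 0}. i < n"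
  using assms finite_nat_set_iff_bounded[of "{i. y i ~= 0}"] by auto
 then show ?thesis by (meson leD mem_Collect_eq)
qed

lemma extend_along_dense_isometry:
 assumes N: "normed_space N" and Z: "normed_space Z" and Y: "banach_space Y" and J: "bounded_operator N Z J"
  and iso: "!!y. y \<in> pts N ==> nrm Z (J y) = nrm N y"
  and dense: "!!z e. z \<in> pts Z ==> e > 0 ==> \<exists>y\<in>pts N. nrm Z (z - J y) < e"
  and L: "bounded_operator N Y L"
 obtains Q where "bounded_operator Z Y Q" "!!y. y \<in> pts N ==> Q (J y) = L y"
proof -
 have inj: "inj_on J (pts N)"
 proof (rule inj_onI)
  fix x y assume xy: "x \<in> pts N" "y \<in> pts N" "J x = J y"
  then have "J (x - y) = 0" using op_diff[OF J N] by simp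
  then have "nrm N (x - y) = 0" using iso[OF pts_diff[OF N xy(1,2)]] nrm_zero[OF Z] by simp
  then show "x = y" using nrm_eq_0[OF N pts_diff[OF N xy(1,2)]] by simp
 qed
 define T where "T z = L (inv_into (pts N) J z)" for z
 have T: "T (J y) = L y" if "y \<in> pts N" for y by (simp add: T_def inv_into_f_f[OF inj that])
 obtain K where K: "K > 0" "!!x. x \<in> pts N ==> nrm Y (L x) <= K * nrm N x" using op_bound[OF L N] by blast
 have sub: "subspace (J ` pts N)"
  unfolding subspace_def
 proof (intro conjI ballI allI)
  show "0 \<in> J ` pts N" using op_zero[OF J N] pts_zero[OF N] by (metis imageI)
  fix a b assume "a \<in> J ` pts N" "b \<in> J ` pts N"
  then obtain x y where "x \<in> pts N" "y \<in> pts N" "a = J x" "b = J y" by blast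
  then show "a + b \<in> J ` pts N" using op_add[OF J] pts_add[OF N] by (metis imageI)
 next
  fix c :: real and a assume "a \<in> J ` pts N"
  then obtain x where "x \<in> pts N" "a = J x" by blast
  then show "c *\<^sub>R a \<in> J ` pts N" using op_scale[OF J] pts_scale[OF N] by (metis imageI)
 qed
 obtain Q where Q: "bounded_operator Z Y Q" "!!x. x \<in> J ` pts N ==> Q x = T x"
 proof (rule extend_dense[OF Z Y sub, where T = T and K = K and c = 0])
  show "J ` pts N \<subseteq> pts Z" using op_mem[OF J] by blast
  show "\<exists>d\<in>J ` pts N. nrm Z (x - d) < e" if "x \<in> pts Z" "0 < e" for x e using dense[OF that] by blast
  fix a assume "a \<in> J ` pts N"
  then obtain x where x: "x \<in> pts N" "a = J x" by blast
  show "T a \<in> pts Y" using x T op_mem[OF L] by simp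
  then show "0 * nrm Z a <= nrm Y (T a)" using nrm_nonneg[OF banach_normed[OF Y]] by simp
  show "nrm Y (T a) <= K * nrm Z a" using x T K iso by simp
  show "T (c *\<^sub>R a) = c *\<^sub>R T a" for c
   using x T[OF pts_scale[OF N x(1)]] T[OF x(1)] by (simp add: op_scale[OF J] op_scale[OF L])
  fix b assume "b \<in> J ` pts N"
  then obtain y where y: "y \<in> pts N" "b = J y" by blast
  show "T (a + b) = T a + T b"
   using x y T[OF pts_add[OF N x(1) y(1)]] T[OF x(1)] T[OF y(1)] by (simp add: op_add[OF J] op_add[OF L])
 qed blast
 then show ?thesis using that T by (metis imageI)
qed

section \<open>The interval norm and the quotient map\<close>

context game
begin

text \<open>Contains the difference of a vector of \<open>F i\<close> and one of
  \<open>F (i - 1)\<close> with the same values on \<open>H (i - 1)\<close>, such as lifts of one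
  vector to consecutive levels.\<close>

definition layer :: "nat => 'x set"
 where "layer i = (if i = 0 then {0} else {x \<in> F i. \<forall>h\<in>H (i - 1). h x = 0})"

text \<open>With all intervals in place of initial segments, every interval sum of a normalized
  block stays in the unit ball of \<open>X\<close>, as the estimate for combinations
  requires.\<close>

definition interval_norm :: "(nat => 'x) => real"
 where "interval_norm z = (SUP (m, n)\<in>UNIV. nrm X (\<Sum>i\<in>{m..<n}. z i))"

definition layer_seqs :: "(nat => 'x) set"
 where "layer_seqs = {z. (\<forall>i. z i \<in> layer i) & finite {i. z i ~= 0}}"

lemma layer_F: "layer i \<subseteq> F i" using subspace_0[OF F_sub] by (auto simp: layer_def)

lemma layer_annihilated:
 assumes "x \<in> layer i" "h \<in> H j" "j < i"
 shows "h x = 0"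
proof -
 have "H j \<subseteq> H (i - 1)" using assms(3) by (intro H_mono) simp
 then show ?thesis using assms by (auto simp: layer_def)
qed

lemma layer_sub: "subspace (layer i)"
proof (cases "i = 0")
 case False
 have *: "h (x + y) = h x + h y" "h (c *\<^sub>R x) = c * h x" "h 0 = 0" if "h \<in> H (i - 1)" "x \<in> F i" "y \<in> F i" for h x y c
  using dual_add[OF H_pts F_pts F_pts, OF that] dual_scale[OF H_pts F_pts, OF that(1,2)] dual_zero[OF H_pts[OF that(1)] X]
  by auto
 have eq: "layer i = {x \<in> F i. \<forall>h\<in>H (i - 1). h x = 0}" using False by (simp add: layer_def)
 show ?thesis
  unfolding eq
 proof (rule subspaceI)
  show "0 \<in> {x \<in> F i. \<forall>h\<in>H (i - 1). h x = 0}" using *(3) subspace_0[OF F_sub[of i]] by blast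
  fix x assume x: "x \<in> {x \<in> F i. \<forall>h\<in>H (i - 1). h x = 0}"
  have "h (c *\<^sub>R x) = 0" if "h \<in> H (i - 1)" for h c using *(2)[OF that, of x x c] x that by simp
  then show "c *\<^sub>R x \<in> {x \<in> F i. \<forall>h\<in>H (i - 1). h x = 0}" for c
   using x subspace_scale[OF F_sub[of i], of x c] by blast
  fix y assume "y \<in> {x \<in> F i. \<forall>h\<in>H (i - 1). h x = 0}"
  moreover have "h (x + y) = 0" if "h \<in> H (i - 1)" for h
  proof -
   have "h x = 0" "h y = 0" using x calculation that by blast+
   then show ?thesis using *(1)[OF that, of x y] x calculation by simp
  qed
  ultimately show "x + y \<in> {x \<in> F i. \<forall>h\<in>H (i - 1). h x = 0}"
   using x subspace_add[OF F_sub[of i], of x y] by blast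
 qed
qed (simp add: layer_def subspace_single_0)

lemma layer_seqs_sub: "subspace layer_seqs"
 unfolding layer_seqs_def by (rule finite_sequences_subspace[OF layer_sub])

lemma layer_seq_pts: "z \<in> layer_seqs ==> z i \<in> pts X"
 using layer_F F_pts unfolding layer_seqs_def by blast

lemma interval_bdd: "z \<in> layer_seqs ==> bdd_above (range (\<lambda>(m, n). nrm X (\<Sum>i\<in>{m..<n}. z i)))"
proof -
 assume z: "z \<in> layer_seqs"
 have fin: "finite {i. z i ~= 0}" using z by (simp add: layer_seqs_def)
 have "nrm X (\<Sum>i\<in>{m..<n}. z i) <= (\<Sum>i\<in>{i. z i ~= 0}. nrm X (z i))" for m n
 proof -
  have "nrm X (\<Sum>i\<in>{m..<n}. z i) <= (\<Sum>i\<in>{m..<n}. nrm X (z i))" by (rule nrm_sum[OF X layer_seq_pts[OF z]])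
  also have "\<dots> = (\<Sum>i\<in>{m..<n} \<inter> {i. z i ~= 0}. nrm X (z i))"
   using nrm_zero[OF X] by (intro sum.mono_neutral_right) auto
  also have "\<dots> <= (\<Sum>i\<in>{i. z i ~= 0}. nrm X (z i))"
   using fin nrm_nonneg[OF X layer_seq_pts[OF z]] by (intro sum_mono2) auto
  finally show ?thesis .
 qed
 then show ?thesis by (intro bdd_aboveI) auto
qed

lemma interval_le: "z \<in> layer_seqs ==> nrm X (\<Sum>i\<in>{m..<n}. z i) <= interval_norm z"
 unfolding interval_norm_def using cSUP_upper[OF _ interval_bdd, of "(m, n)" z] by simp

lemma interval_norm_le: "(!!m n. nrm X (\<Sum>i\<in>{m..<n}. z i) <= c) ==> interval_norm z <= c"
 unfolding interval_norm_def by (rule cSUP_least) auto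

lemma interval_normed: "normed_space \<lparr>pts = layer_seqs, nrm = interval_norm\<rparr>"
proof -
 have eq: "interval_norm = (\<lambda>z. SUP t\<in>UNIV. nrm X (\<Sum>i\<in>{fst t..<snd t}. z i))"
  by (simp add: fun_eq_iff interval_norm_def case_prod_beta')
 have P: "(\<Sum>i\<in>I. z i) \<in> pts X" if "z \<in> layer_seqs" for I z by (rule pts_sum[OF X layer_seq_pts[OF that]])
 show ?thesis
  unfolding eq
 proof (rule sup_seminorms_normed[OF layer_seqs_sub])
  fix t :: "nat \<times> nat" and z assume z: "z \<in> layer_seqs"
  show "0 <= nrm X (\<Sum>i\<in>{fst t..<snd t}. z i)" by (rule nrm_nonneg[OF X P[OF z]])
  show "nrm X (\<Sum>i\<in>{fst t..<snd t}. (c *\<^sub>R z) i) = \<bar>c\<bar> * nrm X (\<Sum>i\<in>{fst t..<snd t}. z i)" for c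
   using nrm_scale[OF X P[OF z]] by (simp add: scaleR_fun_def scaleR_sum_right[symmetric])
  show "bdd_above ((\<lambda>t. nrm X (\<Sum>i\<in>{fst t..<snd t}. z i)) ` UNIV)"
   using interval_bdd[OF z] by (simp add: case_prod_beta')
  show "nrm X (\<Sum>i\<in>{fst t..<snd t}. (z + w) i) <= nrm X (\<Sum>i\<in>{fst t..<snd t}. z i) + nrm X (\<Sum>i\<in>{fst t..<snd t}. w i)"
   if "w \<in> layer_seqs" for w
   using nrm_add[OF X P[OF z] P[OF that]] by (simp add: sum.distrib)
 next
  fix z assume z: "z \<in> layer_seqs" and 0: "!!t. t \<in> UNIV ==> nrm X (\<Sum>i\<in>{fst t..<snd t}. z i) = 0"
  have "z i = 0" for i
   using 0[of "(i, Suc i)"] nrm_eq_0[OF X layer_seq_pts[OF z, of i]] by simp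
  then show "z = 0" by auto
 qed simp
qed

text \<open>An interval sum of a combination is the same combination of interval sums of the blocks,
  each in \<open>F (hi j)\<close> and annihilated by \<open>H (lo j - 1)\<close>. Since
  \<open>lo j - 1\<close> may equal the end of the preceding block, the estimate with overlaps is
  used.\<close>

lemma layer_block_norm:
 assumes G: "good_estimate C N F H" and C: "C >= 1" and N: "strict_mono N"
 shows "block_norm W v layer interval_norm N (2 * C + 2)"
proof unfold_locales
 show "strict_mono N" "1 <= 2 * C + 2" using N C by auto
 show "layer 0 = {0}" by (simp add: layer_def)
 show "\<exists>A. finite A & layer i = span A" for i
 proof -
  obtain B where "finite B" "F i = span B" using F_span by blast
  then show ?thesis using finite_span_subspace[OF layer_sub, of i B] layer_F by metis
 qed
 show "normed_space \<lparr>pts = {z. (\<forall>i. z i \<in> layer i) & finite {i. z i ~= 0}}, nrm = interval_norm\<rparr>"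
  using interval_normed by (simp add: layer_seqs_def)
 show "interval_norm (\<lambda>i. if i < n then z i else 0) <= interval_norm z"
  if "\<forall>i. z i \<in> layer i" "finite {i. z i ~= 0}" for z n
 proof (rule interval_norm_le)
  fix m k
  have "(\<Sum>i\<in>{m..<k}. if i < n then z i else 0) = (\<Sum>i\<in>{m..<min k n}. z i)"
   by (intro sum.mono_neutral_cong_right) auto
  then show "nrm X (\<Sum>i\<in>{m..<k}. if i < n then z i else 0) <= interval_norm z"
   using interval_le[of z m "min k n"] that by (simp add: layer_seqs_def)
 qed
 fix k :: nat and y :: "nat => nat => 'x" and lo hi a
 assume y: "!!j. j < k ==> (\<forall>i. y j i \<in> layer i) & finite {i. y j i ~= 0} & interval_norm (y j) <= 1 &
   1 <= lo j & lo j <= hi j & (\<forall>i. y j i ~= 0 --> lo j <= i & i <= hi j)"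
  and sep: "!!i j. i < j ==> j < k ==> hi i < lo j"
 show "interval_norm (\<Sum>j<k. a j *\<^sub>R y j) <= (2 * C + 2) * nrm W (\<Sum>j<k. a j *\<^sub>R v (N (lo j)))"
 proof (rule interval_norm_le)
  fix m n
  define w where "w j = (\<Sum>i\<in>{m..<n}. y j i)" for j
  have "(\<Sum>i\<in>{m..<n}. (\<Sum>j<k. a j *\<^sub>R y j) i) = (\<Sum>i\<in>{m..<n}. \<Sum>j<k. a j *\<^sub>R y j i)"
   by (simp add: sum_fun_apply scaleR_fun_def)
  also have "\<dots> = (\<Sum>j<k. a j *\<^sub>R w j)"
   unfolding w_def scaleR_sum_right by (rule sum.swap)
  finally have eq: "(\<Sum>i\<in>{m..<n}. (\<Sum>j<k. a j *\<^sub>R y j) i) = (\<Sum>j<k. a j *\<^sub>R w j)" .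
  show "nrm X (\<Sum>i\<in>{m..<n}. (\<Sum>j<k. a j *\<^sub>R y j) i) <= (2 * C + 2) * nrm W (\<Sum>j<k. a j *\<^sub>R v (N (lo j)))"
   unfolding eq
  proof (rule upper_estimate_overlapping[OF G C N])
   fix j assume j: "j < k"
   have yl: "y j i \<in> layer i" for i using y[OF j] by blast
   have "y j i \<in> F (hi j)" for i
   proof (cases "y j i = 0")
    case False
    then have "i <= hi j" using y[OF j] by blast
    then show ?thesis using yl[of i] layer_F[of i] F_mono[of i "hi j"] by blast
   qed (simp add: subspace_0[OF F_sub])
   then have wF: "w j \<in> F (hi j)" unfolding w_def by (intro subspace_sum[OF F_sub])
   have "h (w j) = 0" if h: "h \<in> H (lo j - 1)" for h
   proof -
    have "h (y j i) = 0" for i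
     using y[OF j] layer_annihilated[OF yl h, of i] dual_zero[OF H_pts[OF h] X] by (cases "y j i = 0") auto
    moreover have "h (w j) = (\<Sum>i\<in>{m..<n}. h (y j i))"
     unfolding w_def using yl layer_F F_pts by (intro dual_sum[OF H_pts[OF h] X]) blast
    ultimately show ?thesis by simp
   qed
   moreover have "nrm X (w j) <= 1" using interval_le[of "y j" m n] y[OF j] by (simp add: w_def layer_seqs_def)
   ultimately show "lo j - 1 <= hi j & w j \<in> F (hi j) & (\<forall>h\<in>H (lo j - 1). h (w j) = 0) & nrm X (w j) <= 1"
    using wF y[OF j] by auto
  next
   fix i j assume j: "j < k" and ij: "i + 2 <= j"
   have "hi i < lo (Suc i)" "hi (Suc i) < lo j" "lo (Suc i) <= hi (Suc i)" "lo i <= hi i"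
    using sep[of i "Suc i"] sep[of "Suc i" j] y[of "Suc i"] y[of i] j ij by auto
   then show "hi i < lo j - 1 & max (N (lo i - 1)) (N (lo i)) < min (N (lo j - 1)) (N (lo j))"
    by (auto simp: strict_mono_less[OF N])
  next
   have "lo i < lo j" if "i < j" "j < k" for i j using sep[OF that] y[of i] that by force
   then show "inj_on (\<lambda>j. N (lo j)) {..<k}"
    by (intro linorder_inj_onI') (simp add: strict_mono_eq[OF N], metis less_irrefl)
  qed
 qed
qed

theorem quotient_of_block_space:
 assumes BX: "banach_space X" and G: "good_estimate C N F H" and C: "C >= 1" and N: "strict_mono N"
  and cd: "continuum_dimensional TYPE('z::real_vector)"
 shows "\<exists>Z :: 'z nspace. banach_space Z & is_quotient_of X Z &
  (\<exists>E. shrinking_FDD Z E & upper_block_estimates W v Z E)"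
proof -
 interpret bn: block_norm W v layer interval_norm N "2 * C + 2" by (rule layer_block_norm[OF G C N])
 obtain Z :: "'z nspace" and E J where Z: "banach_space Z" "shrinking_FDD Z E" "upper_block_estimates W v Z E"
  and J: "bounded_operator bn.c00 Z J" "!!y. y \<in> pts bn.c00 ==> nrm Z (J y) = interval_norm y"
   "!!z e. z \<in> pts Z ==> e > 0 ==> \<exists>y\<in>pts bn.c00. nrm Z (z - J y) < e"
  using bn.block_norm_space[OF cd] by blast
 have c00: "pts bn.c00 = layer_seqs" "nrm bn.c00 = interval_norm" by (auto simp: bn.c00_def layer_seqs_def)
 define S where "S y = (\<Sum>i\<in>{i. y i ~= 0}. y i)" for y :: "nat => 'x"
 have S: "S y = (\<Sum>i\<in>{0..<n}. y i)" if "!!i. n <= i ==> y i = 0" for y n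
 proof -
  have "i < n" if "y i ~= 0" for i using \<open>!!i. n <= i ==> y i = 0\<close>[of i] that by (cases "n <= i") auto
  then show ?thesis unfolding S_def by (intro sum.mono_neutral_left) auto
 qed
 have bnd: "\<exists>n. \<forall>i\<ge>n. y i = 0" if y: "y \<in> layer_seqs" for y
  using y by (simp add: layer_seqs_def finite_sequence_bound)
 have opS: "bounded_operator bn.c00 X S"
 proof (rule bounded_operatorI[where K = 1], unfold c00)
  fix y assume y: "y \<in> layer_seqs"
  obtain n where n: "!!i. n <= i ==> y i = 0" using bnd[OF y] by blast
  show "S y \<in> pts X" unfolding S_def by (rule pts_sum[OF X layer_seq_pts[OF y]])
  have Sy: "S y = (\<Sum>i\<in>{0..<n}. y i)" by (rule S) (rule n)
  show "nrm X (S y) <= 1 * interval_norm y" unfolding Sy using interval_le[OF y, of 0 n] by simp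
  have "(c *\<^sub>R y) i = 0" if "n <= i" for i c using n[OF that] by (simp add: scaleR_fun_def)
  then show "S (c *\<^sub>R y) = c *\<^sub>R S y" for c
   using Sy S[of n "c *\<^sub>R y"] by (simp add: scaleR_fun_def scaleR_sum_right)
  fix x assume x: "x \<in> layer_seqs"
  obtain m where m: "!!i. m <= i ==> x i = 0" using bnd[OF x] by blast
  have "S (y + x) = (\<Sum>i\<in>{0..<max n m}. (y + x) i)" "S y = (\<Sum>i\<in>{0..<max n m}. y i)" "S x = (\<Sum>i\<in>{0..<max n m}. x i)"
   by (rule S, simp add: n m)+
  then show "S (y + x) = S y + S x" by (simp add: sum.distrib)
 qed
 obtain Q where Q: "bounded_operator Z X Q" "!!y. y \<in> pts bn.c00 ==> Q (J y) = S y"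
  by (rule extend_along_dense_isometry[OF bn.c00 banach_normed[OF Z(1)] BX J(1) _ _ opS])
   (use J in \<open>auto simp: bn.nrm_c00\<close>)
 have lift: "\<exists>z\<in>pts Z. Q z = x & nrm Z z <= 4 * nrm X x" if xU: "x \<in> (\<Union>n. F n)" for x
 proof -
  obtain n where xF: "x \<in> F n" using xU by blast
  have xp: "x \<in> pts X" by (rule F_pts[OF xF])
  obtain g where g: "!!k. g k \<in> F k" "!!k h. h \<in> H k ==> h (g k) = h x" "!!k. nrm X (g k) <= 2 * nrm X x"
   using F_lift[OF xp] by metis
  have nx: "nrm X x >= 0" by (rule nrm_nonneg[OF X xp])
  \<comment> \<open>Lifts of \<open>x\<close> that agree with it on larger and larger
    \<open>H k\<close> and reach \<open>x\<close> itself at level \<open>n\<close>. Consecutive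
    differences are the layers of a preimage, and its interval sums are differences of two lifts, of
    norm at most 2 + 2 times that of \<open>x\<close>.\<close>
  define w where "w k = (if k < n then g k else x)" for k
  have wF: "w k \<in> F k" for k using g(1) xF F_mono[of n k] by (auto simp: w_def not_less)
  have wH: "h (w k) = h x" if "h \<in> H k" for h k using g(2)[OF that] by (simp add: w_def)
  have wn: "nrm X (w k) <= 2 * nrm X x" for k using g(3) nx by (simp add: w_def)
  have w0: "w 0 = 0" using wF[of 0] F0 by simp
  \<comment> \<open>Shifted by one so that \<open>z i = w i - w (i - 1)\<close> for
    \<open>i > 0\<close>, while layer 0 receives \<open>z 0 = 0\<close>.\<close>
  define u where "u k = (if k = 0 then 0 else w (k - 1))" for k
  define z where "z i = u (Suc i) - u i" for i
  have un: "nrm X (u k) <= 2 * nrm X x" and up: "u k \<in> pts X" for k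
   using wn wF F_pts nx nrm_zero[OF X] pts_zero[OF X] by (auto simp: u_def)
  have zl: "z i \<in> layer i" for i
  proof (cases "i = 0")
   case True
   then show ?thesis by (simp add: z_def u_def w0 layer_def)
  next
   case False
   have "w i - w (i - 1) \<in> F i" using wF[of i] wF[of "i - 1"] F_mono[of "i - 1" i] by (intro subspace_diff[OF F_sub]) auto
   moreover have "h (w i - w (i - 1)) = 0" if h: "h \<in> H (i - 1)" for h
    using wH[OF h] wH[of h i] H_mono[of "i - 1" i] h dual_diff[OF H_pts[OF h] X F_pts[OF wF] F_pts[OF wF], of i "i - 1"] by auto
   ultimately show ?thesis using False by (auto simp: z_def u_def layer_def)
  qed
  have z0: "z i = 0" if "Suc n <= i" for i
  proof -
   have "w i = x" "w (i - 1) = x" "i ~= 0" using that by (auto simp: w_def)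
   then show ?thesis by (simp add: z_def u_def)
  qed
  then have "{i. z i ~= 0} \<subseteq> {..n}" by (auto simp: not_less_eq_eq[symmetric])
  then have zs: "z \<in> layer_seqs" using zl finite_subset by (auto simp: layer_seqs_def)
  have sz: "(\<Sum>i\<in>{m..<k}. z i) = u k - u m" if "m <= k" for m k
   unfolding z_def by (rule sum_Suc_diff'[OF that])
  have "interval_norm z <= 4 * nrm X x"
  proof (rule interval_norm_le)
   fix m k
   show "nrm X (\<Sum>i\<in>{m..<k}. z i) <= 4 * nrm X x"
    using sz[of m k] nrm_diff[OF X up up, of k m] un[of k] un[of m] nx nrm_zero[OF X] by (cases "m <= k") auto
  qed
  moreover have "S z = x" using S[of "Suc n" z, OF z0] sz[OF le0, of "Suc n"] by (simp add: u_def w_def)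
  ultimately show ?thesis using Q(2)[of z] J(2)[of z] op_mem[OF J(1), of z] zs c00 by (intro bexI[of _ "J z"]) auto
 qed
 have "\<exists>z\<in>pts Z. Q z = x & nrm Z z <= 4 * 4 * nrm X x" if "x \<in> pts X" for x
 proof (rule lifts_of_dense_lifts[OF Z(1) X Q(1) _ _ _ lift that])
  show "(\<Union>n. F n) \<subseteq> pts X" using F_pts by blast
  show "\<exists>d\<in>\<Union>n. F n. nrm X (y - d) < e" if "y \<in> pts X" "0 < e" for y e using F_dense[OF that] by blast
 qed auto
 then have "Q ` pts Z = pts X" using op_mem[OF Q(1)] by blast
 then have "is_quotient_of X Z" using Q(1) unfolding is_quotient_of_def by blast
 then show ?thesis using Z by blast
qed

end

section \<open>Coarse interpolation of functionals\<close>

text \<open>Banach-Alaoglu: the ball is the intersection of a Tychonoff cube with the closed set of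
  functions that are linear on \<open>pts X\<close>. Off \<open>pts X\<close> the cube has width 0,
  in accordance with the representation of functionals.\<close>

lemma dual_ball_compact:
 fixes X :: "'x::real_vector nspace"
 assumes X: "normed_space X"
 shows "compact {f \<in> pts (dual X). nrm (dual X) f <= 1}"
proof -
 define r where "r x = (if x \<in> pts X then nrm X x else 0)" for x
 define P where "P = (\<Pi>\<^sub>E x\<in>UNIV. {- r x..r x})"
 define L where "L = (\<Inter>x\<in>pts X. \<Inter>y\<in>pts X. {f :: 'x => real. f (x + y) = f x + f y}) \<inter>
  (\<Inter>c. \<Inter>x\<in>pts X. {f :: 'x => real. f (c *\<^sub>R x) = c * f x})"
 have "compactin (product_topology (\<lambda>_. euclidean) UNIV) P"
  unfolding P_def compactin_PiE by (auto simp: compactin_euclidean_iff)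
 then have cP: "compact P" by (simp add: euclidean_product_topology compactin_euclidean_iff)
 have "closed L"
  unfolding L_def
  by (intro closed_Int closed_INT ballI closed_Collect_eq continuous_intros continuous_on_product_coordinates)
 moreover have "{f \<in> pts (dual X). nrm (dual X) f <= 1} = P \<inter> L"
 proof (intro equalityI subsetI)
  fix f assume "f \<in> {f \<in> pts (dual X). nrm (dual X) f <= 1}"
  then have f: "f \<in> pts (dual X)" "nrm (dual X) f <= 1" by auto
  have "\<bar>f x\<bar> <= r x" for x
   using dual_bound[OF X f(1), of x] mult_right_mono[OF f(2), of "nrm X x"] nrm_nonneg[OF X, of x] dual_off[OF f(1), of x]
   by (auto simp: r_def)
  then have "f \<in> P" by (auto simp: P_def abs_le_iff minus_le_iff)
  then show "f \<in> P \<inter> L" using f(1) by (auto simp: L_def dual_add dual_scale)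
 next
  fix f assume f: "f \<in> P \<inter> L"
  then have b: "\<bar>f x\<bar> <= r x" for x by (auto simp: P_def abs_le_iff minus_le_iff PiE_iff)
  have "f \<in> pts (dual X)"
  proof (rule dualI[where K = 1])
   show "f x = 0" if "x \<notin> pts X" for x using b[of x] that by (simp add: r_def)
   show "\<bar>f x\<bar> <= 1 * nrm X x" if "x \<in> pts X" for x using b[of x] that by (simp add: r_def)
  qed (use f in \<open>auto simp: L_def\<close>)
  moreover have "nrm (dual X) f <= 1"
   by (rule dual_nrm_le_1[OF X]) (use b in \<open>auto simp: r_def\<close>, metis)
  ultimately show "f \<in> {f \<in> pts (dual X). nrm (dual X) f <= 1}" by simp
 qed
 ultimately show ?thesis using compact_Int_closed[OF cP] by simp
qed

text \<open>Each functional is close to a member of some \<open>H s\<close> with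
  \<open>s > i\<close>; on the finite-dimensional \<open>F s\<close> this persists in a weak-star
  neighbourhood. Finitely many such neighbourhoods cover the dual ball, which bounds
  \<open>s\<close> uniformly.\<close>

lemma (in skeleton) coarse_interpolation:
 assumes \<epsilon>: "\<epsilon> > 0"
 obtains k where "i < k" "!!f. f \<in> pts (dual X) ==> nrm (dual X) f <= 1 ==>
  \<exists>s. i < s & s <= k & (\<exists>y\<in>H s. \<forall>x\<in>F s. \<bar>f x - y x\<bar> <= \<epsilon> * nrm X x)"
proof -
 define B where "B = {f \<in> pts (dual X). nrm (dual X) f <= 1}"
 have "\<exists>s y A \<delta>. i < s & y \<in> H s & finite A & \<delta> > 0 &
   (\<forall>g\<in>B. (\<forall>b\<in>A. \<bar>g b - f b\<bar> < \<delta>) --> (\<forall>x\<in>F s. \<bar>g x - y x\<bar> <= \<epsilon> * nrm X x))" if f: "f \<in> B" for f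
 proof -
  have fD: "f \<in> pts (dual X)" using f by (simp add: B_def)
  obtain j y where y: "y \<in> H j" "nrm (dual X) (f - y) < \<epsilon> / 2" using H_dense[OF fD half_gt_zero[OF \<epsilon>]] by blast
  define s where "s = max j (Suc i)"
  have ys: "y \<in> H s" "i < s" using y(1) H_mono[of j s] by (auto simp: s_def)
  have yD: "y \<in> pts (dual X)" by (rule H_pts[OF y(1)])
  obtain A0 where A0: "finite A0" "A0 \<subseteq> pts X" "F s = span A0" using F_span by blast
  obtain A where A: "finite A" "independent A" "F s = span A"
   using finite_span_subspace[OF F_sub, of s A0] A0 by blast
  have Ap: "A \<subseteq> pts X" using A(3) F_pts span_superset by blast
  obtain c where c: "c > 0" "!!u. c * (\<Sum>b\<in>A. \<bar>u b\<bar>) <= nrm X (\<Sum>b\<in>A. u b *\<^sub>R b)"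
   using findim_coeff_bound[OF X A(1,2) Ap] by blast
  have "\<bar>g x - y x\<bar> <= \<epsilon> * nrm X x" if g: "g \<in> B" "\<forall>b\<in>A. \<bar>g b - f b\<bar> < c * (\<epsilon> / 2)" and x: "x \<in> F s" for g x
  proof -
   have gD: "g \<in> pts (dual X)" using g by (simp add: B_def)
   have xp: "x \<in> pts X" by (rule F_pts[OF x])
   obtain u where u: "x = (\<Sum>b\<in>A. u b *\<^sub>R b)" using x A(3) span_finite_ex[OF A(1)] by blast
   have "(g - f) x = (\<Sum>b\<in>A. u b * (g - f) b)"
    unfolding u using Ap pts_diff[OF D gD fD]
    by (subst dual_sum[OF _ X]) (auto intro!: pts_scale[OF X] sum.cong dual_scale[OF pts_diff[OF D gD fD], unfolded minus_apply] simp: subset_iff)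
   also have "\<bar>\<dots>\<bar> <= (\<Sum>b\<in>A. \<bar>u b * (g - f) b\<bar>)" by (rule sum_abs)
   also have "\<dots> <= (\<Sum>b\<in>A. \<bar>u b\<bar> * (c * (\<epsilon> / 2)))"
    unfolding abs_mult
   proof (intro sum_mono mult_left_mono)
    fix b assume "b \<in> A"
    then show "\<bar>(g - f) b\<bar> <= c * (\<epsilon> / 2)" using g(2) by (auto intro: less_imp_le)
   qed simp
   also have "\<dots> = (c * (\<Sum>b\<in>A. \<bar>u b\<bar>)) * (\<epsilon> / 2)" by (simp add: sum_distrib_left sum_distrib_right mult_ac)
   also have "\<dots> <= nrm X x * (\<epsilon> / 2)" using c(2)[of u] \<epsilon> by (intro mult_right_mono) (auto simp: u)
   finally have 1: "\<bar>g x - f x\<bar> <= \<epsilon> / 2 * nrm X x" by (simp add: mult.commute)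
   have "\<bar>f x - y x\<bar> <= nrm (dual X) (f - y) * nrm X x"
    using dual_bound[OF X pts_diff[OF D fD yD] xp] by simp
   also have "\<dots> <= \<epsilon> / 2 * nrm X x" using y(2) nrm_nonneg[OF X xp] by (intro mult_right_mono) auto
   finally have "\<bar>f x - y x\<bar> <= \<epsilon> / 2 * nrm X x" .
   then have "\<bar>g x - y x\<bar> <= \<epsilon> / 2 * nrm X x + \<epsilon> / 2 * nrm X x" using 1 by linarith
   then show ?thesis by simp
  qed
  then show ?thesis using ys A(1) c(1) \<epsilon>
   by (intro exI[of _ s] exI[of _ y] exI[of _ A] exI[of _ "c * (\<epsilon> / 2)"]) auto
 qed
 then obtain s y A \<delta> where *: "!!f. f \<in> B ==> i < s f & y f \<in> H (s f) & finite (A f) & \<delta> f > 0 &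
   (\<forall>g\<in>B. (\<forall>b\<in>A f. \<bar>g b - f b\<bar> < \<delta> f) --> (\<forall>x\<in>F (s f). \<bar>g x - y f x\<bar> <= \<epsilon> * nrm X x))"
  by metis
 define nb where "nb f = (\<Inter>b\<in>A f. {g. \<bar>g b - f b\<bar> < \<delta> f})" for f
 have "open (nb f)" if "f \<in> B" for f
  unfolding nb_def using * that
  by (intro open_INT ballI open_Collect_less continuous_intros continuous_on_product_coordinates) auto
 moreover have "B \<subseteq> (\<Union>f\<in>B. nb f)" using * by (auto simp: nb_def)
 moreover have "compact B" unfolding B_def by (rule dual_ball_compact[OF X])
 ultimately obtain C where C: "C \<subseteq> B" "finite C" "B \<subseteq> (\<Union>f\<in>C. nb f)" by (metis compactE_image)
 define k where "k = Max (insert (Suc i) (s ` C))"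
 have k: "s f <= k" if "f \<in> C" for f unfolding k_def using C(2) that by (intro Max_ge) auto
 show ?thesis
 proof (rule that[of k])
  have "Suc i <= k" unfolding k_def using C(2) by (intro Max_ge) auto
  then show "i < k" by simp
  fix g assume "g \<in> pts (dual X)" "nrm (dual X) g <= 1"
  then have g: "g \<in> B" by (simp add: B_def)
  then obtain f where f: "f \<in> C" "g \<in> nb f" using C(3) by blast
  then have "f \<in> B" "\<forall>b\<in>A f. \<bar>g b - f b\<bar> < \<delta> f" using C(1) by (auto simp: nb_def)
  then show "\<exists>s. i < s & s <= k & (\<exists>y\<in>H s. \<forall>x\<in>F s. \<bar>g x - y x\<bar> <= \<epsilon> * nrm X x)"
   using *[of f] k[OF f(1)] g by blast
 qed
qed

text \<open>The geometric decay with factor \<open>1/64\<close> keeps the sum of all corrections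
  made in \<open>splitting\<close> below \<open>1/4\<close>.\<close>

lemma (in skeleton) coarse_sequence:
 obtains R where "strict_mono R" "R 0 = 0"
  "!!j f. f \<in> pts (dual X) ==> nrm (dual X) f <= 1 ==>
   \<exists>s. R j < s & s <= R (Suc j) & (\<exists>y\<in>H s. \<forall>x\<in>F s. \<bar>f x - y x\<bar> <= (1/64) * (1/2) ^ Suc j * nrm X x)"
proof -
 define ok where "ok j i k \<longleftrightarrow> i < k & (\<forall>f\<in>pts (dual X). nrm (dual X) f <= 1 -->
   (\<exists>s. i < s & s <= k & (\<exists>y\<in>H s. \<forall>x\<in>F s. \<bar>f x - y x\<bar> <= (1/64) * (1/2) ^ Suc j * nrm X x)))" for j i k
 have "\<exists>k. ok j i k" for j i
 proof -
  have "(1/64) * (1/2::real) ^ Suc j > 0" by simp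
  from coarse_interpolation[OF this, of i] show ?thesis unfolding ok_def by metis
 qed
 then obtain g where g: "!!j i. ok j i (g j i)" by metis
 define R where "R = rec_nat 0 g"
 have R: "R 0 = 0" "ok j (R j) (R (Suc j))" for j using g by (simp_all add: R_def)
 show ?thesis
  by (rule that[of R]) (use R in \<open>auto simp: ok_def strict_mono_Suc_iff\<close>)
qed

section \<open>The embedding norm\<close>

locale coarse = game W v X F H
 for W :: "'v::real_vector nspace" and v and X :: "'x::real_vector nspace" and F H +
 fixes C :: real and N R :: "nat => nat"
 assumes G: "good_estimate C N F H" and C: "C >= 1" and N: "strict_mono N"
  and R: "strict_mono R" and R0: "R 0 = 0"
  and interp: "!!j f. f \<in> pts (dual X) ==> nrm (dual X) f <= 1 ==>
   \<exists>s. R j < s & s <= R (Suc j) & (\<exists>y\<in>H s. \<forall>x\<in>F s. \<bar>f x - y x\<bar> <= (1/64) * (1/2) ^ Suc j * nrm X x)"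
begin

text \<open>Cutting points, one in each window of the scale \<open>R\<close>.\<close>

definition valid :: "(nat => nat) => bool"
 where "valid s \<longleftrightarrow> s 0 = 0 & (\<forall>j. R j < s (Suc j) & s (Suc j) <= R (Suc j))"

text \<open>The cutting points may vary with \<open>u\<close>, so this is not treated as a vector
  space; the norm rests on closure under scaling and under restriction to index sets.\<close>

definition splits :: "(nat => 'x => real) set"
 where "splits = {u. u 0 = 0 & finite {j. u j ~= 0} &
  (\<exists>s. valid s & (\<forall>j. u (Suc j) \<in> H (s (Suc j)) & (\<forall>x\<in>F (s j). u (Suc j) x = 0)))}"

definition isum :: "(nat => 'x => real) => nat => nat => 'x => real"
 where "isum u m n = (\<Sum>j\<in>{m..<n}. u j)"

text \<open>The norming set of the new norm. Bounding all interval sums makes it stable under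
  restriction to intervals.\<close>

definition K :: "(nat => 'x => real) set"
 where "K = {u \<in> splits. \<forall>m n. nrm (dual X) (isum u m n) <= 1}"

definition pieces :: "nat => ('x => real) set"
 where "pieces j = (\<lambda>u. u j) ` splits"

text \<open>A vector seen only through the functionals that occur as piece \<open>j\<close>; vectors
  that these do not distinguish become equal, so that \<open>dnorm\<close> is a norm and not only a
  seminorm.\<close>

definition \<rho> :: "nat => 'x => ('x => real) => real"
 where "\<rho> j x = (\<lambda>f. if f \<in> pieces j then f x else 0)"

definition coords :: "nat => (('x => real) => real) set"
 where "coords j = \<rho> j ` F (R j)"

definition cseqs :: "(nat => ('x => real) => real) set"
 where "cseqs = {z. (\<forall>j. z j \<in> coords j) & finite {j. z j ~= 0}}"

definition pair :: "(nat => ('x => real) => real) => (nat => 'x => real) => real"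
 where "pair z u = (\<Sum>j\<in>{j. z j ~= 0}. z j (u j))"

definition dnorm :: "(nat => ('x => real) => real) => real"
 where "dnorm z = (SUP u\<in>K. \<bar>pair z u\<bar>)"

lemma valid_mono: "valid s ==> strict_mono s"
 unfolding strict_mono_Suc_iff
proof
 fix j assume s: "valid s"
 show "s j < s (Suc j)"
 proof (cases j)
  case 0
  then show ?thesis using s by (auto simp: valid_def intro: le_less_trans)
 next
  case (Suc i)
  have "s j <= R j" "R j < s (Suc j)" using s Suc by (auto simp: valid_def)
  then show ?thesis by simp
 qed
qed

lemma valid_le: "valid s ==> s j <= R j" by (cases j) (auto simp: valid_def R0)

lemma valid_R: "valid R" using R by (simp add: valid_def R0 strict_mono_Suc_iff)

lemma splits_H: "u \<in> splits ==> u j \<in> H (R j)"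
proof (cases j)
 case 0
 then show "u \<in> splits ==> u j \<in> H (R j)" by (simp add: splits_def subspace_0[OF H_sub])
next
 case (Suc i)
 assume "u \<in> splits"
 then obtain s where s: "valid s" "u (Suc i) \<in> H (s (Suc i))" by (auto simp: splits_def)
 then show "u j \<in> H (R j)" using H_mono[OF valid_le[OF s(1), of "Suc i"]] Suc by auto
qed

lemma splits_dual: "u \<in> splits ==> u j \<in> pts (dual X)" using splits_H H_pts by blast

lemma isum_dual: "u \<in> splits ==> isum u m n \<in> pts (dual X)"
 unfolding isum_def by (intro pts_sum[OF D] splits_dual)

lemma splits_scale: "u \<in> splits ==> (\<lambda>j. c *\<^sub>R u j) \<in> splits"
proof -
 assume u: "u \<in> splits"
 then obtain s where s: "valid s" "!!j. u (Suc j) \<in> H (s (Suc j))" "!!j x. x \<in> F (s j) ==> u (Suc j) x = 0"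
  by (auto simp: splits_def)
 have "finite {j. c *\<^sub>R u j ~= 0}" by (rule finite_subset[of _ "{j. u j ~= 0}"]) (use u in \<open>auto simp: splits_def\<close>)
 moreover have "\<forall>j. c *\<^sub>R u (Suc j) \<in> H (s (Suc j)) & (\<forall>x\<in>F (s j). (c *\<^sub>R u (Suc j)) x = 0)"
  using subspace_scale[OF H_sub s(2)] s(3) by (simp add: scaleR_fun_def[of _ "u (Suc _)"])
 ultimately show ?thesis using u s(1) unfolding splits_def by (intro CollectI conjI exI[of _ s]) auto
qed

lemma splits_restrict: "u \<in> splits ==> (\<lambda>j. if j \<in> I then u j else 0) \<in> splits"
proof -
 assume u: "u \<in> splits"
 then obtain s where s: "valid s" "!!j. u (Suc j) \<in> H (s (Suc j))" "!!j x. x \<in> F (s j) ==> u (Suc j) x = 0"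
  by (auto simp: splits_def)
 have "finite {j. (if j \<in> I then u j else 0) ~= 0}"
  by (rule finite_subset[of _ "{j. u j ~= 0}"]) (use u in \<open>auto simp: splits_def\<close>)
 moreover have "\<forall>j. (if Suc j \<in> I then u (Suc j) else 0) \<in> H (s (Suc j)) &
   (\<forall>x\<in>F (s j). (if Suc j \<in> I then u (Suc j) else 0) x = 0)"
  using s by (auto intro: subspace_0[OF H_sub])
 ultimately show ?thesis using u s(1) unfolding splits_def by (intro CollectI conjI exI[of _ s]) auto
qed

lemma isum_restrict: "isum (\<lambda>j. if j \<in> {a..<b} then u j else 0) m n = isum u (max m a) (min n b)"
 unfolding isum_def by (intro sum.mono_neutral_cong_right) auto

lemma isum_scale: "isum (\<lambda>j. c *\<^sub>R u j) m n = c *\<^sub>R isum u m n"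
 unfolding isum_def by (simp add: scaleR_sum_right)

lemma K_zero: "0 \<in> K"
proof -
 have "(0 :: nat => 'x => real) \<in> splits"
  unfolding splits_def using valid_R subspace_0[OF H_sub] by (intro CollectI conjI exI[of _ R]) auto
 then show ?thesis by (simp add: K_def isum_def nrm_zero[OF D])
qed

lemma pieces_dual: "f \<in> pieces j ==> f \<in> pts (dual X)" using splits_dual by (auto simp: pieces_def)

lemma pieces_scale: "f \<in> pieces j ==> c *\<^sub>R f \<in> pieces j"
 using splits_scale by (force simp: pieces_def)

lemma \<rho>_add: "x \<in> pts X ==> y \<in> pts X ==> \<rho> j (x + y) = \<rho> j x + \<rho> j y"
 by (auto simp: \<rho>_def fun_eq_iff dual_add[OF pieces_dual])

lemma \<rho>_scale: "x \<in> pts X ==> \<rho> j (c *\<^sub>R x) = c *\<^sub>R \<rho> j x"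
 by (auto simp: \<rho>_def fun_eq_iff dual_scale[OF pieces_dual] scaleR_fun_def)

lemma coords_span: "\<exists>A. finite A & coords j = span A"
proof -
 obtain B where B: "finite B" "B \<subseteq> pts X" "F (R j) = span B" using F_span by blast
 have "\<rho> j ` span B = span (\<rho> j ` B)"
  using F_pts B(3) by (intro image_span_finite[OF B(1)]) (auto intro!: \<rho>_add \<rho>_scale)
 then show ?thesis using B unfolding coords_def by (metis finite_imageI)
qed

lemma coords_sub: "subspace (coords j)" using coords_span[of j] by (auto intro: subspace_span)

lemma coords_zero: "g \<in> coords j ==> g 0 = 0"
 by (auto simp: coords_def \<rho>_def)

lemma cseqs_sub: "subspace cseqs"
 unfolding cseqs_def by (rule finite_sequences_subspace[OF coords_sub])

lemma cseqs_bound: "z \<in> cseqs ==> \<exists>n. \<forall>i\<ge>n. z i = 0"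
 by (simp add: cseqs_def finite_sequence_bound)

lemma pair_eq:
 assumes "!!i. n <= i ==> z i = 0"
 shows "pair z u = (\<Sum>j<n. z j (u j))"
proof -
 have "i < n" if "z i ~= 0" for i using assms[of i] that by (cases "n <= i") auto
 then show ?thesis unfolding pair_def by (intro sum.mono_neutral_left) auto
qed

lemma pair_add:
 assumes "z \<in> cseqs" "w \<in> cseqs"
 shows "pair (z + w) u = pair z u + pair w u"
proof -
 obtain n where n: "!!i. n <= i ==> z i = 0" using assms by (meson cseqs_bound)
 obtain m where m: "!!i. m <= i ==> w i = 0" using assms by (meson cseqs_bound)
 have "pair (z + w) u = (\<Sum>j<max n m. (z + w) j (u j))" by (rule pair_eq) (simp add: n m)
 moreover have "pair z u = (\<Sum>j<max n m. z j (u j))" by (rule pair_eq) (simp add: n)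
 moreover have "pair w u = (\<Sum>j<max n m. w j (u j))" by (rule pair_eq) (simp add: m)
 ultimately show ?thesis by (simp add: sum.distrib)
qed

lemma pair_scale:
 assumes "z \<in> cseqs"
 shows "pair (c *\<^sub>R z) u = c * pair z u"
proof -
 obtain n where n: "!!i. n <= i ==> z i = 0" using assms by (meson cseqs_bound)
 have "pair (c *\<^sub>R z) u = (\<Sum>j<n. (c *\<^sub>R z) j (u j))" by (rule pair_eq) (simp add: n scaleR_fun_def fun_eq_iff)
 moreover have "pair z u = (\<Sum>j<n. z j (u j))" by (rule pair_eq) (simp add: n)
 ultimately show ?thesis by (simp add: scaleR_fun_def sum_distrib_left)
qed

lemma pair_sum:
 assumes "!!j. j < k ==> y j \<in> cseqs"
 shows "pair (\<Sum>j<(k::nat). a j *\<^sub>R y j) u = (\<Sum>j<k. a j * pair (y j) u)"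
 using assms
proof (induction k)
 case 0
 show ?case by (simp add: pair_def)
next
 case (Suc k)
 have "(\<Sum>j<k. a j *\<^sub>R y j) \<in> cseqs" "a k *\<^sub>R y k \<in> cseqs"
  using Suc.prems by (auto intro!: subspace_sum[OF cseqs_sub] subspace_scale[OF cseqs_sub])
 then show ?case using Suc by (simp only: sum.lessThan_Suc pair_add pair_scale)
qed

lemma pair_bdd:
 assumes z: "z \<in> cseqs"
 shows "bdd_above ((\<lambda>u. \<bar>pair z u\<bar>) ` K)"
proof -
 have "\<exists>x. x \<in> F (R j) & z j = \<rho> j x" for j using z by (auto simp: cseqs_def coords_def)
 then obtain x where x: "!!j. x j \<in> F (R j)" "!!j. z j = \<rho> j (x j)" by metis
 have "\<bar>pair z u\<bar> <= (\<Sum>j\<in>{j. z j ~= 0}. nrm X (x j))" if u: "u \<in> K" for u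
 proof -
  have us: "u \<in> splits" using u by (simp add: K_def)
  have "\<bar>z j (u j)\<bar> <= nrm X (x j)" for j
  proof -
   have "z j (u j) = u j (x j)" using us by (auto simp: x(2) \<rho>_def pieces_def)
   moreover have "nrm (dual X) (u j) <= 1"
   proof -
    have "isum u j (Suc j) = u j" by (simp add: isum_def)
    then show ?thesis using u unfolding K_def by (metis (mono_tags, lifting) mem_Collect_eq)
   qed
   ultimately show ?thesis
    using dual_bound[OF X splits_dual[OF us] F_pts[OF x(1)], of j j] nrm_nonneg[OF X F_pts[OF x(1)[of j]]]
     mult_right_mono[of "nrm (dual X) (u j)" 1 "nrm X (x j)"] by simp
  qed
  then show ?thesis unfolding pair_def by (intro order_trans[OF sum_abs] sum_mono)
 qed
 then show ?thesis by (intro bdd_aboveI) auto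
qed

lemma pair_le: "z \<in> cseqs ==> u \<in> K ==> \<bar>pair z u\<bar> <= dnorm z"
 unfolding dnorm_def by (rule cSUP_upper[OF _ pair_bdd])

lemma dnorm_le: "(!!u. u \<in> K ==> \<bar>pair z u\<bar> <= c) ==> dnorm z <= c"
 unfolding dnorm_def using K_zero by (intro cSUP_least) auto

lemma pair_scale_right:
 assumes "z \<in> cseqs" "u \<in> splits"
 shows "pair z (\<lambda>j. c *\<^sub>R u j) = c * pair z u"
proof -
 have "z j (c *\<^sub>R u j) = c * z j (u j)" for j
 proof -
  have "u j \<in> pieces j" using assms(2) by (auto simp: pieces_def)
  moreover obtain x where "z j = \<rho> j x" using assms(1) by (auto simp: cseqs_def coords_def)
  ultimately show ?thesis using pieces_scale by (simp add: \<rho>_def scaleR_fun_def)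
 qed
 then show ?thesis by (simp add: pair_def sum_distrib_left)
qed

lemma dnorm_normed: "normed_space \<lparr>pts = cseqs, nrm = dnorm\<rparr>"
proof -
 have "normed_space \<lparr>pts = cseqs, nrm = \<lambda>z. SUP u\<in>K. \<bar>pair z u\<bar>\<rparr>"
 proof (rule sup_seminorms_normed[OF cseqs_sub])
  show "K ~= {}" using K_zero by blast
  fix z assume z: "z \<in> cseqs" and 0: "!!u. u \<in> K ==> \<bar>pair z u\<bar> = 0"
  have zero: "z j f = 0" for j f
  proof (cases "f \<in> pieces j")
   case False
   then show ?thesis using z by (auto simp: cseqs_def coords_def \<rho>_def dest!: spec[of _ j])
  next
   case True
   then obtain u where u: "u \<in> splits" "f = u j" by (auto simp: pieces_def)
   have fD: "f \<in> pts (dual X)" using True by (rule pieces_dual)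
   \<comment> \<open>A single piece, scaled by \<open>t\<close>, belongs to \<open>K\<close>, since
     its interval sums are 0 or \<open>f\<close>. A sequence of norm 0 therefore vanishes at every
     piece.\<close>
   define w where "w = (\<lambda>i. if i \<in> {j..<Suc j} then u i else 0)"
   have w: "w \<in> splits" unfolding w_def by (rule splits_restrict[OF u(1)])
   define t where "t = 1 / (nrm (dual X) f + 1)"
   have nf: "nrm (dual X) f >= 0" by (rule nrm_nonneg[OF D fD])
   then have t: "t > 0" by (simp add: t_def add_nonneg_pos)
   have wf: "isum w m n = f \<or> isum w m n = 0" for m n
   proof -
    have "isum w m n = isum u (max m j) (min n (Suc j))" unfolding w_def by (rule isum_restrict)
    moreover have "{max m j..<min n (Suc j)} \<subseteq> {j}" by auto
    then have "{max m j..<min n (Suc j)} = {j} \<or> {max m j..<min n (Suc j)} = {}" by (rule subset_singletonD[THEN disj_commute[THEN iffD1]])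
    ultimately show ?thesis unfolding isum_def u(2) by (metis sum.empty sum.insert_remove sum.remove finite.emptyI empty_iff add.right_neutral sum.insert)
   qed
   have "nrm (dual X) (isum w m n) <= nrm (dual X) f" for m n
    using wf[of m n] nf nrm_zero[OF D] by (elim disjE) simp_all
   then have "nrm (dual X) (t *\<^sub>R isum w m n) <= 1" for m n
    using t nf by (simp add: nrm_scale[OF D isum_dual[OF w]] t_def divide_le_eq) (smt (verit))
   then have "(\<lambda>i. t *\<^sub>R w i) \<in> K" using splits_scale[OF w] by (simp add: K_def isum_scale)
   then have "t * pair z w = 0" using 0 pair_scale_right[OF z w, of t] by force
   then have "pair z w = 0" using t by simp
   moreover have "pair z w = z j f"
   proof -
    have z0: "z i 0 = 0" for i using z coords_zero by (auto simp: cseqs_def)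
    then have "pair z w = (\<Sum>i\<in>{i. z i ~= 0}. if i = j then z j f else 0)"
     unfolding pair_def w_def using u(2) by (intro sum.cong) auto
    also have "\<dots> = (if z j ~= 0 then z j f else 0)"
     using z by (subst sum.delta) (auto simp: cseqs_def)
    finally show ?thesis by auto
   qed
   ultimately show ?thesis by simp
  qed
  show "z = 0" by (intro ext) (simp add: zero)
 qed (use pair_add pair_scale pair_bdd in \<open>auto simp: abs_mult\<close>)
 then show ?thesis by (simp add: dnorm_def[abs_def])
qed

text \<open>Truncating \<open>z\<close> amounts to truncating \<open>u\<close>, and \<open>K\<close>
  is closed under the latter.\<close>

lemma dnorm_truncate:
 assumes z: "z \<in> cseqs"
 shows "dnorm (\<lambda>i. if i < n then z i else 0) <= dnorm z"
proof (rule dnorm_le)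
 fix u assume u: "u \<in> K"
 define w where "w = (\<lambda>j. if j \<in> {0..<n} then u j else 0)"
 have "w \<in> splits" using u unfolding w_def K_def by (intro splits_restrict) auto
 moreover have "nrm (dual X) (isum w m k) <= 1" for m k
  unfolding w_def isum_restrict using u by (simp add: K_def)
 ultimately have w: "w \<in> K" by (simp add: K_def)
 have z0: "z i 0 = 0" for i using z coords_zero by (auto simp: cseqs_def)
 obtain m where m: "!!i. m <= i ==> z i = 0" using z by (meson cseqs_bound)
 have "pair (\<lambda>i. if i < n then z i else 0) u = (\<Sum>j<m. (if j < n then z j else 0) (u j))" by (rule pair_eq) (simp add: m)
 also have "\<dots> = (\<Sum>j<m. z j (w j))" by (intro sum.cong) (auto simp: w_def z0)
 also have "\<dots> = pair z w" by (rule pair_eq[symmetric]) (rule m)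
 finally show "\<bar>pair (\<lambda>i. if i < n then z i else 0) u\<bar> <= dnorm z" using pair_le[OF z w] by simp
qed

end

lemma finite_argmax:
 fixes g :: "'a => real"
 assumes "finite A" "A ~= {}"
 shows "\<exists>t\<in>A. \<forall>s\<in>A. g s <= g t"
proof -
 have "Max (g ` A) \<in> g ` A" using assms by (intro Max_in) auto
 then obtain t where t: "t \<in> A" "Max (g ` A) = g t" by blast
 then have "g s <= g t" if "s \<in> A" for s using Max_ge[of "g ` A" "g s"] assms(1) that by simp
 then show ?thesis using t(1) by blast
qed

section \<open>Upper estimates for the pairing norm\<close>

context coarse
begin

lemma splits_vanish:
 assumes "u \<in> splits"
 obtains s where "valid s" "!!j. u j \<in> H (s j)" "!!j x. 1 <= j ==> x \<in> F (s (j - 1)) ==> u j x = 0"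
proof -
 obtain s where s: "valid s" "!!j. u (Suc j) \<in> H (s (Suc j))" "!!j x. x \<in> F (s j) ==> u (Suc j) x = 0"
  using assms by (auto simp: splits_def)
 have "u j \<in> H (s j)" for j using s(2) assms subspace_0[OF H_sub] by (cases j) (auto simp: splits_def)
 moreover have "u j x = 0" if "1 <= j" "x \<in> F (s (j - 1))" for j x using s(3)[of x "j - 1"] that by simp
 ultimately show ?thesis using that s(1) by blast
qed

text \<open>Restricted to the window of the block and divided by a bound for its interval sums,
  \<open>u\<close> enters \<open>K\<close>, where the pairing with \<open>y\<close> is at most 1.
  The additional \<open>e\<close> avoids division by 0.\<close>

lemma pair_block_le:
 assumes y: "y \<in> cseqs" "dnorm y <= 1" "!!i. y i ~= 0 ==> lo <= i & i <= hi" and u: "u \<in> splits"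
  and c: "0 <= c" "!!m n. lo <= m ==> m < n ==> n <= Suc hi ==> nrm (dual X) (isum u m n) <= c"
 shows "\<bar>pair y u\<bar> <= c"
proof (rule field_le_epsilon)
 fix e :: real assume "e > 0"
 define d where "d = c + e"
 have d: "d > 0" using c \<open>e > 0\<close> by (simp add: d_def)
 define w where "w = (\<lambda>j. if j \<in> {lo..<Suc hi} then u j else 0)"
 have w: "w \<in> splits" unfolding w_def by (rule splits_restrict[OF u])
 have wn: "nrm (dual X) (isum w m n) <= d" for m n
 proof (cases "max m lo < min n (Suc hi)")
  case True
  then show ?thesis unfolding w_def isum_restrict using c(2)[of "max m lo" "min n (Suc hi)"] \<open>e > 0\<close> by (simp add: d_def)
 next
  case False
  then have "{max m lo..<min n (Suc hi)} = {}" by (simp only: atLeastLessThan_empty_iff not_less)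
  then show ?thesis unfolding w_def isum_restrict isum_def using d nrm_zero[OF D] by (simp only: sum.empty)
 qed
 have "(1 / d) * nrm (dual X) (isum w m n) <= 1" for m n using wn[of m n] d by (simp add: divide_le_eq)
 then have "nrm (dual X) (isum (\<lambda>j. (1 / d) *\<^sub>R w j) m n) <= 1" for m n
  using d by (simp only: isum_scale nrm_scale[OF D isum_dual[OF w]]) simp
 then have "(\<lambda>j. (1 / d) *\<^sub>R w j) \<in> K" using splits_scale[OF w] by (simp add: K_def)
 then have "\<bar>(1 / d) * pair y w\<bar> <= 1"
  using pair_le[OF y(1)] y(2) pair_scale_right[OF y(1) w, of "1 / d"] by fastforce
 moreover have "pair y w = pair y u"
  unfolding pair_def
 proof (rule sum.cong)
  fix j assume "j \<in> {j. y j ~= 0}"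
  then have "j \<in> {lo..<Suc hi}" using y(3)[of j] by (simp add: less_Suc_eq_le)
  then show "y j (w j) = y j (u j)" by (simp only: w_def if_True)
 qed simp
 ultimately have "\<bar>pair y u\<bar> <= d" using d by (simp add: abs_mult divide_le_eq)
 then show "\<bar>pair y u\<bar> <= c + e" by (simp add: d_def)
qed

text \<open>A vector that norms the interval sum up to a factor 2 is lifted to level
  \<open>s (n - 1)\<close>, which the sum does not notice. Subtracting a further lift to level
  \<open>s (m - 1)\<close>, where the sum is 0, makes it annihilated by
  \<open>H (s (m - 1))\<close>. The lifts have norms at most 2 and 4, hence the 6.\<close>

lemma witness:
 assumes u: "valid s" "!!j. u j \<in> H (s j)" "!!j x. 1 <= j ==> x \<in> F (s (j - 1)) ==> u j x = 0" and us: "u \<in> splits"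
  and mn: "1 <= m" "m < n"
 obtains d where "d \<in> F (s (n - 1))" "!!h. h \<in> H (s (m - 1)) ==> h d = 0" "nrm X d <= 6"
  "nrm (dual X) (isum u m n) <= 2 * isum u m n d"
proof -
 define g where "g = isum u m n"
 have sm: "strict_mono s" by (rule valid_mono[OF u(1)])
 have gD: "g \<in> pts (dual X)" unfolding g_def by (rule isum_dual[OF us])
 have gH: "g \<in> H (s (n - 1))"
  unfolding g_def isum_def
 proof (rule subspace_sum[OF H_sub])
  fix j assume "j \<in> {m..<n}"
  then have "j <= n - 1" by auto
  then have "s j <= s (n - 1)" by (simp add: strict_mono_less_eq[OF sm])
  then show "u j \<in> H (s (n - 1))" using u(2)[of j] H_mono by blast
 qed
 have gF: "g x = 0" if "x \<in> F (s (m - 1))" for x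
 proof -
  have "u j x = 0" if "j \<in> {m..<n}" for j
  proof -
   have "m - 1 <= j - 1" using that by auto
   then have "s (m - 1) <= s (j - 1)" by (simp add: strict_mono_less_eq[OF sm])
   then show ?thesis using u(3)[of j x] that mn(1) \<open>x \<in> F (s (m - 1))\<close> F_mono by auto
  qed
  then show ?thesis by (simp add: g_def isum_def sum_fun_apply)
 qed
 obtain w where w: "w \<in> pts X" "nrm X w <= 1" "nrm (dual X) g <= 2 * g w"
 proof (cases "nrm (dual X) g = 0")
  case True
  then show ?thesis using that[of 0] pts_zero[OF X] nrm_zero[OF X] dual_zero[OF gD X] by simp
 next
  case False
  then have "nrm (dual X) g / 2 < nrm (dual X) g" using nrm_nonneg[OF D gD] by simp
  from dual_nrm_approx[OF X gD this] obtain w where "w \<in> pts X" "nrm X w <= 1" "nrm (dual X) g / 2 < g w" by blast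
  then show ?thesis using that[of w] by simp
 qed
 obtain w' where w': "w' \<in> F (s (n - 1))" "!!h. h \<in> H (s (n - 1)) ==> h w' = h w" "nrm X w' <= 2 * nrm X w"
  using F_lift[OF w(1)] by blast
 have w'p: "w' \<in> pts X" by (rule F_pts[OF w'(1)])
 obtain z where z: "z \<in> F (s (m - 1))" "!!h. h \<in> H (s (m - 1)) ==> h z = h w'" "nrm X z <= 2 * nrm X w'"
  using F_lift[OF w'p] by blast
 have zp: "z \<in> pts X" by (rule F_pts[OF z(1)])
 have "s (m - 1) <= s (n - 1)" using mn by (simp add: strict_mono_less_eq[OF sm])
 then have zF: "z \<in> F (s (n - 1))" using z(1) F_mono by blast
 show ?thesis
 proof (rule that[of "w' - z"])
  show "w' - z \<in> F (s (n - 1))" by (rule subspace_diff[OF F_sub w'(1) zF])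
  show "h (w' - z) = 0" if "h \<in> H (s (m - 1))" for h
   using dual_diff[OF H_pts[OF that] X w'p zp] z(2)[OF that] by simp
  show "nrm X (w' - z) <= 6" using nrm_diff[OF X w'p zp] w'(3) z(3) w(2) by simp
  have "g (w' - z) = g w" using dual_diff[OF gD X w'p zp] gF[OF z(1)] w'(2)[OF gH] by simp
  then show "nrm (dual X) (isum u m n) <= 2 * isum u m n (w' - z)" using w(3) by (simp add: g_def)
 qed
qed

text \<open>The pairing of \<open>u\<close> with a block is bounded by the largest interval sum of
  \<open>u\<close> in its window, which has a witness \<open>d j\<close>. One functional
  \<open>g\<close> of norm at most 1 agrees with all these interval sums at their witnesses, so
  everything is bounded by twice the norm in \<open>X\<close> of the combination of the
  \<open>d j\<close> with coefficients \<open>\<bar>a j\<bar>\<close>. The 12 is this 2 times the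
  norm 6 of the witnesses.\<close>

lemma dnorm_upper:
 fixes k :: nat
 assumes y: "!!j. j < k ==> y j \<in> cseqs & dnorm (y j) <= 1 & 1 <= lo j & lo j <= hi j &
   (\<forall>i. y j i ~= 0 --> lo j <= i & i <= hi j)"
  and sep: "!!i j. i < j ==> j < k ==> hi i < lo j"
 shows "dnorm (\<Sum>j<k. a j *\<^sub>R y j) <= 12 * (2 * C + 2) * nrm W (\<Sum>j<k. a j *\<^sub>R v (N (R (lo j))))"
proof (rule dnorm_le)
 fix u assume uK: "u \<in> K"
 then have us: "u \<in> splits" by (simp add: K_def)
 obtain s where s: "valid s" "!!j. u j \<in> H (s j)" "!!j x. 1 <= j ==> x \<in> F (s (j - 1)) ==> u j x = 0"
  using splits_vanish[OF us] by blast
 have sm: "strict_mono s" by (rule valid_mono[OF s(1)])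
 define largest where "largest j m n \<longleftrightarrow> lo j <= m & m < n & n <= Suc (hi j) &
   (\<forall>m' n'. lo j <= m' & m' < n' & n' <= Suc (hi j) --> nrm (dual X) (isum u m' n') <= nrm (dual X) (isum u m n))" for j m n
 have "\<exists>m n. largest j m n" if j: "j < k" for j
 proof -
  define A where "A = {(m, n). lo j <= m & m < n & n <= Suc (hi j)}"
  have "A \<subseteq> {..Suc (hi j)} \<times> {..Suc (hi j)}" by (auto simp: A_def)
  then have "finite A" by (rule finite_subset) simp
  moreover have "(lo j, Suc (hi j)) \<in> A" using y[OF j] by (auto simp: A_def)
  then have "A ~= {}" by blast
  ultimately have "\<exists>t\<in>A. \<forall>r\<in>A. nrm (dual X) (isum u (fst r) (snd r)) <= nrm (dual X) (isum u (fst t) (snd t))"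
   by (rule finite_argmax)
  then obtain t where t: "t \<in> A" "\<forall>r\<in>A. nrm (dual X) (isum u (fst r) (snd r)) <= nrm (dual X) (isum u (fst t) (snd t))" ..
  have "largest j (fst t) (snd t)"
   unfolding largest_def
  proof (intro conjI allI impI)
   fix m' n' assume "lo j <= m' & m' < n' & n' <= Suc (hi j)"
   then have "(m', n') \<in> A" by (simp add: A_def)
   then show "nrm (dual X) (isum u m' n') <= nrm (dual X) (isum u (fst t) (snd t))" using t(2) by fastforce
  qed (use t(1) in \<open>auto simp: A_def\<close>)
  then show ?thesis by blast
 qed
 then obtain m n where "!!j. j < k ==> largest j (m j) (n j)" by metis
 then have mn: "!!j. j < k ==> lo j <= m j & m j < n j & n j <= Suc (hi j)" and
  mx: "!!j m' n'. j < k ==> lo j <= m' ==> m' < n' ==> n' <= Suc (hi j) ==>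
   nrm (dual X) (isum u m' n') <= nrm (dual X) (isum u (m j) (n j))"
  unfolding largest_def by blast+
 have m1: "1 <= m j" if "j < k" for j using mn[OF that] y[OF that] by simp
 have pb: "\<bar>pair (y j) u\<bar> <= nrm (dual X) (isum u (m j) (n j))" if j: "j < k" for j
  by (rule pair_block_le[where lo = "lo j" and hi = "hi j"])
   (use y[OF j] us mx[OF j] nrm_nonneg[OF D isum_dual[OF us]] in auto)
 define wit where "wit j d \<longleftrightarrow> d \<in> F (s (n j - 1)) & (\<forall>h\<in>H (s (m j - 1)). h d = 0) & nrm X d <= 6 &
   nrm (dual X) (isum u (m j) (n j)) <= 2 * isum u (m j) (n j) d" for j d
 have "\<exists>d. wit j d" if j: "j < k" for j
 proof -
  have "m j < n j" using mn[OF j] by simp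
  from witness[OF s us m1[OF j] this] show ?thesis unfolding wit_def by metis
 qed
 then obtain d where "!!j. j < k ==> wit j (d j)" by metis
 then have d: "!!j. j < k ==> d j \<in> F (s (n j - 1))" "!!j h. j < k ==> h \<in> H (s (m j - 1)) ==> h (d j) = 0"
  "!!j. j < k ==> nrm X (d j) <= 6" "!!j. j < k ==> nrm (dual X) (isum u (m j) (n j)) <= 2 * isum u (m j) (n j) (d j)"
  unfolding wit_def by blast+
 \<comment> \<open>An index beyond all windows; inserting 0 keeps the maximum defined for
   \<open>k = 0\<close>.\<close>
 define L where "L = Suc (Max (insert 0 (hi ` {..<k})))"
 have L: "Suc (hi j) <= L" if "j < k" for j unfolding L_def using that by (intro Suc_le_mono[THEN iffD2] Max_ge) auto
 define g where "g = isum u 0 L"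
 have gD: "g \<in> pts (dual X)" unfolding g_def by (rule isum_dual[OF us])
 have gn: "nrm (dual X) g <= 1" using uK by (simp add: K_def g_def)
 have gd: "g (d j) = isum u (m j) (n j) (d j)" if j: "j < k" for j
 proof -
  have "u i (d j) = 0" if i: "i < m j \<or> n j <= i" for i
   using i
  proof
   assume "i < m j"
   then have "s i <= s (m j - 1)" by (simp add: strict_mono_less_eq[OF sm])
   then have "u i \<in> H (s (m j - 1))" using s(2)[of i] H_mono by blast
   then show ?thesis using d(2)[OF j] by blast
  next
   assume "n j <= i"
   then have "s (n j - 1) <= s (i - 1)" by (simp add: strict_mono_less_eq[OF sm])
   then have "d j \<in> F (s (i - 1))" using d(1)[OF j] F_mono by blast
   then show ?thesis using s(3)[of i] \<open>n j <= i\<close> mn[OF j] m1[OF j] by simp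
  qed
  then show ?thesis
   unfolding g_def isum_def sum_fun_apply using mn[OF j] L[OF j] by (intro sum.mono_neutral_right) auto
 qed
 have dp: "d j \<in> pts X" if "j < k" for j using d(1)[OF that] F_pts by blast
 define V where "V = nrm W (\<Sum>j<k. a j *\<^sub>R v (N (R (lo j))))"
 \<comment> \<open>Neighbouring witnesses may share a level, since \<open>n i - 1\<close> can equal
   \<open>m (Suc i) - 1\<close>. Two steps apart they are separated, as the estimate with overlaps
   asks.\<close>
 have order: "m i - 1 < m j - 1 & n i - 1 < m j - 1 & lo i < m j - 1 & lo i < lo j & m i - 1 < lo j" if "j < k" "i + 2 <= j" for i j
  using mn[of i] mn[of j] sep[of i "Suc i"] sep[of "Suc i" j] y[of "Suc i"] y[of i] that by auto
 have lo_inc: "lo i < lo j" if "i < j" "j < k" for i j using sep[OF that] y[of i] that by force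
 have inj: "inj_on (\<lambda>j. N (R (lo j))) {..<k}"
  using lo_inc by (intro linorder_inj_onI') (auto simp: strict_mono_eq[OF N] strict_mono_eq[OF R] dest: less_imp_neq)
 have U: "nrm X (\<Sum>j<k. \<bar>a j\<bar> *\<^sub>R (1/6) *\<^sub>R d j) <= (2 * C + 2) * nrm W (\<Sum>j<k. \<bar>a j\<bar> *\<^sub>R v (N (R (lo j))))"
 proof (rule upper_estimate_overlapping[OF G C N _ _ inj])
  fix j assume j: "j < k"
  have "s (m j - 1) <= s (n j - 1)" using mn[OF j] diff_le_mono[of "m j" "n j" 1] by (simp add: strict_mono_less_eq[OF sm])
  moreover have "h ((1/6) *\<^sub>R d j) = 0" if "h \<in> H (s (m j - 1))" for h
   using d(2)[OF j that] dual_scale[OF H_pts[OF that] dp[OF j]] by simp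
  ultimately show "s (m j - 1) <= s (n j - 1) & (1/6) *\<^sub>R d j \<in> F (s (n j - 1)) &
    (\<forall>h\<in>H (s (m j - 1)). h ((1/6) *\<^sub>R d j) = 0) & nrm X ((1/6) *\<^sub>R d j) <= 1"
   using d(1,3)[OF j] by (auto intro: subspace_scale[OF F_sub] simp: nrm_scale[OF X dp[OF j]])
 next
  fix i j assume j: "j < k" and ij: "i + 2 <= j"
  note o = order[OF j ij]
  have 1: "s (n i - 1) < s (m j - 1)" using o by (simp add: strict_mono_less[OF sm])
  have 2: "s (m i - 1) < s (m j - 1)" using o by (simp add: strict_mono_less[OF sm])
  have 3: "R (lo i) < R (lo j)" using o by (simp add: strict_mono_less[OF R])
  have 4: "s (m i - 1) < R (lo j)"
   using valid_le[OF s(1), of "m i - 1"] o strict_mono_less[OF R, of "m i - 1" "lo j"] by simp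
  \<comment> \<open>The window condition puts the cutting point \<open>s (m j - 1)\<close> above
    \<open>R (m j - 2)\<close>.\<close>
  have 5: "R (lo i) < s (m j - 1)"
  proof -
   have "lo i <= m j - 2" using o by arith
   then have "R (lo i) <= R (m j - 2)" by (simp add: strict_mono_less_eq[OF R])
   moreover have "R (m j - 2) < s (Suc (m j - 2))" using s(1) by (simp add: valid_def)
   moreover have "Suc (m j - 2) = m j - 1" using o by arith
   ultimately show ?thesis by simp
  qed
  show "s (n i - 1) < s (m j - 1) & max (N (s (m i - 1))) (N (R (lo i))) < min (N (s (m j - 1))) (N (R (lo j)))"
   using 1 2 3 4 5 by (simp add: strict_mono_less[OF N])
 qed
 have sp: "(\<Sum>j<k. \<bar>a j\<bar> *\<^sub>R d j) \<in> pts X" using dp by (intro pts_sum[OF X] pts_scale[OF X]) auto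
 have "\<bar>pair (\<Sum>j<k. a j *\<^sub>R y j) u\<bar> = \<bar>\<Sum>j<k. a j * pair (y j) u\<bar>" using y by (subst pair_sum) auto
 also have "\<dots> <= (\<Sum>j<k. \<bar>a j * pair (y j) u\<bar>)" by (rule sum_abs)
 also have "\<dots> <= (\<Sum>j<k. \<bar>a j\<bar> * (2 * g (d j)))"
  unfolding abs_mult using pb d(4) gd by (intro sum_mono mult_left_mono) (auto intro: order_trans)
 also have "\<dots> = 2 * (\<Sum>j<k. g (\<bar>a j\<bar> *\<^sub>R d j))"
  unfolding sum_distrib_left by (intro sum.cong) (auto simp: dual_scale[OF gD dp])
 also have "\<dots> = 2 * g (\<Sum>j<k. \<bar>a j\<bar> *\<^sub>R d j)" using dp by (subst dual_sum[OF gD X]) (auto intro: pts_scale[OF X])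
 also have "\<dots> <= 2 * (1 * nrm X (\<Sum>j<k. \<bar>a j\<bar> *\<^sub>R d j))"
  using dual_bound[OF X gD sp] mult_right_mono[OF gn nrm_nonneg[OF X sp]] by (simp add: abs_le_iff)
 also have "(\<Sum>j<k. \<bar>a j\<bar> *\<^sub>R d j) = 6 *\<^sub>R (\<Sum>j<k. \<bar>a j\<bar> *\<^sub>R (1/6) *\<^sub>R d j)" by (simp add: scaleR_sum_right)
 also have "nrm X \<dots> = 6 * nrm X (\<Sum>j<k. \<bar>a j\<bar> *\<^sub>R (1/6) *\<^sub>R d j)"
  using dp by (subst nrm_scale[OF X]) (auto intro!: pts_sum[OF X] pts_scale[OF X])
 also have "2 * (1 * (6 * nrm X (\<Sum>j<k. \<bar>a j\<bar> *\<^sub>R (1/6) *\<^sub>R d j))) <=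
   12 * ((2 * C + 2) * nrm W (\<Sum>j<k. \<bar>a j\<bar> *\<^sub>R v (N (R (lo j)))))" using U by simp
 also have "\<dots> <= 12 * ((2 * C + 2) * V)"
  unfolding V_def using C inj by (intro mult_left_mono coeff_mono) auto
 finally show "\<bar>pair (\<Sum>j<k. a j *\<^sub>R y j) u\<bar> <= 12 * (2 * C + 2) * nrm W (\<Sum>j<k. a j *\<^sub>R v (N (R (lo j))))"
  unfolding V_def mult.assoc .
qed

lemma coarse_block_norm: "block_norm W v coords dnorm (\<lambda>j. N (R j)) (12 * (2 * C + 2))"
proof unfold_locales
 show "strict_mono (\<lambda>j. N (R j))" using N R by (simp add: strict_mono_def)
 show "1 <= 12 * (2 * C + 2)" using C by simp
 show "\<exists>A. finite A & coords i = span A" for i by (rule coords_span)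
 have "\<rho> 0 0 = 0" using \<rho>_scale[OF pts_zero[OF X], of 0 0] by simp
 then show "coords 0 = {0}" by (simp add: coords_def R0 F0)
 show "normed_space \<lparr>pts = {z. (\<forall>i. z i \<in> coords i) & finite {i. z i ~= 0}}, nrm = dnorm\<rparr>"
  using dnorm_normed by (simp add: cseqs_def)
 show "dnorm (\<lambda>i. if i < n then z i else 0) <= dnorm z" if "\<forall>i. z i \<in> coords i" "finite {i. z i ~= 0}" for z n
  using dnorm_truncate[of z n] that by (simp add: cseqs_def)
 fix k :: nat and y lo hi a
 assume "!!j. j < k ==> (\<forall>i. y j i \<in> coords i) & finite {i. y j i ~= 0} & dnorm (y j) <= 1 &
   1 <= lo j & lo j <= hi j & (\<forall>i. y j i ~= 0 --> lo j <= i & i <= hi j)"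
  and "!!i j. i < j ==> j < k ==> hi i < lo j"
 then show "dnorm (\<Sum>j<k. a j *\<^sub>R y j) <= 12 * (2 * C + 2) * nrm W (\<Sum>j<k. a j *\<^sub>R v (N (R (lo j))))"
  by (intro dnorm_upper[where hi = hi]) (auto simp: cseqs_def)
qed

end

section \<open>Splitting functionals and the embedding\<close>

context coarse
begin

text \<open>A functional is split along the coarse scale: the interpolating \<open>y j \<in> H (s j)\<close> are corrected
 by small functionals \<open>c j\<close> so that their differences vanish on \<open>F (s (j - 1))\<close>.\<close>

lemma splitting:
 assumes f: "f \<in> H (Suc n)" "nrm (dual X) f <= 1"
 obtains u L where "u \<in> splits" "!!m k. nrm (dual X) (isum u m k) <= 9"
  "!!i. L <= i ==> u i = 0" "!!x. x \<in> pts X ==> f x - (1/4) * nrm X x <= isum u 0 L x"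
proof -
 have fD: "f \<in> pts (dual X)" by (rule H_pts[OF f(1)])
 define e where "e j = (1/64) * (1/2::real) ^ j" for j :: nat
 have e0: "e j > 0" for j by (simp add: e_def)
 have esum: "(\<Sum>j\<in>{a..<b}. e j) <= 1/32" for a b
 proof -
  have "(\<Sum>j\<in>{a..<b}. e j) = (1/64) * (\<Sum>j\<in>{a..<b}. (1/2) ^ j)" by (simp add: e_def sum_distrib_left)
  also have "\<dots> <= (1/64) * (2 * (1/2) ^ a)" by (intro mult_left_mono geometric_partial_sum) simp
  also have "\<dots> <= 1/32" using power_le_one[of "1/2::real" a] by simp
  finally show ?thesis .
 qed
 have e1: "e j <= 1" for j using power_le_one[of "1/2::real" j] by (simp add: e_def)
 \<comment> \<open>From level \<open>n + 2\<close> on the interpolant is \<open>f\<close> itself,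
   which already lies in \<open>H (Suc n)\<close>; this keeps the splitting finite. At 0 the level 0
   forces the zero functional.\<close>
 define ok where "ok j s y \<longleftrightarrow> y \<in> H s & (\<forall>x\<in>F s. \<bar>f x - y x\<bar> <= e j * nrm X x) &
   (j = 0 --> s = 0) & (0 < j --> R (j - 1) < s & s <= R j) & (n + 2 <= j --> y = f)" for j s y
 have "\<exists>s y. ok j s y" for j
 proof (cases j)
  case 0
  then have "ok j 0 0"
   using subspace_0[OF H_sub] F0 nrm_zero[OF X] dual_zero[OF fD X] by (simp add: ok_def)
  then show ?thesis by blast
 next
  case (Suc i)
  show ?thesis
  proof (cases "n + 2 <= j")
   case True
   have "Suc n <= R j" using strict_mono_imp_increasing[OF R, of j] True by simp
   then have "f \<in> H (R j)" using f(1) H_mono by blast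
   moreover have "0 <= e j * nrm X x" if "x \<in> F (R j)" for x
    using e0[of j] nrm_nonneg[OF X F_pts[OF that]] by simp
   ultimately have "ok j (R j) f"
    using Suc strict_mono_less[OF R, of i "Suc i"] by (simp add: ok_def)
   then show ?thesis by blast
  next
   case False
   obtain s y where "R i < s" "s <= R (Suc i)" "y \<in> H s" "\<forall>x\<in>F s. \<bar>f x - y x\<bar> <= e (Suc i) * nrm X x"
    using interp[OF fD f(2), of i] unfolding e_def by blast
   then have "ok j s y" using Suc False by (simp add: ok_def)
   then show ?thesis by blast
  qed
 qed
 then obtain s y where ok: "!!j. ok j (s j) (y j)" by metis
 have s: "valid s" using ok[of 0] ok[of "Suc _"] by (simp add: valid_def ok_def)
 have sm: "strict_mono s" by (rule valid_mono[OF s])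
 have yH: "y j \<in> H (s j)" and near: "x \<in> F (s j) ==> \<bar>f x - y j x\<bar> <= e j * nrm X x"
  and yf: "n + 2 <= j ==> y j = f" for j x
  using ok[of j] by (auto simp: ok_def)
 have yD: "y j \<in> pts (dual X)" for j by (rule H_pts[OF yH])
 have y0: "y 0 = 0" using yH[of 0] s H0 by (simp add: valid_def)
 \<comment> \<open>Tested on a lift to \<open>F (s j)\<close> of norm at most 2, where
   \<open>f\<close> is at most 2 and \<open>y j\<close> differs from \<open>f\<close> by at most
   2.\<close>
 have yn: "nrm (dual X) (y j) <= 4" for j
 proof (rule dual_nrm_le[OF X])
  fix x assume x: "x \<in> pts X" "nrm X x <= 1"
  obtain z where z: "z \<in> F (s j)" "!!h. h \<in> H (s j) ==> h z = h x" "nrm X z <= 2 * nrm X x"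
   using F_lift[OF x(1)] by blast
  have zp: "z \<in> pts X" by (rule F_pts[OF z(1)])
  have z2: "nrm X z <= 2" "0 <= nrm X z" using z(3) x(2) nrm_nonneg[OF X zp] by auto
  have "\<bar>f z\<bar> <= 1 * nrm X z" using dual_bound[OF X fD zp] mult_right_mono[OF f(2) z2(2)] by linarith
  moreover have "e j * nrm X z <= 1 * nrm X z" using e1 z2 by (intro mult_right_mono) auto
  ultimately have "\<bar>y j z\<bar> <= 4" using near[OF z(1)] z2 by linarith
  then show "\<bar>y j x\<bar> <= 4" using z(2)[OF yH] by simp
 qed simp
 define corr where "corr j c \<longleftrightarrow> c \<in> H (Suc (s j)) & (\<forall>x\<in>F (s j). c x = y (Suc j) x - y j x) &
   nrm (dual X) c <= 2 * (e j + e (Suc j)) & (n + 2 <= j --> c = 0)" for j c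
 have "\<exists>c. corr j c" for j
 proof (cases "n + 2 <= j")
  case True
  then have "corr j 0"
   using yf[of j] yf[of "Suc j"] subspace_0[OF H_sub] nrm_zero[OF D] e0[of j] e0[of "Suc j"] by (simp add: corr_def)
  then show ?thesis by blast
 next
  case False
  \<comment> \<open>This difference is known to be small on \<open>F (s j)\<close> only. Hahn-Banach
    replaces it by a functional small everywhere, and \<open>H_lift\<close> moves that one into the
    skeleton at the price of a factor 2.\<close>
  define h where "h = y (Suc j) - y j"
  have hD: "h \<in> pts (dual X)" unfolding h_def by (rule pts_diff[OF D yD yD])
  have hb: "\<bar>h x\<bar> <= (e j + e (Suc j)) * nrm X x" if x: "x \<in> F (s j)" for x
  proof -
   have "x \<in> F (s (Suc j))" using x F_mono[of "s j" "s (Suc j)"] strict_mono_less[OF sm, of j "Suc j"] by auto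
   then have "\<bar>f x - y (Suc j) x\<bar> <= e (Suc j) * nrm X x" by (rule near)
   then show ?thesis using near[OF x] by (simp add: h_def algebra_simps)
  qed
  obtain g where g: "g \<in> pts (dual X)" "!!x. x \<in> F (s j) ==> g x = h x" "nrm (dual X) g <= e j + e (Suc j)"
  proof (rule hahn_banach[OF X F_sub, of "s j" "e j + e (Suc j)" h])
   show "F (s j) \<subseteq> pts X" using F_pts by blast
   show "0 <= e j + e (Suc j)" using e0[of j] e0[of "Suc j"] by simp
  qed (use hb F_pts dual_add[OF hD] dual_scale[OF hD] in auto)
  obtain c where "c \<in> H (Suc (s j))" "!!x. x \<in> F (s j) ==> c x = g x" "nrm (dual X) c <= 2 * nrm (dual X) g"
   using H_lift[OF g(1)] by blast
  then have "corr j c" using g False by (simp add: corr_def h_def)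
  then show ?thesis by blast
 qed
 then obtain c where c: "!!j. corr j (c j)" by metis
 have cH: "c j \<in> H (Suc (s j))" and ceq: "x \<in> F (s j) ==> c j x = y (Suc j) x - y j x"
  and cn: "nrm (dual X) (c j) <= 2 * (e j + e (Suc j))" and c0: "n + 2 <= j ==> c j = 0" for j x
  using c[of j] by (auto simp: corr_def)
 have cD: "c j \<in> pts (dual X)" for j by (rule H_pts[OF cH])
 define u where "u j = (if j = 0 then 0 else y j - y (j - 1) - c (j - 1))" for j
 have u: "u (Suc j) = y (Suc j) - y j - c j" "u 0 = 0" for j by (simp_all add: u_def)
 define L where "L = n + 4"
 have uL: "u i = 0" if "L <= i" for i
 proof -
  have "y i = f" "y (i - 1) = f" "c (i - 1) = 0" "i ~= 0" using that yf c0 by (auto simp: L_def)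
  then show ?thesis by (simp add: u_def)
 qed
 have "u \<in> splits"
  unfolding splits_def
 proof (intro CollectI conjI exI[of _ s] s allI ballI u)
  show "finite {j. u j ~= 0}" by (rule finite_subset[of _ "{..<L}"]) (use uL in \<open>force simp: not_less[symmetric]\<close>, simp)
  fix j
  have "s j <= s (Suc j)" "Suc (s j) <= s (Suc j)" using strict_mono_less[OF sm, of j "Suc j"] by auto
  then show "u (Suc j) \<in> H (s (Suc j))"
   unfolding u using yH[of "Suc j"] yH[of j] cH[of j] H_mono by (intro subspace_diff[OF H_sub]) blast+
  show "u (Suc j) x = 0" if "x \<in> F (s j)" for x using ceq[OF that] by (simp add: u)
 qed
 moreover
 have us: "(\<Sum>j\<in>{Suc m..<Suc k}. u j) = y k - y m - (\<Sum>j\<in>{m..<k}. c j)" if "m <= k" for m k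
 proof -
  have "(\<Sum>j\<in>{Suc m..<Suc k}. u j) = (\<Sum>j\<in>{m..<k}. u (Suc j))" by (rule sum.shift_bounds_Suc_ivl)
  also have "\<dots> = (\<Sum>j\<in>{m..<k}. y (Suc j) - y j) - (\<Sum>j\<in>{m..<k}. c j)" by (simp add: u sum_subtractf)
  also have "(\<Sum>j\<in>{m..<k}. y (Suc j) - y j) = y k - y m" by (rule sum_Suc_diff'[OF that])
  finally show ?thesis .
 qed
 have u0: "(\<Sum>j\<in>{0..<Suc k}. u j) = (\<Sum>j\<in>{Suc 0..<Suc k}. u j)" for k
  by (simp add: sum.atLeast_Suc_lessThan u)
 have cs: "nrm (dual X) (\<Sum>j\<in>{m..<k}. c j) <= 1/4" for m k
 proof -
  have "nrm (dual X) (\<Sum>j\<in>{m..<k}. c j) <= (\<Sum>j\<in>{m..<k}. nrm (dual X) (c j))" by (rule nrm_sum[OF D cD])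
  also have "\<dots> <= (\<Sum>j\<in>{m..<k}. 2 * (e j + e (Suc j)))" by (intro sum_mono cn)
  also have "\<dots> = 2 * ((\<Sum>j\<in>{m..<k}. e j) + (\<Sum>j\<in>{Suc m..<Suc k}. e j))"
   by (simp only: sum_distrib_left[symmetric] sum.distrib sum.shift_bounds_Suc_ivl)
  also have "\<dots> <= 2 * (1/32 + 1/32)" by (intro mult_left_mono add_mono esum) simp
  finally show ?thesis by simp
 qed
 have csD: "(\<Sum>j\<in>{m..<k}. c j) \<in> pts (dual X)" for m k by (rule pts_sum[OF D cD])
 \<comment> \<open>4 for each of the two interpolants and \<open>1/4\<close> for the
   corrections.\<close>
 have b9: "nrm (dual X) (\<Sum>j\<in>{Suc m..<Suc k}. u j) <= 9" if "m <= k" for m k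
  unfolding us[OF that]
  using nrm_diff[OF D pts_diff[OF D yD yD] csD, of k m m k] nrm_diff[OF D yD yD, of k m] yn[of k] yn[of m] cs[of m k]
  by linarith
 have "nrm (dual X) (isum u m k) <= 9" for m k
 proof (cases "m < k")
  case False
  then show ?thesis by (simp add: isum_def nrm_zero[OF D])
 next
  case True
  then obtain k' where k': "k = Suc k'" by (cases k) auto
  show ?thesis
  proof (cases m)
   case 0
   then show ?thesis unfolding isum_def k' using u0[of k'] b9[of 0 k'] by simp
  next
   case (Suc m')
   then show ?thesis unfolding isum_def k' using b9[of m' k'] True k' by simp
  qed
 qed
 moreover have "f x - (1/4) * nrm X x <= isum u 0 L x" if x: "x \<in> pts X" for x
 proof -
  have "isum u 0 L = y (n + 3) - y 0 - (\<Sum>j\<in>{0..<n + 3}. c j)"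
   unfolding isum_def using u0[of "n + 3"] us[of 0 "n + 3"] by (simp add: L_def eval_nat_numeral)
  then have "isum u 0 L x = f x - (\<Sum>j\<in>{0..<n + 3}. c j) x" using yf[of "n + 3"] y0 by simp
  moreover have "\<bar>(\<Sum>j\<in>{0..<n + 3}. c j) x\<bar> <= 1/4 * nrm X x"
   using dual_bound[OF X csD x, of 0 "n + 3"] mult_right_mono[OF cs[of 0 "n + 3"] nrm_nonneg[OF X x]] by linarith
  ultimately show ?thesis by linarith
 qed
 ultimately show ?thesis using that uL by blast
qed

definition embed :: "'x => nat => ('x => real) => real"
 where "embed x = (\<lambda>j. \<rho> j x)"

text \<open>Cutting points are strictly increasing, so \<open>s (j - 1)\<close> is at least
  \<open>j - 1\<close>, hence above \<open>n\<close>, and every piece \<open>j\<close> vanishes on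
  \<open>F n\<close>.\<close>

lemma embed_zero_from:
 assumes x: "x \<in> F n" and j: "n + 2 <= j"
 shows "\<rho> j x = 0"
proof
 fix f
 show "\<rho> j x f = 0 f"
 proof (cases "f \<in> pieces j")
  case True
  then obtain u where u: "u \<in> splits" "f = u j" by (auto simp: pieces_def)
  obtain s where s: "valid s" "!!j. u j \<in> H (s j)" "!!j x. 1 <= j ==> x \<in> F (s (j - 1)) ==> u j x = 0"
   using splits_vanish[OF u(1)] by blast
  have "n <= s (j - 1)" using strict_mono_imp_increasing[OF valid_mono[OF s(1)], of "j - 1"] j by simp
  then have "x \<in> F (s (j - 1))" using x F_mono by blast
  then show ?thesis using s(3)[of j x] j u(2) by (simp add: \<rho>_def)
 qed (simp add: \<rho>_def)
qed

text \<open>Pieces \<open>j\<close> belong to \<open>H (R j)\<close>, so they do not distinguish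
  \<open>x\<close> from its lift to \<open>F (R j)\<close>.\<close>

lemma embed_cseqs:
 assumes x: "x \<in> F n"
 shows "embed x \<in> cseqs"
proof -
 have "\<rho> j x \<in> coords j" for j
 proof -
  obtain y where y: "y \<in> F (R j)" "!!h. h \<in> H (R j) ==> h y = h x" using F_lift[OF F_pts[OF x]] by blast
  have "\<rho> j x = \<rho> j y" by (auto simp: \<rho>_def pieces_def fun_eq_iff y(2)[OF splits_H])
  then show ?thesis using y(1) by (simp add: coords_def)
 qed
 moreover have "finite {j. \<rho> j x ~= 0}"
  by (rule finite_subset[of _ "{..<n + 2}"]) (use embed_zero_from[OF x] in \<open>force simp: not_less[symmetric]\<close>, simp)
 ultimately show ?thesis by (simp add: embed_def cseqs_def)
qed

lemma pair_embed:
 assumes x: "x \<in> F n" and u: "u \<in> splits" and L: "n + 2 <= L"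
 shows "pair (embed x) u = isum u 0 L x"
proof -
 have "pair (embed x) u = (\<Sum>j<L. embed x j (u j))"
  by (rule pair_eq) (use embed_zero_from[OF x] L in \<open>simp add: embed_def\<close>)
 also have "\<dots> = (\<Sum>j<L. u j x)" using u by (intro sum.cong) (auto simp: embed_def \<rho>_def pieces_def)
 finally show ?thesis by (simp add: isum_def sum_fun_apply lessThan_atLeast0)
qed

lemma dnorm_embed_le:
 assumes x: "x \<in> F n"
 shows "dnorm (embed x) <= nrm X x"
proof (rule dnorm_le)
 fix u assume u: "u \<in> K"
 then have us: "u \<in> splits" and n1: "nrm (dual X) (isum u 0 (n + 2)) <= 1" by (auto simp: K_def)
 show "\<bar>pair (embed x) u\<bar> <= nrm X x"
  unfolding pair_embed[OF x us order_refl]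
  using dual_bound[OF X isum_dual[OF us] F_pts[OF x], of 0 "n + 2"] mult_right_mono[OF n1 nrm_nonneg[OF X F_pts[OF x]]]
  by linarith
qed

text \<open>A norming functional is pushed into \<open>H (Suc n)\<close> and halved to restore norm
  1; splitting it loses at most \<open>1/4\<close> of the norm of \<open>x\<close>, leaving
  \<open>1/2 - 1/4\<close>. Division by the bound 9 on interval sums gives
  \<open>1/36\<close>.\<close>

lemma dnorm_embed_ge:
 assumes x: "x \<in> F n"
 shows "(1/36) * nrm X x <= dnorm (embed x)"
proof -
 have xp: "x \<in> pts X" by (rule F_pts[OF x])
 obtain f where f: "f \<in> pts (dual X)" "nrm (dual X) f <= 1" "f x = nrm X x" by (rule norming_functional[OF X xp])
 obtain g where g: "g \<in> H (Suc n)" "!!z. z \<in> F n ==> g z = f z" "nrm (dual X) g <= 2 * nrm (dual X) f"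
  using H_lift[OF f(1)] by blast
 have gD: "g \<in> pts (dual X)" by (rule H_pts[OF g(1)])
 have "(1/2) *\<^sub>R g \<in> H (Suc n)" by (rule subspace_scale[OF H_sub g(1)])
 moreover have "nrm (dual X) ((1/2) *\<^sub>R g) <= 1" using g(3) f(2) by (simp add: nrm_scale[OF D gD])
 ultimately obtain u L where u: "u \<in> splits" "!!m k. nrm (dual X) (isum u m k) <= 9" "!!i. L <= i ==> u i = 0"
  "!!x. x \<in> pts X ==> ((1/2) *\<^sub>R g) x - (1/4) * nrm X x <= isum u 0 L x"
  using splitting by blast
 define M where "M = max L (n + 2)"
 have "isum u 0 M = isum u 0 L"
  unfolding isum_def by (intro sum.mono_neutral_right) (use u(3) in \<open>auto simp: M_def\<close>)
 then have "pair (embed x) u = isum u 0 L x" using pair_embed[OF x u(1), of M] by (simp add: M_def)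
 then have 1: "(1/4) * nrm X x <= pair (embed x) u"
  using u(4)[OF xp] g(2)[OF x] f(3) by (simp add: scaleR_fun_def)
 have "nrm (dual X) (isum (\<lambda>j. (1/9) *\<^sub>R u j) m k) <= 1" for m k
  unfolding isum_scale nrm_scale[OF D isum_dual[OF u(1)]] using u(2)[of m k] by simp
 then have "(\<lambda>j. (1/9) *\<^sub>R u j) \<in> K" using splits_scale[OF u(1)] by (simp add: K_def)
 then have "\<bar>(1/9) * pair (embed x) u\<bar> <= dnorm (embed x)"
  using pair_le[OF embed_cseqs[OF x]] pair_scale_right[OF embed_cseqs[OF x] u(1), of "1/9"] by metis
 then show ?thesis using 1 by (simp add: abs_le_iff)
qed

theorem embeds_in_block_space:
 assumes BX: "banach_space X" and cd: "continuum_dimensional TYPE('z::real_vector)"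
 shows "\<exists>Z :: 'z nspace. banach_space Z & (\<exists>T. iso_embedding X Z T) &
  (\<exists>E. shrinking_FDD Z E & upper_block_estimates W v Z E)"
proof -
 interpret bn: block_norm W v coords dnorm "\<lambda>j. N (R j)" "12 * (2 * C + 2)" by (rule coarse_block_norm)
 obtain Z :: "'z nspace" and E J where Z: "banach_space Z" "shrinking_FDD Z E" "upper_block_estimates W v Z E"
  and J: "bounded_operator bn.c00 Z J" "!!y. y \<in> pts bn.c00 ==> nrm Z (J y) = dnorm y"
   "!!z e. z \<in> pts Z ==> e > 0 ==> \<exists>y\<in>pts bn.c00. nrm Z (z - J y) < e"
  using bn.block_norm_space[OF cd] by blast
 have c00: "pts bn.c00 = cseqs" by (auto simp: bn.c00_def cseqs_def)
 define U where "U = (\<Union>n. F n)"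
 have U2: "\<exists>n. x \<in> F n & y \<in> F n" if xy: "x \<in> U" "y \<in> U" for x y
 proof -
  obtain i j where "x \<in> F i" "y \<in> F j" using xy by (auto simp: U_def)
  then have "x \<in> F (max i j)" "y \<in> F (max i j)" using F_mono[of i "max i j"] F_mono[of j "max i j"] by auto
  then show ?thesis by blast
 qed
 have Usub: "subspace U"
  unfolding subspace_def
 proof (intro conjI ballI allI)
  show "0 \<in> U" using F0 by (auto simp: U_def)
  show "x + y \<in> U" if "x \<in> U" "y \<in> U" for x y using U2[OF that] subspace_add[OF F_sub] by (auto simp: U_def)
  show "c *\<^sub>R x \<in> U" if "x \<in> U" for x c using that subspace_scale[OF F_sub] by (auto simp: U_def)
 qed
 have Ep: "embed x \<in> pts bn.c00" if "x \<in> U" for x using that embed_cseqs c00 by (auto simp: U_def)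
 obtain S where S: "bounded_operator X Z S" "!!x. x \<in> pts X ==> (1/36) * nrm X x <= nrm Z (S x)"
 proof (rule extend_dense[OF X Z(1) Usub, where T = "\<lambda>x. J (embed x)" and K = 1 and c = "1/36"])
  show "U \<subseteq> pts X" using F_pts by (auto simp: U_def)
  show "\<exists>d\<in>U. nrm X (x - d) < e" if "x \<in> pts X" "0 < e" for x e using F_dense[OF that] by (auto simp: U_def)
  fix x assume x: "x \<in> U"
  then have xp: "x \<in> pts X" using F_pts by (auto simp: U_def)
  show "J (embed x) \<in> pts Z" by (rule op_mem[OF J(1) Ep[OF x]])
  show "nrm Z (J (embed x)) <= 1 * nrm X x" using x J(2)[OF Ep[OF x]] dnorm_embed_le by (auto simp: U_def)
  show "1/36 * nrm X x <= nrm Z (J (embed x))" using x J(2)[OF Ep[OF x]] dnorm_embed_ge by (auto simp: U_def)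
  show "J (embed (c *\<^sub>R x)) = c *\<^sub>R J (embed x)" for c
  proof -
   have "embed (c *\<^sub>R x) = c *\<^sub>R embed x" by (simp add: embed_def fun_eq_iff \<rho>_scale[OF xp] scaleR_fun_def)
   then show ?thesis using op_scale[OF J(1) Ep[OF x]] by simp
  qed
  fix y assume y: "y \<in> U"
  then have yp: "y \<in> pts X" using F_pts by (auto simp: U_def)
  have "embed (x + y) = embed x + embed y" by (simp add: embed_def fun_eq_iff \<rho>_add[OF xp yp])
  then show "J (embed (x + y)) = J (embed x) + J (embed y)" using op_add[OF J(1) Ep[OF x] Ep[OF y]] by simp
 qed blast
 then have "iso_embedding X Z S" unfolding iso_embedding_def by (intro conjI exI[of _ "1/36"]) auto
 then show ?thesis using Z by blast
qed

end

theorem (in game) embeds_in_block_space: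
 assumes BX: "banach_space X" and G: "good_estimate C N F H" and C: "C >= 1" and N: "strict_mono N"
  and cd: "continuum_dimensional TYPE('z::real_vector)"
 shows "\<exists>Z :: 'z nspace. banach_space Z & (\<exists>T. iso_embedding X Z T) &
  (\<exists>E. shrinking_FDD Z E & upper_block_estimates W v Z E)"
proof -
 obtain R where R: "strict_mono R" "R 0 = 0"
  "!!j f. f \<in> pts (dual X) ==> nrm (dual X) f <= 1 ==>
   \<exists>s. R j < s & s <= R (Suc j) & (\<exists>y\<in>H s. \<forall>x\<in>F s. \<bar>f x - y x\<bar> <= (1/64) * (1/2) ^ Suc j * nrm X x)"
  using coarse_sequence by blast
 interpret coarse W v X F H C N R using G C N R by unfold_locales
 show ?thesis by (rule embeds_in_block_space[OF BX cd])
qed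

section \<open>Duality of upper and lower estimates\<close>

context vseq
begin

lemma SN: "normed_space S" by (rule banach_normed[OF BS])

lemma functional_eq_if_eq_on_v:
 assumes f: "f \<in> pts (dual S)" "g \<in> pts (dual S)" and eq: "!!j. f (v j) = g (v j)"
 shows "f = g"
proof
 fix x
 interpret L: fdd S "lines v" by (rule S_fdd)
 show "f x = g x"
 proof (cases "x \<in> pts S")
  case False
  then show ?thesis using f by (simp add: dual_off)
 next
  case True
  have "f y = g y" if "y \<in> span {v i}" for i y
   using eq_on_span_points[OF SN _ f, of "{v i}" y] that eq v_S by auto
  then have "f (component S (lines v) x i) = g (component S (lines v) x i)" for i
   using L.comp_mem[OF True] by blast
  then have "f (proj S (lines v) n x) = g (proj S (lines v) n x)" for n
   by (simp add: proj_def dual_sum[OF f(1) SN L.comp_pts[OF True]] dual_sum[OF f(2) SN L.comp_pts[OF True]] cong: sum.cong)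
  then show ?thesis
   using LIMSEQ_unique[OF dual_conv[OF SN f(1) L.proj_pts[OF True] L.proj_conv[OF True]]]
    dual_conv[OF SN f(2) L.proj_pts[OF True] L.proj_conv[OF True]] by simp
 qed
qed

text \<open>Uniqueness holds because a functional is determined by its values on \<open>v\<close>;
  existence is the coefficient in the FDD expansion, bounded because the partial sum projections
  are.\<close>

lemma biorthogonal:
 shows biorthogonal_dual: "biorthogonal W v i \<in> pts (dual S)"
  and biorthogonal_v: "biorthogonal W v i (v j) = (if j = i then 1 else 0)"
  and component_biorthogonal: "x \<in> pts S ==> component S (lines v) x i = biorthogonal W v i x *\<^sub>R v i"
proof -
 interpret L: fdd S "lines v" by (rule S_fdd)
 have "\<exists>c. component S (lines v) x i = c *\<^sub>R v i" if "x \<in> pts S" for x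
  using L.comp_mem[OF that, of i] by (auto simp: span_singleton)
 then obtain c where c: "!!x. x \<in> pts S ==> component S (lines v) x i = c x *\<^sub>R v i" by metis
 have vi: "a = b" if "a *\<^sub>R v i = b *\<^sub>R v i" for a b using that v_nonzero[of i] by simp
 obtain K where K: "K > 0" "!!n z. z \<in> pts S ==> nrm S (proj S (lines v) n z) <= K * nrm S z"
  by (rule L.proj_bounded) blast
 define b where "b x = (if x \<in> pts S then c x else 0)" for x
 have bd: "b \<in> pts (dual S)"
  unfolding b_def
 proof (rule dual_restrictI[OF SN, where K = "2 * K"])
  fix x y assume x: "x \<in> pts S" and y: "y \<in> pts S"
  show "c (x + y) = c x + c y"
   by (rule vi) (simp add: c[symmetric] L.comp_add x y pts_add[OF SN] scaleR_add_left)
 next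
  fix r x assume x: "x \<in> pts S"
  show "c (r *\<^sub>R x) = r * c x"
   by (rule vi) (simp add: c[symmetric] L.comp_scale x pts_scale[OF SN] flip: scaleR_scaleR)
  have "\<bar>c x\<bar> = nrm S (component S (lines v) x i)"
   using c[OF x] by (simp add: nrm_S nrm_scale[OF W v_pts] v_nrm)
  also have "component S (lines v) x i = proj S (lines v) (Suc i) x - proj S (lines v) i x" by (simp add: proj_def)
  also have "nrm S \<dots> <= 2 * K * nrm S x"
   using nrm_diff[OF SN L.proj_pts[OF x] L.proj_pts[OF x], of "Suc i" i] K(2)[OF x, of i] K(2)[OF x, of "Suc i"] by simp
  finally show "\<bar>c x\<bar> <= 2 * K * nrm S x" .
 qed
 have bv: "b (v j) = (if j = i then 1 else 0)" for j
 proof -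
  have "c (v j) *\<^sub>R v i = (if j = i then 1 else 0) *\<^sub>R v i"
   using c[OF v_S, of j, symmetric] L.comp_single[of "v j" j i] by (simp add: span_base)
  then show ?thesis using vi[of "c (v j)" "if j = i then 1 else 0"] v_S by (simp add: b_def)
 qed
 have "biorthogonal W v i = b"
  unfolding biorthogonal_def
 proof (rule the_equality)
  show "b \<in> pts (dual S) & (\<forall>j. b (v j) = (if j = i then 1 else 0))" using bd bv by blast
  show "f = b" if "f \<in> pts (dual S) & (\<forall>j. f (v j) = (if j = i then 1 else 0))" for f
   by (rule functional_eq_if_eq_on_v[OF conjunct1[OF that] bd]) (use that bv in simp)
 qed
 then show "biorthogonal W v i \<in> pts (dual S)" "biorthogonal W v i (v j) = (if j = i then 1 else 0)"
  "x \<in> pts S ==> component S (lines v) x i = biorthogonal W v i x *\<^sub>R v i"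
  using bd bv c by (auto simp: b_def)
qed

text \<open>Unconditionality compares the chosen coordinates with a long partial sum, whose norm
  tends to that of \<open>x\<close>.\<close>

lemma coordinates_norm_le:
 assumes x: "x \<in> pts S" and J: "finite J" "inj_on m J"
 shows "nrm W (\<Sum>k\<in>J. biorthogonal W v (m k) x *\<^sub>R v (m k)) <= nrm W x"
proof -
 interpret L: fdd S "lines v" by (rule S_fdd)
 obtain p0 where p0: "\<forall>i\<in>m ` J. i < p0" using finite_nat_set_iff_bounded[of "m ` J"] J(1) by auto
 have "nrm W (\<Sum>k\<in>J. biorthogonal W v (m k) x *\<^sub>R v (m k)) <= nrm S (proj S (lines v) p x)" if "p >= p0" for p
 proof -
  have "(\<Sum>k\<in>J. biorthogonal W v (m k) x *\<^sub>R v (m k)) = (\<Sum>i\<in>m ` J. biorthogonal W v i x *\<^sub>R v i)"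
   by (simp add: sum.reindex[OF J(2)])
  also have "nrm W \<dots> <= nrm W (\<Sum>i\<in>{..<p}. biorthogonal W v i x *\<^sub>R v i)"
   using coeff_mono[of "{..<p}" "m ` J" "\<lambda>i. i"] p0 that by fastforce
  finally show ?thesis by (simp add: proj_def component_biorthogonal[OF x] nrm_S)
 qed
 moreover have "(\<lambda>p. nrm S (proj S (lines v) p x)) \<longlonglongrightarrow> nrm S x"
  by (rule nconv_nrm[OF SN L.proj_pts[OF x] L.proj_conv[OF x]])
 ultimately show ?thesis using LIMSEQ_le_const[of _ "nrm S x"] unfolding nrm_S by blast
qed

end

context fdd
begin

lemma dproj_diff: "f \<in> pts (dual Z) ==> g \<in> pts (dual Z) ==> dproj (f - g) n = dproj f n - dproj g n"
 by (auto simp: dproj_def)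

lemma dproj_of_sum:
 assumes s: "!!i. s i \<in> dual_FDD Z E i" and nm: "m <= n" and z: "z \<in> pts Z"
 shows "(\<Sum>i<m. s i) z = (\<Sum>i<n. s i) (proj Z E m z)"
proof -
 have "s i (proj Z E m z) = (if i < m then s i z else 0)" for i
 proof -
  have sd: "s i \<in> pts (dual Z)" using s[of i] by (simp add: dual_FDD_def)
  have "s i (proj Z E m z) = s i (component Z E (proj Z E m z) i)"
   by (rule coord_of_dual_FDD[OF s proj_pts[OF z]])
  also have "\<dots> = (if i < m then s i (component Z E z i) else 0)"
   by (simp add: comp_proj[OF z] dual_zero[OF sd Z])
  finally show ?thesis using coord_of_dual_FDD[OF s z, of i] by simp
 qed
 then have "(\<Sum>i<n. s i) (proj Z E m z) = (\<Sum>i<n. if i < m then s i z else 0)" by (simp add: sum_fun_apply)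
 also have "\<dots> = (\<Sum>i<m. s i z)" using nm by (intro sum.mono_neutral_cong_right) auto
 finally show ?thesis by (simp add: sum_fun_apply)
qed

text \<open>Pointwise convergence is enough to recover the coordinates; for bounded completeness of
  the dual FDD it is all that is available at first.\<close>

lemma coord_of_limit:
 assumes s: "!!i. s i \<in> dual_FDD Z E i" and f: "f \<in> pts (dual Z)"
  and lim: "!!z. z \<in> pts Z ==> (\<lambda>n. (\<Sum>i<n. s i) z) \<longlonglongrightarrow> f z"
 shows "coord f i = s i"
proof
 fix z
 have sd: "s j \<in> pts (dual Z)" for j using s[of j] by (simp add: dual_FDD_def)
 show "coord f i z = s i z"
 proof (cases "z \<in> pts Z")
  case False
  then show ?thesis by (simp add: coord_def dual_off[OF sd])
 next
  case True
  have "(\<Sum>j<n. s j) (component Z E z i) = s i z" if "n > i" for n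
  proof -
   have "s j (component Z E z i) = (if j = i then s i z else 0)" for j
    using coord_of_dual_FDD[OF s comp_pts[OF True], of j i] comp_single[OF comp_mem[OF True], of i j]
     coord_of_dual_FDD[OF s True, of i] dual_zero[OF sd Z] by auto
   then show ?thesis using that by (simp add: sum_fun_apply)
  qed
  then have "(\<lambda>n. (\<Sum>j<n. s j) (component Z E z i)) \<longlonglongrightarrow> s i z"
   by (intro tendsto_eventually eventually_sequentiallyI[of "Suc i"]) auto
  then show ?thesis using LIMSEQ_unique lim[OF comp_pts[OF True]] True by (auto simp: coord_def)
 qed
qed

lemma dual_conv_pointwise:
 assumes "!!n. g n \<in> pts (dual Z)" "nconv (dual Z) g f" "z \<in> pts Z"
 shows "(\<lambda>n. g n z) \<longlonglongrightarrow> f z"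
 using op_conv[OF eval_functional[OF Z assms(3)] D normed_space_real assms(1,2)]
 by (auto simp: nconv_def intro: LIM_zero_cancel tendsto_rabs_zero_cancel)

lemma dual_FDD_span: "\<exists>A. finite A & dual_FDD Z E i = span A"
proof -
 obtain A where A: "finite A" "E i = span A" by (rule E_span)
 show ?thesis
 proof (rule findim_functions[OF A(1) dual_FDD_sub])
  fix f assume f: "f \<in> dual_FDD Z E i" and 0: "!!b. b \<in> A ==> f b = 0"
  have fD: "f \<in> pts (dual Z)" using f by (simp add: dual_FDD_def)
  have Ap: "A \<subseteq> pts Z" using A(2) E_pts span_superset by blast
  have "f x = 0" if "x \<in> E i" for x
   using eq_on_span_points[OF Z Ap fD pts_zero[OF D]] 0 that A(2) by auto
  then have "f z = 0" for z
   using coord_of_dual_FDD[OF f] comp_mem dual_off[OF fD] by (cases "z \<in> pts Z") auto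
  then show "f = 0" by auto
 qed
qed

text \<open>The adjoint projections are uniformly bounded and eventually fix each element of the
  dense span.\<close>

lemma dproj_conv:
 assumes dense: "closed_span (dual Z) (\<Union>i. dual_FDD Z E i) = pts (dual Z)" and f: "f \<in> pts (dual Z)"
 shows "nconv (dual Z) (\<lambda>n. dproj f n) f"
 unfolding nconv_iff[OF D dproj_dual[OF f]]
proof (intro conjI f allI impI)
 obtain K where K: "K > 0" "!!f n. f \<in> pts (dual Z) ==> nrm (dual Z) (dproj f n) <= K * nrm (dual Z) f"
  by (rule dproj_norm) blast
 have U: "(\<Union>i. dual_FDD Z E i) \<subseteq> pts (dual Z)" by (auto simp: dual_FDD_def)
 fix e :: real assume "e > 0"
 then have "e / (1 + K) > 0" using K(1) by simp
 moreover have "f \<in> closed_span (dual Z) (\<Union>i. dual_FDD Z E i)" using f dense by simp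
 ultimately obtain g where g: "g \<in> span (\<Union>i. dual_FDD Z E i)" "nrm (dual Z) (f - g) < e / (1 + K)"
  unfolding closed_span_iff[OF D U] by blast
 have gD: "g \<in> pts (dual Z)" using g(1) span_subset_pts[OF D U] by blast
 obtain m s where s: "\<forall>i. s i \<in> span (dual_FDD Z E i)" "g = (\<Sum>i<m. s i)"
  using span_Union_finite_support[OF g(1)] by blast
 have sE: "s i \<in> dual_FDD Z E i" for i using s(1)[rule_format, of i] span_eq_iff[THEN iffD2, OF dual_FDD_sub, of i] by simp
 have gm: "dproj g n = g" if "n >= m" for n
 proof
  fix z
  show "dproj g n z = g z"
  proof (cases "z \<in> pts Z")
   case True
   have "g (proj Z E n z) = (\<Sum>i<n. if i < m then s i else 0) (proj Z E n z)"
    unfolding s(2) using that by (intro fun_cong[of "sum s {..<m}"] sum.mono_neutral_cong_left) auto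
   also have "\<dots> = (\<Sum>i<n. if i < m then s i else 0) z"
    by (rule dproj_of_sum[symmetric, OF _ order_refl True]) (auto simp: sE subspace_0[OF dual_FDD_sub])
   also have "\<dots> = g z"
    unfolding s(2) using that by (intro fun_cong[of _ "sum s {..<m}"] sum.mono_neutral_cong_right) auto
   finally show ?thesis using True by (simp add: dproj_def)
  qed (simp add: dproj_def dual_off[OF gD])
 qed
 have "nrm (dual Z) (dproj f n - f) < e" if "n >= m" for n
 proof -
  have "dproj f n - f = dproj (f - g) n - (f - g)" using gm[OF that] by (simp add: dproj_diff f gD)
  then have "nrm (dual Z) (dproj f n - f) <= nrm (dual Z) (dproj (f - g) n) + nrm (dual Z) (f - g)"
   using nrm_diff[OF D dproj_dual pts_diff[OF D f gD], OF pts_diff[OF D f gD], of n] by (simp only:)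
  also have "\<dots> <= (1 + K) * nrm (dual Z) (f - g)"
   using K(2)[OF pts_diff[OF D f gD], of n] by (simp add: algebra_simps)
  also have "\<dots> < (1 + K) * (e / (1 + K))" using g(2) K(1) by (intro mult_strict_left_mono) auto
  finally show ?thesis using K(1) by simp
 qed
 then show "\<exists>N. \<forall>n\<ge>N. nrm (dual Z) (dproj f n - f) < e" by blast
qed

end

locale shrinking = fdd Z E for Z :: "'a::real_vector nspace" and E +
 assumes dense: "closed_span (dual Z) (\<Union>i. dual_FDD Z E i) = pts (dual Z)"
begin

lemma dual_is_FDD: "is_FDD (dual Z) (dual_FDD Z E)"
 unfolding is_FDD_def
proof (intro conjI allI ballI)
 show sub: "dual_FDD Z E i \<subseteq> pts (dual Z)" for i by (auto simp: dual_FDD_def)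
 show "\<exists>B. finite B & dual_FDD Z E i = span B" for i by (rule dual_FDD_span)
 fix f assume f: "f \<in> pts (dual Z)"
 have cD: "coord f i \<in> pts (dual Z)" for i using coord_mem[OF f] sub by blast
 have "series_to (dual Z) (coord f) f"
  using series_to_nconv[OF D, of "coord f" f] cD dproj_conv[OF dense f] dproj_sum[OF f] by simp
 moreover have "s = coord f" if s: "\<forall>i. s i \<in> dual_FDD Z E i" "series_to (dual Z) s f" for s
 proof
  fix i
  have sD: "s i \<in> pts (dual Z)" for i using s(1) sub by blast
  have "nconv (dual Z) (\<lambda>n. \<Sum>i<n. s i) f" using s(2) series_to_nconv[OF D, of s f] sD by simp
  then have "coord f i = s i"
   using s(1) sD f by (intro coord_of_limit dual_conv_pointwise pts_sum[OF D]) auto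
  then show "s i = coord f i" by simp
 qed
 ultimately show "\<exists>!s. (\<forall>i. s i \<in> dual_FDD Z E i) & series_to (dual Z) s f"
  using coord_mem[OF f] by (intro ex1I[of _ "coord f"]) auto
qed

sublocale dual: fdd "dual Z" "dual_FDD Z E"
 by unfold_locales (rule banach_dual[OF Z], rule dual_is_FDD)

lemma dual_component: "f \<in> pts (dual Z) ==> component (dual Z) (dual_FDD Z E) f i = coord f i"
proof -
 assume f: "f \<in> pts (dual Z)"
 have "component (dual Z) (dual_FDD Z E) f = coord f"
  using coord_mem[OF f] dproj_conv[OF dense f] by (intro dual.comp_eq) (simp_all add: dproj_sum[OF f])
 then show ?thesis by simp
qed

text \<open>Bounded partial sums converge at every vector, since \<open>T m\<close> is any later
  \<open>T n\<close> composed with a projection. The limit functional has the coordinates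
  \<open>s\<close>, and shrinking turns its expansion into norm convergence.\<close>

lemma dual_boundedly_complete: "boundedly_complete_FDD (dual Z) (dual_FDD Z E)"
 unfolding boundedly_complete_FDD_def
proof (intro conjI dual_is_FDD allI impI, elim conjE exE)
 fix s K assume s: "\<forall>i. s i \<in> dual_FDD Z E i" and K: "\<forall>n. nrm (dual Z) (\<Sum>i<n. s i) <= K"
 have sD: "s i \<in> pts (dual Z)" for i using s by (auto simp: dual_FDD_def)
 define T where "T n = (\<Sum>i<n. s i)" for n
 have TD: "T n \<in> pts (dual Z)" for n unfolding T_def by (rule pts_sum[OF D sD])
 have K0: "K >= 0" using K[rule_format, of 0] nrm_zero[OF D] by simp
 have Tb: "\<bar>T n z\<bar> <= K * nrm Z z" if "z \<in> pts Z" for n z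
  using dual_bound[OF Z TD that, of n] mult_right_mono[of "nrm (dual Z) (T n)" K "nrm Z z"] K nrm_nonneg[OF Z that]
  by (force simp: T_def)
 have Tp: "T m z = T n (proj Z E m z)" if "m <= n" "z \<in> pts Z" for m n z
  unfolding T_def by (rule dproj_of_sum) (use s that in auto)
 have "convergent (\<lambda>n. T n z)" if z: "z \<in> pts Z" for z
 proof (rule Cauchy_convergent, unfold Cauchy_def dist_real_def, intro allI impI)
  fix e :: real assume "e > 0"
  then have "e / (2 * (K + 1)) > 0" using K0 by simp
  then obtain N where N: "!!n. n >= N ==> nrm Z (proj Z E n z - z) < e / (2 * (K + 1))"
   using proj_conv[OF z, unfolded nconv_iff[OF Z proj_pts[OF z]]] by meson
  have "\<bar>T m z - T n z\<bar> < e" if "m >= N" "n >= N" for m n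
  proof -
   have pp: "proj Z E m z - proj Z E n z \<in> pts Z" by (intro pts_diff[OF Z] proj_pts z)
   have "T m z - T n z = T (max m n) (proj Z E m z - proj Z E n z)"
    using Tp[of m "max m n", OF _ z] Tp[of n "max m n", OF _ z] dual_diff[OF TD Z proj_pts[OF z] proj_pts[OF z]] by simp
   then have "\<bar>T m z - T n z\<bar> <= K * nrm Z (proj Z E m z - proj Z E n z)" using Tb[OF pp] by simp
   also have "\<dots> <= K * (2 * (e / (2 * (K + 1))))"
    using nrm_triangle[OF Z proj_pts[OF z, of m] z proj_pts[OF z, of n]] N[OF that(1)] N[OF that(2)]
     nrm_diff_commute[OF Z z proj_pts[OF z, of n]] K0 by (intro mult_left_mono) linarith+
   also have "\<dots> < e" using K0 \<open>e > 0\<close> by (simp add: field_simps)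
   finally show ?thesis .
  qed
  then show "\<exists>M. \<forall>m\<ge>M. \<forall>n\<ge>M. \<bar>T m z - T n z\<bar> < e" by blast
 qed
 then obtain g where g: "!!z. z \<in> pts Z ==> (\<lambda>n. T n z) \<longlonglongrightarrow> g z" unfolding convergent_def by metis
 define f where "f z = (if z \<in> pts Z then g z else 0)" for z
 have f: "f \<in> pts (dual Z)"
  unfolding f_def
 proof (rule dual_restrictI[OF Z, where K = K])
  fix x y assume x: "x \<in> pts Z" and y: "y \<in> pts Z"
  have "(\<lambda>n. T n (x + y)) \<longlonglongrightarrow> g x + g y" using tendsto_add[OF g[OF x] g[OF y]] by (simp add: dual_add[OF TD x y])
  then show "g (x + y) = g x + g y" using LIMSEQ_unique g[OF pts_add[OF Z x y]] by blast
 next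
  fix c x assume x: "x \<in> pts Z"
  have "(\<lambda>n. T n (c *\<^sub>R x)) \<longlonglongrightarrow> c * g x"
   using tendsto_mult[OF tendsto_const g[OF x], of c] by (simp add: dual_scale[OF TD x])
  then show "g (c *\<^sub>R x) = c * g x" using LIMSEQ_unique g[OF pts_scale[OF Z x]] by blast
  show "\<bar>g x\<bar> <= K * nrm Z x"
   by (rule LIMSEQ_le_const2[OF tendsto_rabs[OF g[OF x]]]) (use Tb[OF x] in blast)
 qed
 have "coord f i = s i" for i
  by (rule coord_of_limit[OF _ f]) (use s g in \<open>auto simp: f_def T_def\<close>)
 then have "dproj f n = (\<Sum>i<n. s i)" for n using dproj_sum[OF f] by simp
 then have "series_to (dual Z) s f" using dproj_conv[OF dense f] series_to_nconv[OF D, of s f] sD by simp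
 then show "\<exists>f. series_to (dual Z) s f" by blast
qed

lemma dual_separable: "separable_space (ntop (dual Z))"
proof -
 obtain A where A: "!!i. finite (A i)" "!!i. dual_FDD Z E i = span (A i)" using dual_FDD_span by metis
 define B where "B = (\<Union>i. A i)"
 have B: "B \<subseteq> pts (dual Z)" using A(2) span_superset by (fastforce simp: B_def dual_FDD_def)
 have "countable B" unfolding B_def using A(1) by (intro countable_UN) (auto intro: countable_finite)
 then show ?thesis
 proof (rule separable_if_countable_span_dense[OF D _ B])
  fix f and e :: real assume f: "f \<in> pts (dual Z)" and "e > 0"
  then obtain n where n: "nrm (dual Z) (dproj f n - f) < e"
   using dproj_conv[OF dense f, unfolded nconv_iff[OF D dproj_dual[OF f]]] by (meson order_refl)
  have "coord f i \<in> span B" for i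
   using coord_mem[OF f, of i] A(2)[of i] span_mono[of "A i" B] by (auto simp: B_def)
  then have "dproj f n \<in> span B" unfolding dproj_sum[OF f] by (intro span_sum)
  then show "\<exists>a\<in>span B. nrm (dual Z) (f - a) < e"
   using n nrm_diff_commute[OF D f dproj_dual[OF f], of n] by (intro bexI[of _ "dproj f n"]) auto
 qed
qed

end

context fdd
begin

lemma eval_zero_if_disjoint:
 assumes f: "f \<in> pts (dual Z)" and z: "z \<in> pts Z"
  and disj: "!!i. coord f i = 0 \<or> component Z E z i = 0"
 shows "f z = 0"
proof -
 have "f (component Z E z i) = 0" for i
  using disj[of i] dual_zero[OF f Z] z by (auto simp: coord_def fun_eq_iff split: if_splits)
 then have "f (proj Z E n z) = 0" for n
  by (simp add: proj_def dual_sum[OF f Z comp_pts[OF z]])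
 then show ?thesis
  using dual_conv[OF Z f proj_pts[OF z] proj_conv[OF z]] LIMSEQ_unique[OF tendsto_const] by fastforce
qed

end

context shrinking
begin

lemma dual_proj: "f \<in> pts (dual Z) ==> proj (dual Z) (dual_FDD Z E) n f = dproj f n"
 by (simp add: proj_def dual_component dproj_sum)

text \<open>Cutting a vector that almost norms \<open>f\<close> to the window of \<open>f\<close>
  keeps its value and costs at most \<open>2 * K\<close> in norm.\<close>

lemma biorthogonal_test_vector:
 assumes f: "f \<in> pts (dual Z)" "nrm (dual Z) f = 1"
  and sp: "supp (dual Z) (dual_FDD Z E) f \<subseteq> {m..<n}" and mn: "m <= n"
  and K: "!!n z. z \<in> pts Z ==> nrm Z (proj Z E n z) <= K * nrm Z z"
 shows "\<exists>y\<in>pts Z. nrm Z y <= 2 * K & supp Z E y \<subseteq> {m..<n} & f y >= 1 / 2"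
proof -
 obtain z where z: "z \<in> pts Z" "nrm Z z <= 1" "1 / 2 < f z"
  by (rule dual_nrm_approx[OF Z f(1), of "1 / 2"]) (use f(2) in auto)
 have c0: "coord f i = 0" if "i < m \<or> n <= i" for i
 proof -
  have "i \<notin> supp (dual Z) (dual_FDD Z E) f" using that subsetD[OF sp, of i] by auto
  then show ?thesis using dual.comp_outside_supp dual_component[OF f(1), of i] by metis
 qed
 define y where "y = proj Z E n z - proj Z E m z"
 have y: "y \<in> pts Z" unfolding y_def by (intro pts_diff[OF Z] proj_pts z)
 have cy: "component Z E y i = (if m <= i & i < n then component Z E z i else 0)" for i
  using mn by (simp add: y_def comp_diff proj_pts z(1) comp_proj)
 have "z ~= 0" using z(3) dual_zero[OF f(1) Z] by auto
 then have "nrm Z z > 0" by (rule nrm_pos[OF Z z(1)])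
 moreover have "0 <= K * nrm Z z"
  using nrm_nonneg[OF Z proj_pts[OF z(1), of 0]] K[OF z(1), of 0] by linarith
 ultimately have K0: "K >= 0" by (simp add: zero_le_mult_iff)
 have "nrm Z y <= K * nrm Z z + K * nrm Z z"
  unfolding y_def using nrm_diff[OF Z proj_pts[OF z(1)] proj_pts[OF z(1)], of n m] K[OF z(1), of n] K[OF z(1), of m] by linarith
 also have "\<dots> <= 2 * K" using mult_left_mono[OF z(2) K0] by simp
 finally have "nrm Z y <= 2 * K" .
 moreover have "f (z - y) = 0"
 proof (rule eval_zero_if_disjoint[OF f(1) pts_diff[OF Z z(1) y]])
  show "coord f i = 0 \<or> component Z E (z - y) i = 0" for i
   using c0[of i] cy[of i] by (auto simp: comp_diff z(1) y)
 qed
 then have "f y = f z" by (simp add: dual_diff[OF f(1) Z z(1) y])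
 moreover have "supp Z E y \<subseteq> {m..<n}" using cy by (auto simp: supp_def)
 ultimately show ?thesis using y z(3) by (intro bexI[of _ y]) auto
qed

text \<open>Test vectors \<open>y k\<close>, biorthogonal to the blocks up to normalization, turn
  \<open>x\<close> in the closed span of \<open>v\<close> into a vector \<open>Y\<close> of
  \<open>Z\<close>: the combination of the \<open>f k\<close> takes at \<open>Y\<close> the value
  that the combination of biorthogonal functionals takes at \<open>x\<close>. Upper estimates bound
  \<open>Y\<close> by \<open>4 * K * C\<close> times the norm of \<open>x\<close>.\<close>

lemma dual_lower_estimates:
 assumes V: "vseq W v" and up: "upper_block_estimates W v Z E"
 shows "lower_block_estimates (dual (seq_space W v)) (biorthogonal W v) (dual Z) (dual_FDD Z E)"
proof -
 interpret vseq W v by (rule V)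
 obtain C where C: "C >= 1" and UW: "!!(k :: nat) z p m a. (!!l. l < k ==> z l \<in> pts Z & nrm Z (z l) <= 1) ==>
   (!!l. l < k ==> supp Z E (z l) \<subseteq> {p l..<p (Suc l)} & m l \<in> {p l..<p (Suc l)}) ==>
   nrm Z (\<Sum>l<k. a l *\<^sub>R z l) <= C * nrm W (\<Sum>l<k. a l *\<^sub>R v (m l))"
  by (rule windowed_upper_estimate[OF V up]) blast
 obtain K where K: "K > 0" "!!n z. z \<in> pts Z ==> nrm Z (proj Z E n z) <= K * nrm Z z"
  by (rule proj_bounded) blast
 show ?thesis
  unfolding lower_block_estimates_def
 proof (intro exI[of _ "4 * K * C + 1"] conjI allI impI, goal_cases)
  case 1
  show ?case using K(1) C by simp
 next
  case (2 f)
  define m where "m k = Min (supp (dual Z) (dual_FDD Z E) (f k))" for k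
  define M where "M k = Max (supp (dual Z) (dual_FDD Z E) (f k))" for k
  have f: "f k \<in> pts (dual Z)" "nrm (dual Z) (f k) = 1" for k using 2 by (auto simp: normalized_def)
  have fin: "finite (supp (dual Z) (dual_FDD Z E) (f k))" and Mm: "M k < m (Suc k)" for k
   using 2 by (auto simp: block_seq_def m_def M_def)
  have sub: "supp (dual Z) (dual_FDD Z E) (f k) \<subseteq> {m k..<Suc (M k)}" for k
   using Min_le[OF fin] Max_ge[OF fin] by (auto simp: m_def M_def less_Suc_eq_le)
  have ne: "supp (dual Z) (dual_FDD Z E) (f k) ~= {}" for k
   using 2 by (intro dual.supp_nonempty f) (auto simp: block_seq_def)
  have mM: "m k <= M k" for k using sub[of k] ne[of k] by auto
  have sm: "strict_mono m" unfolding strict_mono_Suc_iff using mM Mm by (metis le_less_trans)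
  have "\<exists>y\<in>pts Z. nrm Z y <= 2 * K & supp Z E y \<subseteq> {m k..<Suc (M k)} & f k y >= 1 / 2" for k
   by (rule biorthogonal_test_vector[OF f sub _ K(2)]) (use mM[of k] in auto)
  then obtain y where y: "!!k. y k \<in> pts Z" "!!k. nrm Z (y k) <= 2 * K"
   "!!k. supp Z E (y k) \<subseteq> {m k..<Suc (M k)}" "!!k. f k (y k) >= 1 / 2" by metis
  have fy: "f j (y k) = 0" if "j ~= k" for j k
  proof (rule eval_zero_if_disjoint[OF f(1) y(1)])
   fix i
   have "\<not> (i \<in> supp (dual Z) (dual_FDD Z E) (f j) & i \<in> supp Z E (y k))"
   proof
    assume "i \<in> supp (dual Z) (dual_FDD Z E) (f j) & i \<in> supp Z E (y k)"
    then have i: "m j <= i" "i <= M j" "m k <= i" "i <= M k" using sub[of j] y(3)[of k] by auto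
    consider "Suc j <= k" | "Suc k <= j" using \<open>j ~= k\<close> by linarith
    then show False
     using i Mm[of j] Mm[of k] strict_mono_mono[OF sm, THEN monoD, of "Suc j" k]
      strict_mono_mono[OF sm, THEN monoD, of "Suc k" j] by cases linarith+
   qed
   then show "coord (f j) i = 0 \<or> component Z E (y k) i = 0"
    by (auto simp: supp_def dual_component[OF f(1)])
  qed
  show ?case
   unfolding dominated_by_def m_def[symmetric]
  proof (intro allI)
   fix n and a :: "nat => real"
   define F where "F = (\<Sum>k<n. a k *\<^sub>R f k)"
   have F: "F \<in> pts (dual Z)" unfolding F_def by (intro pts_sum[OF D] pts_scale[OF D] f)
   have F0: "nrm (dual Z) F >= 0" by (rule dual_nrm_nonneg[OF Z F])
   have "nrm (dual S) (\<Sum>k<n. a k *\<^sub>R biorthogonal W v (m k)) <= 4 * K * C * nrm (dual Z) F"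
   proof (rule dual_nrm_le'[OF SN])
    show "0 <= 4 * K * C * nrm (dual Z) F" using K(1) C F0 by simp
    fix x assume x: "x \<in> pts S"
    define b where "b k = biorthogonal W v (m k) x" for k
    \<comment> \<open>Division by \<open>f k (y k)\<close>, which is at least \<open>1/2\<close>,
      normalizes the test vectors and costs a factor 2 in \<open>cle\<close>.\<close>
    define c where "c k = b k / f k (y k)" for k
    define Y where "Y = (\<Sum>k<n. c k *\<^sub>R y k)"
    have cy: "c k *\<^sub>R y k \<in> pts Z" for k by (rule pts_scale[OF Z y(1)])
    have Y: "Y \<in> pts Z" unfolding Y_def by (rule pts_sum[OF Z cy])
    have cle: "\<bar>c k * (2 * K)\<bar> <= \<bar>4 * K * b k\<bar>" for k
    proof -
     have "\<bar>b k\<bar> <= 2 * f k (y k) * \<bar>b k\<bar>" using y(4)[of k] mult_right_mono[of 1 "2 * f k (y k)" "\<bar>b k\<bar>"] by simp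
     moreover have "\<bar>c k\<bar> = \<bar>b k\<bar> / f k (y k)" using y(4)[of k] by (simp add: c_def)
     moreover have "f k (y k) > 0" using y(4)[of k] by linarith
     ultimately have "\<bar>c k\<bar> <= 2 * \<bar>b k\<bar>" by (simp add: divide_le_eq mult_ac)
     then show ?thesis using K(1) mult_left_mono[of "\<bar>c k\<bar>" "2 * \<bar>b k\<bar>" "2 * K"] by (simp add: abs_mult mult_ac)
    qed
    have FY: "F Y = (\<Sum>k<n. a k * b k)"
    proof -
     have fY: "f j Y = (if j < n then b j else 0)" for j
     proof -
      have "f j Y = (\<Sum>k<n. c k * f j (y k))"
       unfolding Y_def by (simp add: dual_sum[OF f(1) Z cy] dual_scale[OF f(1) y(1)])
      also have "\<dots> = (\<Sum>k<n. if k = j then b j else 0)"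
       using fy y(4)[of j] by (intro sum.cong) (auto simp: c_def)
      finally show ?thesis by (simp add: sum.delta)
     qed
     then show ?thesis by (simp add: F_def sum_fun_apply scaleR_fun_def)
    qed
    have "Y = (\<Sum>k<n. (c k * (2 * K)) *\<^sub>R (1 / (2 * K)) *\<^sub>R y k)" using K(1) by (simp add: Y_def)
    also have "nrm Z \<dots> <= C * nrm W (\<Sum>k<n. (c k * (2 * K)) *\<^sub>R v (m k))"
    proof (rule UW)
     show "(1 / (2 * K)) *\<^sub>R y l \<in> pts Z & nrm Z ((1 / (2 * K)) *\<^sub>R y l) <= 1" for l
      using y(2)[of l] K(1) by (simp add: pts_scale[OF Z y(1)] nrm_scale[OF Z y(1)] divide_le_eq)
     show "supp Z E ((1 / (2 * K)) *\<^sub>R y l) \<subseteq> {m l..<m (Suc l)} & m l \<in> {m l..<m (Suc l)}" for l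
      using y(3)[of l] Mm[of l] mM[of l] K(1) supp_scale[OF y(1)[of l], of "1 / (2 * K)"]
      by (auto simp del: atLeastLessThanSuc)
    qed
    also have "nrm W (\<Sum>k<n. (c k * (2 * K)) *\<^sub>R v (m k)) <= nrm W (\<Sum>k<n. (4 * K * b k) *\<^sub>R v (m k))"
     using cle by (intro coeff_mono strict_mono_on_imp_inj_on[OF monotone_on_subset[OF sm]]) auto
    also have "(\<Sum>k<n. (4 * K * b k) *\<^sub>R v (m k)) = (4 * K) *\<^sub>R (\<Sum>k<n. b k *\<^sub>R v (m k))"
     by (simp add: scaleR_sum_right)
    also have "nrm W \<dots> = 4 * K * nrm W (\<Sum>k<n. b k *\<^sub>R v (m k))"
     using K(1) nrm_scale[OF W sum_pts, of "4 * K"] by simp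
    also have "nrm W (\<Sum>k<n. b k *\<^sub>R v (m k)) <= nrm W x"
     unfolding b_def by (rule coordinates_norm_le[OF x])
      (auto intro: strict_mono_on_imp_inj_on[OF monotone_on_subset[OF sm]])
    finally have "nrm Z Y <= C * (4 * K * nrm W x)" using C K(1) by (simp add: mult_left_mono)
    then have "nrm (dual Z) F * nrm Z Y <= nrm (dual Z) F * (C * (4 * K * nrm W x))" by (rule mult_left_mono[OF _ F0])
    then have "\<bar>F Y\<bar> <= nrm (dual Z) F * (C * (4 * K * nrm W x))" using dual_bound[OF Z F Y] by linarith
    then show "\<bar>(\<Sum>k<n. a k *\<^sub>R biorthogonal W v (m k)) x\<bar> <= 4 * K * C * nrm (dual Z) F * nrm S x"
     unfolding FY b_def by (simp add: sum_fun_apply scaleR_fun_def nrm_S mult_ac)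
   qed
   then show "nrm (dual S) (\<Sum>k<n. a k *\<^sub>R biorthogonal W v (m k)) <= (4 * K * C + 1) * nrm (dual Z) (\<Sum>k<n. a k *\<^sub>R f k)"
    using F0 unfolding F_def[symmetric] by (simp add: algebra_simps)
  qed
 qed
qed

end

section \<open>Weak-star continuous embeddings and quotients\<close>

text \<open>Bounded lifts from the open mapping theorem make the adjoint bounded below; it is
  weak-star continuous because each value of \<open>T f\<close> is a value of \<open>f\<close> at a
  fixed point, or 0.\<close>

lemma adjoint_of_quotient:
 fixes X :: "'x::real_vector nspace" and Z :: "'z::real_vector nspace"
 assumes BX: "banach_space X" and BZ: "banach_space Z" and Q: "is_quotient_of X Z"
 shows "\<exists>T. iso_embedding (dual X) (dual Z) T & continuous_map (weak_star_topology X) (weak_star_topology Z) T"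
proof -
 note X = banach_normed[OF BX] and Z = banach_normed[OF BZ]
 obtain Q where Q: "bounded_operator Z X Q" "Q ` pts Z = pts X" using Q unfolding is_quotient_of_def by blast
 obtain K where K: "K > 0" "!!z. z \<in> pts Z ==> nrm X (Q z) <= K * nrm Z z" using op_bound[OF Q(1) Z] by blast
 obtain C where C: "C > 0" "!!x. x \<in> pts X ==> \<exists>z\<in>pts Z. Q z = x & nrm Z z <= C * nrm X x"
  by (rule open_mapping[OF BZ BX Q]) blast
 define T where "T f = (\<lambda>z. if z \<in> pts Z then f (Q z) else 0 :: real)" for f
 have fQ: "\<bar>f (Q z)\<bar> <= K * nrm (dual X) f * nrm Z z" if "f \<in> pts (dual X)" "z \<in> pts Z" for f z
  using order_trans[OF dual_bound[OF X that(1) op_mem[OF Q(1) that(2)]]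
    mult_left_mono[OF K(2)[OF that(2)] dual_nrm_nonneg[OF X that(1)]]] by (simp add: mult_ac)
 have T: "T f \<in> pts (dual Z)" if f: "f \<in> pts (dual X)" for f
  unfolding T_def
  by (rule dual_restrictI[OF Z, where K = "K * nrm (dual X) f"])
   (use fQ[OF f] f Q(1) in \<open>simp_all add: op_add[OF Q(1)] op_scale[OF Q(1)] dual_add[OF f] dual_scale[OF f] op_mem[OF Q(1)]\<close>)
 have "bounded_operator (dual X) (dual Z) T"
 proof (rule bounded_operatorI[where K = K])
  show "nrm (dual Z) (T f) <= K * nrm (dual X) f" if f: "f \<in> pts (dual X)" for f
   by (rule dual_nrm_le'[OF Z]) (use fQ[OF f] K(1) dual_nrm_nonneg[OF X f] in \<open>auto simp: T_def\<close>)
 qed (use T in \<open>auto simp: T_def fun_eq_iff scaleR_fun_def\<close>)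
 moreover have "1 / C * nrm (dual X) f <= nrm (dual Z) (T f)" if f: "f \<in> pts (dual X)" for f
 proof -
  have "nrm (dual X) f <= C * nrm (dual Z) (T f)"
  proof (rule dual_nrm_le'[OF X])
   show "0 <= C * nrm (dual Z) (T f)" using C(1) dual_nrm_nonneg[OF Z T[OF f]] by simp
   fix x assume x: "x \<in> pts X"
   obtain z where z: "z \<in> pts Z" "Q z = x" "nrm Z z <= C * nrm X x" using C(2)[OF x] by blast
   have "\<bar>f x\<bar> = \<bar>T f z\<bar>" using z by (simp add: T_def)
   also have "\<dots> <= nrm (dual Z) (T f) * nrm Z z" by (rule dual_bound[OF Z T[OF f] z(1)])
   also have "\<dots> <= nrm (dual Z) (T f) * (C * nrm X x)" by (rule mult_left_mono[OF z(3) dual_nrm_nonneg[OF Z T[OF f]]])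
   finally show "\<bar>f x\<bar> <= C * nrm (dual Z) (T f) * nrm X x" by (simp add: mult_ac)
  qed
  then show ?thesis using C(1) by (simp add: field_simps)
 qed
 moreover have "continuous_map (weak_star_topology X) (weak_star_topology Z) T"
  unfolding weak_star_topology_def continuous_map_in_subtopology
 proof (intro conjI)
  show "continuous_map (subtopology (product_topology (\<lambda>_. euclideanreal) UNIV) (pts (dual X)))
    (product_topology (\<lambda>_. euclideanreal) UNIV) T"
   unfolding continuous_map_componentwise_UNIV
  proof
   fix z
   show "continuous_map (subtopology (product_topology (\<lambda>_. euclideanreal) UNIV) (pts (dual X))) euclideanreal (\<lambda>f. T f z)"
   proof (cases "z \<in> pts Z")
    case True
    have "continuous_map (product_topology (\<lambda>_. euclideanreal) UNIV) euclideanreal (\<lambda>f :: 'x => real. f (Q z))"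
     by (rule continuous_map_product_projection) simp
    then show ?thesis using True by (simp add: T_def continuous_map_from_subtopology)
   qed (simp add: T_def)
  qed
  show "T \<in> topspace (subtopology (product_topology (\<lambda>_. euclideanreal) UNIV) (pts (dual X))) \<rightarrow> pts (dual Z)"
   using T by auto
 qed
 ultimately show ?thesis unfolding iso_embedding_def using C(1) by (intro exI[of _ T] conjI exI[of _ "1 / C"]) auto
qed

text \<open>A functional vanishing on the common kernel of finitely many evaluations is a
  combination of them. In the induction, subtracting a multiple of some \<open>g\<close> with
  \<open>g a = 1\<close> leads to the functions vanishing at \<open>a\<close>.\<close>

lemma functional_combination:
 fixes V :: "('a => real) set" and \<phi> :: "('a => real) => real"
 assumes "finite A" "subspace V"
  and "!!f g. f \<in> V ==> g \<in> V ==> \<phi> (f + g) = \<phi> f + \<phi> g" "!!c f. f \<in> V ==> \<phi> (c *\<^sub>R f) = c * \<phi> f"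
  and "!!f. f \<in> V ==> (!!a. a \<in> A ==> f a = 0) ==> \<phi> f = 0"
 shows "\<exists>c. \<forall>f\<in>V. \<phi> f = (\<Sum>a\<in>A. c a * f a)"
 using assms
proof (induction A arbitrary: V rule: finite_induct)
 case empty
 then show ?case by auto
next
 case (insert a A)
 define V' where "V' = {f \<in> V. f a = 0}"
 have "\<exists>c. \<forall>f\<in>V'. \<phi> f = (\<Sum>a\<in>A. c a * f a)"
 proof (rule insert.IH)
  show "subspace V'" using insert.prems(1) by (auto simp: V'_def subspace_def scaleR_fun_def)
  show "\<phi> f = 0" if "f \<in> V'" "!!b. b \<in> A ==> f b = 0" for f
   by (rule insert.prems(4)) (use that in \<open>auto simp: V'_def\<close>)
 qed (use insert.prems in \<open>auto simp: V'_def\<close>)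
 then obtain c where c: "!!f. f \<in> V' ==> \<phi> f = (\<Sum>b\<in>A. c b * f b)" by blast
 show ?case
 proof (cases "\<forall>f\<in>V. f a = 0")
  case True
  then have "\<phi> f = (\<Sum>b\<in>insert a A. c b * f b)" if "f \<in> V" for f
   using c[of f] that insert.hyps by (simp add: V'_def)
  then show ?thesis by blast
 next
  case False
  then obtain g0 where g0: "g0 \<in> V" "g0 a ~= 0" by blast
  define g where "g = (1 / g0 a) *\<^sub>R g0"
  have g: "g \<in> V" "g a = 1" using subspace_scale[OF insert.prems(1) g0(1)] g0(2) by (simp_all add: g_def) (simp add: scaleR_fun_def)
  define d where "d b = (if b = a then \<phi> g - (\<Sum>b\<in>A. c b * g b) else c b)" for b
  have "\<phi> f = (\<Sum>b\<in>insert a A. d b * f b)" if f: "f \<in> V" for f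
  proof -
   have gs: "(- f a) *\<^sub>R g \<in> V" by (rule subspace_scale[OF insert.prems(1) g(1)])
   define h where "h = f + (- f a) *\<^sub>R g"
   have hb: "h b = f b - f a * g b" for b by (simp add: h_def scaleR_fun_def)
   have "h \<in> V'" using subspace_add[OF insert.prems(1) f gs] g(2) hb[of a] unfolding V'_def h_def[symmetric] by simp
   moreover have "\<phi> h = \<phi> f - f a * \<phi> g"
    unfolding h_def insert.prems(2)[OF f gs] insert.prems(3)[OF g(1), of "- f a"] by simp
   ultimately have "\<phi> f - f a * \<phi> g = (\<Sum>b\<in>A. c b * (f b - f a * g b))" using c[of h] hb by simp
   also have "\<dots> = (\<Sum>b\<in>A. c b * f b) - f a * (\<Sum>b\<in>A. c b * g b)"
    by (simp add: algebra_simps sum_subtractf sum_distrib_left)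
   finally have "\<phi> f = (\<Sum>b\<in>A. c b * f b) + (\<phi> g - (\<Sum>b\<in>A. c b * g b)) * f a" by (simp add: algebra_simps)
   also have "(\<Sum>b\<in>A. c b * f b) = (\<Sum>b\<in>A. d b * f b)" using insert.hyps by (intro sum.cong) (auto simp: d_def)
   finally show ?thesis using insert.hyps by (simp add: d_def)
  qed
  then show ?thesis by blast
 qed
qed

text \<open>A basic neighbourhood of 0 restricts only a finite set \<open>A\<close> of coordinates.
  On functionals vanishing on \<open>A\<close>, scaling forces \<open>\<phi>\<close> to be 0, so
  \<open>\<phi>\<close> is a combination of evaluations at \<open>A\<close>.\<close>

lemma weak_star_continuous_functional:
 fixes X :: "'a::real_vector nspace"
 assumes X: "normed_space X" and add: "!!f g. f \<in> pts (dual X) ==> g \<in> pts (dual X) ==> \<phi> (f + g) = \<phi> f + \<phi> g"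
  and scale: "!!c f. f \<in> pts (dual X) ==> \<phi> (c *\<^sub>R f) = c * \<phi> f"
  and cont: "continuous_map (weak_star_topology X) euclideanreal \<phi>"
 shows "\<exists>x\<in>pts X. \<forall>f\<in>pts (dual X). \<phi> f = f x"
proof -
 note D = normed_space_dual[OF X]
 have zero: "\<phi> 0 = 0" using scale[OF pts_zero[OF D], of 0] by simp
 have "openin (weak_star_topology X) {f \<in> topspace (weak_star_topology X). \<phi> f \<in> {-1<..<1}}"
  by (rule openin_continuous_map_preimage[OF cont]) simp
 then have "openin (subtopology (product_topology (\<lambda>_. euclideanreal) UNIV) (pts (dual X))) {f \<in> pts (dual X). \<phi> f \<in> {-1<..<1}}"
  by (simp add: weak_star_topology_def)
 then obtain U where U: "openin (product_topology (\<lambda>_. euclideanreal) UNIV) U"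
  "{f \<in> pts (dual X). \<phi> f \<in> {-1<..<1}} = U \<inter> pts (dual X)" unfolding openin_subtopology by blast
 have "0 \<in> U \<inter> pts (dual X)" unfolding U(2)[symmetric] using zero pts_zero[OF D] by simp
 then have "\<exists>V. finite {i \<in> UNIV. V i ~= topspace euclideanreal} & (\<forall>i\<in>UNIV. openin euclideanreal (V i)) &
   (0 :: 'a => real) \<in> Pi\<^sub>E UNIV V & Pi\<^sub>E UNIV V \<subseteq> U"
  using U(1) unfolding openin_product_topology_alt by blast
 then obtain V where V: "finite {i. V i ~= UNIV}" "(0 :: 'a => real) \<in> Pi\<^sub>E UNIV V" "Pi\<^sub>E UNIV V \<subseteq> U" by auto
 define A where "A = {i. V i ~= UNIV}"
 have V0: "0 \<in> V i" for i using V(2) by (auto simp: PiE_def)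
 have ker: "\<phi> f = 0" if f: "f \<in> pts (dual X)" and 0: "!!a. a \<in> A ==> f a = 0" for f
 proof (rule ccontr)
  assume ne: "\<phi> f ~= 0"
  define h where "h = (1 / \<phi> f) *\<^sub>R f"
  have h: "h \<in> pts (dual X)" unfolding h_def by (rule pts_scale[OF D f])
  have "h i \<in> V i" for i using V0[of i] 0[of i] by (cases "i \<in> A") (auto simp: A_def h_def scaleR_fun_def)
  then have "h \<in> U" using V(3) by (auto simp: PiE_def)
  then have "h \<in> {f \<in> pts (dual X). \<phi> f \<in> {-1<..<1}}" unfolding U(2) using h by blast
  then have "\<phi> h < 1" by simp
  then show False using ne by (simp add: h_def scale[OF f])
 qed
 obtain c where c: "\<forall>f\<in>pts (dual X). \<phi> f = (\<Sum>a\<in>A. c a * f a)"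
  using functional_combination[of A "pts (dual X)" \<phi>] V(1) add scale ker normed_space_subspace[OF D] unfolding A_def by blast
 \<comment> \<open>Points of \<open>A\<close> outside \<open>pts X\<close> are dropped, since all
   members of \<open>dual X\<close> vanish there.\<close>
 define x where "x = (\<Sum>a\<in>A \<inter> pts X. c a *\<^sub>R a)"
 have ca: "c a *\<^sub>R a \<in> pts X" if "a \<in> A \<inter> pts X" for a using that by (auto intro: pts_scale[OF X])
 have "x \<in> pts X" unfolding x_def by (rule pts_sum[OF X ca])
 moreover have "\<phi> f = f x" if f: "f \<in> pts (dual X)" for f
 proof -
  have "f x = (\<Sum>a\<in>A \<inter> pts X. f (c a *\<^sub>R a))" unfolding x_def by (rule dual_sum[OF f X ca])
  also have "\<dots> = (\<Sum>a\<in>A \<inter> pts X. c a * f a)" using dual_scale[OF f] by (intro sum.cong) auto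
  also have "\<dots> = (\<Sum>a\<in>A. c a * f a)"
   using V(1) dual_off[OF f] by (intro sum.mono_neutral_left) (auto simp: A_def)
  finally show ?thesis using c f by simp
 qed
 ultimately show ?thesis by blast
qed

text \<open>Weak-star continuity makes \<open>f \<mapsto> T f z\<close> the evaluation at a point
  \<open>Q z\<close>. As \<open>T\<close> is bounded below, no functional separates \<open>x\<close>
  from the image of a suitable ball, so by Mazur's theorem that image comes close to
  \<open>x\<close>, and approximate lifts can be iterated.\<close>

lemma predual_quotient:
 fixes X :: "'x::real_vector nspace" and Z :: "'z::real_vector nspace"
 assumes BX: "banach_space X" and BZ: "banach_space Z" and iso: "iso_embedding (dual X) (dual Z) T"
  and cont: "continuous_map (weak_star_topology X) (weak_star_topology Z) T"
 shows "is_quotient_of X Z"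
proof -
 note X = banach_normed[OF BX] and Z = banach_normed[OF BZ]
 note DX = normed_space_dual[OF X] and DZ = normed_space_dual[OF Z]
 have T: "bounded_operator (dual X) (dual Z) T" using iso by (simp add: iso_embedding_def)
 obtain c where c: "c > 0" "!!f. f \<in> pts (dual X) ==> c * nrm (dual X) f <= nrm (dual Z) (T f)"
  using iso unfolding iso_embedding_def by blast
 obtain K where K: "K > 0" "!!f. f \<in> pts (dual X) ==> nrm (dual Z) (T f) <= K * nrm (dual X) f"
  using op_bound[OF T DX] by blast
 have "\<exists>x\<in>pts X. \<forall>f\<in>pts (dual X). T f z = f x" for z
 proof (rule weak_star_continuous_functional[OF X])
  show "T (f + g) z = T f z + T g z" if "f \<in> pts (dual X)" "g \<in> pts (dual X)" for f g
   using op_add[OF T that] by simp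
  show "T (r *\<^sub>R f) z = r * T f z" if "f \<in> pts (dual X)" for r f
   using op_scale[OF T that] by (simp add: scaleR_fun_def)
  have "continuous_map (product_topology (\<lambda>_. euclideanreal) UNIV) euclideanreal (\<lambda>f :: 'z => real. f z)"
   by (rule continuous_map_product_projection) simp
  then have "continuous_map (weak_star_topology Z) euclideanreal (\<lambda>f. f z)"
   unfolding weak_star_topology_def by (rule continuous_map_from_subtopology)
  from continuous_map_compose[OF cont this]
  show "continuous_map (weak_star_topology X) euclideanreal (\<lambda>f. T f z)" by (simp add: o_def)
 qed
 then obtain Q where Q: "!!z. Q z \<in> pts X" "!!z f. f \<in> pts (dual X) ==> T f z = f (Q z)" by metis
 have eq: "x = y" if xy: "x \<in> pts X" "y \<in> pts X" "!!f. f \<in> pts (dual X) ==> f x = f y" for x y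
 proof -
  obtain f where f: "f \<in> pts (dual X)" "f (x - y) = nrm X (x - y)"
   using norming_functional[OF X pts_diff[OF X xy(1,2)]] by blast
  then have "nrm X (x - y) = 0" using xy(3)[OF f(1)] dual_diff[OF f(1) X xy(1,2)] by simp
  then show ?thesis using nrm_eq_0[OF X pts_diff[OF X xy(1,2)]] by simp
 qed
 have QB: "bounded_operator Z X Q"
 proof (rule bounded_operatorI[where K = K])
  fix x y assume x: "x \<in> pts Z" and y: "y \<in> pts Z"
  show "Q (x + y) = Q x + Q y"
   by (rule eq) (simp_all add: Q(1) pts_add[OF X] dual_add Q(2)[symmetric] dual_add[OF op_mem[OF T] x y])
 next
  fix r x assume x: "x \<in> pts Z"
  show "Q (r *\<^sub>R x) = r *\<^sub>R Q x"
   by (rule eq) (simp_all add: Q(1) pts_scale[OF X] dual_scale Q(2)[symmetric] dual_scale[OF op_mem[OF T] x])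
  obtain f where f: "f \<in> pts (dual X)" "nrm (dual X) f <= 1" "f (Q x) = nrm X (Q x)"
   by (rule norming_functional[OF X Q(1)])
  have "nrm X (Q x) = T f x" using Q(2)[OF f(1)] f(3) by simp
  also have "\<dots> <= nrm (dual Z) (T f) * nrm Z x" using dual_bound[OF Z op_mem[OF T f(1)] x] by linarith
  also have "\<dots> <= K * nrm Z x"
   using K(2)[OF f(1)] mult_left_mono[OF f(2) less_imp_le[OF K(1)]] nrm_nonneg[OF Z x] by (intro mult_right_mono) auto
  finally show "nrm X (Q x) <= K * nrm Z x" .
 qed (rule Q(1))
 \<comment> \<open>The factor \<open>1 / c\<close> comes from the lower bound of \<open>T\<close>,
   the 2 from vectors that norm \<open>T f\<close> only up to one half.\<close>
 define C where "C = 2 / c"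
 have C0: "C > 0" using c(1) by (simp add: C_def)
 have approx: "\<exists>z\<in>pts Z. nrm Z z <= C * nrm X x & nrm X (x - Q z) <= 1 / 2 * nrm X x" if x: "x \<in> pts X" for x
 proof (cases "x = 0")
  case True
  then show ?thesis
   using op_zero[OF QB Z] by (intro bexI[of _ 0]) (auto simp: nrm_zero[OF Z] nrm_zero[OF X] pts_zero[OF Z])
 next
  case False
  then have pos: "nrm X x > 0" by (rule nrm_pos[OF X x])
  define A where "A = {z \<in> pts Z. nrm Z z <= C * nrm X x}"
  have "\<exists>y\<in>(\<lambda>z. x - Q z) ` A. nrm X y < 1 / 2 * nrm X x"
  proof (rule mazur[OF X])
   show "convex ((\<lambda>z. x - Q z) ` A)"
   proof (rule convexI, elim imageE)
    fix a b z w and r t :: real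
    assume rt: "0 <= r" "0 <= t" "r + t = 1" and ab: "a = x - Q z" "b = x - Q w" and zA: "z \<in> A" "w \<in> A"
    have zw: "z \<in> pts Z" "w \<in> pts Z" "r *\<^sub>R z \<in> pts Z" "t *\<^sub>R w \<in> pts Z" using zA by (auto simp: A_def pts_scale[OF Z])
    have "nrm Z (r *\<^sub>R z + t *\<^sub>R w) <= r * nrm Z z + t * nrm Z w"
     using nrm_add[OF Z zw(3,4)] rt by (simp add: nrm_scale[OF Z] zw)
    also have "\<dots> <= C * nrm X x" using rt zA by (intro convex_bound_le) (auto simp: A_def)
    finally have "r *\<^sub>R z + t *\<^sub>R w \<in> A" using zw by (simp add: A_def pts_add[OF Z])
    moreover have "r *\<^sub>R a + t *\<^sub>R b = x - Q (r *\<^sub>R z + t *\<^sub>R w)"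
     using rt(3) by (simp add: ab op_add[OF QB zw(3,4)] op_scale[OF QB] zw algebra_simps flip: scaleR_add_left)
    ultimately show "r *\<^sub>R a + t *\<^sub>R b \<in> (\<lambda>z. x - Q z) ` A" by blast
   qed
   show "(\<lambda>z. x - Q z) ` A \<subseteq> pts X" using pts_diff[OF X x Q(1)] by blast
   show "1 / 2 * nrm X x > 0" using pos by simp
   fix f assume f: "f \<in> pts (dual X)"
   have "\<exists>k\<in>A. f (x - Q k) < 1 / 2 * nrm X x"
   proof (cases "nrm (dual X) f = 0")
    case True
    then have "f (x - Q 0) = 0" using dual_bound[OF X f pts_diff[OF X x Q(1)], of 0] by simp
    then show ?thesis using pos C0 by (intro bexI[of _ 0]) (auto simp: A_def nrm_zero[OF Z] pts_zero[OF Z])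
   next
    case False
    then have "nrm (dual X) f > 0" using dual_nrm_nonneg[OF X f] by linarith
    then have "nrm (dual Z) (T f) > 0" using c(2)[OF f] mult_pos_pos[OF c(1)] by fastforce
    then obtain z where z: "z \<in> pts Z" "nrm Z z <= 1" "nrm (dual Z) (T f) / 2 < T f z"
     by (rule_tac dual_nrm_approx[OF Z op_mem[OF T f], of "nrm (dual Z) (T f) / 2"]) auto
    define w where "w = (C * nrm X x) *\<^sub>R z"
    have w: "w \<in> A" unfolding A_def w_def
     using z C0 pos mult_left_mono[OF z(2), of "C * nrm X x"] by (simp add: pts_scale[OF Z] nrm_scale[OF Z])
    have "f x <= nrm (dual X) f * nrm X x" using dual_bound[OF X f x] by linarith
    also have "\<dots> = C * nrm X x * (c * nrm (dual X) f / 2)" using c(1) by (simp add: C_def)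
    also have "\<dots> <= C * nrm X x * T f z"
     using c(2)[OF f] z(3) C0 pos by (intro mult_left_mono) auto
    also have "\<dots> = f (Q w)" using Q(2)[OF f, of w] dual_scale[OF op_mem[OF T f] z(1)] by (simp add: w_def)
    finally have "f (x - Q w) <= 0" by (simp add: dual_diff[OF f X x Q(1)])
    then show ?thesis using w pos by (intro bexI[of _ w]) auto
   qed
   then show "\<exists>y\<in>(\<lambda>z. x - Q z) ` A. f y < 1 / 2 * nrm X x" by blast
  qed
  then show ?thesis by (auto simp: A_def intro: less_imp_le)
 qed
 have "x \<in> Q ` pts Z" if "x \<in> pts X" for x
  using lifts_of_approximate_lifts[OF BZ X QB less_imp_le[OF C0] approx that] by blast
 then show ?thesis unfolding is_quotient_of_def using QB Q(1) by blast
qed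

section \<open>From lower estimates in the dual back to upper estimates\<close>

context fdd
begin

lemma shrinking_if_dual_FDD:
 assumes "is_FDD (dual Z) (dual_FDD Z E)"
 shows "shrinking Z E"
proof unfold_locales
 interpret dual: fdd "dual Z" "dual_FDD Z E" using assms banach_dual[OF Z] by unfold_locales
 have U: "(\<Union>i. dual_FDD Z E i) \<subseteq> pts (dual Z)" by (auto simp: dual_FDD_def)
 have "\<exists>g\<in>span (\<Union>i. dual_FDD Z E i). nrm (dual Z) (f - g) < e" if f: "f \<in> pts (dual Z)" and e: "e > 0" for f e
 proof -
  obtain n where n: "nrm (dual Z) (proj (dual Z) (dual_FDD Z E) n f - f) < e"
   using dual.proj_conv[OF f, unfolded nconv_iff[OF D dual.proj_pts[OF f]]] e by (meson order_refl)
  have "proj (dual Z) (dual_FDD Z E) n f \<in> span (\<Union>i. dual_FDD Z E i)"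
   unfolding proj_def by (intro span_sum span_base) (use dual.comp_mem[OF f] in blast)
  then show ?thesis using n nrm_diff_commute[OF D f dual.proj_pts[OF f], of n]
   by (intro bexI[of _ "proj (dual Z) (dual_FDD Z E) n f"]) auto
 qed
 then show "closed_span (dual Z) (\<Union>i. dual_FDD Z E i) = pts (dual Z)"
  using closed_span_iff[OF D U] by blast
qed

end

context shrinking
begin

lemma dual_FDD_nonzero:
 assumes "E i ~= {0}"
 shows "dual_FDD Z E i ~= {0}"
proof -
 obtain x where x: "x \<in> E i" "nrm Z x = 1" using exists_unit_vector[OF assms] by blast
 have xp: "x \<in> pts Z" using x(1) E_pts by blast
 obtain f where f: "f \<in> pts (dual Z)" "f x = nrm Z x" using norming_functional[OF Z xp] by blast
 have "coord f i x = 1" using f x xp comp_single[OF x(1), of i] by (simp add: coord_def)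
 then show ?thesis using coord_mem[OF f(1), of i] by fastforce
qed

text \<open>A functional norming the combination is cut to the windows of the blocks. Lower
  estimates for the pieces bound the combination \<open>B\<close> of biorthogonal functionals with
  the norms of the pieces as coefficients, and pairing \<open>B\<close> with a combination of the
  \<open>v\<close> bounds the norm sought.\<close>

lemma upper_estimates_if_dual_lower:
 assumes V: "vseq W v"
  and low: "lower_block_estimates (dual (seq_space W v)) (biorthogonal W v) (dual Z) (dual_FDD Z E)"
 shows "upper_block_estimates W v Z E"
proof -
 interpret vseq W v by (rule V)
 note DS = normed_space_dual[OF SN]
 obtain C where C: "C >= 1" and dom: "!!f. block_seq (dual Z) (dual_FDD Z E) f ==> normalized (dual Z) f ==>
   dominated_by C (dual S) (\<lambda>i. biorthogonal W v (Min (supp (dual Z) (dual_FDD Z E) (f i)))) (dual Z) f"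
  using low unfolding lower_block_estimates_def by blast
 obtain C2 where C2: "C2 >= 1" and ex: "!!J p q (a :: nat => real). finite J ==>
  (!!i j. i \<in> J ==> j \<in> J ==> i < j ==> max (p i) (q i) < min (p j) (q j)) ==>
  nrm W (\<Sum>j\<in>J. a j *\<^sub>R v (p j)) <= C2 * nrm W (\<Sum>j\<in>J. a j *\<^sub>R v (q j))"
  by (rule exchange_set) blast
 obtain K where K: "K > 0" "!!f n. f \<in> pts (dual Z) ==> nrm (dual Z) (dproj f n) <= K * nrm (dual Z) f"
  by (rule dproj_norm) blast
 show ?thesis
  unfolding upper_block_estimates_def
 proof (intro exI[of _ "2 * K * C * C2 + 1"] conjI allI impI, goal_cases)
  case 1
  show ?case using K(1) C C2 by simp
 next
  case (2 z)
  define m where "m k = Min (supp Z E (z k))" for k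
  have z: "z k \<in> pts Z" "nrm Z (z k) = 1" for k using 2 by (auto simp: normalized_def)
  have fin: "finite (supp Z E (z k))" and Mm: "Max (supp Z E (z k)) < m (Suc k)" for k
   using 2 by (auto simp: block_seq_def m_def)
  have ne: "supp Z E (z k) ~= {}" for k using 2 by (intro supp_nonempty z) (auto simp: block_seq_def)
  have sub: "m k <= i & i < m (Suc k)" if "i \<in> supp Z E (z k)" for i k
   using Min_le[OF fin that] Max_ge[OF fin that] Mm[of k] by (simp add: m_def)
  have m_in: "m k \<in> supp Z E (z k)" for k unfolding m_def by (rule Min_in[OF fin ne])
  have sm: "strict_mono m" unfolding strict_mono_Suc_iff using sub[OF m_in] by blast
  have Em: "E (m k) ~= {0}" for k using m_in[of k] comp_mem[OF z(1), of k "m k"] by (auto simp: supp_def)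
  have "infinite (range m)" using strict_mono_imp_inj_on[OF sm] by (rule range_inj_infinite)
  moreover have "range m \<subseteq> {i. dual_FDD Z E i ~= {0}}" using dual_FDD_nonzero[OF Em] by blast
  ultimately have inf: "infinite {i. dual_FDD Z E i ~= {0}}" using finite_subset by blast
  show ?case
   unfolding dominated_by_def m_def[symmetric]
  proof (intro allI)
   fix n and a :: "nat => real"
   define x where "x = (\<Sum>i<n. a i *\<^sub>R z i)"
   have x: "x \<in> pts Z" unfolding x_def by (intro pts_sum[OF Z] pts_scale[OF Z] z)
   obtain f where f: "f \<in> pts (dual Z)" "nrm (dual Z) f <= 1" "f x = nrm Z x"
    by (rule norming_functional[OF Z x])
   define g where "g i = dproj f (m (Suc i)) - dproj f (m i)" for i
   have g: "g i \<in> pts (dual Z)" for i unfolding g_def by (intro pts_diff[OF D] dproj_dual f)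
   have mm: "m i <= m (Suc i)" for i using sub[OF m_in, of i] by simp
   have cg: "component (dual Z) (dual_FDD Z E) (g i) j =
     (if m i <= j & j < m (Suc i) then component (dual Z) (dual_FDD Z E) f j else 0)" for i j
    using mm[of i] by (simp add: g_def dual_proj[OF f(1), symmetric] dual.comp_diff dual.proj_pts f(1) dual.comp_proj)
   have gz: "g i (z i) = f (z i)" for i
   proof -
    have "(f - g i) (z i) = 0"
    proof (rule eval_zero_if_disjoint[OF pts_diff[OF D f(1) g] z(1)])
     fix j
     have "component (dual Z) (dual_FDD Z E) (f - g i) j = 0 \<or> component Z E (z i) j = 0"
      using sub[of j i] by (auto simp: dual.comp_diff f(1) g cg supp_def)
     then show "coord (f - g i) j = 0 \<or> component Z E (z i) j = 0"
      unfolding dual_component[OF pts_diff[OF D f(1) g]] .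
    qed
    then show ?thesis by simp
   qed
   \<comment> \<open>Zero pieces have no place in a block sequence and contribute nothing to the
     pairing.\<close>
   define J where "J = {i. i < n & g i ~= 0}"
   have J: "finite J" "J \<subseteq> {..<n}" by (auto simp: J_def)
   have gne: "g i ~= 0" if "i \<in> J" for i using that by (simp add: J_def)
   define sp where "sp i = supp (dual Z) (dual_FDD Z E) (g i)" for i
   \<comment> \<open>The piece \<open>g i\<close> may start later than the block \<open>z i\<close>;
     both indices lie in the same window, so block stability exchanges them at the end.\<close>
   define \<mu> where "\<mu> i = Min (sp i)" for i
   have spw: "m i <= j & j < m (Suc i)" if "j \<in> sp i" for i j
    using that cg[of i j] by (auto simp: sp_def supp_def split: if_splits)
   have spf: "finite (sp i)" for i by (rule finite_subset[of _ "{..<m (Suc i)}"]) (use spw in auto)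
   have spn: "sp i ~= {}" if "i \<in> J" for i unfolding sp_def by (rule dual.supp_nonempty[OF g gne[OF that]])
   have m_le: "m (Suc i) <= m j" if "i < j" for i j using monoD[OF strict_mono_mono[OF sm], of "Suc i" j] that by simp
   have \<mu>in: "\<mu> i \<in> sp i" "Max (sp i) \<in> sp i" if "i \<in> J" for i
    using Min_in[OF spf spn[OF that]] Max_in[OF spf spn[OF that]] by (auto simp: \<mu>_def)
   have less: "Max (sp i) < Min (sp j)" if "i \<in> J" "j \<in> J" "i < j" for i j
    using spw[OF \<mu>in(2)[OF that(1)]] spw[OF \<mu>in(1)[OF that(2)]] m_le[OF that(3)] by (simp add: \<mu>_def)
   obtain w where w: "block_seq (dual Z) (dual_FDD Z E) w" "normalized (dual Z) w"
    "!!i. i < card J ==> w i = (1 / nrm (dual Z) (g (sorted_list_of_set J ! i))) *\<^sub>R g (sorted_list_of_set J ! i)"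
    "!!i. i < card J ==> supp (dual Z) (dual_FDD Z E) (w i) = supp (dual Z) (dual_FDD Z E) (g (sorted_list_of_set J ! i))"
    by (rule dual.extend_to_block_seq[OF inf J(1), of g])
     (use g gne spf less in \<open>auto simp: sp_def\<close>)
   define G where "G i = nrm (dual Z) (g i)" for i
   have Gpos: "G i ~= 0" if "i \<in> J" for i
    unfolding G_def using nrm_pos[OF D g gne[OF that]] by simp
   define B where "B = (\<Sum>i\<in>J. G i *\<^sub>R biorthogonal W v (\<mu> i))"
   have B: "B \<in> pts (dual S)" unfolding B_def by (intro pts_sum[OF DS] pts_scale[OF DS] biorthogonal_dual)
   have eqB: "(\<Sum>i<card J. G (sorted_list_of_set J ! i) *\<^sub>R
     biorthogonal W v (Min (supp (dual Z) (dual_FDD Z E) (w i)))) = B"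
    unfolding B_def using w(4) by (subst sum_sorted_list[OF J(1), symmetric]) (auto simp: \<mu>_def sp_def intro: sum.cong)
   have eqg: "(\<Sum>i<card J. G (sorted_list_of_set J ! i) *\<^sub>R w i) = (\<Sum>i<n. g i)"
   proof -
    have "(\<Sum>i<n. g i) = (\<Sum>i\<in>J. g i)" by (rule sum.mono_neutral_right) (auto simp: J_def)
    also have "\<dots> = (\<Sum>i\<in>J. G i *\<^sub>R (1 / G i) *\<^sub>R g i)" using Gpos by (intro sum.cong) auto
    also have "\<dots> = (\<Sum>i<card J. G (sorted_list_of_set J ! i) *\<^sub>R w i)"
     using w(3) by (subst sum_sorted_list[OF J(1), symmetric]) (auto simp: G_def intro: sum.cong)
    finally show ?thesis by simp
   qed
   have "nrm (dual S) B <= C * nrm (dual Z) (\<Sum>i<n. g i)"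
    using dom[OF w(1,2)] unfolding dominated_by_def eqB[symmetric] eqg[symmetric] by (elim allE)
   also have "(\<Sum>i<n. g i) = dproj f (m n) - dproj f (m 0)"
    unfolding g_def by (rule sum_lessThan_telescope)
   also have "nrm (dual Z) \<dots> <= 2 * K"
    using nrm_diff[OF D dproj_dual[OF f(1)] dproj_dual[OF f(1)], of "m n" "m 0"] K(2)[OF f(1), of "m n"]
     K(2)[OF f(1), of "m 0"] mult_left_mono[OF f(2) less_imp_le[OF K(1)]] by linarith
   finally have nB: "nrm (dual S) B <= C * (2 * K)" using C by (simp add: mult_left_mono)
   define Y where "Y = (\<Sum>i\<in>J. \<bar>a i\<bar> *\<^sub>R v (\<mu> i))"
   have Y: "Y \<in> pts S" unfolding Y_def by (rule sum_pts_S)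
   have \<mu>lt: "\<mu> i < \<mu> j" if "i \<in> J" "j \<in> J" "i < j" for i j
    using spw[OF \<mu>in(1)[OF that(1)]] spw[OF \<mu>in(1)[OF that(2)]] m_le[OF that(3)] by simp
   have \<mu>inj: "\<mu> i = \<mu> j \<longleftrightarrow> i = j" if "i \<in> J" "j \<in> J" for i j
    using \<mu>lt[of i j] \<mu>lt[of j i] that by (cases i j rule: linorder_cases) auto
   have BY: "B Y = (\<Sum>i\<in>J. G i * \<bar>a i\<bar>)"
   proof -
    have "biorthogonal W v (\<mu> i) Y = \<bar>a i\<bar>" if i: "i \<in> J" for i
    proof -
     have "biorthogonal W v (\<mu> i) Y = (\<Sum>j\<in>J. biorthogonal W v (\<mu> i) (\<bar>a j\<bar> *\<^sub>R v (\<mu> j)))"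
      unfolding Y_def by (rule dual_sum[OF biorthogonal_dual SN]) (rule pts_scale[OF SN v_S])
     also have "\<dots> = (\<Sum>j\<in>J. if j = i then \<bar>a i\<bar> else 0)"
      using \<mu>inj[OF _ i] by (intro sum.cong) (auto simp: dual_scale[OF biorthogonal_dual v_S] biorthogonal_v)
     finally show ?thesis using J(1) i by (simp add: sum.delta)
    qed
    then show ?thesis by (simp add: B_def sum_fun_apply scaleR_fun_def)
   qed
   have "f x = (\<Sum>i<n. f (a i *\<^sub>R z i))"
    unfolding x_def by (rule dual_sum[OF f(1) Z]) (rule pts_scale[OF Z z(1)])
   then have "nrm Z x = (\<Sum>i<n. a i * g i (z i))"
    unfolding f(3) by (simp add: dual_scale[OF f(1) z(1)] gz)
   also have "\<dots> = (\<Sum>i\<in>J. a i * g i (z i))"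
    by (rule sum.mono_neutral_right) (auto simp: J_def)
   also have "\<dots> <= (\<Sum>i\<in>J. G i * \<bar>a i\<bar>)"
   proof (rule sum_mono)
    fix i
    have "\<bar>g i (z i)\<bar> <= G i" unfolding G_def using dual_bound[OF Z g z(1), of i i] z(2)[of i] by simp
    then show "a i * g i (z i) <= G i * \<bar>a i\<bar>"
     using mult_left_mono[of "\<bar>g i (z i)\<bar>" "G i" "\<bar>a i\<bar>"] abs_ge_self[of "a i * g i (z i)"] by (simp add: abs_mult mult_ac)
   qed
   also have "\<dots> <= nrm (dual S) B * nrm S Y" using dual_bound[OF SN B Y] BY by linarith
   also have "\<dots> <= C * (2 * K) * nrm S Y" by (rule mult_right_mono[OF nB nrm_nonneg[OF SN Y]])
   also have "nrm S Y <= C2 * nrm W (\<Sum>i\<in>J. \<bar>a i\<bar> *\<^sub>R v (m i))"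
    unfolding nrm_S Y_def
   proof (rule ex[OF J(1)])
    fix i j assume ij: "i \<in> J" "j \<in> J" "i < j"
    show "max (\<mu> i) (m i) < min (\<mu> j) (m j)"
     using spw[OF \<mu>in(1)[OF ij(1)]] spw[OF \<mu>in(1)[OF ij(2)]] m_le[OF ij(3)] by auto
   qed
   also have "nrm W (\<Sum>i\<in>J. \<bar>a i\<bar> *\<^sub>R v (m i)) <= nrm W (\<Sum>i<n. a i *\<^sub>R v (m i))"
    by (rule coeff_mono[OF _ J(2) strict_mono_on_imp_inj_on[OF monotone_on_subset[OF sm]]]) auto
   finally have "nrm Z x <= C * (2 * K) * (C2 * nrm W (\<Sum>i<n. a i *\<^sub>R v (m i)))"
    using C C2 K(1) by (simp add: mult_left_mono)
   then show "nrm Z (\<Sum>i<n. a i *\<^sub>R z i) <= (2 * K * C * C2 + 1) * nrm W (\<Sum>i<n. a i *\<^sub>R v (m i))"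
    using nrm_nonneg[OF W sum_pts, of a m "{..<n}"] unfolding x_def by (simp add: algebra_simps)
  qed
 qed
qed

end

section \<open>Tree estimates from block estimates\<close>

context fdd
begin

lemma proj_range_finite: "\<exists>A. finite A & A \<subseteq> pts Z & (\<forall>z\<in>pts Z. proj Z E n z \<in> span A)"
proof -
 have "\<exists>A. finite A & E i = span A" for i by (meson E_span)
 then obtain A where A: "!!i. finite (A i)" "!!i. E i = span (A i)" by metis
 have "A i \<subseteq> pts Z" for i using A(2)[of i] E_pts span_superset by blast
 moreover have "proj Z E n z \<in> span (\<Union>i<n. A i)" if "z \<in> pts Z" for z
  unfolding proj_def
 proof (rule span_sum)
  fix i assume "i \<in> {..<n}"
  then show "component Z E z i \<in> span (\<Union>i<n. A i)"
   using comp_mem[OF that, of i] A(2)[of i] span_mono[of "A i" "\<Union>i<n. A i"] by blast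
 qed
 ultimately show ?thesis using A(1) by (intro exI[of _ "\<Union>i<n. A i"]) auto
qed

text \<open>The lifts of a weakly null sequence have nearly constant initial parts along some subsequence.
 Subtracting a convex combination of lifts of a norm-small convex combination (Mazur) removes them.\<close>

lemma node_approximation:
 fixes x :: "nat => 'x::real_vector" and Y :: "'y::real_vector nspace"
 assumes X: "normed_space X" and Y: "normed_space Y"
  and A: "bounded_operator X Y A" and B: "bounded_operator Z Y B"
  and lift: "!!x. x \<in> pts X ==> \<exists>z\<in>pts Z. B z = A x & nrm Z z <= C * nrm X x" and C: "C > 0"
  and K: "K > 0" "!!n z. z \<in> pts Z ==> nrm Z (proj Z E n z) <= K * nrm Z z"
  and null: "weakly_null X x" and x1: "!!k. nrm X (x k) = 1" and \<delta>: "\<delta> > 0"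
 shows "\<exists>k z r. z \<in> pts Z & supp Z E z \<subseteq> {n..<r} & nrm Z z <= 4 * K * C & nrm Y (A (x k) - B z) <= \<delta>"
proof -
 obtain KA where KA: "KA > 0" "!!x. x \<in> pts X ==> nrm Y (A x) <= KA * nrm X x" using op_bound[OF A X] by blast
 obtain KB where KB: "KB > 0" "!!z. z \<in> pts Z ==> nrm Y (B z) <= KB * nrm Z z" using op_bound[OF B Z] by blast
 \<comment> \<open>The final error collects \<open>KA\<close> once and \<open>KB\<close> three
   times.\<close>
 define \<epsilon> where "\<epsilon> = \<delta> / (KA + 3 * KB)"
 have \<epsilon>: "\<epsilon> > 0" using \<delta> KA(1) KB(1) by (simp add: \<epsilon>_def)
 have xp: "x k \<in> pts X" for k using null by (auto simp: weakly_null_def)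
 have "\<exists>z\<in>pts Z. B z = A (x k) & nrm Z z <= C" for k using lift[OF xp, of k] x1[of k] by simp
 then obtain y where y: "!!k. y k \<in> pts Z" "!!k. B (y k) = A (x k)" "!!k. nrm Z (y k) <= C" by metis
 obtain G where G: "finite G" "G \<subseteq> pts Z" "!!z. z \<in> pts Z ==> proj Z E n z \<in> span G" using proj_range_finite[of n] by blast
 have "\<exists>D. finite D & D \<subseteq> range (\<lambda>k. proj Z E n (y k)) &
   (\<forall>a\<in>range (\<lambda>k. proj Z E n (y k)). \<exists>d\<in>D. nrm Z (a - d) <= \<epsilon>)"
 proof (rule findim_net[OF Z G(1,2) _ _ \<epsilon>, where R = "K * C"])
  show "range (\<lambda>k. proj Z E n (y k)) \<subseteq> span G" using G(3) y(1) by blast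
  show "nrm Z a <= K * C" if a: "a \<in> range (\<lambda>k. proj Z E n (y k))" for a
  proof -
   obtain k where "a = proj Z E n (y k)" using a by blast
   then show ?thesis using K(2)[OF y(1), of n k] mult_left_mono[OF y(3) less_imp_le[OF K(1)], of k] by simp
  qed
 qed
 then obtain D where D: "finite D" "D \<subseteq> range (\<lambda>k. proj Z E n (y k))"
  "\<forall>a\<in>range (\<lambda>k. proj Z E n (y k)). \<exists>d\<in>D. nrm Z (a - d) <= \<epsilon>" by (elim exE conjE)
 have "UNIV = (\<Union>d\<in>D. {k. nrm Z (proj Z E n (y k) - d) <= \<epsilon>})" using D(3) by auto
 then have "infinite (\<Union>d\<in>D. {k. nrm Z (proj Z E n (y k) - d) <= \<epsilon>})" by (metis infinite_UNIV_nat)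
 then obtain d where d: "d \<in> D" "infinite {k. nrm Z (proj Z E n (y k) - d) <= \<epsilon>}" using D(1) by blast
 define I where "I = {k. nrm Z (proj Z E n (y k) - d) <= \<epsilon>}"
 have dp: "d \<in> pts Z" using d(1) D(2) proj_pts[OF y(1)] by blast
 \<comment> \<open>Pairs of a vector and a lift whose initial part is near \<open>d\<close>. Working
   with pairs keeps the lift attached when Mazur's theorem is applied to the first
   components.\<close>
 define L where "L = {(a, b). a \<in> pts X & b \<in> pts Z & B b = A a & nrm Z b <= C & nrm Z (proj Z E n b - d) <= \<epsilon>}"
 have yL: "(x k, y k) \<in> L" if "k \<in> I" for k using that xp y by (auto simp: L_def I_def)
 have "convex L"
 proof (rule convexI)
  fix p q and r t :: real assume "p \<in> L" "q \<in> L" and rt: "0 <= r" "0 <= t" "r + t = 1"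
  then obtain a b a' b' where p: "p = (a, b)" "a \<in> pts X" "b \<in> pts Z" "B b = A a" "nrm Z b <= C" "nrm Z (proj Z E n b - d) <= \<epsilon>"
   and q: "q = (a', b')" "a' \<in> pts X" "b' \<in> pts Z" "B b' = A a'" "nrm Z b' <= C" "nrm Z (proj Z E n b' - d) <= \<epsilon>"
   by (auto simp: L_def)
  have comb: "nrm Z (r *\<^sub>R u + t *\<^sub>R w) <= R" if "u \<in> pts Z" "w \<in> pts Z" "nrm Z u <= R" "nrm Z w <= R" for u w R
   using nrm_add[OF Z pts_scale[OF Z that(1)] pts_scale[OF Z that(2)], of r t] convex_bound_le[OF that(3,4) rt] rt
   by (simp add: nrm_scale[OF Z] that)
  have "r *\<^sub>R d + t *\<^sub>R d = d" using rt(3) by (simp flip: scaleR_add_left)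
  then have "proj Z E n (r *\<^sub>R b + t *\<^sub>R b') - d = r *\<^sub>R (proj Z E n b - d) + t *\<^sub>R (proj Z E n b' - d)"
   using p(3) q(3) by (simp add: proj_add proj_scale pts_scale[OF Z] algebra_simps)
  then show "r *\<^sub>R p + t *\<^sub>R q \<in> L"
   using p q comb[OF p(3) q(3)] comb[OF pts_diff[OF Z proj_pts[OF p(3)] dp] pts_diff[OF Z proj_pts[OF q(3)] dp], of n \<epsilon> n]
   by (simp add: L_def pts_add[OF X] pts_add[OF Z] pts_scale[OF X] pts_scale[OF Z] op_add[OF A] op_add[OF B] op_scale[OF A] op_scale[OF B])
 qed
 then have "convex (fst ` L)" by (intro convex_linear_image linear_fst)
 then have "\<exists>g\<in>fst ` L. nrm X g < \<epsilon>"
 proof (rule mazur[OF X _ _ \<epsilon>])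
  show "fst ` L \<subseteq> pts X" by (auto simp: L_def)
  fix f assume "f \<in> pts (dual X)"
  then have "(\<lambda>k. f (x k)) \<longlonglongrightarrow> 0" using null by (simp add: weakly_null_def)
  then obtain N where N: "!!k. k >= N ==> \<bar>f (x k)\<bar> < \<epsilon>" using \<epsilon> unfolding LIMSEQ_iff by fastforce
  obtain k where k: "k \<in> I" "k >= N" using d(2) unfolding I_def infinite_nat_iff_unbounded_le by blast
  then have "f (x k) < \<epsilon>" using N[of k] by linarith
  then show "\<exists>a\<in>fst ` L. f a < \<epsilon>" using yL[OF k(1)] by force
 qed
 then obtain g b where gb: "(g, b) \<in> L" "nrm X g < \<epsilon>" by auto
 then have g: "g \<in> pts X" and b: "b \<in> pts Z" "B b = A g" "nrm Z b <= C" "nrm Z (proj Z E n b - d) <= \<epsilon>" by (auto simp: L_def)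
 obtain k where k: "k \<in> I" using d(2) not_finite_existsD[of "\<lambda>k. k \<in> I"] by (auto simp: I_def)
 \<comment> \<open>The difference of the second components of two members of \<open>L\<close>: the
   initial parts cancel up to \<open>2 * \<epsilon>\<close>, while the image is still
   \<open>A (x k)\<close> up to the small \<open>A g\<close>.\<close>
 define w where "w = y k - b"
 have w: "w \<in> pts Z" unfolding w_def by (rule pts_diff[OF Z y(1) b(1)])
 have nw: "nrm Z w <= 2 * C" using nrm_diff[OF Z y(1) b(1), of k] y(3)[of k] b(3) by (simp add: w_def)
 have "nrm Z (proj Z E n (y k) - d) <= \<epsilon>" using k by (simp add: I_def)
 then have nPw: "nrm Z (proj Z E n w) <= 2 * \<epsilon>"
  using nrm_triangle[OF Z proj_pts[OF y(1), of n k] dp proj_pts[OF b(1), of n]] b(4)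
   nrm_diff_commute[OF Z dp proj_pts[OF b(1), of n]] by (simp add: w_def proj_diff y(1) b(1))
 obtain N where N: "!!r. r >= N ==> nrm Z (proj Z E r w - w) < \<epsilon>"
  using proj_conv[OF w, unfolded nconv_iff[OF Z proj_pts[OF w]]] \<epsilon> by meson
 define r where "r = max N n"
 define z where "z = proj Z E r w - proj Z E n w"
 have z: "z \<in> pts Z" unfolding z_def by (intro pts_diff[OF Z] proj_pts w)
 have "component Z E z i = (if n <= i & i < r then component Z E w i else 0)" for i
  by (auto simp: z_def comp_diff proj_pts w comp_proj r_def)
 then have sz: "supp Z E z \<subseteq> {n..<r}" by (auto simp: supp_def)
 have "nrm Z z <= K * nrm Z w + K * nrm Z w"
  unfolding z_def using nrm_diff[OF Z proj_pts[OF w, of r] proj_pts[OF w, of n]] K(2)[OF w, of r] K(2)[OF w, of n] by linarith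
 also have "\<dots> <= 4 * K * C" using mult_left_mono[OF nw less_imp_le[OF K(1)]] by linarith
 finally have nz: "nrm Z z <= 4 * K * C" .
 have Bw: "B w = A (x k) - A g" using op_diff[OF B Z y(1) b(1)] y(2) b(2) by (simp add: w_def)
 define e1 where "e1 = proj Z E r w - w"
 have e1: "e1 \<in> pts Z" "nrm Z e1 < \<epsilon>" using N[of r] by (auto simp: e1_def r_def intro: pts_diff[OF Z] proj_pts w)
 have "z = w + e1 - proj Z E n w" by (simp add: z_def e1_def)
 then have "B z = B w + B e1 - B (proj Z E n w)"
  using op_diff[OF B Z pts_add[OF Z w e1(1)] proj_pts[OF w]] op_add[OF B w e1(1)] by simp
 then have "A (x k) - B z = (A g - B e1) + B (proj Z E n w)" using Bw by simp
 then have "nrm Y (A (x k) - B z) <= nrm Y (A g) + nrm Y (B e1) + nrm Y (B (proj Z E n w))"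
  using nrm_add[OF Y pts_diff[OF Y op_mem[OF A g] op_mem[OF B e1(1)]] op_mem[OF B proj_pts[OF w]], of n]
   nrm_diff[OF Y op_mem[OF A g] op_mem[OF B e1(1)]] by simp
 also have "\<dots> <= KA * \<epsilon> + KB * \<epsilon> + KB * (2 * \<epsilon>)"
 proof (intro add_mono)
  show "nrm Y (A g) <= KA * \<epsilon>"
   using KA(2)[OF g] mult_left_mono[OF less_imp_le[OF gb(2)] less_imp_le[OF KA(1)]] by simp
  show "nrm Y (B e1) <= KB * \<epsilon>"
   using KB(2)[OF e1(1)] mult_left_mono[OF less_imp_le[OF e1(2)] less_imp_le[OF KB(1)]] by simp
  show "nrm Y (B (proj Z E n w)) <= KB * (2 * \<epsilon>)"
   using KB(2)[OF proj_pts[OF w], of n] mult_left_mono[OF nPw less_imp_le[OF KB(1)]] by simp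
 qed
 also have "\<dots> = (KA + 3 * KB) * \<epsilon>" by (simp add: algebra_simps)
 also have "\<dots> = \<delta>" using KA(1) KB(1) by (simp add: \<epsilon>_def)
 finally show ?thesis using z sz nz by blast
qed

text \<open>The window of \<open>z l\<close> starts at \<open>n (2 * l)\<close>, fixed before the
  node is entered; the node approximation then supplies the next tree index together with the end of
  the window.\<close>

lemma tree_branch:
 assumes tree: "weakly_null_even_tree X x"
  and node: "!!s n \<delta>. weakly_null X s ==> (!!k. nrm X (s k) = 1) ==> \<delta> > 0 ==>
   \<exists>k z r. z \<in> pts Z & supp Z E z \<subseteq> {n..<r} & nrm Z z <= M & nrm Y (A (s k) - B z) <= \<delta>"
 shows "\<exists>n z. strict_mono n & (\<forall>l. z l \<in> pts Z & nrm Z (z l) <= M &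
  supp Z E (z l) \<subseteq> {n (2 * l)..<n (2 * Suc l)} & nrm Y (A (x (map n [0..<2 * l + 2])) - B (z l)) <= (1 / 2) ^ Suc l)"
proof -
 define P where "P l s = (sorted_wrt (<) (fst s) & length (fst s) = 2 * l & (\<forall>i\<in>set (fst s). i < fst (snd s)))"
  for l :: nat and s :: "nat list \<times> nat \<times> 'a"
 define R where "R l s s' = (\<exists>j. fst s' = fst s @ [fst (snd s), fst (snd s) + 1 + j] & fst (snd s) + 1 + j < fst (snd s') &
  snd (snd s') \<in> pts Z & nrm Z (snd (snd s')) <= M & supp Z E (snd (snd s')) \<subseteq> {fst (snd s)..<fst (snd s')} &
  nrm Y (A (x (fst s')) - B (snd (snd s'))) <= (1 / 2) ^ Suc l)"
  for l :: nat and s s' :: "nat list \<times> nat \<times> 'a"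
 have "\<exists>f. \<forall>l. P l (f l) & R l (f l) (f (Suc l))"
 proof (rule dependent_nat_choice)
  show "\<exists>s. P 0 s" by (rule exI[of _ "([], 0, 0)"]) (simp add: P_def)
  fix s :: "nat list \<times> nat \<times> 'a" and l assume P: "P l s"
  define ns r where "ns = fst s" and "r = fst (snd s)"
  have ns: "sorted_wrt (<) ns" "length ns = 2 * l" "\<forall>i\<in>set ns. i < r" using P by (auto simp: P_def ns_def r_def)
  define nr where "nr = ns @ [r]"
  have nr: "sorted_wrt (<) nr" "odd (length nr)" "last nr = r" using ns by (auto simp: nr_def sorted_wrt_append)
  have "weakly_null X (\<lambda>j. x (nr @ [last nr + 1 + j]))" using tree nr unfolding weakly_null_even_tree_def by blast
  moreover have "nrm X (x (nr @ [last nr + 1 + j])) = 1" for j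
  proof -
   have "nr @ [last nr + 1 + j] \<in> even_indices" using ns by (auto simp: even_indices_def nr_def sorted_wrt_append)
   then show ?thesis using tree unfolding weakly_null_even_tree_def by blast
  qed
  ultimately have "\<exists>k z t. z \<in> pts Z & supp Z E z \<subseteq> {r..<t} & nrm Z z <= M &
    nrm Y (A (x (nr @ [last nr + 1 + k])) - B z) <= (1 / 2) ^ Suc l"
   by (intro node) auto
  then obtain k z t where z: "z \<in> pts Z" "supp Z E z \<subseteq> {r..<t}" "nrm Z z <= M"
   "nrm Y (A (x (nr @ [last nr + 1 + k])) - B z) <= (1 / 2) ^ Suc l" by blast
  \<comment> \<open>The end of the window must also exceed the tree index just chosen, to keep the
    branch increasing.\<close>
  have "P (Suc l) (ns @ [r, r + 1 + k], max t (r + 2 + k), z)"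
   using ns by (auto simp: P_def sorted_wrt_append)
  moreover have "R l s (ns @ [r, r + 1 + k], max t (r + 2 + k), z)"
   using z(1,3,4) nr(3) subset_trans[OF z(2), of "{r..<max t (r + 2 + k)}"]
   by (simp add: R_def nr_def ns_def r_def)
  ultimately show "\<exists>s'. P (Suc l) s' & R l s s'" by blast
 qed
 then obtain f where fP: "!!l. P l (f l)" and fR: "!!l. R l (f l) (f (Suc l))" by blast
 define r z where "r l = fst (snd (f l))" and "z l = snd (snd (f (Suc l)))" for l
 have "\<exists>j. fst (f (Suc l)) = fst (f l) @ [r l, r l + 1 + j] & r l + 1 + j < r (Suc l) &
  z l \<in> pts Z & nrm Z (z l) <= M & supp Z E (z l) \<subseteq> {r l..<r (Suc l)} &
  nrm Y (A (x (fst (f (Suc l)))) - B (z l)) <= (1 / 2) ^ Suc l" for l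
  using fR[of l] by (simp add: R_def r_def z_def)
 then obtain j where j: "!!l. fst (f (Suc l)) = fst (f l) @ [r l, r l + 1 + j l]" "!!l. r l + 1 + j l < r (Suc l)"
  "!!l. z l \<in> pts Z" "!!l. nrm Z (z l) <= M" "!!l. supp Z E (z l) \<subseteq> {r l..<r (Suc l)}"
  "!!l. nrm Y (A (x (fst (f (Suc l)))) - B (z l)) <= (1 / 2) ^ Suc l" by metis
 define n where "n i = (if even i then r (i div 2) else r (i div 2) + 1 + j (i div 2))" for i
 have n2: "n (2 * l) = r l" "n (Suc (2 * l)) = r l + 1 + j l" for l by (simp_all add: n_def)
 have f0: "fst (f 0) = []" using fP[of 0] by (simp add: P_def)
 have map: "map n [0..<2 * l] = fst (f l)" for l
  by (induction l) (simp_all add: f0 j(1) n2)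
 have "strict_mono n"
  unfolding strict_mono_Suc_iff
 proof
  fix i show "n i < n (Suc i)"
  proof (cases "even i")
   case True
   then obtain l where "i = 2 * l" by (rule evenE)
   then show ?thesis using n2[of l] by simp
  next
   case False
   then obtain l where i: "i = 2 * l + 1" by (rule oddE)
   show ?thesis using n2[of l] n2(1)[of "Suc l"] j(2)[of l] unfolding i by simp
  qed
 qed
 moreover have "z l \<in> pts Z & nrm Z (z l) <= M & supp Z E (z l) \<subseteq> {n (2 * l)..<n (2 * Suc l)} &
   nrm Y (A (x (map n [0..<2 * l + 2])) - B (z l)) <= (1 / 2) ^ Suc l" for l
  using j(3-6)[of l] map[of "Suc l"] n2(1)[of l] n2(1)[of "Suc l"] by simp
 ultimately show ?thesis by blast
qed

text \<open>One statement for two uses: an embedding \<open>A\<close> with \<open>B\<close> the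
  identity, or \<open>A\<close> the identity with \<open>B\<close> a quotient map. The branch is
  compared with blocks whose windows start at \<open>n (2 * l)\<close>, the very indices of
  \<open>v\<close> in the estimate.\<close>

lemma tree_estimates_of_lifts:
 fixes X :: "'x::real_vector nspace" and Y :: "'y::real_vector nspace"
 assumes V: "vseq W v" and up: "upper_block_estimates W v Z E"
  and X: "normed_space X" and Y: "normed_space Y"
  and A: "iso_embedding X Y A" and B: "bounded_operator Z Y B"
  and lift: "!!x. x \<in> pts X ==> \<exists>z\<in>pts Z. B z = A x & nrm Z z <= C * nrm X x" and C: "C > 0"
 shows "upper_tree_estimates W v X"
proof -
 interpret vseq W v by (rule V)
 obtain L where L: "L >= 1" and UW: "!!(k :: nat) z p m a. (!!l. l < k ==> z l \<in> pts Z & nrm Z (z l) <= 1) ==>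
   (!!l. l < k ==> supp Z E (z l) \<subseteq> {p l..<p (Suc l)} & m l \<in> {p l..<p (Suc l)}) ==>
   nrm Z (\<Sum>l<k. a l *\<^sub>R z l) <= L * nrm W (\<Sum>l<k. a l *\<^sub>R v (m l))"
  by (rule windowed_upper_estimate[OF V up]) blast
 obtain K where K: "K > 0" "!!n z. z \<in> pts Z ==> nrm Z (proj Z E n z) <= K * nrm Z z"
  by (rule proj_bounded) blast
 have AB: "bounded_operator X Y A" using A by (simp add: iso_embedding_def)
 obtain c where c: "c > 0" "!!x. x \<in> pts X ==> c * nrm X x <= nrm Y (A x)" using A unfolding iso_embedding_def by blast
 obtain KB where KB: "KB > 0" "!!z. z \<in> pts Z ==> nrm Y (B z) <= KB * nrm Z z" using op_bound[OF B Z] by blast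
 define M where "M = 4 * K * C"
 have M: "M > 0" using K(1) C by (simp add: M_def)
 \<comment> \<open>\<open>KB * (M * L)\<close> bounds the image of the blocks, 1 the accumulated
   approximation errors, and division by \<open>c\<close> undoes \<open>A\<close>.\<close>
 define R where "R = (KB * (M * L) + 1) / c"
 have R: "R > 0" unfolding R_def using KB(1) M L c(1) by (intro divide_pos_pos add_nonneg_pos) auto
 show ?thesis
  unfolding upper_tree_estimates_def
 proof (intro exI[of _ "R + 1"] conjI allI impI)
  show "1 <= R + 1" using R by simp
  fix x assume tree: "weakly_null_even_tree X x"
  have "\<exists>n z. strict_mono n & (\<forall>l. z l \<in> pts Z & nrm Z (z l) <= M &
   supp Z E (z l) \<subseteq> {n (2 * l)..<n (2 * Suc l)} & nrm Y (A (x (map n [0..<2 * l + 2])) - B (z l)) <= (1 / 2) ^ Suc l)"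
   by (rule tree_branch[OF tree]) (unfold M_def, rule node_approximation[OF X Y AB B lift C K])
  then obtain n z where n: "strict_mono n" and z: "!!l. z l \<in> pts Z" "!!l. nrm Z (z l) <= M"
   "!!l. supp Z E (z l) \<subseteq> {n (2 * l)..<n (2 * Suc l)}"
   "!!l. nrm Y (A (x (map n [0..<2 * l + 2])) - B (z l)) <= (1 / 2) ^ Suc l" by blast
  define t where "t l = x (map n [0..<2 * l + 2])" for l
  have tp: "t l \<in> pts X" for l
  proof -
   have "map n [0..<2 * l + 2] \<in> even_indices"
    using strict_monoD[OF n] by (auto simp: even_indices_def sorted_wrt_iff_nth_less simp del: upt_Suc)
   then show ?thesis using tree unfolding weakly_null_even_tree_def t_def by blast
  qed
  have "nrm X (\<Sum>l<k. a l *\<^sub>R t l) <= (R + 1) * nrm W (\<Sum>l<k. a l *\<^sub>R v (n (2 * l)))" for k and a :: "nat => real"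
  proof -
   define T where "T = nrm W (\<Sum>l<k. a l *\<^sub>R v (n (2 * l)))"
   have T0: "T >= 0" unfolding T_def by (rule nrm_nonneg[OF W sum_pts])
   have at: "a l *\<^sub>R t l \<in> pts X" and az: "a l *\<^sub>R z l \<in> pts Z" for l
    by (rule pts_scale[OF X tp], rule pts_scale[OF Z z(1)])
   define s where "s = (\<Sum>l<k. a l *\<^sub>R t l)"
   define y where "y = (\<Sum>l<k. a l *\<^sub>R z l)"
   have s: "s \<in> pts X" and y: "y \<in> pts Z" unfolding s_def y_def by (rule pts_sum[OF X at], rule pts_sum[OF Z az])
   have dp: "A (t l) - B (z l) \<in> pts Y" for l by (intro pts_diff[OF Y] op_mem[OF AB] op_mem[OF B] tp z)
   have inj: "inj_on (\<lambda>l. n (2 * l)) {..<k}"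
    by (rule inj_onI) (use strict_mono_eq[OF n] in auto)
   have ny: "nrm Z y <= M * L * T"
   proof -
    have "y = (\<Sum>l<k. (a l * M) *\<^sub>R (1 / M) *\<^sub>R z l)" using M by (simp add: y_def)
    also have "nrm Z \<dots> <= L * nrm W (\<Sum>l<k. (a l * M) *\<^sub>R v (n (2 * l)))"
    proof (rule UW)
     show "(1 / M) *\<^sub>R z l \<in> pts Z & nrm Z ((1 / M) *\<^sub>R z l) <= 1" for l
      using z(2)[of l] M by (simp add: pts_scale[OF Z z(1)] nrm_scale[OF Z z(1)])
     show "supp Z E ((1 / M) *\<^sub>R z l) \<subseteq> {n (2 * l)..<n (2 * Suc l)} & n (2 * l) \<in> {n (2 * l)..<n (2 * Suc l)}" for l
      using z(3)[of l] M strict_monoD[OF n, of "2 * l" "2 * Suc l"] by (simp add: supp_scale[OF z(1)])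
    qed
    also have "(\<Sum>l<k. (a l * M) *\<^sub>R v (n (2 * l))) = M *\<^sub>R (\<Sum>l<k. a l *\<^sub>R v (n (2 * l)))"
     by (simp add: scaleR_sum_right mult.commute)
    also have "nrm W \<dots> = M * T" using M by (simp add: T_def nrm_scale[OF W sum_pts])
    finally show ?thesis by (simp add: mult_ac)
   qed
   have "A s - B y = (\<Sum>l<k. a l *\<^sub>R (A (t l) - B (z l)))"
    unfolding s_def y_def op_sum[OF AB X at] op_sum[OF B Z az]
    by (simp add: op_scale[OF AB tp] op_scale[OF B z(1)] scaleR_diff_right sum_subtractf)
   also have "nrm Y \<dots> <= (\<Sum>l<k. nrm Y (a l *\<^sub>R (A (t l) - B (z l))))"
    by (rule nrm_sum[OF Y pts_scale[OF Y dp]])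
   also have "\<dots> <= (\<Sum>l<k. T * (1 / 2) ^ Suc l)"
   proof (rule sum_mono)
    fix l assume l: "l \<in> {..<k}"
    have "\<bar>a l\<bar> <= T" unfolding T_def by (rule coeff_le[OF _ inj l]) simp
    then show "nrm Y (a l *\<^sub>R (A (t l) - B (z l))) <= T * (1 / 2) ^ Suc l"
     using z(4)[of l] T0 nrm_scale[OF Y dp, of "a l" l] mult_mono[OF _ _ T0 nrm_nonneg[OF Y dp], of "\<bar>a l\<bar>" l "(1 / 2) ^ Suc l"]
     unfolding t_def by linarith
   qed
   also have "\<dots> = T * (1 - (1 / 2) ^ k)"
    by (induction k) (simp_all add: algebra_simps)
   also have "\<dots> <= T" using T0 by (simp add: algebra_simps)
   finally have diff: "nrm Y (A s - B y) <= T" .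
   have "c * nrm X s <= nrm Y (A s)" by (rule c(2)[OF s])
   also have "\<dots> <= nrm Y (A s - B y) + nrm Y (B y)"
    using nrm_add[OF Y pts_diff[OF Y op_mem[OF AB s] op_mem[OF B y]] op_mem[OF B y]] by simp
   also have "\<dots> <= T + KB * (M * L * T)"
    using diff KB(2)[OF y] mult_left_mono[OF ny less_imp_le[OF KB(1)]] by linarith
   also have "\<dots> = c * (R * T)" using c(1) by (simp add: R_def field_simps)
   finally have "nrm X s <= R * T" using c(1) by simp
   also have "\<dots> <= (R + 1) * T" using T0 by (simp add: algebra_simps)
   finally show ?thesis by (simp add: s_def T_def)
  qed
  then have "dominated_by (R + 1) X (\<lambda>l. x (map n [0..<2 * l + 2])) W (\<lambda>l. v (n (2 * l)))"
   unfolding dominated_by_def t_def by blast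
  then show "\<exists>n. strict_mono n & dominated_by (R + 1) X (\<lambda>l. x (map n [0..<2 * l + 2])) W (\<lambda>l. v (n (2 * l)))"
   using n by blast
 qed
qed

end

section \<open>Assembling the equivalences\<close>

lemma fdd_if_shrinking_FDD: "banach_space Z ==> shrinking_FDD Z E ==> shrinking Z E"
 by (simp add: shrinking_def shrinking_axioms_def fdd_def shrinking_FDD_def)

lemma
 assumes V: "vseq W v" and BX: "banach_space X" and sep: "separable_space (ntop (dual X))"
  and tree: "upper_tree_estimates W v X" and cd: "continuum_dimensional TYPE('z::real_vector)"
 shows quotient_of_block_space_if_tree: "\<exists>Z :: 'z nspace. banach_space Z & is_quotient_of X Z &
   (\<exists>E. shrinking_FDD Z E & upper_block_estimates W v Z E)"
  and embeds_in_block_space_if_tree: "\<exists>Z :: 'z nspace. banach_space Z & (\<exists>T. iso_embedding X Z T) &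
   (\<exists>E. shrinking_FDD Z E & upper_block_estimates W v Z E)"
proof -
 obtain F H where sk: "skeleton X F H" by (rule skeleton_exists[OF banach_normed[OF BX] sep])
 interpret g: game W v X F H by (rule game.intro[OF V sk])
 obtain C N t where t: "C >= 1" "strict_mono N" "strict_mono t" "t 0 = 0"
  "g.good_estimate C N (\<lambda>i. F (t i)) (\<lambda>i. H (t i))" by (rule g.thinning[OF tree])
 interpret h: game W v X "\<lambda>i. F (t i)" "\<lambda>i. H (t i)" by (rule game.intro[OF V g.subskeleton[OF t(3,4)]])
 show "\<exists>Z :: 'z nspace. banach_space Z & is_quotient_of X Z &
   (\<exists>E. shrinking_FDD Z E & upper_block_estimates W v Z E)"
  using h.quotient_of_block_space[OF BX t(5,1,2) cd] by blast
 show "\<exists>Z :: 'z nspace. banach_space Z & (\<exists>T. iso_embedding X Z T) &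
   (\<exists>E. shrinking_FDD Z E & upper_block_estimates W v Z E)"
  using h.embeds_in_block_space[OF BX t(5,1,2) cd] by blast
qed

lemma bounded_operator_id: "bounded_operator X X (\<lambda>x. x)"
 by (rule bounded_operatorI[where K = 1]) auto

lemma iso_embedding_id: "iso_embedding X X (\<lambda>x. x)"
 unfolding iso_embedding_def using bounded_operator_id by (auto intro!: exI[of _ 1])

lemma tree_estimates_if_embeds:
 assumes V: "vseq W v" and X: "normed_space X" and BZ: "banach_space Z" and T: "iso_embedding X Z T"
  and E: "shrinking_FDD Z E" "upper_block_estimates W v Z E"
 shows "upper_tree_estimates W v X"
proof -
 interpret shrinking Z E by (rule fdd_if_shrinking_FDD[OF BZ E(1)])
 have TB: "bounded_operator X Z T" using T by (simp add: iso_embedding_def)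
 obtain K where K: "K > 0" "!!x. x \<in> pts X ==> nrm Z (T x) <= K * nrm X x" using op_bound[OF TB X] by blast
 show ?thesis
  by (rule tree_estimates_of_lifts[OF V E(2) X Z T bounded_operator_id _ K(1)]) (use op_mem[OF TB] K(2) in blast)
qed

lemma tree_estimates_if_quotient:
 assumes V: "vseq W v" and BX: "banach_space X" and BZ: "banach_space Z" and Q: "is_quotient_of X Z"
  and E: "shrinking_FDD Z E" "upper_block_estimates W v Z E"
 shows "upper_tree_estimates W v X"
proof -
 interpret shrinking Z E by (rule fdd_if_shrinking_FDD[OF BZ E(1)])
 obtain Q where Q: "bounded_operator Z X Q" "Q ` pts Z = pts X" using Q unfolding is_quotient_of_def by blast
 obtain C where C: "C > 0" "!!x. x \<in> pts X ==> \<exists>z\<in>pts Z. Q z = x & nrm Z z <= C * nrm X x"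
  by (rule open_mapping[OF BZ BX Q]) blast
 show ?thesis
  by (rule tree_estimates_of_lifts[OF V E(2) banach_normed[OF BX] banach_normed[OF BX] iso_embedding_id Q(1) C(2,1)])
qed

lemma is_quotient_of_trans:
 assumes X: "is_quotient_of X Y" and Y: "is_quotient_of Y Z" and Zn: "normed_space Y" "normed_space Z"
 shows "is_quotient_of X Z"
proof -
 obtain P where P: "bounded_operator Y X P" "P ` pts Y = pts X" using X unfolding is_quotient_of_def by blast
 obtain Q where Q: "bounded_operator Z Y Q" "Q ` pts Z = pts Y" using Y unfolding is_quotient_of_def by blast
 have "bounded_operator Z X (\<lambda>z. P (Q z))" by (rule op_comp[OF Q(1) P(1) Zn(2,1)])
 moreover have "(\<lambda>z. P (Q z)) ` pts Z = pts X" using P(2) Q(2) by (simp flip: image_image)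
 ultimately show ?thesis unfolding is_quotient_of_def by blast
qed

theorem theorem1p1:
  fixes X :: "'x::real_vector nspace"
    and W :: "'v::real_vector nspace" and v :: "nat \<Rightarrow> 'v"
  assumes "continuum_dimensional TYPE('z::real_vector)"
    and "banach_space X"
    and "separable_space (ntop (dual X))"
    and "banach_space W"
    and "basic_seq W v"
    and "normalized W v"
    and "one_unconditional W v"
    and "block_stable W v"
    and "right_dominant W v"
    and "shrinking_seq W v"
  shows
    "(upper_tree_estimates W v X \<longleftrightarrow>
      (\<exists>Z :: 'z nspace. banach_space Z \<and> is_quotient_of X Z \<and>
        separable_space (ntop (dual Z)) \<and> upper_tree_estimates W v Z)) \<and>
     (upper_tree_estimates W v X \<longleftrightarrow>
      (\<exists>Z :: 'z nspace. banach_space Z \<and> is_quotient_of X Z \<and>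
        (\<exists>E. shrinking_FDD Z E \<and> upper_block_estimates W v Z E))) \<and>
     (upper_tree_estimates W v X \<longleftrightarrow>
      (\<exists>Z :: 'z nspace. banach_space Z \<and>
        (\<exists>F. is_FDD Z F \<and> boundedly_complete_FDD (dual Z) (dual_FDD Z F) \<and>
          lower_block_estimates (dual (seq_space W v)) (biorthogonal W v)
            (dual Z) (dual_FDD Z F)) \<and>
        (\<exists>T. iso_embedding (dual X) (dual Z) T \<and>
          continuous_map (weak_star_topology X) (weak_star_topology Z) T))) \<and>
     (upper_tree_estimates W v X \<longleftrightarrow>
      (\<exists>Z :: 'z nspace. banach_space Z \<and> (\<exists>T. iso_embedding X Z T) \<and>
        (\<exists>E. shrinking_FDD Z E \<and> upper_block_estimates W v Z E)))"
proof -
 have V: "vseq W v" by (rule vseq.intro) (use assms in auto)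
 note BX = assms(2) and sep = assms(3) and cd = assms(1)
 note X = banach_normed[OF BX]
 show ?thesis (is "(?P1 \<longleftrightarrow> ?P2) & (?P1 \<longleftrightarrow> ?P3) & (?P1 \<longleftrightarrow> ?P4) & (?P1 \<longleftrightarrow> ?P5)")
 proof -
  have "?P3" if ?P1 using quotient_of_block_space_if_tree[OF V BX sep that cd] .
  moreover have "?P5" if ?P1 using embeds_in_block_space_if_tree[OF V BX sep that cd] .
  moreover have "?P1" if a: ?P5
  proof -
   obtain Z :: "'z nspace" and T E where "banach_space Z" "iso_embedding X Z T" "shrinking_FDD Z E"
    "upper_block_estimates W v Z E" using a by blast
   then show ?thesis by (intro tree_estimates_if_embeds[OF V X])
  qed
  moreover have "?P1" if a: ?P3
  proof -
   obtain Z :: "'z nspace" and E where "banach_space Z" "is_quotient_of X Z" "shrinking_FDD Z E"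
    "upper_block_estimates W v Z E" using a by blast
   then show ?thesis by (intro tree_estimates_if_quotient[OF V BX])
  qed
  moreover have "?P2 & ?P4" if a: ?P3
  proof -
   obtain Z :: "'z nspace" and E where ZQ: "banach_space Z" "is_quotient_of X Z" and E: "shrinking_FDD Z E"
    "upper_block_estimates W v Z E" using a by blast
   interpret shrinking Z E by (rule fdd_if_shrinking_FDD[OF ZQ(1) E(1)])
   have "upper_tree_estimates W v Z"
    by (rule tree_estimates_if_embeds[OF V banach_normed[OF ZQ(1)] ZQ(1) iso_embedding_id E])
   then have ?P2 using ZQ dual_separable by blast
   moreover have ?P4 using ZQ(1) FDD dual_boundedly_complete dual_lower_estimates[OF V E(2)] adjoint_of_quotient[OF BX ZQ] by blast
   ultimately show ?thesis by blast
  qed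
  \<comment> \<open>Tree estimates are not passed to a quotient directly: \<open>Y\<close> is first
    written as a quotient of a space with block estimates, and quotients of such spaces are
    covered.\<close>
  moreover have "?P1" if a: ?P2
  proof -
   obtain Y :: "'z nspace" where Y: "banach_space Y" "is_quotient_of X Y" "separable_space (ntop (dual Y))"
    "upper_tree_estimates W v Y" using a by blast
   obtain Z :: "'z nspace" and E where Z: "banach_space Z" "is_quotient_of Y Z" and E: "shrinking_FDD Z E"
    "upper_block_estimates W v Z E" using quotient_of_block_space_if_tree[OF V Y(1,3,4) cd] by blast
   have "is_quotient_of X Z" by (rule is_quotient_of_trans[OF Y(2) Z(2) banach_normed[OF Y(1)] banach_normed[OF Z(1)]])
   then show ?thesis by (intro tree_estimates_if_quotient[OF V BX Z(1) _ E])
  qed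
  moreover have "?P3" if a: ?P4
  proof -
   obtain Z :: "'z nspace" and F T where BZ: "banach_space Z" and F: "is_FDD Z F" "boundedly_complete_FDD (dual Z) (dual_FDD Z F)"
    "lower_block_estimates (dual (seq_space W v)) (biorthogonal W v) (dual Z) (dual_FDD Z F)"
    and T: "iso_embedding (dual X) (dual Z) T" "continuous_map (weak_star_topology X) (weak_star_topology Z) T"
    using a by blast
   interpret fdd Z F using BZ F(1) by unfold_locales
   \<comment> \<open>That the dual FDD expands every functional already makes \<open>F\<close>
     shrinking.\<close>
   interpret shrinking Z F
    by (rule shrinking_if_dual_FDD) (use F(2) in \<open>simp add: boundedly_complete_FDD_def\<close>)
   have "shrinking_FDD Z F" unfolding shrinking_FDD_def using FDD dense by blast
   then show ?thesis
    using BZ predual_quotient[OF BX BZ T] upper_estimates_if_dual_lower[OF V F(3)] by blast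
  qed
  ultimately show ?thesis by blast
 qed
qed

end
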